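(* For every integer $m \ge 2$, the function $[a,b] \mapsto s([a,b])$ is a bijection from the set of reduced positive roots of $\mathcal H(m)$ onto the set of rigid reflections of $W(m)$.
   Context: For an integer $m\ge 2$ let $W(m)=\langle s_1,s_2,s_3 : s_1^2=s_2^2=s_3^2=(s_1s_2)^m=(s_2s_3)^m=e\rangle$ (no relation on $s_1s_3$ is imposed). Roots. $\mathcal H(m)$ is the rank 2 Kac--Moody algebra with Cartan matrix $\begin{pmatrix}2&-m\\-m&2\end{pmatrix}$. An element of its root lattice is written $[a,b]$, $a,b\in\mathbb Z$, where $[1,0],[0,1]$ are the positive simple roots. A root $[a,b]$ (real or imaginary) is called reduced if $\gcd(a,b)=1$ and $ab\ne 0$. Equivalently, $[a,b]$ is a reduced positive root iff $a,b$ are coprime positive integers with $a^2+b^2-mab\le 1$. The function $s$. For coprime positive integers $a,b$, consider in $\mathbb R^2$ the vertical lines $\{x\in\mathbb Z\}$ labeled $3$, the horizontal lines $\{y\in\mathbb Z\}$ labeled $1$, and the lines $\{x+y\in\mathbb Z\}$ labeled $2$. Let $i_1,\dots,i_k$ be the labels, read in order from $(0,0)$ to $(a,b)$, of the crossings of the open line segment from $(0,0)$ to $(a,b)$ with these lines. Then $s([a,b]):=s_{i_1}s_{i_2}\cdots s_{i_k}\in W(m)$. For example $s([5,3])=s_2s_3s_2s_1s_2s_3s_2s_3s_2s_1s_2s_3s_2$. Rigid reflections. Let $G_1,G_2$ be two identical copies of a regular triangle, with the edges of each labeled $T_1,T_2,T_3$ counter-clockwise. For $i=1,2$ let $L_i$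 be the line segment in $G_i$ from the center of $G_i$ to the common endpoint of $T_3$ and $T_1$. Orient the edges of $G_1$ counter-clockwise and those of $G_2$ clockwise, and let $\Sigma$ be the surface (a torus) obtained by gluing $G_1$ and $G_2$ along all edges of the same label according to these orientations. Let $\mathcal T=T_1\cup T_2\cup T_3\subset \Sigma$ and let $V\subset\mathcal T$ be the set consisting of the (single) image of the vertices. An admissible curve is a continuous map $\eta:[0,1]\to\Sigma$ such that: (1) $\eta(x)\in V$ iff $x\in\{0,1\}$; (2) there is $\epsilon>0$ with $\eta([0,\epsilon])\subset L_1$ and $\eta([1-\epsilon,1])\subset L_2$ (so $\eta$ starts and ends at the common endpoint of $T_1$ and $T_3$); (3) if $\eta(x)\in\mathcal T\setminus V$ then $\eta([x-\epsilon,x+\epsilon])$ meets $\mathcal T$ transversally for sufficiently small $\epsilon>0$. For such $\eta$, writing $\{x\in(0,1):\eta(x)\in\mathcal T\}=\{x_1<\dots<x_k\}$ with $\eta(x_\ell)\in T_{i_\ell}$, put $\upsilon(\eta)=i_1\cdots i_k$, a word in the alphabet $\{1,2,3\}$. Let $\mathfrak R$ be the set of words $i_1\cdots i_k$ with $k$ odd and $i_j=i_{k+1-j}$ for all $j$. An element $w\in W(m)$ is a rigid reflection if there exist an expression $w=s_{i_1}s_{i_2}\cdots s_{i_k}$ and a non-self-crossing admissible curve $\eta$ such that $\upsilon(\eta)=i_1\cdots i_k\in\mathfrak R$. *)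

theory Defs
  imports "HOL-Analysis.Analysis" "HOL-Algebra.Group"
begin

section \<open>Groups given by generators and relators\<close>

text \<open>A letter \<open>(x, True)\<close> stands for the generator \<open>x\<close> and \<open>(x, False)\<close> for its formal inverse.\<close>

type_synonym 'g letter = "'g \<times> bool"

inductive pres_cong :: "'g letter list set \<Rightarrow> 'g letter list \<Rightarrow> 'g letter list \<Rightarrow> bool"
  for R where
  pc_refl: "pres_cong R u u"
| pc_sym: "pres_cong R u v \<Longrightarrow> pres_cong R v u"
| pc_trans: "pres_cong R u v \<Longrightarrow> pres_cong R v w \<Longrightarrow> pres_cong R u w"
| pc_cancel: "pres_cong R (u @ [(x, e), (x, \<not> e)] @ v) (u @ v)"
| pc_relator: "r \<in> R \<Longrightarrow> pres_cong R (u @ r @ v) (u @ v)"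

definition pres_class :: "'g letter list set \<Rightarrow> 'g letter list \<Rightarrow> 'g letter list set" where
  "pres_class R u = {v. pres_cong R u v}"

definition presented_group :: "'g letter list set \<Rightarrow> 'g letter list set monoid" where
  "presented_group R =
     \<lparr>carrier = range (pres_class R),
      mult = (\<lambda>A B. \<Union>u\<in>A. \<Union>v\<in>B. pres_class R (u @ v)),
      one = pres_class R []\<rparr>"

lemma pres_class_eq_iff: "pres_class R u = pres_class R v \<longleftrightarrow> pres_cong R u v"
proof
  assume "pres_class R u = pres_class R v"
  moreover have "v \<in> pres_class R v"
    by (simp add: pres_class_def pc_refl)
  ultimately have "v \<in> pres_class R u" by simp
  then show "pres_cong R u v" by (simp add: pres_class_def)
next
  assume uv: "pres_cong R u v"
  have "pres_cong R u w \<longleftrightarrow> pres_cong R v w" for w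
    using pc_trans[OF uv] pc_trans[OF pc_sym[OF uv]] by auto
  then show "pres_class R u = pres_class R v" by (simp add: pres_class_def)
qed

lemma pres_cong_append_left: "pres_cong R u v \<Longrightarrow> pres_cong R (w @ u) (w @ v)"
proof (induction rule: pres_cong.induct)
  case (pc_refl u)
  show ?case by (rule pres_cong.pc_refl)
next
  case (pc_sym u v)
  then show ?case by (simp add: pres_cong.pc_sym)
next
  case (pc_trans u v x)
  then show ?case using pres_cong.pc_trans by metis
next
  case (pc_cancel u x e v)
  show ?case using pres_cong.pc_cancel[of R "w @ u" x e v] by simp
next
  case (pc_relator r u v)
  then show ?case using pres_cong.pc_relator[of r R "w @ u" v] by simp
qed

lemma pres_cong_append_right: "pres_cong R u v \<Longrightarrow> pres_cong R (u @ w) (v @ w)"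
proof (induction rule: pres_cong.induct)
  case (pc_refl u)
  show ?case by (rule pres_cong.pc_refl)
next
  case (pc_sym u v)
  then show ?case by (simp add: pres_cong.pc_sym)
next
  case (pc_trans u v x)
  then show ?case using pres_cong.pc_trans by metis
next
  case (pc_cancel u x e v)
  show ?case using pres_cong.pc_cancel[of R u x e "v @ w"] by simp
next
  case (pc_relator r u v)
  then show ?case using pres_cong.pc_relator[of r R u "v @ w"] by simp
qed

lemma mult_presented_group:
  "pres_class R u \<otimes>\<^bsub>presented_group R\<^esub> pres_class R v = pres_class R (u @ v)"
proof -
  have "pres_class R (u' @ v') = pres_class R (u @ v)"
    if "u' \<in> pres_class R u" "v' \<in> pres_class R v" for u' v'
  proof -
    have "pres_cong R (u @ v) (u' @ v)" "pres_cong R (u' @ v) (u' @ v')"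
      using that by (simp_all add: pres_class_def pres_cong_append_left pres_cong_append_right)
    then have "pres_cong R (u @ v) (u' @ v')" by (rule pc_trans)
    then show ?thesis using pres_class_eq_iff[of R "u @ v" "u' @ v'"] by simp
  qed
  moreover have "u \<in> pres_class R u" "v \<in> pres_class R v"
    by (simp_all add: pres_class_def pc_refl)
  ultimately have "(\<Union>u'\<in>pres_class R u. \<Union>v'\<in>pres_class R v. pres_class R (u' @ v'))
      = pres_class R (u @ v)"
    by blast
  then show ?thesis by (simp add: presented_group_def)
qed

lemma group_presented_group: "group (presented_group R)"
proof (rule groupI)
  have car: "carrier (presented_group R) = range (pres_class R)"
    and one: "\<one>\<^bsub>presented_group R\<^esub> = pres_class R []"
    by (simp_all add: presented_group_def)
  note eqs = car one mult_presented_group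
  show "\<one>\<^bsub>presented_group R\<^esub> \<in> carrier (presented_group R)"
    by (simp add: eqs)
  show "x \<otimes>\<^bsub>presented_group R\<^esub> y \<in> carrier (presented_group R)"
    if "x \<in> carrier (presented_group R)" "y \<in> carrier (presented_group R)" for x y
    using that by (auto simp: eqs)
  show "x \<otimes>\<^bsub>presented_group R\<^esub> y \<otimes>\<^bsub>presented_group R\<^esub> z
      = x \<otimes>\<^bsub>presented_group R\<^esub> (y \<otimes>\<^bsub>presented_group R\<^esub> z)"
    if "x \<in> carrier (presented_group R)" "y \<in> carrier (presented_group R)"
      "z \<in> carrier (presented_group R)" for x y z
    using that by (auto simp: eqs)
  show "\<one>\<^bsub>presented_group R\<^esub> \<otimes>\<^bsub>presented_group R\<^esub> x = x"
    if "x \<in> carrier (presented_group R)" for x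
    using that by (auto simp: eqs)
  have inv: "\<exists>v. pres_cong R (v @ u) []" for u :: "'a letter list"
  proof (induction u)
    case Nil
    show ?case by (rule exI[of _ "[]"]) (simp add: pres_cong.pc_refl)
  next
    case (Cons p u)
    then obtain v where v: "pres_cong R (v @ u) []" by blast
    obtain x e where p: "p = (x, e)" by (cases p)
    have "pres_cong R (v @ [(x, \<not> e), (x, \<not> \<not> e)] @ u) (v @ u)"
      by (rule pres_cong.pc_cancel)
    then have "pres_cong R ((v @ [(x, \<not> e)]) @ p # u) []"
      using v p by (auto intro: pres_cong.pc_trans)
    then show ?case by blast
  qed
  show "\<exists>y\<in>carrier (presented_group R). y \<otimes>\<^bsub>presented_group R\<^esub> x = \<one>\<^bsub>presented_group R\<^esub>"
    if "x \<in> carrier (presented_group R)" for x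
    using that inv by (auto simp: eqs pres_class_eq_iff)
qed


section \<open>The Coxeter group \<open>W(m)\<close>\<close>

text \<open>The alphabet \<open>{1,2,3}\<close>, indexing both the generators of \<open>W(m)\<close> and the edges of the triangles.\<close>

datatype idx = I1 | I2 | I3

abbreviation gen_word :: "idx list \<Rightarrow> idx letter list" where
  "gen_word w \<equiv> map (\<lambda>i. (i, True)) w"

definition W_relators :: "nat \<Rightarrow> idx letter list set" where
  "W_relators m =
     {gen_word [I1, I1], gen_word [I2, I2], gen_word [I3, I3],
      concat (replicate m (gen_word [I1, I2])),
      concat (replicate m (gen_word [I2, I3]))}"

definition W_group :: "nat \<Rightarrow> idx letter list set monoid" where
  "W_group m = presented_group (W_relators m)"

definition W_gen :: "nat \<Rightarrow> idx \<Rightarrow> idx letter list set" where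
  "W_gen m i = pres_class (W_relators m) [(i, True)]"

definition W_prod :: "nat \<Rightarrow> idx list \<Rightarrow> idx letter list set" where
  "W_prod m w = foldr (\<lambda>i x. W_gen m i \<otimes>\<^bsub>W_group m\<^esub> x) w \<one>\<^bsub>W_group m\<^esub>"


section \<open>Lie algebras given by generators and relations\<close>

datatype 'g lie_term =
    LGen 'g
  | LZero
  | LAdd "'g lie_term" "'g lie_term"
  | LScale complex "'g lie_term"
  | LBr "'g lie_term" "'g lie_term"

text \<open>The least congruence containing \<open>R\<close> modulo which the terms form a complex Lie algebra, that
  is, equality in the Lie algebra presented by the generators and the relations \<open>R\<close>.\<close>

inductive lie_cong :: "('g lie_term \<times> 'g lie_term) set \<Rightarrow> 'g lie_term \<Rightarrow> 'g lie_term \<Rightarrow> bool"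
  for R where
  lc_rel: "(x, y) \<in> R \<Longrightarrow> lie_cong R x y"
| lc_refl: "lie_cong R x x"
| lc_sym: "lie_cong R x y \<Longrightarrow> lie_cong R y x"
| lc_trans: "lie_cong R x y \<Longrightarrow> lie_cong R y z \<Longrightarrow> lie_cong R x z"
| lc_add: "lie_cong R x x' \<Longrightarrow> lie_cong R y y' \<Longrightarrow> lie_cong R (LAdd x y) (LAdd x' y')"
| lc_scale: "lie_cong R x x' \<Longrightarrow> lie_cong R (LScale c x) (LScale c x')"
| lc_br: "lie_cong R x x' \<Longrightarrow> lie_cong R y y' \<Longrightarrow> lie_cong R (LBr x y) (LBr x' y')"
| lc_add_assoc: "lie_cong R (LAdd (LAdd x y) z) (LAdd x (LAdd y z))"
| lc_add_commute: "lie_cong R (LAdd x y) (LAdd y x)"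
| lc_add_zero: "lie_cong R (LAdd x LZero) x"
| lc_add_neg: "lie_cong R (LAdd x (LScale (- 1) x)) LZero"
| lc_scale_add: "lie_cong R (LScale c (LAdd x y)) (LAdd (LScale c x) (LScale c y))"
| lc_add_scale: "lie_cong R (LScale (c + d) x) (LAdd (LScale c x) (LScale d x))"
| lc_scale_scale: "lie_cong R (LScale c (LScale d x)) (LScale (c * d) x)"
| lc_scale_one: "lie_cong R (LScale 1 x) x"
| lc_br_add_left: "lie_cong R (LBr (LAdd x y) z) (LAdd (LBr x z) (LBr y z))"
| lc_br_add_right: "lie_cong R (LBr x (LAdd y z)) (LAdd (LBr x y) (LBr x z))"
| lc_br_scale_left: "lie_cong R (LBr (LScale c x) y) (LScale c (LBr x y))"
| lc_br_scale_right: "lie_cong R (LBr x (LScale c y)) (LScale c (LBr x y))"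
| lc_br_self: "lie_cong R (LBr x x) LZero"
| lc_jacobi: "lie_cong R (LAdd (LBr x (LBr y z)) (LAdd (LBr y (LBr z x)) (LBr z (LBr x y)))) LZero"


section \<open>The rank 2 Kac--Moody algebra \<open>H(m)\<close> and its roots\<close>

datatype node = N1 | N2

definition cartan :: "nat \<Rightarrow> node \<Rightarrow> node \<Rightarrow> int" where
  "cartan m i j = (if i = j then 2 else - int m)"

text \<open>The Cartan subalgebra is spanned by the simple coroots and, in the only degenerate case
  \<open>m = 2\<close>, an additional derivation \<open>CD\<close>, so that the simple roots are linearly independent.
  For \<open>m \<noteq> 2\<close> the generator \<open>CD\<close> is set to zero.\<close>

datatype cartan_gen = CH node | CD

datatype km_gen = KE node | KF node | KC cartan_gen

fun simple_root :: "nat \<Rightarrow> node \<Rightarrow> cartan_gen \<Rightarrow> int" where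
  "simple_root m j (CH i) = cartan m i j"
| "simple_root m j CD = (if m = 2 \<and> j = N2 then 1 else 0)"

abbreviation "kE i \<equiv> LGen (KE i)"
abbreviation "kF i \<equiv> LGen (KF i)"
abbreviation "kC c \<equiv> LGen (KC c)"

text \<open>The Chevalley--Serre presentation. Since the Cartan matrix is symmetric, by Gabber and Kac it
  agrees with the quotient by the largest ideal meeting the Cartan subalgebra trivially.\<close>

definition km_relations :: "nat \<Rightarrow> (km_gen lie_term \<times> km_gen lie_term) set" where
  "km_relations m =
     {(LBr (kC c) (kC c'), LZero) | c c'. True}
   \<union> {(LBr (kE i) (kF i), kC (CH i)) | i. True}
   \<union> {(LBr (kE i) (kF j), LZero) | i j. i \<noteq> j}
   \<union> {(LBr (kC c) (kE j), LScale (of_int (simple_root m j c)) (kE j)) | c j. True}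
   \<union> {(LBr (kC c) (kF j), LScale (- of_int (simple_root m j c)) (kF j)) | c j. True}
   \<union> {((LBr (kE i) ^^ nat (1 - cartan m i j)) (kE j), LZero) | i j. i \<noteq> j}
   \<union> {((LBr (kF i) ^^ nat (1 - cartan m i j)) (kF j), LZero) | i j. i \<noteq> j}
   \<union> (if m = 2 then {} else {(kC CD, LZero)})"

abbreviation km_eq :: "nat \<Rightarrow> km_gen lie_term \<Rightarrow> km_gen lie_term \<Rightarrow> bool" where
  "km_eq m \<equiv> lie_cong (km_relations m)"

text \<open>The value on \<open>c\<close> of the element \<open>[a,b]\<close> of the root lattice.\<close>

definition lattice_weight :: "nat \<Rightarrow> int \<times> int \<Rightarrow> cartan_gen \<Rightarrow> int" where
  "lattice_weight m \<alpha> c = fst \<alpha> * simple_root m N1 c + snd \<alpha> * simple_root m N2 c"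

definition km_root_space :: "nat \<Rightarrow> int \<times> int \<Rightarrow> km_gen lie_term set" where
  "km_root_space m \<alpha> =
     {x. \<forall>c. km_eq m (LBr (kC c) x) (LScale (of_int (lattice_weight m \<alpha> c)) x)}"

definition km_root :: "nat \<Rightarrow> int \<times> int \<Rightarrow> bool" where
  "km_root m \<alpha> \<longleftrightarrow> \<alpha> \<noteq> (0, 0) \<and> (\<exists>x \<in> km_root_space m \<alpha>. \<not> km_eq m x LZero)"

definition reduced_positive_roots :: "nat \<Rightarrow> (int \<times> int) set" where
  "reduced_positive_roots m =
     {(a, b). km_root m (a, b) \<and> 0 \<le> a \<and> 0 \<le> b \<and> gcd a b = 1 \<and> a * b \<noteq> 0}"


section \<open>The function \<open>s\<close>\<close>

text \<open>The parameters \<open>t\<close> at which \<open>(t a, t b)\<close> lies on one of the lines. For coprime \<open>a, b > 0\<close>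
  this set is finite and no two lines are crossed at the same parameter.\<close>

definition crossing_times :: "int \<times> int \<Rightarrow> real set" where
  "crossing_times = (\<lambda>(a, b). {t \<in> {0<..<1}.
     t * of_int a \<in> \<int> \<or> t * of_int b \<in> \<int> \<or> t * of_int a + t * of_int b \<in> \<int>})"

definition crossing_label :: "int \<times> int \<Rightarrow> real \<Rightarrow> idx" where
  "crossing_label = (\<lambda>(a, b) t.
     if t * of_int a \<in> \<int> then I3 else if t * of_int b \<in> \<int> then I1 else I2)"

definition s_word :: "int \<times> int \<Rightarrow> idx list" where
  "s_word \<alpha> = map (crossing_label \<alpha>) (sorted_list_of_set (crossing_times \<alpha>))"

definition s_elt :: "nat \<Rightarrow> int \<times> int \<Rightarrow> idx letter list set" where
  "s_elt m \<alpha> = W_prod m (s_word \<alpha>)"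


section \<open>The surface \<open>\<Sigma>\<close>\<close>

definition quotient_topology :: "'a topology \<Rightarrow> ('a \<Rightarrow> 'b) \<Rightarrow> 'b topology" where
  "quotient_topology X f =
     topology (\<lambda>U. U \<subseteq> f ` topspace X \<and> openin X {x \<in> topspace X. f x \<in> U})"

lemma openin_quotient_topology:
  "openin (quotient_topology X f) U \<longleftrightarrow>
     U \<subseteq> f ` topspace X \<and> openin X {x \<in> topspace X. f x \<in> U}"
proof -
  have "istopology (\<lambda>U. U \<subseteq> f ` topspace X \<and> openin X {x \<in> topspace X. f x \<in> U})"
    unfolding istopology_def
  proof (intro conjI allI impI)
    fix S T
    assume S: "S \<subseteq> f ` topspace X \<and> openin X {x \<in> topspace X. f x \<in> S}"
      and T: "T \<subseteq> f ` topspace X \<and> openin X {x \<in> topspace X. f x \<in> T}"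
    show "S \<inter> T \<subseteq> f ` topspace X" using S by blast
    have "{x \<in> topspace X. f x \<in> S \<inter> T}
        = {x \<in> topspace X. f x \<in> S} \<inter> {x \<in> topspace X. f x \<in> T}" by blast
    then show "openin X {x \<in> topspace X. f x \<in> S \<inter> T}" using S T by auto
  next
    fix K
    assume K: "\<forall>U\<in>K. U \<subseteq> f ` topspace X \<and> openin X {x \<in> topspace X. f x \<in> U}"
    show "\<Union>K \<subseteq> f ` topspace X" using K by blast
    have "{x \<in> topspace X. f x \<in> \<Union>K} = (\<Union>U\<in>K. {x \<in> topspace X. f x \<in> U})" by blast
    then show "openin X {x \<in> topspace X. f x \<in> \<Union>K}" using K by auto
  qed
  then show ?thesis
    unfolding quotient_topology_def by (simp add: topology_inverse')
qed

datatype sheet = G1 | G2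

fun next_idx :: "idx \<Rightarrow> idx" where
  "next_idx I1 = I2" | "next_idx I2 = I3" | "next_idx I3 = I1"

text \<open>The triangle is inscribed in the unit circle; its centre is \<open>0\<close>. The edge \<open>T\<^sub>i\<close> runs
  counter-clockwise from \<open>tri_vertex i\<close> to \<open>tri_vertex (next_idx i)\<close>, hence \<open>tri_vertex I1\<close> is the
  common endpoint of \<open>T\<^sub>3\<close> and \<open>T\<^sub>1\<close>.\<close>

fun tri_vertex :: "idx \<Rightarrow> complex" where
  "tri_vertex I1 = 1"
| "tri_vertex I2 = cis (2 * pi / 3)"
| "tri_vertex I3 = cis (4 * pi / 3)"

definition triangle :: "complex set" where
  "triangle = convex hull (range tri_vertex)"

definition edge_point :: "idx \<Rightarrow> real \<Rightarrow> complex" where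
  "edge_point i t = (1 - t) *\<^sub>R tri_vertex i + t *\<^sub>R tri_vertex (next_idx i)"

text \<open>Edges of \<open>G\<^sub>1\<close> are traversed counter-clockwise, those of \<open>G\<^sub>2\<close> clockwise.\<close>

fun oriented_edge :: "sheet \<Rightarrow> idx \<Rightarrow> real \<Rightarrow> sheet \<times> complex" where
  "oriented_edge G1 i t = (G1, edge_point i t)"
| "oriented_edge G2 i t = (G2, edge_point i (1 - t))"

definition glue_rel :: "((sheet \<times> complex) \<times> (sheet \<times> complex)) set" where
  "glue_rel = {(oriented_edge G1 i t, oriented_edge G2 i t) | i t. t \<in> {0..1}}"

definition glue :: "sheet \<times> complex \<Rightarrow> (sheet \<times> complex) set" where
  "glue p = (glue_rel \<union> glue_rel\<inverse>)\<^sup>* `` {p}"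

definition Sigma_top :: "(sheet \<times> complex) set topology" where
  "Sigma_top = quotient_topology (sum_topology (\<lambda>_. top_of_set triangle) UNIV) glue"

definition Edge :: "idx \<Rightarrow> (sheet \<times> complex) set set" where
  "Edge i = glue ` (UNIV \<times> edge_point i ` {0..1})"

definition Edges :: "(sheet \<times> complex) set set" where
  "Edges = (\<Union>i. Edge i)"

definition Vertices :: "(sheet \<times> complex) set set" where
  "Vertices = glue ` (UNIV \<times> range tri_vertex)"

definition Face :: "sheet \<Rightarrow> (sheet \<times> complex) set set" where
  "Face j = glue ` ({j} \<times> interior triangle)"

definition Lseg :: "sheet \<Rightarrow> (sheet \<times> complex) set set" where
  "Lseg j = glue ` ({j} \<times> closed_segment 0 (tri_vertex I1))"


section \<open>Admissible curves and rigid reflections\<close>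

text \<open>Near an interior point of an edge the two sides of that edge are the two open faces, so a
  (topologically) transversal meeting at parameter \<open>x\<close> is a passage from one open face to the
  other one that meets the edges at \<open>x\<close> only.\<close>

definition transversal_at :: "(real \<Rightarrow> (sheet \<times> complex) set) \<Rightarrow> real \<Rightarrow> bool" where
  "transversal_at \<eta> x \<longleftrightarrow>
     (\<exists>\<epsilon>>0. {x - \<epsilon>..x + \<epsilon>} \<subseteq> {0..1} \<and>
       (\<exists>j k. j \<noteq> k \<and> \<eta> ` {x - \<epsilon>..<x} \<subseteq> Face j \<and> \<eta> ` {x<..x + \<epsilon>} \<subseteq> Face k))"

definition admissible :: "(real \<Rightarrow> (sheet \<times> complex) set) \<Rightarrow> bool" where
  "admissible \<eta> \<longleftrightarrow>
     continuous_map (top_of_set {0..1}) Sigma_top \<eta> \<and>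
     (\<forall>x\<in>{0..1}. \<eta> x \<in> Vertices \<longleftrightarrow> x \<in> {0, 1}) \<and>
     (\<exists>\<epsilon>>0. \<epsilon> \<le> 1 \<and> \<eta> ` {0..\<epsilon>} \<subseteq> Lseg G1 \<and> \<eta> ` {1 - \<epsilon>..1} \<subseteq> Lseg G2) \<and>
     (\<forall>x\<in>{0..1}. \<eta> x \<in> Edges - Vertices \<longrightarrow> transversal_at \<eta> x)"

text \<open>Both endpoints of an admissible curve are the point of \<open>Vertices\<close>, whence the half-open interval.\<close>

definition non_self_crossing :: "(real \<Rightarrow> (sheet \<times> complex) set) \<Rightarrow> bool" where
  "non_self_crossing \<eta> \<longleftrightarrow> inj_on \<eta> {0..<1}"

definition curve_word :: "(real \<Rightarrow> (sheet \<times> complex) set) \<Rightarrow> idx list \<Rightarrow> bool" where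
  "curve_word \<eta> w \<longleftrightarrow>
     (\<exists>ts. sorted_wrt (<) ts \<and> set ts = {x \<in> {0<..<1}. \<eta> x \<in> Edges} \<and>
           list_all2 (\<lambda>t i. \<eta> t \<in> Edge i) ts w)"

definition palindromic_words :: "idx list set" where
  "palindromic_words = {w. odd (length w) \<and> rev w = w}"

definition rigid_reflections :: "nat \<Rightarrow> idx letter list set set" where
  "rigid_reflections m =
     {g \<in> carrier (W_group m). \<exists>w \<eta>. g = W_prod m w \<and> admissible \<eta> \<and> non_self_crossing \<eta> \<and>
        curve_word \<eta> w \<and> w \<in> palindromic_words}"

end

theory Submission
  imports Defs "HOL-Library.Function_Algebras"
begin

text \<open>Both sides of the bijection are compared with the same arithmetic set: by \<open>is_root\<close>, the
  coprime \<open>a, b > 0\<close> with \<open>a\<^sup>2 + b\<^sup>2 \<le> m a b + 1\<close>.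

  \<^emph>\<open>Curves and words.\<close> The edges cut a non-self-crossing admissible curve into arcs inside the
  two triangles. Arcs in the same triangle are disjoint, so by a planar separation theorem their
  endpoints do not interlace on its boundary (\<open>disjoint_arcs_non_interlaced\<close>). Only this is kept of
  the curve: it becomes a finite chord diagram (\<open>admissible_curve_diagram\<close>). An innermost pair of
  consecutive crossings of the same edge can be removed, which deletes two equal letters and so does
  not change the element of \<open>W(m)\<close> (\<open>diagram_uturn_free\<close>). If a remaining palindromic diagram first
  crosses \<open>T\<^sub>2\<close>, then counting the crossings on both sides of each chord shows that the crossings of
  \<open>T\<^sub>2\<close> are permuted by a rotation, and the word is that of a straight line of coprime slope.
  Otherwise the first and the last letter can be stripped off. Hence the word is a \<open>spiral\<close> word
  (\<open>palindromic_diagram_spiral\<close>). Conversely a straight line of coprime slope, bent slightly near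
  its ends, is an admissible curve (\<open>line_admissible_curve\<close>), and its word is a palindrome.

  \<^emph>\<open>The group.\<close> \<open>W(m)\<close> is the semidirect product of the free product of two cyclic groups of
  order \<open>m\<close>, generated by \<open>s\<^sub>2 s\<^sub>1\<close> and \<open>s\<^sub>2 s\<^sub>3\<close>, with the group of order \<open>2\<close> generated by \<open>s\<^sub>2\<close>.
  The word of the line to \<open>(a, b)\<close> is \<open>u s\<^sub>2\<close>, where \<open>u\<close> is the cutting word of the line in these
  two generators. The key identity is \<open>cut_word_reflect\<close>: passing from \<open>[a, b]\<close> to its simple
  reflection \<open>[m b - a, b]\<close> complements the exponents of one generator modulo \<open>m\<close>. It lets a descent
  in the style of the Euclidean algorithm lead from every spiral word to the word of a root
  (\<open>spiral_root_element\<close>), and it describes the normal forms in the free product by a recursion from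
  which the root can be read off (\<open>line_word_inj\<close>).

  \<^emph>\<open>The roots.\<close> By the representation theory of \<open>sl\<^sub>2\<close> the weights of the Kac--Moody algebra are
  stable under simple reflections (\<open>km_root_string\<close>), and by the triangular decomposition no weight
  has two coordinates of opposite sign (\<open>km_root_same_sign\<close>). So a coprime root can be reflected
  down until it is simple or lies in the fundamental chamber, which bounds its norm. In the other
  direction, a root of maximal height below a given element of the fundamental chamber must be that
  element, because the simple root vectors do not vanish (\<open>kE_nonzero\<close>); reflections reach the rest
  (\<open>reduced_positive_roots_eq\<close>).\<close>

section \<open>Free reduction of words in involutions\<close>

fun push_letter :: "'a \<Rightarrow> 'a list \<Rightarrow> 'a list" where
  "push_letter i [] = [i]"
| "push_letter i (j # w) = (if i = j then w else i # j # w)"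

text \<open>Reducing letter by letter makes invariance under deletions and under reversal easy; the
  reduced word is the only one without equal neighbours that deletions can reach.\<close>

definition free_red :: "'a list \<Rightarrow> 'a list" where
  "free_red w = foldr push_letter w []"

inductive deletes :: "'a list \<Rightarrow> 'a list \<Rightarrow> bool" where
  deletes_refl: "deletes w w"
| deletes_step: "deletes w (xs @ [i, i] @ ys) \<Longrightarrow> deletes w (xs @ ys)"

lemma deletes_trans: "deletes v w \<Longrightarrow> deletes u v \<Longrightarrow> deletes u w"
  by (induction rule: deletes.induct) (auto intro: deletes.intros)

lemma deletes_append_left: "deletes v w \<Longrightarrow> deletes (u @ v) (u @ w)"
proof (induction rule: deletes.induct)
  case (deletes_step w xs i ys)
  then show ?case using deletes.deletes_step[of "u @ w" "u @ xs" i ys] by simp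
qed (rule deletes_refl)

lemma deletes_rev: "deletes v w \<Longrightarrow> deletes (rev v) (rev w)"
proof (induction rule: deletes.induct)
  case (deletes_step w xs i ys)
  then show ?case using deletes.deletes_step[of "rev w" "rev ys" i "rev xs"] by simp
qed (rule deletes_refl)

lemma distinct_adj_push_letter: "distinct_adj w \<Longrightarrow> distinct_adj (push_letter i w)"
  by (cases w) (auto simp: distinct_adj_Cons)

lemma push_letter_twice: "distinct_adj w \<Longrightarrow> push_letter i (push_letter i w) = w"
proof (cases w)
  case (Cons j v)
  assume "distinct_adj w"
  then show ?thesis using Cons by (cases v) auto
qed simp

lemma distinct_adj_foldr_push: "distinct_adj s \<Longrightarrow> distinct_adj (foldr push_letter w s)"
  by (induction w) (auto intro: distinct_adj_push_letter)

lemma distinct_adj_free_red: "distinct_adj (free_red w)"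
  by (simp add: free_red_def distinct_adj_foldr_push)

lemma free_red_deletes: "deletes v w \<Longrightarrow> free_red v = free_red w"
proof (induction rule: deletes.induct)
  case (deletes_step w xs i ys)
  have "push_letter i (push_letter i (foldr push_letter ys [])) = foldr push_letter ys []"
    by (rule push_letter_twice) (simp add: distinct_adj_foldr_push)
  then show ?case using deletes_step by (simp add: free_red_def)
qed simp

lemma free_red_id: "distinct_adj w \<Longrightarrow> free_red w = w"
proof (induction w)
  case (Cons i w)
  then show ?case by (cases w) (auto simp: free_red_def distinct_adj_Cons)
qed (simp add: free_red_def)

lemma deletes_free_red: "deletes w (free_red w)"
proof (induction w)
  case Nil
  show ?case by (simp add: free_red_def deletes_refl)
next
  case (Cons i w)
  have 1: "deletes (i # w) (i # free_red w)"
    using deletes_append_left[OF Cons, of "[i]"] by simp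
  have "deletes (i # free_red w) (push_letter i (free_red w))"
  proof (cases "free_red w")
    case Nil
    then show ?thesis by (simp add: deletes_refl)
  next
    case C: (Cons j v)
    show ?thesis
    proof (cases "i = j")
      case True
      then show ?thesis
        using deletes_step[of "i # free_red w" "[]" i v] C deletes_refl[of "i # free_red w"] by simp
    next
      case False
      then show ?thesis using C by (simp add: deletes_refl)
    qed
  qed
  then show ?case using 1 deletes_trans by (fastforce simp: free_red_def)
qed

text \<open>A palindrome reduces to a palindrome, which is what survives of the symmetry of a curve after
  its U-turns are removed.\<close>

lemma free_red_rev: "free_red (rev w) = rev (free_red w)"
proof -
  have "free_red (rev w) = free_red (rev (free_red w))"
    by (rule free_red_deletes[OF deletes_rev[OF deletes_free_red]])
  also have "\<dots> = rev (free_red w)"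
    by (rule free_red_id) (simp add: distinct_adj_free_red)
  finally show ?thesis .
qed

section \<open>Chord diagrams of curves on the torus\<close>

text \<open>The boundary of a triangle is parametrized by \<open>[0, 3)\<close>, starting at the common endpoint of
  \<open>T\<^sub>3\<close> and \<open>T\<^sub>1\<close>. A crossing is recorded by its edge and its coordinate \<open>t\<close> on the edge. The flag
  of \<open>bpos\<close> tells the triangles apart: the edges of the second one are traversed clockwise, which
  turns \<open>t\<close> into \<open>1 - t\<close>. \<open>None\<close> stands for the vertex.\<close>

definition edge_num :: "idx \<Rightarrow> real" where
  "edge_num i = (case i of I1 \<Rightarrow> 0 | I2 \<Rightarrow> 1 | I3 \<Rightarrow> 2)"

fun bpos :: "bool \<Rightarrow> (idx \<times> real) option \<Rightarrow> real" where
  "bpos s None = 0"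
| "bpos s (Some (i, t)) = edge_num i + (if s then t else 1 - t)"

text \<open>The chords from \<open>a\<close> to \<open>b\<close> and from \<open>c\<close> to \<open>d\<close> of a disk, cut open at a boundary point, do not
  cross.\<close>

definition non_interlaced :: "real \<Rightarrow> real \<Rightarrow> real \<Rightarrow> real \<Rightarrow> bool" where
  "non_interlaced a b c d \<longleftrightarrow> ((a < c) \<noteq> (b < c)) = ((a < d) \<noteq> (b < d))"

definition stops :: "(idx \<times> real) list \<Rightarrow> (idx \<times> real) option list" where
  "stops D = None # map Some D @ [None]"

definition arc_pos :: "(idx \<times> real) list \<Rightarrow> nat \<Rightarrow> nat \<Rightarrow> real" where
  "arc_pos D l i = bpos (even l) (stops D ! i)"

text \<open>The chord \<open>l\<close> joins the stops \<open>l\<close> and \<open>l + 1\<close>; it lies in the first triangle if \<open>l\<close> is even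
  and in the second one otherwise, and the length is odd because the curve ends in the second
  triangle.\<close>

definition diagram :: "(idx \<times> real) list \<Rightarrow> bool" where
  "diagram D \<longleftrightarrow> odd (length D) \<and> distinct D \<and> (\<forall>(i, t) \<in> set D. 0 < t \<and> t < 1) \<and>
     (\<forall>l l'. l \<le> length D \<and> l' \<le> length D \<and> l \<noteq> l' \<and> even l = even l' \<longrightarrow>
        non_interlaced (arc_pos D l l) (arc_pos D l (Suc l)) (arc_pos D l l') (arc_pos D l (Suc l')))"

lemma stops_0 [simp]: "stops D ! 0 = None"
  by (simp add: stops_def)

lemma stops_last [simp]: "stops D ! Suc (length D) = None"
  by (simp add: stops_def nth_append)

lemma stops_Suc: "i < length D \<Longrightarrow> stops D ! Suc i = Some (D ! i)"
  by (simp add: stops_def nth_append)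

lemma stops_mid: "0 < i \<Longrightarrow> i \<le> length D \<Longrightarrow> stops D ! i = Some (D ! (i - 1))"
  using stops_Suc[of "i - 1" D] by simp

lemma bpos_Some_range:
  "0 < t \<Longrightarrow> t < 1 \<Longrightarrow> edge_num i < bpos s (Some (i, t)) \<and> bpos s (Some (i, t)) < edge_num i + 1"
  by auto

lemma edge_num_simps [simp]: "edge_num I1 = 0" "edge_num I2 = 1" "edge_num I3 = 2"
  by (simp_all add: edge_num_def)

lemma edge_num_eq_iff:
  assumes "edge_num i < x" "x < edge_num i + 1" "edge_num j < x" "x < edge_num j + 1"
  shows "i = j"
  using assms by (cases i; cases j) auto

lemma bpos_inj:
  assumes "0 < t" "t < 1" "0 < t'" "t' < 1" "bpos s (Some (i, t)) = bpos s (Some (i', t'))"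
  shows "i = i' \<and> t = t'"
proof -
  have "i = i'"
    using bpos_Some_range[OF assms(1,2), of i s] bpos_Some_range[OF assms(3,4), of i' s] assms(5)
      edge_num_eq_iff[of i "bpos s (Some (i, t))" i'] by simp
  then show ?thesis using assms(5) by (auto split: if_splits)
qed

lemma bpos_Some_pos: "0 < t \<Longrightarrow> t < 1 \<Longrightarrow> 0 < bpos s (Some (i, t))"
  using bpos_Some_range[of t i s] by (cases i) auto

lemma diagramD:
  assumes "diagram D"
  shows "odd (length D)" "distinct D" "\<And>i t. (i, t) \<in> set D \<Longrightarrow> 0 < t \<and> t < 1"
    "\<And>l l'. l \<le> length D \<Longrightarrow> l' \<le> length D \<Longrightarrow> l \<noteq> l' \<Longrightarrow> even l = even l' \<Longrightarrow>
        non_interlaced (arc_pos D l l) (arc_pos D l (Suc l)) (arc_pos D l l') (arc_pos D l (Suc l'))"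
  using assms unfolding diagram_def by blast+

lemma arc_pos_range:
  assumes "diagram D" "0 < i" "i \<le> length D"
  shows "edge_num (fst (D ! (i - 1))) < arc_pos D l i"
    "arc_pos D l i < edge_num (fst (D ! (i - 1))) + 1" "0 < arc_pos D l i"
proof -
  obtain e t where e: "D ! (i - 1) = (e, t)" by (cases "D ! (i - 1)")
  have "D ! (i - 1) \<in> set D" using assms by auto
  then have t: "0 < t" "t < 1" using diagramD(3)[OF assms(1)] e by auto
  show "edge_num (fst (D ! (i - 1))) < arc_pos D l i"
    "arc_pos D l i < edge_num (fst (D ! (i - 1))) + 1" "0 < arc_pos D l i"
    using bpos_Some_range[OF t, of e "even l"] bpos_Some_pos[OF t, of "even l" e] e assms
    by (simp_all add: arc_pos_def stops_mid)
qed

lemma arc_pos_inj: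
  assumes "diagram D" "0 < i" "i \<le> length D" "0 < j" "j \<le> length D"
    and eq: "arc_pos D l i = arc_pos D l j"
  shows "i = j"
proof -
  obtain e t where e: "D ! (i - 1) = (e, t)" by (cases "D ! (i - 1)")
  obtain e' t' where e': "D ! (j - 1) = (e', t')" by (cases "D ! (j - 1)")
  have "D ! (i - 1) \<in> set D" "D ! (j - 1) \<in> set D" using assms by auto
  then have t: "0 < t" "t < 1" "0 < t'" "t' < 1" using diagramD(3)[OF assms(1)] e e' by auto
  have "e = e' \<and> t = t'"
    by (rule bpos_inj[OF t, of "even l"]) (use eq e e' assms in \<open>simp add: arc_pos_def stops_mid\<close>)
  then have "D ! (i - 1) = D ! (j - 1)" using e e' by simp
  then have "i - 1 = j - 1"
    using diagramD(2)[OF assms(1)] assms by (subst (asm) nth_eq_iff_index_eq) auto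
  then show ?thesis using assms by simp
qed

lemma arc_pos_ends [simp]: "arc_pos D l 0 = 0" "arc_pos D l (Suc (length D)) = 0"
  by (simp_all add: arc_pos_def)

lemma arc_pos_parity: "even l = even l' \<Longrightarrow> arc_pos D l i = arc_pos D l' i"
  by (simp add: arc_pos_def)

text \<open>Inside a face the chords cannot leave the region cut off by another chord.\<close>

definition between :: "real \<Rightarrow> real \<Rightarrow> real \<Rightarrow> bool" where
  "between a b c \<longleftrightarrow> min a b < c \<and> c < max a b"

lemma non_interlaced_between:
  assumes "non_interlaced a b c d" "a \<noteq> c" "a \<noteq> d" "b \<noteq> c" "b \<noteq> d"
  shows "between a b c \<longleftrightarrow> between a b d"
  using assms unfolding non_interlaced_def between_def by (auto simp: min_def max_def)

text \<open>The other end of the chord at \<open>i\<close> in the triangle that contains the chord \<open>l\<close>.\<close>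

definition partner :: "nat \<Rightarrow> nat \<Rightarrow> nat" where
  "partner l i = (if even l = even i then Suc i else i - 1)"

lemma partner_between:
  assumes D: "diagram D" and l: "l \<le> length D" and i: "0 < i" "i \<le> length D" "i \<noteq> l" "i \<noteq> Suc l"
    and b: "between (arc_pos D l l) (arc_pos D l (Suc l)) (arc_pos D l i)"
  shows "0 < partner l i" "partner l i \<le> length D" "partner l i \<noteq> l" "partner l i \<noteq> Suc l"
    "between (arc_pos D l l) (arc_pos D l (Suc l)) (arc_pos D l (partner l i))"
proof -
  define l' where "l' = (if even l = even i then i else i - 1)"
  have l': "even l = even l'" "l' \<noteq> l" "l' \<le> length D"
    using i unfolding l'_def by auto
  have ends: "(i = l' \<and> partner l i = Suc l') \<or> (i = Suc l' \<and> partner l i = l')"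
    using i unfolding l'_def partner_def by auto
  have k: "odd (length D)" by (rule diagramD(1)[OF D])
  have nl: "Suc l' \<noteq> l" "l' \<noteq> Suc l" using l' by auto
  have dist: "arc_pos D l x \<noteq> arc_pos D l y"
    if "x \<in> {l, Suc l}" "y \<in> {l', Suc l'}" for x y
  proof
    assume eq: "arc_pos D l x = arc_pos D l y"
    have "x \<noteq> y" using that nl l' by auto
    have xy: "x \<le> Suc (length D)" "y \<le> Suc (length D)" using that l l' by auto
    have "\<not> (x = 0 \<and> y = Suc (length D))" "\<not> (y = 0 \<and> x = Suc (length D))"
      using that l l' k by auto
    moreover have "x = 0 \<or> x = Suc (length D) \<Longrightarrow> y = 0 \<or> y = Suc (length D)"
      using eq arc_pos_range(3)[OF D, of y l] xy by (cases "0 < y \<and> y \<le> length D") auto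
    moreover have "y = 0 \<or> y = Suc (length D) \<Longrightarrow> x = 0 \<or> x = Suc (length D)"
      using eq arc_pos_range(3)[OF D, of x l] xy by (cases "0 < x \<and> x \<le> length D") auto
    moreover have "0 < x \<Longrightarrow> x \<le> length D \<Longrightarrow> 0 < y \<Longrightarrow> y \<le> length D \<Longrightarrow> x = y"
      using arc_pos_inj[OF D] eq by blast
    ultimately show False using xy \<open>x \<noteq> y\<close> by (metis le_Suc_eq not_gr_zero)
  qed
  have "between (arc_pos D l l) (arc_pos D l (Suc l)) (arc_pos D l l') \<longleftrightarrow>
      between (arc_pos D l l) (arc_pos D l (Suc l)) (arc_pos D l (Suc l'))"
    by (rule non_interlaced_between[OF diagramD(4)[OF D l l'(3)]]) (use l' dist in auto)
  then show bt: "between (arc_pos D l l) (arc_pos D l (Suc l)) (arc_pos D l (partner l i))"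
    using ends b by auto
  have nonneg: "arc_pos D l x \<ge> 0" if "x \<le> Suc (length D)" for x
    using arc_pos_range(3)[OF D, of x l] that by (cases "0 < x \<and> x \<le> length D") (auto simp: le_Suc_eq)
  have "arc_pos D l (partner l i) > 0"
    using bt nonneg[of l] nonneg[of "Suc l"] l unfolding between_def by auto
  then have "partner l i \<noteq> 0" "partner l i \<noteq> Suc (length D)"
    by (auto intro: ccontr) 
  then show "0 < partner l i" "partner l i \<le> length D"
    using ends l' by auto
  show "partner l i \<noteq> l" "partner l i \<noteq> Suc l" using ends l' nl by auto
qed

text \<open>Both ends of a U-turn lie on one edge, so the boundary interval between them stays inside that
  edge.\<close>

lemma uturn_pos:
  assumes D: "diagram D" and l: "0 < l" "l < length D" "fst (D ! (l - 1)) = fst (D ! l)"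
    and b: "between (arc_pos D j l) (arc_pos D j (Suc l)) (arc_pos D j i)" and i: "i \<le> Suc (length D)"
  shows "0 < i" "i \<le> length D" "fst (D ! (i - 1)) = fst (D ! l)"
proof -
  have r: "edge_num (fst (D ! l)) < arc_pos D j l" "arc_pos D j l < edge_num (fst (D ! l)) + 1"
    "edge_num (fst (D ! l)) < arc_pos D j (Suc l)" "arc_pos D j (Suc l) < edge_num (fst (D ! l)) + 1"
    "0 < arc_pos D j l" "0 < arc_pos D j (Suc l)"
    using arc_pos_range[OF D, of l j] arc_pos_range[OF D, of "Suc l" j] l by auto
  have p: "edge_num (fst (D ! l)) < arc_pos D j i" "arc_pos D j i < edge_num (fst (D ! l)) + 1"
    "0 < arc_pos D j i"
    using b r unfolding between_def by auto
  then have "i \<noteq> 0" "i \<noteq> Suc (length D)" by (metis arc_pos_ends less_irrefl)+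
  then show i': "0 < i" "i \<le> length D" using i by auto
  show "fst (D ! (i - 1)) = fst (D ! l)"
    using edge_num_eq_iff p arc_pos_range(1,2)[OF D i', of j] by metis
qed

lemma arc_pos_flip:
  assumes "0 < i" "i \<le> length D"
  shows "arc_pos D (Suc l) i = 2 * edge_num (fst (D ! (i - 1))) + 1 - arc_pos D l i"
proof -
  obtain e t where e: "D ! (i - 1) = (e, t)" by (cases "D ! (i - 1)")
  show ?thesis using assms e by (simp add: arc_pos_def stops_mid)
qed

text \<open>A chord that ends between the two ends of a U-turn is trapped there by non-crossing, hence is
  itself a shorter U-turn. So a shortest U-turn has no crossing between its ends, and then the same
  holds seen from the other triangle.\<close>

lemma innermost_uturn:
  assumes D: "diagram D" and U: "\<not> distinct_adj (map fst D)"
  obtains l where "0 < l" "l < length D" "fst (D ! (l - 1)) = fst (D ! l)"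
    "\<And>i j. i \<le> Suc (length D) \<Longrightarrow> i \<noteq> l \<Longrightarrow> i \<noteq> Suc l \<Longrightarrow>
       \<not> between (arc_pos D j l) (arc_pos D j (Suc l)) (arc_pos D j i)"
proof -
  define L where "L = {l. 0 < l \<and> l < length D \<and> fst (D ! (l - 1)) = fst (D ! l)}"
  define f where "f l = \<bar>arc_pos D l l - arc_pos D l (Suc l)\<bar>" for l
  have "finite L" by (rule finite_subset[of _ "{..<length D}"]) (auto simp: L_def)
  moreover have "L \<noteq> {}"
  proof -
    obtain i where "Suc i < length D" "fst (D ! i) = fst (D ! Suc i)"
      using U by (auto simp: distinct_adj_conv_nth)
    then have "Suc i \<in> L" by (auto simp: L_def)
    then show ?thesis by blast
  qed
  ultimately obtain l where l: "l \<in> L" and min: "\<And>x. x \<in> L \<Longrightarrow> f l \<le> f x"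
    using arg_min_if_finite[of L f] by (metis not_le)
  have l': "0 < l" "l < length D" "fst (D ! (l - 1)) = fst (D ! l)" using l by (auto simp: L_def)
  have no: "\<not> between (arc_pos D l l) (arc_pos D l (Suc l)) (arc_pos D l i)"
    if i: "i \<le> Suc (length D)" "i \<noteq> l" "i \<noteq> Suc l" for i
  proof
    assume b: "between (arc_pos D l l) (arc_pos D l (Suc l)) (arc_pos D l i)"
    note u = uturn_pos[OF D l' b i(1)]
    note p = partner_between[OF D less_imp_le[OF l'(2)] u(1,2) i(2,3) b]
    have u2: "fst (D ! (partner l i - 1)) = fst (D ! l)"
      by (rule uturn_pos(3)[OF D l' p(5)]) (use p(2) in simp)
    define l2 where "l2 = min i (partner l i)"
    have l2: "{i, partner l i} = {l2, Suc l2}" "even l2 = even l"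
      using u(1) unfolding l2_def partner_def by (auto simp: min_def)
    have l2': "0 < l2" "l2 < length D" "fst (D ! (l2 - 1)) = fst (D ! l2)"
      using u p u2 l2 unfolding l2_def partner_def by (auto simp: min_def split: if_splits)
    then have "f l \<le> f l2" by (intro min) (simp add: L_def)
    moreover have "between (arc_pos D l l) (arc_pos D l (Suc l)) (arc_pos D l l2)"
      "between (arc_pos D l l) (arc_pos D l (Suc l)) (arc_pos D l (Suc l2))"
      using b p(5) l2(1) by (metis insertCI insertE singletonD)+
    moreover have "arc_pos D l2 = arc_pos D l" using arc_pos_parity[OF l2(2)] by blast
    ultimately show False unfolding f_def between_def by (auto simp: min_def max_def split: if_splits)
  qed
  show thesis
  proof (rule that[OF l'])
    fix i j assume i: "i \<le> Suc (length D)" "i \<noteq> l" "i \<noteq> Suc l"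
    show "\<not> between (arc_pos D j l) (arc_pos D j (Suc l)) (arc_pos D j i)"
    proof (cases "even j = even l")
      case True
      then have "arc_pos D j = arc_pos D l" using arc_pos_parity by blast
      then show ?thesis using no[OF i] by simp
    next
      case False
      then have j: "arc_pos D j = arc_pos D (Suc l)" using arc_pos_parity[of j "Suc l"] by auto
      show ?thesis
      proof
        assume b: "between (arc_pos D j l) (arc_pos D j (Suc l)) (arc_pos D j i)"
        note u = uturn_pos[OF D l' b i(1)]
        have "between (arc_pos D l l) (arc_pos D l (Suc l)) (arc_pos D l i)"
          using b u l' arc_pos_flip[OF u(1,2), of l] arc_pos_flip[of l D l]
            arc_pos_flip[of "Suc l" D l]
          unfolding j between_def by (auto simp: min_def max_def split: if_splits)
        then show False using no[OF i] by blast
      qed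
    qed
  qed
qed

text \<open>Without the U-turn its two neighbouring chords merge into one. Nothing lies between the two
  removed crossings, so every other crossing is on the same side of both, and the merged chord
  crosses nothing.\<close>

lemma diagram_remove_uturn:
  assumes D: "diagram D" and U: "\<not> distinct_adj (map fst D)"
  obtains xs x y ys where "D = xs @ [x, y] @ ys" "fst x = fst y" "diagram (xs @ ys)"
proof -
  obtain l where l: "0 < l" "l < length D" "fst (D ! (l - 1)) = fst (D ! l)"
    and no: "\<And>i j. i \<le> Suc (length D) \<Longrightarrow> i \<noteq> l \<Longrightarrow> i \<noteq> Suc l \<Longrightarrow>
       \<not> between (arc_pos D j l) (arc_pos D j (Suc l)) (arc_pos D j i)"
    using innermost_uturn[OF D U] by blast
  define xs where "xs = take (l - 1) D"
  define ys where "ys = drop (Suc l) D"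
  have split: "D = xs @ [D ! (l - 1), D ! l] @ ys"
  proof -
    have "drop (l - 1) D = D ! (l - 1) # drop l D"
      using l Cons_nth_drop_Suc[of "l - 1" D] by simp
    also have "drop l D = D ! l # ys" using l Cons_nth_drop_Suc[of l D] by (simp add: ys_def)
    finally show ?thesis using append_take_drop_id[of "l - 1" D] by (simp add: xs_def)
  qed
  have lenx: "length xs = l - 1" using l by (simp add: xs_def)
  define D' where "D' = xs @ ys"
  have len: "length D' + 2 = length D" using arg_cong[OF split, of length] by (simp add: D'_def)
  \<comment> \<open>The position in \<open>D\<close> of the stop \<open>i\<close> of the shorter diagram.\<close>
  define g where "g i = (if i < l then i else i + 2)" for i
  have st: "stops D' ! i = stops D ! g i" if "i \<le> Suc (length D')" for i
  proof -
    have s1: "stops D = (None # map Some xs) @ [Some (D ! (l - 1)), Some (D ! l)] @ (map Some ys @ [None])"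
      by (subst split) (simp add: stops_def)
    have s2: "stops D' = (None # map Some xs) @ (map Some ys @ [None])"
      by (simp add: stops_def D'_def)
    have ll: "length (None # map Some xs) = l" using lenx l by simp
    show ?thesis
    proof (cases "i < l")
      case True
      then show ?thesis unfolding s1 s2 g_def by (simp only: nth_append ll) simp
    next
      case False
      then have "i + 2 - l = Suc (Suc (i - l))" by simp
      then show ?thesis using False unfolding s1 s2 g_def by (simp only: nth_append ll) simp
    qed
  qed
  have ap: "arc_pos D' j i = arc_pos D j (g i)" if "i \<le> Suc (length D')" for i j
    using st[OF that] by (simp add: arc_pos_def)
  have odd: "odd (length D')" using diagramD(1)[OF D] len by presburger
  have dst: "distinct D'" using diagramD(2)[OF D] by (subst (asm) split) (auto simp: D'_def)
  have rng: "\<forall>(i, t) \<in> set D'. 0 < t \<and> t < 1"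
  proof -
    have "set D' \<subseteq> set D" by (subst split) (auto simp: D'_def)
    then show ?thesis using diagramD(3)[OF D] by blast
  qed
  have adj: "(arc_pos D j l < arc_pos D j i) = (arc_pos D j (Suc l) < arc_pos D j i)"
    "(arc_pos D j i < arc_pos D j l) = (arc_pos D j i < arc_pos D j (Suc l))"
    if i: "i \<le> Suc (length D)" "i \<noteq> l" "i \<noteq> Suc l" for i j
  proof -
    have p: "0 < arc_pos D j l" "0 < arc_pos D j (Suc l)"
      using arc_pos_range(3)[OF D, of l j] arc_pos_range(3)[OF D, of "Suc l" j] l by auto
    have ne: "arc_pos D j i \<noteq> arc_pos D j l" "arc_pos D j i \<noteq> arc_pos D j (Suc l)"
    proof -
      have "i = 0 \<or> i = Suc (length D) \<or> 0 < i \<and> i \<le> length D" using i by auto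
      then show "arc_pos D j i \<noteq> arc_pos D j l" "arc_pos D j i \<noteq> arc_pos D j (Suc l)"
        using p arc_pos_inj[OF D, of i l j] arc_pos_inj[OF D, of i "Suc l" j] i l by auto
    qed
    show "(arc_pos D j l < arc_pos D j i) = (arc_pos D j (Suc l) < arc_pos D j i)"
      "(arc_pos D j i < arc_pos D j l) = (arc_pos D j i < arc_pos D j (Suc l))"
      using no[OF i, of j] ne unfolding between_def by (auto simp: min_def max_def split: if_splits)
  qed
  have nc: "non_interlaced (arc_pos D' j j) (arc_pos D' j (Suc j)) (arc_pos D' j j') (arc_pos D' j (Suc j'))"
    if j: "j \<le> length D'" "j' \<le> length D'" "j \<noteq> j'" "even j = even j'" for j j'
  proof -
    have old: "non_interlaced (arc_pos D j i) (arc_pos D j (Suc i)) (arc_pos D j i') (arc_pos D j (Suc i'))"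
      if "i \<le> length D" "i' \<le> length D" "i \<noteq> i'" "even i = even j" "even i' = even j" for i i'
      using diagramD(4)[OF D that(1,2,3)] that arc_pos_parity[of i j D] by auto
    have gb: "g i \<le> length D" "g i \<noteq> l" "g i \<noteq> Suc l" "even (g i) = even i"
      if "i \<le> length D'" for i
      using that len unfolding g_def by auto
    have gS: "g (Suc i) = Suc (g i)" if "i \<noteq> l - 1" for i using that l unfolding g_def by auto
    have gSb: "g (Suc i) \<le> Suc (length D)" "g (Suc i) \<noteq> l" "g (Suc i) \<noteq> Suc l" 
      if "i \<le> length D'" for i
      using that len unfolding g_def by auto
    note e = ap[of j j] ap[of "Suc j" j] ap[of j' j] ap[of "Suc j'" j]
    consider "j \<noteq> l - 1" "j' \<noteq> l - 1" | "j = l - 1" "j' \<noteq> l - 1" | "j \<noteq> l - 1" "j' = l - 1"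
      using j(3) by blast
    then show ?thesis
    proof cases
      case 1
      have "g j \<noteq> g j'" using j(3) unfolding g_def by auto
      then show ?thesis using old[of "g j" "g j'"] 1 j gb e gS by simp
    next
      case 2
      have gg: "g j = l - 1" "g (Suc j) = Suc (Suc l)" using 2 l unfolding g_def by auto
      have "Suc (l - 1) = l" using l by simp
      have n: "g j' \<noteq> l - 1" "g j' \<noteq> Suc l" using 2 gb[OF j(2)] unfolding g_def by auto
      have 3: "non_interlaced (arc_pos D j (l - 1)) (arc_pos D j l) (arc_pos D j (g j')) (arc_pos D j (Suc (g j')))"
        using old[of "l - 1" "g j'"] 2 j gb[OF j(2)] n l by simp
      have 4: "non_interlaced (arc_pos D j (Suc l)) (arc_pos D j (Suc (Suc l))) (arc_pos D j (g j')) (arc_pos D j (Suc (g j')))"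
        using old[of "Suc l" "g j'"] 2 j gb[OF j(2)] n l by simp
      have a1: "(arc_pos D j l < arc_pos D j (g j')) = (arc_pos D j (Suc l) < arc_pos D j (g j'))"
        using adj(1)[of "g j'" j] gb[OF j(2)] by simp
      have a2: "(arc_pos D j l < arc_pos D j (Suc (g j'))) = (arc_pos D j (Suc l) < arc_pos D j (Suc (g j')))"
        using adj(1)[of "Suc (g j')" j] gSb[OF j(2)] gS[OF 2(2)] by simp
      show ?thesis using 3 4 a1 a2 e j gg gS[OF 2(2)] unfolding non_interlaced_def by auto
    next
      case 3
      have gg: "g j' = l - 1" "g (Suc j') = Suc (Suc l)" using 3 l unfolding g_def by auto
      have n: "g j \<noteq> l - 1" "g j \<noteq> Suc l" using 3 gb[OF j(1)] unfolding g_def by auto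
      have 4: "non_interlaced (arc_pos D j (g j)) (arc_pos D j (Suc (g j))) (arc_pos D j (l - 1)) (arc_pos D j l)"
        using old[of "g j" "l - 1"] 3 j gb[OF j(1)] n l by simp
      have 5: "non_interlaced (arc_pos D j (g j)) (arc_pos D j (Suc (g j))) (arc_pos D j (Suc l)) (arc_pos D j (Suc (Suc l)))"
        using old[of "g j" "Suc l"] 3 j gb[OF j(1)] n l by simp
      have a1: "(arc_pos D j (g j) < arc_pos D j l) = (arc_pos D j (g j) < arc_pos D j (Suc l))"
        using adj(2)[of "g j" j] gb[OF j(1)] by simp
      have a2: "(arc_pos D j (Suc (g j)) < arc_pos D j l) = (arc_pos D j (Suc (g j)) < arc_pos D j (Suc l))"
        using adj(2)[of "Suc (g j)" j] gSb[OF j(1)] gS[OF 3(1)] by simp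
      show ?thesis using 4 5 a1 a2 e j gg gS[OF 3(1)] unfolding non_interlaced_def by auto
    qed
  qed
  have "diagram D'" unfolding diagram_def using odd dst rng nc by blast
  then show thesis using that[OF split l(3)] by (simp add: D'_def)
qed

lemma diagram_uturn_free:
  assumes "diagram D"
  obtains D' where "diagram D'" "distinct_adj (map fst D')" "deletes (map fst D) (map fst D')"
proof -
  have "\<exists>D'. diagram D' \<and> distinct_adj (map fst D') \<and> deletes (map fst D) (map fst D')"
    using assms
  proof (induction "length D" arbitrary: D rule: less_induct)
    case less
    show ?case
    proof (cases "distinct_adj (map fst D)")
      case True
      then show ?thesis using less.prems deletes_refl by blast
    next
      case False
      obtain xs x y ys where s: "D = xs @ [x, y] @ ys" "fst x = fst y" "diagram (xs @ ys)"
        using diagram_remove_uturn[OF less.prems False] .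
      obtain D' where D': "diagram D'" "distinct_adj (map fst D')" "deletes (map fst (xs @ ys)) (map fst D')"
        using less.hyps[OF _ s(3)] s(1) by auto
      have "deletes (map fst D) (map fst (xs @ ys))"
        using deletes_step[OF deletes_refl, of "map fst xs" "fst x" "map fst ys"] s(1,2) by simp
      then show ?thesis using D' deletes_trans by blast
    qed
  qed
  then show thesis using that by blast
qed

section \<open>Cutting words of lines and spiral words\<close>

text \<open>\<open>cut_letter a b j\<close> tells which line other than a diagonal the segment to \<open>(a, b)\<close> crosses
  between the diagonals \<open>x + y = j\<close> and \<open>x + y = j + 1\<close>: the abscissa there goes from \<open>j a / (a +
  b)\<close> to \<open>(j + 1) a / (a + b)\<close>, and the line is vertical if and only if the integer part jumps.\<close>

definition cut_letter :: "nat \<Rightarrow> nat \<Rightarrow> nat \<Rightarrow> idx" where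
  "cut_letter a b j = (if Suc j * a div (a + b) = j * a div (a + b) then I1 else I3)"

definition cut_word :: "nat \<Rightarrow> nat \<Rightarrow> idx list" where
  "cut_word a b = map (cut_letter a b) [1..<a + b - 1]"

text \<open>The segment to \<open>(a, b)\<close> crosses diagonals and other lines alternately.\<close>

definition interleave :: "idx list \<Rightarrow> idx list" where
  "interleave u = I2 # concat (map (\<lambda>i. [i, I2]) u)"

abbreviation line_word :: "nat \<Rightarrow> nat \<Rightarrow> idx list" where
  "line_word a b \<equiv> interleave (cut_word a b)"

fun prev_idx :: "idx \<Rightarrow> idx" where
  "prev_idx I1 = I3" | "prev_idx I2 = I1" | "prev_idx I3 = I2"

fun mirror_idx :: "idx \<Rightarrow> idx" where
  "mirror_idx I1 = I3" | "mirror_idx I2 = I2" | "mirror_idx I3 = I1"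

text \<open>The words of curves that wind around the vertex before and after following a straight line.
  The relabelling by \<open>next_idx\<close> or \<open>prev_idx\<close> rotates the triangles by a third of a full turn.\<close>

inductive spiral :: "idx list \<Rightarrow> bool" where
  spiral_line: "0 < a \<Longrightarrow> 0 < b \<Longrightarrow> coprime a b \<Longrightarrow> spiral (line_word a b)"
| spiral_I1: "spiral [I1]"
| spiral_I3: "spiral [I3]"
| spiral_right: "spiral w \<Longrightarrow> spiral (I1 # map next_idx w @ [I1])"
| spiral_left: "spiral w \<Longrightarrow> spiral (I3 # map prev_idx w @ [I3])"

lemma idx_inverses [simp]:
  "next_idx (prev_idx i) = i" "prev_idx (next_idx i) = i" "mirror_idx (mirror_idx i) = i"
  "mirror_idx (next_idx i) = prev_idx (mirror_idx i)"
  "mirror_idx (prev_idx i) = next_idx (mirror_idx i)"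
  by (cases i; simp)+

lemma interleave_append: "interleave (u @ [i]) = interleave u @ [i, I2]"
  by (simp add: interleave_def)

lemma interleave_eqI:
  assumes "length w = 2 * n + 1" "length u = n" "\<And>j. j \<le> n \<Longrightarrow> w ! (2 * j) = I2"
    "\<And>j. j < n \<Longrightarrow> w ! (2 * j + 1) = u ! j"
  shows "w = interleave u"
  using assms
proof (induction n arbitrary: w u)
  case 0
  then have "w = [w ! 0]" by (cases w) auto
  then show ?case using 0 by (simp add: interleave_def)
next
  case (Suc n)
  have s: "w = take (2 * n + 1) w @ [w ! (2 * n + 1), w ! (2 * n + 2)]"
    using Suc.prems(1) by (intro nth_equalityI)
      (auto simp: nth_append less_Suc_eq nth_Cons' not_less)
  have t: "take (2 * n + 1) w = interleave (butlast u)"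
    by (rule Suc.IH) (use Suc.prems in \<open>auto simp: nth_butlast\<close>)
  have u: "u = butlast u @ [u ! n]"
    using Suc.prems(2) by (metis append_butlast_last_id diff_Suc_1 last_conv_nth length_0_conv nat.distinct(1))
  have "w ! (2 * n + 1) = u ! n" "w ! (2 * n + 2) = I2"
    using Suc.prems(3)[of "Suc n"] Suc.prems(4)[of n] by simp_all
  then show ?case using s t u interleave_append by metis
qed

text \<open>In this form a cutting word is the coding of a rotation by \<open>a\<close> modulo \<open>a + b\<close>, the form in
  which it comes out of a chord diagram.\<close>

lemma cut_letter_alt:
  "cut_letter a b j = (if j * a mod (a + b) + a < a + b then I1 else I3)" if "0 < b"
proof -
  have "Suc j * a div (a + b) = (j * a mod (a + b) + a + (a + b) * (j * a div (a + b))) div (a + b)"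
    by (metis add.assoc add.commute mod_mult_div_eq mult_Suc)
  also have "\<dots> = (j * a mod (a + b) + a) div (a + b) + j * a div (a + b)"
    using that by (metis add.commute add_gr_0 div_mult_self2 neq0_conv)
  finally have "Suc j * a div (a + b) = j * a div (a + b) \<longleftrightarrow> (j * a mod (a + b) + a) div (a + b) = 0"
    by simp
  also have "\<dots> \<longleftrightarrow> j * a mod (a + b) + a < a + b" using that by (auto simp: div_eq_0_iff)
  finally show ?thesis by (simp add: cut_letter_def)
qed

lemma coprime_add_self: "coprime (a :: nat) (a + b) \<longleftrightarrow> coprime a b"
  by (simp only: coprime_iff_gcd_eq_1 gcd_add2)

lemma coprime_not_dvd: "coprime N a \<Longrightarrow> 0 < j \<Longrightarrow> j < N \<Longrightarrow> \<not> N dvd j * a" for N a j :: nat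
  using coprime_dvd_mult_left_iff[of N a j] dvd_imp_le[of N j] by auto

text \<open>The two quotients add up to the integer \<open>i m\<close> without being integers, so their integer parts
  add up to one less.\<close>

lemma div_complement: "\<not> b dvd i * a \<Longrightarrow> i * (m * b - a) div b + i * a div b + 1 = i * m"
  if "0 < b" "a < m * b" for a b i m :: nat
proof -
  assume nd: "\<not> b dvd i * a"
  then have r: "0 < i * a mod b" "i * a mod b < b" using that by (simp_all add: mod_greater_zero_iff_not_dvd)
  have e: "i * (m * b - a) + i * a = i * m * b"
    using that by (simp add: diff_mult_distrib2 algebra_simps)
  have q: "i * a = i * a div b * b + i * a mod b" by simp
  have lt: "i * a div b < i * m"
  proof -
    have "0 < i" using nd by (cases i) auto
    then have "i * a < i * (m * b)" using that by simp
    then show ?thesis using that by (simp add: div_less_iff_less_mult algebra_simps)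
  qed
  define d where "d = i * m - i * a div b - 1"
  have im: "i * m = d + i * a div b + 1" using lt by (simp add: d_def)
  have "i * (m * b - a) + (i * a div b * b + i * a mod b) = (d + i * a div b + 1) * b" using e q im by simp
  moreover have "(d + i * a div b + 1) * b = d * b + i * a div b * b + b" by (simp add: algebra_simps)
  moreover define e where "e = b - i * a mod b"
  ultimately have "i * (m * b - a) = d * b + e" using r by linarith
  moreover have "e < b" using r by (simp add: e_def)
  ultimately have "i * (m * b - a) div b = d" by simp
  then show ?thesis using im by simp
qed

lemma div_Suc_cases: "Suc j * a div (a + b) = j * a div (a + b) \<or> Suc j * a div (a + b) = j * a div (a + b) + 1" if "0 < b" for a b j :: nat
proof -
  have "Suc j * a div (a + b) \<le> (j * a + (a + b) * 1) div (a + b)" by (rule div_le_mono) simp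
  also have "\<dots> = j * a div (a + b) + 1" using that by simp
  finally show ?thesis using div_le_mono[of "j * a" "Suc j * a" "a + b"] by simp linarith
qed

lemma cut_letter_mirror:
  assumes "0 < a" "0 < b" "coprime a b" "1 \<le> j" "j < a + b - 1"
  shows "cut_letter b a j = mirror_idx (cut_letter a b j)"
proof -
  define N where "N = a + b"
  have cN: "coprime N a"
    using assms(3) coprime_add_self[of a b] unfolding N_def by (simp add: coprime_commute)
  have nd: "\<not> N dvd j * a" "\<not> N dvd Suc j * a"
    using coprime_not_dvd[OF cN, of j] coprime_not_dvd[OF cN, of "Suc j"] assms by (auto simp: N_def)
  have e: "1 * N - a = b" "0 < N" "a < 1 * N" using assms by (auto simp: N_def)
  have "j * b div N + j * a div N + 1 = j" "Suc j * b div N + Suc j * a div N + 1 = Suc j"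
    using div_complement[OF e(2,3) nd(1)] div_complement[OF e(2,3) nd(2)] unfolding e(1) by simp_all
  moreover have "Suc j * a div N = j * a div N \<or> Suc j * a div N = j * a div N + 1"
    unfolding N_def by (rule div_Suc_cases[OF assms(2)])
  ultimately have "Suc j * b div N = j * b div N \<longleftrightarrow> Suc j * a div N \<noteq> j * a div N" by linarith
  then show ?thesis by (simp add: cut_letter_def N_def add.commute[of b a] del: mult_Suc)
qed

lemma interleave_map: "f I2 = I2 \<Longrightarrow> map f (interleave u) = interleave (map f u)"
  by (induction u) (auto simp: interleave_def)

lemma line_word_mirror:
  assumes "0 < a" "0 < b" "coprime a b"
  shows "line_word b a = map mirror_idx (line_word a b)"
proof -
  have "cut_word b a = map mirror_idx (cut_word a b)"
    using cut_letter_mirror[OF assms] by (auto simp: cut_word_def add.commute)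
  then show ?thesis by (simp add: interleave_map)
qed

lemma spiral_mirror: "spiral w \<Longrightarrow> spiral (map mirror_idx w)"
proof (induction rule: spiral.induct)
  case (spiral_line a b)
  then show ?case using spiral.spiral_line[of b a] line_word_mirror[of a b] by (simp add: coprime_commute)
next
  case (spiral_right w)
  then show ?case using spiral.spiral_left[of "map mirror_idx w"] by (simp add: o_def)
next
  case (spiral_left w)
  then show ?case using spiral.spiral_right[of "map mirror_idx w"] by (simp add: o_def)
qed (simp_all add: spiral.intros)

section \<open>Classification of the diagrams without U-turns\<close>

definition label :: "(idx \<times> real) list \<Rightarrow> nat \<Rightarrow> idx" where
  "label D i = fst (D ! (i - 1))"

definition height :: "(idx \<times> real) list \<Rightarrow> nat \<Rightarrow> real" where
  "height D i = snd (D ! (i - 1))"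

lemma arc_pos_label:
  assumes "0 < i" "i \<le> length D"
  shows "arc_pos D l i = edge_num (label D i) + (if even l then height D i else 1 - height D i)"
  using assms by (cases "D ! (i - 1)") (simp add: arc_pos_def stops_mid label_def height_def)

lemma height_range:
  assumes "diagram D" "0 < i" "i \<le> length D"
  shows "0 < height D i" "height D i < 1"
proof -
  have "D ! (i - 1) \<in> set D" using assms by auto
  then show "0 < height D i" "height D i < 1"
    using diagramD(3)[OF assms(1), of "fst (D ! (i - 1))" "snd (D ! (i - 1))"] by (auto simp: height_def)
qed

lemma label_neq:
  assumes "distinct_adj (map fst D)" "0 < i" "Suc i \<le> length D"
  shows "label D i \<noteq> label D (Suc i)"
proof -
  have "Suc (i - 1) < length (map fst D)" using assms by simp
  then have "map fst D ! (i - 1) \<noteq> map fst D ! Suc (i - 1)"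
    using assms(1) by (simp only: distinct_adj_conv_nth) auto
  then show ?thesis using assms by (simp add: label_def)
qed

lemma label_partner_neq:
  assumes "distinct_adj (map fst D)" "0 < i" "i \<le> length D" "0 < partner l i" "partner l i \<le> length D"
  shows "label D i \<noteq> label D (partner l i)"
proof (cases "even l = even i")
  case True
  then show ?thesis using label_neq[OF assms(1), of i] assms by (simp add: partner_def)
next
  case False
  then show ?thesis using label_neq[OF assms(1), of "i - 1"] assms by (simp add: partner_def)
qed

text \<open>The chord from the vertex to \<open>T\<^sub>1\<close> cuts off a piece of \<open>T\<^sub>1\<close> only. A chord inside that piece
  would join two points of \<open>T\<^sub>1\<close>, which is a U-turn.\<close>

lemma end_lowest:
  assumes D: "diagram D" and U: "distinct_adj (map fst D)"
    and e: "e = 1 \<and> l = 0 \<or> e = length D \<and> l = length D"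
    and lab: "label D e = I1" and i: "0 < i" "i \<le> length D" "i \<noteq> e" "label D i = I1"
  shows "arc_pos D l e < arc_pos D l i"
proof (rule ccontr)
  assume neg: "\<not> arc_pos D l e < arc_pos D l i"
  have e': "0 < e" "e \<le> length D" using e i by auto
  have "arc_pos D l i \<noteq> arc_pos D l e" using arc_pos_inj[OF D i(1,2) e'] i by blast
  then have lt: "arc_pos D l i < arc_pos D l e" using neg by simp
  have l: "l \<le> length D" "{l, Suc l} = {0, 1} \<or> {l, Suc l} = {length D, Suc (length D)}" using e by auto
  have p: "{arc_pos D l l, arc_pos D l (Suc l)} = {0, arc_pos D l e}" using e by auto
  have il: "i \<noteq> l" "i \<noteq> Suc l" using e i by auto
  have e1: "arc_pos D l e < 1" "0 < arc_pos D l e"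
    using height_range[OF D e'] lab by (auto simp: arc_pos_label[OF e'])
  have bt: "between (arc_pos D l l) (arc_pos D l (Suc l)) x \<longleftrightarrow> 0 < x \<and> x < arc_pos D l e" for x
    using p e1 unfolding between_def by (auto simp: doubleton_eq_iff)
  have "0 < arc_pos D l i" by (rule arc_pos_range(3)[OF D i(1,2)])
  then have "between (arc_pos D l l) (arc_pos D l (Suc l)) (arc_pos D l i)" using bt lt by simp
  note q = partner_between[OF D l(1) i(1,2) il this]
  have "arc_pos D l (partner l i) < 1" using q(5) bt e1 by auto
  then have "label D (partner l i) = I1"
    using height_range[OF D q(1,2)] arc_pos_label[OF q(1,2), of l]
    by (cases "label D (partner l i)") (auto split: if_splits)
  then show False using label_partner_neq[OF U i(1,2) q(1,2)] i(4) by simp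
qed

text \<open>The new parameter after the starting point of the boundary is moved to the other end of \<open>T\<^sub>1\<close>.\<close>

definition rot_pos :: "real \<Rightarrow> real" where
  "rot_pos p = (if p < 1 then p + 2 else p - 1)"

lemma non_interlaced_rot:
  assumes "0 \<le> a" "a < 3" "0 \<le> b" "b < 3" "0 \<le> c" "c < 3" "0 \<le> d" "d < 3"
    and "non_interlaced a b c d"
  shows "non_interlaced (rot_pos a) (rot_pos b) (rot_pos c) (rot_pos d)"
proof -
  have r: "(rot_pos x < rot_pos y) = ((x < y) \<noteq> ((x < 1) \<noteq> (y < 1)))"
    if "0 \<le> x" "x < 3" "0 \<le> y" "y < 3" for x y
    using that unfolding rot_pos_def by auto
  show ?thesis using assms r unfolding non_interlaced_def by auto
qed

text \<open>If both end chords run from the vertex to \<open>T\<^sub>1\<close>, the ends of the curve can be pulled across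
  \<open>T\<^sub>1\<close>. They are then attached to the other endpoint of \<open>T\<^sub>1\<close>, which is the same point of the
  torus, and the triangles exchange their roles: hence \<open>1 - t\<close> and the shifted labels.\<close>

definition strip :: "(idx \<times> real) list \<Rightarrow> (idx \<times> real) list" where
  "strip D = map (\<lambda>(i, t). (prev_idx i, 1 - t)) (butlast (tl D))"

lemma diagram_strip:
  assumes D: "diagram D" and U: "distinct_adj (map fst D)" and k: "3 \<le> length D"
    and lab: "label D 1 = I1" "label D (length D) = I1"
  shows "diagram (strip D)"
proof -
  define k where "k = length D"
  have k3: "3 \<le> k" "odd k" using k diagramD(1)[OF D] by (auto simp: k_def)
  have len: "length (strip D) = k - 2" by (simp add: strip_def k_def)
  \<comment> \<open>The ends of the shorter curve sit at the parameter \<open>1\<close>, which \<open>rot_pos\<close> sends to \<open>0\<close>.\<close>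
  define h where "h l i = (if i = 1 \<or> i = k then 1 else arc_pos D l i)" for l i
  have nthS: "strip D ! j = (case D ! Suc j of (i, t) \<Rightarrow> (prev_idx i, 1 - t))" if "j < k - 2" for j
    using that k3 by (auto simp: strip_def k_def nth_butlast nth_tl)
  have new: "arc_pos (strip D) l j = rot_pos (h (Suc l) (Suc j))" if j: "j \<le> k - 1" for l j
  proof (cases "j = 0 \<or> j = k - 1")
    case True
    then have "stops (strip D) ! j = None" using len k3 by (auto simp: stops_def nth_append)
    then show ?thesis using True k3 by (auto simp: arc_pos_def h_def rot_pos_def)
  next
    case False
    then have j: "0 < j" "j \<le> k - 2" using j by auto
    obtain e t where et: "D ! j = (e, t)" by (cases "D ! j")
    have "D ! j \<in> set D" using j by (auto simp: k_def)
    then have t: "0 < t" "t < 1" using et diagramD(3)[OF D] by auto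
    have "stops (strip D) ! j = Some (prev_idx e, 1 - t)"
      using j len nthS[of "j - 1"] et by (simp add: stops_mid)
    moreover have "stops D ! Suc j = Some (e, t)" using j et by (simp add: stops_Suc k_def)
    ultimately show ?thesis using j t k3 by (cases e) (auto simp: arc_pos_def h_def rot_pos_def)
  qed
  have low1: "arc_pos D 0 1 < arc_pos D 0 i" if "0 < i" "i \<le> k" "i \<noteq> 1" "label D i = I1" for i
    using end_lowest[OF D U _ lab(1), of 0 i] that by (simp add: k_def)
  have lowk: "arc_pos D k k < arc_pos D k i" if "0 < i" "i \<le> k" "i \<noteq> k" "label D i = I1" for i
    using end_lowest[OF D U _ lab(2), of k i] that by (simp add: k_def)
  have special: "(arc_pos D l s < arc_pos D l c) = (1 < arc_pos D l c)"
     "(arc_pos D l c < arc_pos D l s) = (arc_pos D l c < 1)"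
    if s: "s = 1 \<and> odd l \<or> s = k \<and> even l" and c: "0 < c" "c \<le> k" "c \<noteq> s" for l s c
  proof -
    have s': "0 < s" "s \<le> k" "label D s = I1" using s k3 lab by (auto simp: k_def)
    have "arc_pos D l c < arc_pos D l s \<and> arc_pos D l c < 1 \<and> arc_pos D l s < 1" if "label D c = I1"
    proof -
      have "arc_pos D (Suc l) s < arc_pos D (Suc l) c"
        using s low1[OF c(1,2) _ that] lowk[OF c(1,2) _ that] c(3) k3
          arc_pos_parity[of "Suc l" 0 D] arc_pos_parity[of "Suc l" k D] by auto
      then show ?thesis
        using arc_pos_flip[of s D l] arc_pos_flip[of c D l] s' c that
          height_range[OF D, of s] height_range[OF D, of c]
        by (auto simp: label_def k_def arc_pos_label split: if_splits)
    qed
    moreover have "1 < arc_pos D l c \<and> arc_pos D l s < 1" if "label D c \<noteq> I1"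
      using that c s' height_range[OF D, of s] height_range[OF D, of c]
      by (cases "label D c") (auto simp: k_def arc_pos_label split: if_splits)
    ultimately show "(arc_pos D l s < arc_pos D l c) = (1 < arc_pos D l c)"
       "(arc_pos D l c < arc_pos D l s) = (arc_pos D l c < 1)" by fastforce+
  qed
  have hr: "0 \<le> h l i" "h l i < 3" if "0 < i" "i \<le> k" for l i
    using that arc_pos_range[OF D, of i l] unfolding h_def k_def
    by (cases "fst (D ! (i - 1))"; auto)+
  have nch: "non_interlaced (h l l) (h l (Suc l)) (h l l') (h l (Suc l'))"
    if l: "0 < l" "l < k" "0 < l'" "l' < k" "l \<noteq> l'" "even l = even l'" for l l'
  proof -
    have nc: "non_interlaced (arc_pos D l l) (arc_pos D l (Suc l)) (arc_pos D l l') (arc_pos D l (Suc l'))"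
      by (rule diagramD(4)[OF D]) (use l in \<open>auto simp: k_def\<close>)
    have cmp: "(h l x < h l y) = (arc_pos D l x < arc_pos D l y)"
      if x: "x \<in> {l, Suc l, l', Suc l'}" and y: "y \<in> {l, Suc l, l', Suc l'}" and ne: "x \<noteq> y" for x y
    proof -
      have sp: "s = 1 \<and> odd l \<or> s = k \<and> even l"
        if "s \<in> {l, Suc l, l', Suc l'}" "s = 1 \<or> s = k" for s
        using that l k3 by auto
      have "x \<in> {1..k}" "y \<in> {1..k}" using x y l by auto
      moreover have "\<not> ((x = 1 \<or> x = k) \<and> (y = 1 \<or> y = k))"
        using sp[OF x] sp[OF y] ne k3 by auto
      ultimately show ?thesis
        using special[of x l y] special[of y l x] sp[OF x] sp[OF y] ne unfolding h_def by auto
    qed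
    have ne: "l \<noteq> l'" "l \<noteq> Suc l'" "Suc l \<noteq> l'" "Suc l \<noteq> Suc l'" using l by auto
    show ?thesis using nc cmp[of l l'] cmp[of l "Suc l'"] cmp[of "Suc l" l'] cmp[of "Suc l" "Suc l'"] ne
      unfolding non_interlaced_def by simp
  qed
  have "inj_on (\<lambda>(i, t). (prev_idx i, 1 - t)) X" for X :: "(idx \<times> real) set"
    by (rule inj_onI) (auto, metis idx_inverses(1))
  then have "distinct (strip D)"
    using diagramD(2)[OF D] by (simp add: strip_def distinct_map distinct_butlast distinct_tl)
  moreover have "\<forall>(i, t) \<in> set (strip D). 0 < t \<and> t < 1"
  proof -
    have "set (butlast (tl D)) \<subseteq> set D"
      by (cases D) (auto dest: in_set_butlastD)
    then show ?thesis using diagramD(3)[OF D] by (fastforce simp: strip_def)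
  qed
  moreover have "non_interlaced (arc_pos (strip D) l l) (arc_pos (strip D) l (Suc l))
      (arc_pos (strip D) l l') (arc_pos (strip D) l (Suc l'))"
    if "l \<le> k - 2" "l' \<le> k - 2" "l \<noteq> l'" "even l = even l'" for l l'
  proof -
    have "arc_pos (strip D) l j = rot_pos (h (Suc l) (Suc j))" if "j \<in> {l, Suc l, l', Suc l'}" for j
      by (rule new) (use that \<open>l \<le> k - 2\<close> \<open>l' \<le> k - 2\<close> k3 in auto)
    moreover have "non_interlaced (h (Suc l) (Suc l)) (h (Suc l) (Suc (Suc l)))
        (h (Suc l) (Suc l')) (h (Suc l) (Suc (Suc l')))"
      by (rule nch) (use that k3 in auto)
    ultimately show ?thesis using non_interlaced_rot hr that k3 by simp
  qed
  ultimately show ?thesis using len k3 unfolding diagram_def by auto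
qed

text \<open>The chords of one triangle match the points on one side of a chord with each other, and the
  two ends of a chord have indices of different parity.\<close>

lemma partner_balance:
  assumes D: "diagram D" and l: "l \<le> length D"
  defines "S \<equiv> {i \<in> {1..length D}. between (arc_pos D l l) (arc_pos D l (Suc l)) (arc_pos D l i)}"
  shows "card {i \<in> S. even i} = card {i \<in> S. odd i}"
proof -
  have ns: "i \<noteq> l" "i \<noteq> Suc l" if "i \<in> S" for i
    using that by (auto simp: S_def between_def)
  have S: "partner l i \<in> S" "partner l (partner l i) = i" "even (partner l i) = odd i"
    if i: "i \<in> S" for i
  proof -
    have i': "0 < i" "i \<le> length D"
      and b: "between (arc_pos D l l) (arc_pos D l (Suc l)) (arc_pos D l i)"
      using i by (auto simp: S_def)
    note p = partner_between[OF D l i' ns[OF i] b]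
    show "partner l i \<in> S" using p by (auto simp: S_def)
    show "partner l (partner l i) = i" "even (partner l i) = odd i"
      using p(1) i' by (auto simp: partner_def)
  qed
  have "bij_betw (partner l) {i \<in> S. even i} {i \<in> S. odd i}"
    by (rule bij_betw_byWitness[of _ "partner l"]) (use S in auto)
  then show ?thesis by (rule bij_betw_same_card)
qed

text \<open>The chord from the vertex to \<open>T\<^sub>2\<close> separates \<open>T\<^sub>1\<close> from \<open>T\<^sub>3\<close>, so without U-turns every other
  chord of the first triangle has exactly one end on \<open>T\<^sub>2\<close>; successively this is seen to be its
  later end.\<close>

lemma start_I2_labels:
  assumes D: "diagram D" and U: "distinct_adj (map fst D)" and lab: "label D 1 = I2"
  shows "i \<le> length D \<Longrightarrow> odd i \<Longrightarrow> label D i = I2"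
    and "0 < i \<Longrightarrow> i \<le> length D \<Longrightarrow> even i \<Longrightarrow> label D i \<noteq> I2"
proof -
  have ne: "0 < length D" using diagramD(1)[OF D] by (cases D) auto
  have *: "label D (2 * j + 1) = I2" if "2 * j + 1 \<le> length D" for j
    using that
  proof (induction j)
    case (Suc j)
    have 1: "label D (2 * j + 2) \<noteq> I2" "label D (2 * j + 2) \<noteq> label D (2 * j + 3)"
      using label_neq[OF U, of "2 * j + 1"] label_neq[OF U, of "2 * j + 2"] Suc
      by (auto simp: eval_nat_numeral)
    have nc: "non_interlaced (arc_pos D 0 0) (arc_pos D 0 1) (arc_pos D 0 (2 * j + 2)) (arc_pos D 0 (2 * j + 3))"
    proof -
      have "2 * j + 3 = Suc (2 * j + 2)" by simp
      moreover have "2 * j + 2 \<le> length D" using Suc.prems by simp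
      ultimately show ?thesis using diagramD(4)[OF D, of 0 "2 * j + 2"] by (simp only: One_nat_def) simp
    qed
    have r: "0 < height D i" "height D i < 1" if "i \<in> {1, 2 * j + 2, 2 * j + 3}" for i
      using height_range[OF D, of i] that Suc by auto
    have "arc_pos D 0 i = edge_num (label D i) + height D i" if "i \<in> {1, 2 * j + 2, 2 * j + 3}" for i
      using arc_pos_label[of i D 0] that Suc by auto
    then have "label D (2 * j + 3) = I2"
      using nc r[of 1] r[of "2 * j + 2"] r[of "2 * j + 3"] 1 lab
      by (cases "label D (2 * j + 2)"; cases "label D (2 * j + 3)") (auto simp: non_interlaced_def)
    then show ?case by (simp add: eval_nat_numeral)
  qed (use lab in simp)
  show o: "label D i = I2" if "i \<le> length D" "odd i" for i
    using that * by (metis oddE)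
  show "label D i \<noteq> I2" if "0 < i" "i \<le> length D" "even i" 
    using label_neq[OF U, of "i - 1"] o[of "i - 1"] that by auto
qed

text \<open>Order the crossings of \<open>T\<^sub>2\<close> by height. By \<open>partner_balance\<close> the number of points below or
  above the end of a chord is the same on both of its edges, so going from one crossing of \<open>T\<^sub>2\<close> to
  the next one either lowers the height rank by the number \<open>a\<close> or raises it by \<open>b\<close>, according to the
  edge crossed in between: a rotation by \<open>a\<close> modulo \<open>a + b\<close>. As all ranks occur, \<open>a\<close> and \<open>a + b\<close> are
  coprime.\<close>

lemma start_I2_line:
  assumes D: "diagram D" and U: "distinct_adj (map fst D)" and lab: "label D 1 = I2"
  obtains a b where "0 < a" "0 < b" "coprime a b" "map fst D = line_word a b"
proof -
  define k where "k = length D"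
  have k: "odd k" using diagramD(1)[OF D] by (simp add: k_def)
  define A where "A e = {i \<in> {1..k}. label D i = e}" for e
  have fin [simp]: "finite (A e)" for e by (simp add: A_def)
  define a where "a = card (A I3) + 1"
  define b where "b = card (A I1) + 1"
  have b0: "0 < b" by (simp add: b_def)
  define N where "N = a + b"
  note lb = start_I2_labels[OF D U lab]
  have Acong: "{i \<in> {1..k}. P i} = {i \<in> {1..k}. Q i}" if "\<And>i. 0 < i \<Longrightarrow> i \<le> k \<Longrightarrow> P i = Q i" for P Q
    using that by auto
  have Acol: "{j \<in> A e. P j} = {j \<in> {1..k}. label D j = e \<and> P j}" for e P
    by (auto simp: A_def)
  have A2: "A I2 = {i \<in> {1..k}. odd i}" using lb by (auto simp: A_def k_def)
  have A13: "A I1 \<union> A I3 = {i \<in> {1..k}. even i}"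
  proof -
    have "label D i = I1 \<or> label D i = I3 \<longleftrightarrow> even i" if "0 < i" "i \<le> k" for i
      using lb(1)[of i] lb(2)[of i] that by (cases "label D i") (auto simp: k_def)
    moreover have "A I1 \<union> A I3 = {i \<in> {1..k}. label D i = I1 \<or> label D i = I3}"
      by (auto simp: A_def)
    moreover have "{i \<in> {1..k}. label D i = I1 \<or> label D i = I3} = {i \<in> {1..k}. even i}"
      by (rule Acong) fact
    ultimately show ?thesis by simp
  qed
  obtain n where n: "k = 2 * n + 1" using k by (metis oddE)
  have cA2: "card (A I2) = n + 1"
  proof -
    have "A I2 = (\<lambda>j. 2 * j + 1) ` {..n}" unfolding A2 n by (auto elim!: oddE)
    then show ?thesis by (simp add: card_image inj_on_def)
  qed
  have cA13: "card (A I1) + card (A I3) = n"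
  proof -
    have "A I1 \<union> A I3 = (\<lambda>j. 2 * j) ` {1..n}" unfolding A13 n by (auto elim!: evenE)
    moreover have "card (A I1 \<union> A I3) = card (A I1) + card (A I3)"
      by (rule card_Un_disjoint) (auto simp: A_def)
    ultimately show ?thesis by (simp add: card_image inj_on_def)
  qed
  have N: "N = n + 2" using cA13 by (simp add: N_def a_def b_def)
  define lo where "lo e i = card {j \<in> A e. height D j < height D i}" for e i
  define hi where "hi e i = card {j \<in> A e. height D i < height D j}" for e i
  have inj: "i = j" if "label D i = label D j" "height D i = height D j" "0 < i" "i \<le> k" "0 < j" "j \<le> k" for i j
    using arc_pos_inj[OF D, of i j 0] that by (simp add: k_def arc_pos_label)
  have lohi: "lo e i + hi e i + 1 = card (A e)" if "i \<in> A e" for e i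
  proof -
    have "A e = insert i ({j \<in> A e. height D j < height D i} \<union> {j \<in> A e. height D i < height D j})"
    proof -
      have "x = i \<or> height D x < height D i \<or> height D i < height D x" if "x \<in> A e" for x
        using inj[of x i] that \<open>i \<in> A e\<close> linorder_less_linear[of "height D x" "height D i"]
        by (auto simp: A_def)
      then show ?thesis using that by blast
    qed
    from arg_cong[OF this, of card]
    have "card (A e) = Suc (card ({j \<in> A e. height D j < height D i} \<union> {j \<in> A e. height D i < height D j}))"
      by (subst (asm) card_insert_disjoint) auto
    also have "card ({j \<in> A e. height D j < height D i} \<union> {j \<in> A e. height D i < height D j}) = lo e i + hi e i"
      unfolding lo_def hi_def by (rule card_Un_disjoint) auto
    finally show ?thesis by simp
  qed
  have hr: "0 < height D i" "height D i < 1" if "0 < i" "i \<le> k" for i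
    using height_range[OF D, of i] that by (auto simp: k_def)
  have ap: "arc_pos D l i = edge_num (label D i) + (if even l then height D i else 1 - height D i)"
    if "0 < i" "i \<le> k" for l i using arc_pos_label[of i D l] that by (simp add: k_def)
  have mem: "i \<in> A I2 \<longleftrightarrow> 0 < i \<and> i \<le> k \<and> odd i"
    "i \<in> A I1 \<Longrightarrow> even i" "i \<in> A I3 \<Longrightarrow> even i" for i
    subgoal by (auto simp: A2)
    subgoal using A13 by blast
    subgoal using A13 by blast
    done
  have lab2: "label D i = I2 \<longleftrightarrow> odd i" if "0 < i" "i \<le> k" for i
    using lb that by (auto simp: k_def)
  have count: "card {i \<in> {1..k}. between (arc_pos D l l) (arc_pos D l (Suc l)) (arc_pos D l i) \<and> even i} =
     card {i \<in> {1..k}. between (arc_pos D l l) (arc_pos D l (Suc l)) (arc_pos D l i) \<and> odd i}"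
    if "l \<le> k" for l
    using partner_balance[OF D, of l] that by (simp add: k_def)
  have side: "card {j \<in> A e. P (height D j)} = card {j \<in> A I2. Q (height D j)}"
    if l: "l \<le> k" and s: "\<And>i. 0 < i \<Longrightarrow> i \<le> k \<Longrightarrow>
      (between (arc_pos D l l) (arc_pos D l (Suc l)) (arc_pos D l i) \<and> even i \<longleftrightarrow> label D i = e \<and> P (height D i)) \<and>
      (between (arc_pos D l l) (arc_pos D l (Suc l)) (arc_pos D l i) \<and> odd i \<longleftrightarrow> label D i = I2 \<and> Q (height D i))"
    for l e P Q
  proof -
    have "{i \<in> {1..k}. between (arc_pos D l l) (arc_pos D l (Suc l)) (arc_pos D l i) \<and> even i} = {j \<in> A e. P (height D j)}"
      "{i \<in> {1..k}. between (arc_pos D l l) (arc_pos D l (Suc l)) (arc_pos D l i) \<and> odd i} = {j \<in> A I2. Q (height D j)}"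
      unfolding Acol by (rule Acong, use s in blast)+
    then show ?thesis using count[OF l] by simp
  qed
  have start: "lo I2 1 + 1 = b"
  proof -
    have "card {j \<in> A I1. True} = lo I2 1"
      unfolding lo_def
      apply (rule side[of 0])
      subgoal by simp
      subgoal for i using hr[of i] hr[of 1] ap[of i 0] ap[of 1 0] lab lab2[of i] n
        by (cases "label D i") (auto simp: between_def)
      done
    then show ?thesis by (simp add: b_def)
  qed
  have step1: "hi I1 x = lo I2 (Suc x)" "lo I1 x = hi I2 (x - 1)"
    if x: "x \<in> A I1" for x
  proof -
    have x': "0 < x" "x < k" "even x" "label D x = I1" using x mem(2)[OF x] k by (auto simp: A_def le_less)
    define y where "y = x - 1"
    have y: "x = Suc y" "odd y" "0 < y" using x'(1,3) unfolding y_def by presburger+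
    have l2: "label D (Suc x) = I2" "label D y = I2" using lab2 y x' by auto
    show "hi I1 x = lo I2 (Suc x)"
      unfolding lo_def hi_def
      apply (rule side[of x])
      subgoal using x' by simp
      subgoal for i using hr[of i] hr[of x] hr[of "Suc x"] ap[of i x] ap[of x x] ap[of "Suc x" x] l2 lab2[of i] x'
        by (cases "label D i") (auto simp: between_def)
      done
    show "lo I1 x = hi I2 (x - 1)"
      unfolding lo_def hi_def y_def[symmetric]
      apply (rule side[of y])
      subgoal using x' y by simp
      subgoal for i using hr[of i] hr[of x] hr[of y] ap[of i y] ap[of x y] ap[of y y] l2 lab2[of i] x' y
        by (cases "label D i") (auto simp: between_def)
      done
  qed
  have step3: "lo I3 x = hi I2 (Suc x)" "hi I3 x = lo I2 (x - 1)"
    if x: "x \<in> A I3" for x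
  proof -
    have x': "0 < x" "x < k" "even x" "label D x = I3" using x mem(3)[OF x] k by (auto simp: A_def le_less)
    define y where "y = x - 1"
    have y: "x = Suc y" "odd y" "0 < y" using x'(1,3) unfolding y_def by presburger+
    have l2: "label D (Suc x) = I2" "label D y = I2" using lab2 y x' by auto
    show "lo I3 x = hi I2 (Suc x)"
      unfolding lo_def hi_def
      apply (rule side[of x])
      subgoal using x' by simp
      subgoal for i using hr[of i] hr[of x] hr[of "Suc x"] ap[of i x] ap[of x x] ap[of "Suc x" x] l2 lab2[of i] x'
        by (cases "label D i") (auto simp: between_def)
      done
    show "hi I3 x = lo I2 (x - 1)"
      unfolding lo_def hi_def y_def[symmetric]
      apply (rule side[of y])
      subgoal using x' y by simp
      subgoal for i using hr[of i] hr[of x] hr[of y] ap[of i y] ap[of x y] ap[of y y] l2 lab2[of i] x' y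
        by (cases "label D i") (auto simp: between_def)
      done
  qed
  \<comment> \<open>The crossing \<open>2 j + 1\<close> is number \<open>(j + 1) a mod N\<close> among the crossings of \<open>T\<^sub>2\<close>, counted from the top.\<close>
  have dual: "lo I2 (2 * j + 1) + 1 + (Suc j * a mod N) = N \<and>
      (0 < j \<longrightarrow> label D (2 * j) = cut_letter a b j)" if "j \<le> n" for j
    using that
  proof (induction j)
    case 0
    then show ?case using start by (simp add: N_def b_def)
  next
    case (Suc j)
    define x where "x = 2 * j + 2"
    have x: "0 < x" "x \<le> k" "even x" "Suc x \<le> k" using Suc.prems n unfolding x_def by auto
    have IH: "lo I2 (x - 1) + 1 + (Suc j * a mod N) = N" using Suc unfolding x_def by simp
    have x1: "x - 1 \<in> A I2" "Suc x \<in> A I2" using x mem(1) by (auto simp: x_def)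
    have l1: "lo I2 (x - 1) + hi I2 (x - 1) + 1 = n + 1" "lo I2 (Suc x) + hi I2 (Suc x) + 1 = n + 1"
      using lohi[OF x1(1)] lohi[OF x1(2)] cA2 by auto
    have "x \<in> A I1 \<union> A I3" using A13 x by auto
    have md: "(Suc (Suc j) * a) mod N = (Suc j * a mod N + a) mod N"
      by (metis add.commute mod_add_right_eq mult_Suc)
    have cl: "cut_letter a b (Suc j) = (if Suc j * a mod N + a < N then I1 else I3)"
      using cut_letter_alt[where b = b and a = a and j = "Suc j"] b0 by (simp add: N_def)
    consider "x \<in> A I1" | "x \<in> A I3" using \<open>x \<in> A I1 \<union> A I3\<close> by blast
    then show ?case
    proof cases
      case 1
      have "lo I1 x + hi I1 x + 1 + 1 = b" using lohi[OF 1] by (simp add: b_def)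
      then have "lo I2 (x - 1) = lo I2 (Suc x) + a"
        using step1[OF 1] l1 N by (simp add: N_def)
      then have s: "Suc j * a mod N + a + (lo I2 (Suc x) + 1) = N" using IH by simp
      then have "(Suc (Suc j) * a) mod N = Suc j * a mod N + a" using md by simp
      moreover have "label D x = I1" using 1 by (simp add: A_def)
      ultimately show ?thesis using s cl by (simp add: x_def)
    next
      case 2
      have "lo I3 x + hi I3 x + 1 + 1 = a" using lohi[OF 2] by (simp add: a_def)
      then have s0: "lo I2 (Suc x) = lo I2 (x - 1) + b"
        using step3[OF 2] l1 N by (simp add: N_def)
      have s: "Suc j * a mod N + a = N + (N - (lo I2 (Suc x) + 1))" "lo I2 (Suc x) + 1 < N"
        using IH s0 l1(2) N by (auto simp: N_def)
      then have "(Suc (Suc j) * a) mod N = (N + (N - (lo I2 (Suc x) + 1))) mod N" by (simp only: md s)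
      then have "(Suc (Suc j) * a) mod N = (N - (lo I2 (Suc x) + 1)) mod N" by (simp only: mod_add_self1)
      then have "(Suc (Suc j) * a) mod N = N - (lo I2 (Suc x) + 1)" using s(2) by simp
      moreover have "label D x = I3" using 2 by (simp add: A_def)
      ultimately show ?thesis using s cl by (simp add: x_def)
    qed
  qed
  have "coprime a N"
  proof -
    have "A I2 \<noteq> {}" using cA2 by auto
    \<comment> \<open>The topmost crossing yields a multiple of \<open>a\<close> that is congruent to \<open>1\<close>.\<close>
    then have "Max (height D ` A I2) \<in> height D ` A I2" by (intro Max_in) auto
    then obtain i where i: "i \<in> A I2" "height D i = Max (height D ` A I2)" by auto
    then have "height D j \<le> height D i" if "j \<in> A I2" for j using that by simp
    then have "{j \<in> A I2. height D i < height D j} = {}" by (auto simp: not_less)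
    then have "hi I2 i = 0" unfolding hi_def by (metis card.empty)
    then have lo: "lo I2 i = n" using lohi[OF i(1)] cA2 by simp
    obtain j where j: "i = 2 * j + 1" "j \<le> n" using i(1) mem(1) n by (auto elim!: oddE)
    have "Suc j * a mod N = 1" using dual[OF j(2)] lo j N by simp
    then have "gcd a N dvd 1" by (metis dvd_mod dvd_mult gcd_dvd1 gcd_dvd2)
    then show ?thesis by (simp add: coprime_iff_gcd_eq_1)
  qed
  then have cop: "coprime a b" unfolding N_def by (simp add: coprime_add_self)
  have "map fst D = line_word a b"
  proof (rule interleave_eqI[of _ n])
    show "length (map fst D) = 2 * n + 1" using n by (simp add: k_def)
    show lc: "length (cut_word a b) = n" using N by (simp add: cut_word_def N_def)
    show "map fst D ! (2 * j) = I2" if "j \<le> n" for j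
      using lab2[of "2 * j + 1"] that n by (simp add: label_def k_def)
    show "map fst D ! (2 * j + 1) = cut_word a b ! j" if "j < n" for j
      using dual[of "Suc j"] that n N by (simp add: label_def k_def cut_word_def N_def del: upt_Suc)
  qed
  then show thesis using that[of a b] cop by (simp add: a_def b_def)
qed

text \<open>Reflection in the axis through the vertex exchanges \<open>T\<^sub>1\<close> and \<open>T\<^sub>3\<close> and reverses all edges.\<close>

lemma diagram_mirror:
  assumes D: "diagram D"
  shows "diagram (map (\<lambda>(i, t). (mirror_idx i, 1 - t)) D)" (is "diagram (map ?f D)")
proof -
  let ?D = "map ?f D"
  have inj: "inj_on ?f X" for X by (rule inj_onI) (auto, metis idx_inverses(3))
  have ap: "arc_pos ?D l i = 3 - arc_pos D l i" if "0 < i" "i \<le> length D" for l i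
  proof -
    obtain e t where et: "D ! (i - 1) = (e, t)" by (cases "D ! (i - 1)")
    show ?thesis using that et by (cases e) (simp_all add: arc_pos_def stops_mid)
  qed
  have lt: "arc_pos D l i < 3" "0 < arc_pos D l i" if "0 < i" "i \<le> length D" for l i
    using arc_pos_range[OF D that, of l] by (cases "fst (D ! (i - 1))"; simp)+
  have nc: "non_interlaced (arc_pos ?D l l) (arc_pos ?D l (Suc l)) (arc_pos ?D l l') (arc_pos ?D l (Suc l'))"
    if l: "l \<le> length D" "l' \<le> length D" "l \<noteq> l'" "even l = even l'" for l l'
  proof -
    define P where "P i = arc_pos D l i" for i
    define Q where "Q i = arc_pos ?D l i" for i
    define V where "V i \<longleftrightarrow> i = 0 \<or> i = Suc (length D)" for i
    have QV: "Q i = 0" "P i = 0" if "V i" for i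
      using that arc_pos_ends[of ?D l] by (auto simp: V_def P_def Q_def)
    have Q: "Q i = 3 - P i" "0 < P i" "P i < 3" if "\<not> V i" "i \<le> Suc (length D)" for i
      using ap[of i l] lt[of i l] that by (auto simp: V_def P_def Q_def)
    have ne: "P i \<noteq> P j" if "i \<in> {l, Suc l}" "j \<in> {l', Suc l'}" "\<not> V i" "\<not> V j" for i j
    proof -
      have "0 < i" "i \<le> length D" "0 < j" "j \<le> length D" "i \<noteq> j" using that l by (cases "l = 0"; cases "l' = 0"; auto simp: V_def)+
      then show ?thesis using arc_pos_inj[OF D, of i j l] by (auto simp: P_def)
    qed
    have onlyV: "\<not> (V i \<and> V j)" if "i \<in> {l, Suc l}" "j \<in> {l', Suc l'}" for i j
      using that l diagramD(1)[OF D] by (cases "l = 0") (auto simp: V_def)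
    have b: "l \<le> Suc (length D)" "Suc l \<le> Suc (length D)" "l' \<le> Suc (length D)" "Suc l' \<le> Suc (length D)"
      using l by auto
    have nc: "non_interlaced (P l) (P (Suc l)) (P l') (P (Suc l'))"
      unfolding P_def by (rule diagramD(4)[OF D l])
    have cmp: "(Q i < Q j) = ((P i < P j) = (V i \<or> V j))" if "i \<in> {l, Suc l}" "j \<in> {l', Suc l'}" for i j
    proof -
      have bi: "i \<le> Suc (length D)" "j \<le> Suc (length D)" using that b by auto
      show ?thesis
        using onlyV[OF that] ne[OF that] Q[OF _ bi(1)] Q[OF _ bi(2)] QV[of i] QV[of j]
        by (cases "V i"; cases "V j") auto
    qed
    show ?thesis using nc cmp[of l l'] cmp[of l "Suc l'"] cmp[of "Suc l" l'] cmp[of "Suc l" "Suc l'"]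
        onlyV[of l l'] onlyV[of l "Suc l'"] onlyV[of "Suc l" l'] onlyV[of "Suc l" "Suc l'"]
      unfolding non_interlaced_def Q_def[symmetric] by auto
  qed
  have "distinct ?D" using diagramD(2)[OF D] inj by (simp add: distinct_map)
  moreover have "\<forall>(i, t) \<in> set ?D. 0 < t \<and> t < 1" using diagramD(3)[OF D] by fastforce
  ultimately show ?thesis using nc diagramD(1)[OF D] unfolding diagram_def by simp
qed

lemma label_strip:
  assumes "3 \<le> length D" "label D 1 = I1" "label D (length D) = I1"
  shows "map fst D = I1 # map next_idx (map fst (strip D)) @ [I1]"
proof -
  obtain x E where D: "D = x # E" using assms(1) by (cases D) auto
  then have "E \<noteq> []" using assms(1) by auto
  then have E: "D = x # butlast E @ [last E]" using D by simp
  have "fst x = I1" using assms(2) D by (simp add: label_def)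
  moreover have "fst (last E) = I1" using assms(3) D \<open>E \<noteq> []\<close> by (simp add: label_def last_conv_nth nth_Cons')
  moreover have "map next_idx (map fst (strip D)) = map fst (butlast E)"
    using D by (simp add: strip_def) (auto simp: o_def split_def)
  ultimately show ?thesis by (subst E) simp
qed

lemma distinct_adj_map_inj: "inj f \<Longrightarrow> distinct_adj (map f xs) = distinct_adj xs"
  by (induction xs rule: induct_list012) (auto simp: inj_eq)

text \<open>The first and the last label agree because the word is a palindrome; without this assumption there are
  more diagrams, such as the loop around the vertex with the word \<open>123\<close>.\<close>

theorem palindromic_diagram_spiral:
  assumes "diagram D" "distinct_adj (map fst D)" "rev (map fst D) = map fst D"
  shows "spiral (map fst D)"
  using assms
proof (induction "length D" arbitrary: D rule: less_induct)
  case less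
  have pal: "rev (map fst D) = map fst D" by fact
  have odd: "odd (length D)" using diagramD(1)[OF less.prems(1)] .
  then have ne: "D \<noteq> []" by auto
  have ends: "label D (length D) = label D 1"
    if "rev (map fst D) = map fst D" "D \<noteq> []" for D :: "(idx \<times> real) list"
  proof -
    have "hd (map fst D) = last (map fst D)" using that(1) by (metis hd_rev)
    then show ?thesis using that(2) by (simp add: label_def hd_conv_nth last_conv_nth)
  qed
  have start_I1: "spiral (map fst D')"
    if D': "diagram D'" "distinct_adj (map fst D')" "rev (map fst D') = map fst D'"
      "length D' = length D" "label D' 1 = I1" for D'
  proof (cases "length D = 1")
    case True
    then have "map fst D' = [I1]" using D'(4,5) by (cases D') (auto simp: label_def)
    then show ?thesis by (simp add: spiral_I1)
  next
    case False
    then have "3 \<le> length D" using odd by (cases "length D") (auto elim!: oddE)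
    then have l3: "3 \<le> length D'" "label D' (length D') = I1"
      using D' ends[OF D'(3)] ne by (auto simp flip: length_greater_0_conv)
    note w = label_strip[OF l3(1) D'(5) l3(2)]
    have inj: "inj next_idx" by (rule injI) (metis idx_inverses(2))
    define v where "v = map fst (strip D')"
    have w: "map fst D' = I1 # map next_idx v @ [I1]" using w unfolding v_def .
    have "map next_idx (rev v) = map next_idx v"
      using D'(3) unfolding w by (simp add: rev_map)
    then have "rev v = v" using inj_map_eq_map[OF inj] by blast
    moreover have "distinct_adj v"
    proof -
      have "distinct_adj (map next_idx v)"
        using D'(2) unfolding w by (auto simp: distinct_adj_Cons distinct_adj_append_iff)
      then show ?thesis using distinct_adj_map_inj[OF inj] by blast
    qed
    moreover have "length (strip D') < length D" using l3 D'(4) by (simp add: strip_def)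
    ultimately have "spiral v"
      using less.hyps[OF _ diagram_strip[OF D'(1,2) l3(1) D'(5) l3(2)]] unfolding v_def by simp
    then show ?thesis unfolding w by (rule spiral_right)
  qed
  show ?case
  proof (cases "label D 1")
    case I1
    then show ?thesis using start_I1 less.prems by blast
  next
    case I2
    obtain a b where "0 < a" "0 < b" "coprime a b" "map fst D = line_word a b"
      using start_I2_line[OF less.prems(1,2) I2] .
    then show ?thesis using spiral_line by simp
  next
    case I3
    define M where "M = map (\<lambda>(i, t). (mirror_idx i, 1 - t)) D"
    have f: "map fst M = map mirror_idx (map fst D)" by (auto simp: M_def o_def split_def)
    have inj: "inj mirror_idx" by (rule injI) (metis idx_inverses(3))
    have "spiral (map fst M)"
    proof (rule start_I1)
      show "diagram M" unfolding M_def by (rule diagram_mirror[OF less.prems(1)])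
      show "distinct_adj (map fst M)" unfolding f using distinct_adj_map_inj[OF inj] less.prems(2) by blast
      show "rev (map fst M) = map fst M" unfolding f using pal by (metis rev_map)
      show "length M = length D" by (simp add: M_def)
      show "label M 1 = I1" using I3 ne by (cases D) (auto simp: label_def M_def split: prod.splits)
    qed
    then have "spiral (map mirror_idx (map fst M))" by (rule spiral_mirror)
    then show ?thesis unfolding f by (simp add: o_def)
  qed
qed

section \<open>Coordinates on the torus\<close>

text \<open>Barycentric coordinates with respect to the second and the third vertex: \<open>T\<^sub>1\<close> is \<open>y = 0\<close>,
  \<open>T\<^sub>2\<close> is \<open>x + y = 1\<close> and \<open>T\<^sub>3\<close> is \<open>x = 0\<close>.\<close>

definition tri_point :: "real \<Rightarrow> real \<Rightarrow> complex" where
  "tri_point x y = (1 - x - y) *\<^sub>R tri_vertex I1 + x *\<^sub>R tri_vertex I2 + y *\<^sub>R tri_vertex I3"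

definition simplex2 :: "real \<Rightarrow> real \<Rightarrow> bool" where
  "simplex2 x y \<longleftrightarrow> 0 \<le> x \<and> 0 \<le> y \<and> x + y \<le> 1"

definition tri_x :: "complex \<Rightarrow> real" where
  "tri_x z = (1 - Re z) / 3 + Im z / sqrt 3"

definition tri_y :: "complex \<Rightarrow> real" where
  "tri_y z = (1 - Re z) / 3 - Im z / sqrt 3"

lemma cis_120: "cis (2 * pi / 3) = Complex (- 1 / 2) (sqrt 3 / 2)"
proof -
  have "cos (2 * pi / 3) = - 1 / 2" by (simp add: cos_120)
  moreover have "sin (2 * pi / 3) = sqrt 3 / 2" by (simp add: sin_120)
  ultimately show ?thesis by (simp add: complex_eq_iff)
qed

lemma cis_240: "cis (4 * pi / 3) = Complex (- 1 / 2) (- sqrt 3 / 2)"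
proof -
  have "4 * pi / 3 = pi / 3 + pi" by simp
  then have "cos (4 * pi / 3) = - 1 / 2" "sin (4 * pi / 3) = - sqrt 3 / 2"
    by (simp_all only: cos_periodic_pi sin_periodic_pi) (simp_all add: cos_60 sin_60)
  then show ?thesis by (simp add: complex_eq_iff)
qed

lemma tri_point_Re_Im: "Re (tri_point x y) = 1 - 3 / 2 * (x + y)" "Im (tri_point x y) = sqrt 3 / 2 * (x - y)"
  unfolding tri_point_def tri_vertex.simps cis_120 cis_240 by (simp_all add: field_simps)

lemma tri_xy_point [simp]: "tri_x (tri_point x y) = x" "tri_y (tri_point x y) = y"
  by (simp_all add: tri_x_def tri_y_def tri_point_Re_Im field_simps)

lemma tri_point_xy [simp]: "tri_point (tri_x z) (tri_y z) = z"
proof (rule complex_eqI)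
  show "Re (tri_point (tri_x z) (tri_y z)) = Re z"
    by (simp add: tri_point_Re_Im tri_x_def tri_y_def field_simps)
  show "Im (tri_point (tri_x z) (tri_y z)) = Im z"
    by (simp add: tri_point_Re_Im tri_x_def tri_y_def field_simps)
qed

lemma tri_point_eq_iff [simp]: "tri_point x y = tri_point x' y' \<longleftrightarrow> x = x' \<and> y = y'"
  by (metis tri_xy_point)

lemma range_tri_vertex: "range tri_vertex = {tri_vertex I1, tri_vertex I2, tri_vertex I3}"
  by (auto simp del: tri_vertex.simps) (metis idx.exhaust)

lemma triangle_eq: "triangle = {tri_point x y | x y. simplex2 x y}"
proof -
  have "triangle = {u *\<^sub>R tri_vertex I1 + v *\<^sub>R tri_vertex I2 + w *\<^sub>R tri_vertex I3 | u v w.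
      0 \<le> u \<and> 0 \<le> v \<and> 0 \<le> w \<and> u + v + w = 1}"
    unfolding triangle_def range_tri_vertex convex_hull_3 ..
  also have "\<dots> = {tri_point x y | x y. simplex2 x y}" (is "?L = ?R")
  proof (intro equalityI subsetI)
    fix z assume "z \<in> ?L"
    then obtain u v w where z: "z = u *\<^sub>R tri_vertex I1 + v *\<^sub>R tri_vertex I2 + w *\<^sub>R tri_vertex I3"
      and h: "0 \<le> u" "0 \<le> v" "0 \<le> w" "u + v + w = 1" by blast
    have "u = 1 - v - w" using h by simp
    then have "z = tri_point v w" using z by (simp only: tri_point_def)
    moreover have "simplex2 v w" using h by (simp add: simplex2_def)
    ultimately show "z \<in> ?R" by blast
  next
    fix z assume "z \<in> ?R"
    then obtain x y where "z = tri_point x y" "simplex2 x y" by blast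
    then show "z \<in> ?L"
      by (intro CollectI exI[of _ "1 - x - y"] exI[of _ x] exI[of _ y]) (simp only: tri_point_def simplex2_def, simp)
  qed
  finally show ?thesis .
qed

lemma tri_point_in_triangle [simp]: "tri_point x y \<in> triangle \<longleftrightarrow> simplex2 x y"
  by (auto simp: triangle_eq)

lemma in_triangle_iff: "z \<in> triangle \<longleftrightarrow> simplex2 (tri_x z) (tri_y z)"
  by (metis tri_point_in_triangle tri_point_xy)

lemma compact_triangle: "compact triangle"
  unfolding triangle_def by (rule compact_convex_hull) (simp add: range_tri_vertex finite_imp_compact)

lemma interior_triangle: "tri_point x y \<in> interior triangle \<longleftrightarrow> 0 < x \<and> 0 < y \<and> x + y < 1"
proof -
  have nc: "\<not> collinear {tri_vertex I1, tri_vertex I2, tri_vertex I3}"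
  proof
    assume "collinear {tri_vertex I1, tri_vertex I2, tri_vertex I3}"
    then have "tri_vertex I1 = tri_vertex I3 \<or> (\<exists>u. tri_vertex I2 = u *\<^sub>R tri_vertex I1 + (1 - u) *\<^sub>R tri_vertex I3)"
      by (simp only: collinear_3_expand)
    then show False
      unfolding tri_vertex.simps cis_120 cis_240 by (auto simp: complex_eq_iff field_simps)
  qed
  have "interior triangle = {v. \<exists>x y z. 0 < x \<and> 0 < y \<and> 0 < z \<and> x + y + z = 1 \<and>
      x *\<^sub>R tri_vertex I1 + y *\<^sub>R tri_vertex I2 + z *\<^sub>R tri_vertex I3 = v}"
    unfolding triangle_def range_tri_vertex by (rule interior_convex_hull_3_minimal[OF nc]) simp
  also have "tri_point x y \<in> \<dots> \<longleftrightarrow> 0 < x \<and> 0 < y \<and> x + y < 1" (is "?l \<longleftrightarrow> ?r")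
  proof
    assume ?l
    then obtain u v w where u: "0 < u" "0 < v" "0 < w" "u + v + w = 1"
      "u *\<^sub>R tri_vertex I1 + v *\<^sub>R tri_vertex I2 + w *\<^sub>R tri_vertex I3 = tri_point x y" by blast
    have "u = 1 - v - w" using u(4) by simp
    then have "tri_point v w = tri_point x y" using u(5) by (simp only: tri_point_def)
    then show ?r using u by auto
  next
    assume ?r
    then show ?l
      by (intro CollectI exI[of _ "1 - x - y"] exI[of _ x] exI[of _ y]) (simp only: tri_point_def, simp)
  qed
  finally show ?thesis .
qed

lemma edge_point_tri:
  "edge_point I1 t = tri_point t 0" "edge_point I2 t = tri_point (1 - t) t" "edge_point I3 t = tri_point 0 (1 - t)"
  by (simp_all add: edge_point_def tri_point_def del: tri_vertex.simps)

lemma tri_vertex_tri: "tri_vertex I1 = tri_point 0 0" "tri_vertex I2 = tri_point 1 0" "tri_vertex I3 = tri_point 0 1"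
  by (simp_all add: tri_point_def del: tri_vertex.simps)

text \<open>The two triangles are unfolded to the plane, the second one by a half turn; points are glued
  exactly if their images differ by a lattice vector.\<close>

fun plane_sign :: "sheet \<Rightarrow> real" where
  "plane_sign G1 = 1" | "plane_sign G2 = - 1"

definition lattice_eq :: "sheet \<times> complex \<Rightarrow> sheet \<times> complex \<Rightarrow> bool" where
  "lattice_eq p q \<longleftrightarrow>
     plane_sign (fst p) * tri_x (snd p) - plane_sign (fst q) * tri_x (snd q) \<in> \<int> \<and>
     plane_sign (fst p) * tri_y (snd p) - plane_sign (fst q) * tri_y (snd q) \<in> \<int>"

definition gpt :: "sheet \<Rightarrow> real \<Rightarrow> real \<Rightarrow> (sheet \<times> complex) set" where
  "gpt j x y = glue (j, tri_point x y)"

lemma Ints_diff_sym: "a - b \<in> \<int> \<Longrightarrow> b - a \<in> \<int>" for a b :: real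
  using Ints_minus[of "a - b"] by simp

lemma Ints_diff_trans: "a - b \<in> \<int> \<Longrightarrow> b - c \<in> \<int> \<Longrightarrow> a - c \<in> \<int>" for a b c :: real
  using Ints_add[of "a - b" "b - c"] by simp

lemma Ints_diff_iff: "a - b \<in> \<int> \<Longrightarrow> a \<in> \<int> \<longleftrightarrow> b \<in> \<int>" for a b :: real
  using Ints_diff_trans[of a b 0] Ints_diff_trans[of b a 0] Ints_diff_sym[of a b] by auto

lemma lattice_eq_refl: "lattice_eq p p"
  by (simp add: lattice_eq_def)

lemma lattice_eq_sym: "lattice_eq p q \<Longrightarrow> lattice_eq q p"
  unfolding lattice_eq_def using Ints_diff_sym by blast

lemma lattice_eq_trans: "lattice_eq p q \<Longrightarrow> lattice_eq q r \<Longrightarrow> lattice_eq p r"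
  unfolding lattice_eq_def using Ints_diff_trans by blast

lemma glue_rel_lattice_eq: "(p, q) \<in> glue_rel \<Longrightarrow> lattice_eq p q"
proof -
  assume "(p, q) \<in> glue_rel"
  then obtain i t where pq: "p = oriented_edge G1 i t" "q = oriented_edge G2 i t"
    by (auto simp: glue_rel_def)
  show ?thesis unfolding pq by (cases i) (simp_all add: lattice_eq_def edge_point_tri)
qed

lemma glue_lattice_eq: "q \<in> glue p \<Longrightarrow> lattice_eq p q"
proof -
  assume "q \<in> glue p"
  then have "(p, q) \<in> (glue_rel \<union> glue_rel\<inverse>)\<^sup>*" by (simp add: glue_def)
  then show ?thesis
  proof (induction rule: rtrancl_induct)
    case base
    show ?case by (rule lattice_eq_refl)
  next
    case (step y z)
    then have "lattice_eq y z" using glue_rel_lattice_eq lattice_eq_sym by blast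
    then show ?case using step.IH lattice_eq_trans by blast
  qed
qed

lemma glue_self: "p \<in> glue p"
  by (simp add: glue_def)

lemma glue_eqI: "(p, q) \<in> glue_rel \<Longrightarrow> glue p = glue q"
proof -
  assume pq: "(p, q) \<in> glue_rel"
  let ?R = "glue_rel \<union> glue_rel\<inverse>"
  have "(p, q) \<in> ?R\<^sup>*" "(q, p) \<in> ?R\<^sup>*" using pq by auto
  then show ?thesis unfolding glue_def by (auto intro: rtrancl_trans)
qed

lemma gpt_edges:
  assumes "0 \<le> t" "t \<le> 1"
  shows "gpt G1 t 0 = gpt G2 (1 - t) 0" "gpt G1 (1 - t) t = gpt G2 t (1 - t)" "gpt G1 0 (1 - t) = gpt G2 0 t"
proof -
  have "(oriented_edge G1 i t, oriented_edge G2 i t) \<in> glue_rel" for i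
    using assms by (auto simp: glue_rel_def)
  from this[THEN glue_eqI]
  have "glue (oriented_edge G1 i t) = glue (oriented_edge G2 i t)" for i .
  from this[of I1] this[of I2] this[of I3]
  show "gpt G1 t 0 = gpt G2 (1 - t) 0" "gpt G1 (1 - t) t = gpt G2 t (1 - t)" "gpt G1 0 (1 - t) = gpt G2 0 t"
    by (simp_all add: gpt_def edge_point_tri)
qed

lemma gpt_vertices:
  "gpt G1 1 0 = gpt G1 0 0" "gpt G1 0 1 = gpt G1 0 0" "gpt G2 0 0 = gpt G1 0 0"
  "gpt G2 1 0 = gpt G1 0 0" "gpt G2 0 1 = gpt G1 0 0"
  using gpt_edges[of 0] gpt_edges[of 1] by simp_all

lemma gpt_vertex:
  assumes "simplex2 x y" "x \<in> \<int>" "y \<in> \<int>"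
  shows "gpt j x y = gpt G1 0 0"
proof -
  obtain a b :: int where ab: "x = a" "y = b" using assms(2,3) by (auto elim!: Ints_cases)
  have "0 \<le> a" "0 \<le> b" "a + b \<le> 1" using assms(1) unfolding simplex2_def ab by linarith+
  then have "(a, b) \<in> {(0, 0), (1, 0), (0, 1)}" by auto
  then show ?thesis using gpt_vertices ab by (cases j) auto
qed

lemma simplex2_Ints:
  assumes "simplex2 x y"
  shows "x \<in> \<int> \<Longrightarrow> x = 0 \<or> x = 1 \<and> y = 0"
    "y \<in> \<int> \<Longrightarrow> y = 0 \<or> y = 1 \<and> x = 0"
    "x + y \<in> \<int> \<Longrightarrow> x + y = 1 \<or> x = 0 \<and> y = 0"
proof -
  have I: "u = 0 \<or> u = 1" if "u \<in> \<int>" "0 \<le> u" "u \<le> 1" for u :: real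
    using that by (auto elim!: Ints_cases)
  show "x \<in> \<int> \<Longrightarrow> x = 0 \<or> x = 1 \<and> y = 0"
    "y \<in> \<int> \<Longrightarrow> y = 0 \<or> y = 1 \<and> x = 0"
    "x + y \<in> \<int> \<Longrightarrow> x + y = 1 \<or> x = 0 \<and> y = 0"
    using I[of x] I[of y] I[of "x + y"] assms by (auto simp: simplex2_def)
qed

lemma lattice_eq_Ints:
  assumes "lattice_eq (j, tri_point x y) (j', tri_point x' y')"
  shows "x \<in> \<int> \<longleftrightarrow> x' \<in> \<int>" "y \<in> \<int> \<longleftrightarrow> y' \<in> \<int>" "x + y \<in> \<int> \<longleftrightarrow> x' + y' \<in> \<int>"
proof -
  have *: "u \<in> \<int> \<longleftrightarrow> v \<in> \<int>" if "plane_sign j * u - plane_sign j' * v \<in> \<int>" for u v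
  proof -
    have "plane_sign j * u \<in> \<int> \<longleftrightarrow> plane_sign j' * v \<in> \<int>"
      using that by (rule Ints_diff_iff)
    then show ?thesis by (cases j; cases j') auto
  qed
  show "x \<in> \<int> \<longleftrightarrow> x' \<in> \<int>" "y \<in> \<int> \<longleftrightarrow> y' \<in> \<int>" 
    using assms *[of x x'] *[of y y'] unfolding lattice_eq_def by auto
  have "plane_sign j * (x + y) - plane_sign j' * (x' + y') \<in> \<int>"
    using Ints_add[of "plane_sign j * x - plane_sign j' * x'" "plane_sign j * y - plane_sign j' * y'"] assms
    by (simp add: lattice_eq_def algebra_simps)
  then show "x + y \<in> \<int> \<longleftrightarrow> x' + y' \<in> \<int>" by (rule *)
qed

lemma simplex2_less_1:
  assumes "simplex2 x y" "\<not> (x \<in> \<int> \<and> y \<in> \<int>)"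
  shows "x < 1" "y < 1"
proof -
  have "x = 1 \<Longrightarrow> y = 0" "y = 1 \<Longrightarrow> x = 0" using assms(1) by (auto simp: simplex2_def)
  then have "x \<noteq> 1" "y \<noteq> 1" using assms(2) by auto
  then show "x < 1" "y < 1" using assms(1) by (auto simp: simplex2_def)
qed

lemma Ints_small: "u \<in> \<int> \<Longrightarrow> - 1 < u \<Longrightarrow> u < 1 \<Longrightarrow> u = 0" for u :: real
  by (auto elim!: Ints_cases)

lemma lattice_eq_opposite:
  assumes "lattice_eq (j, tri_point x y) (j', tri_point x' y')" "j \<noteq> j'"
  shows "x + x' \<in> \<int>" "y + y' \<in> \<int>"
proof -
  have "plane_sign j' = - plane_sign j" using assms(2) by (cases j; cases j') auto
  then have "plane_sign j * (x + x') \<in> \<int>" "plane_sign j * (y + y') \<in> \<int>"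
    using assms(1) by (simp_all add: lattice_eq_def algebra_simps)
  moreover have "u \<in> \<int>" if "plane_sign j * u \<in> \<int>" for u using that by (cases j) auto
  ultimately show "x + x' \<in> \<int>" "y + y' \<in> \<int>" by blast+
qed

text \<open>Apart from the vertices, two points of the closed triangles whose unfoldings differ by a
  lattice vector either coincide or lie on the two copies of one edge.\<close>

lemma gpt_eqI:
  assumes s: "simplex2 x y" "simplex2 x' y'" and l: "lattice_eq (j, tri_point x y) (j', tri_point x' y')"
  shows "gpt j x y = gpt j' x' y'"
proof (cases "(x \<in> \<int> \<and> y \<in> \<int>) \<or> (x' \<in> \<int> \<and> y' \<in> \<int>)")
  case True
  have "x \<in> \<int> \<longleftrightarrow> x' \<in> \<int>" "y \<in> \<int> \<longleftrightarrow> y' \<in> \<int>" using lattice_eq_Ints[OF l] by auto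
  then have "x \<in> \<int>" "y \<in> \<int>" "x' \<in> \<int>" "y' \<in> \<int>" using True by blast+
  then show ?thesis using gpt_vertex[OF s(1), of j] gpt_vertex[OF s(2), of j'] by simp
next
  case False
  then have "\<not> (x \<in> \<int> \<and> y \<in> \<int>)" "\<not> (x' \<in> \<int> \<and> y' \<in> \<int>)" by blast+
  then have r: "x < 1" "y < 1" "x' < 1" "y' < 1" "0 \<le> x" "0 \<le> y" "0 \<le> x'" "0 \<le> y'" "x + y \<le> 1" "x' + y' \<le> 1"
    using simplex2_less_1[OF s(1)] simplex2_less_1[OF s(2)] s by (simp_all add: simplex2_def)
  have cases: "u = 0 \<or> u = 1 \<or> u = 2" if "u \<in> \<int>" "0 \<le> u" "u \<le> 2" for u :: real
    using that by (auto elim!: Ints_cases)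
  show ?thesis
  proof (cases "j = j'")
    case True
    have "x - x' \<in> \<int>" "y - y' \<in> \<int>"
      using l True by (cases j; auto simp: lattice_eq_def minus_diff_commute dest: Ints_minus)+
    then have "x - x' = 0" "y - y' = 0" using Ints_small[of "x - x'"] Ints_small[of "y - y'"] r by auto
    then show ?thesis using True by simp
  next
    case ne: False
    have sum: "x + x' \<in> \<int>" "y + y' \<in> \<int>" by (rule lattice_eq_opposite[OF l ne])+
    have c: "x + x' = 0 \<or> x + x' = 1" "y + y' = 0 \<or> y + y' = 1"
      using cases[OF sum(1)] cases[OF sum(2)] r by auto
    have e: "gpt G1 u v = gpt G2 u' v'"
      if "u + u' = 0 \<or> u + u' = 1" "v + v' = 0 \<or> v + v' = 1" "\<not> (u + u' = 0 \<and> v + v' = 0)"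
        "0 \<le> u" "0 \<le> v" "0 \<le> u'" "0 \<le> v'" "u + v \<le> 1" "u' + v' \<le> 1" "u < 1" "v < 1" "u' < 1" "v' < 1"
      for u v u' v'
    proof -
      have "u + u' = 1 \<and> v = 0 \<and> v' = 0 \<or> u = 0 \<and> u' = 0 \<and> v + v' = 1 \<or>
          u + u' = 1 \<and> v + v' = 1 \<and> u + v = 1" using that by (smt (verit))
      then consider "u + u' = 1" "v = 0" "v' = 0" | "u = 0" "u' = 0" "v + v' = 1"
        | "u + u' = 1" "v + v' = 1" "u + v = 1" by blast
      then show ?thesis
      proof cases
        case 1
        then have "u' = 1 - u" by simp
        then show ?thesis unfolding 1(2,3) using gpt_edges(1)[of u] that less_imp_le by metis
      next
        case 2
        then have "v = 1 - v'" by simp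
        then show ?thesis unfolding 2(1,2) using gpt_edges(3)[of v'] that less_imp_le by metis
      next
        case 3
        then have "u = 1 - v" "u' = v" "v' = 1 - v" by auto
        then show ?thesis using gpt_edges(2)[of v] that less_imp_le by metis
      qed
    qed
    have n0: "\<not> (x + x' = 0 \<and> y + y' = 0)" "\<not> (x' + x = 0 \<and> y' + y = 0)"
      using False r by (smt (verit) Ints_0)+
    show ?thesis
    proof (cases j)
      case G1
      then have "j' = G2" using ne by (cases j') auto
      then show ?thesis using e[OF c n0(1)] r G1 by simp
    next
      case G2
      then have "j' = G1" using ne by (cases j') auto
      then show ?thesis using e[of x' x y' y] c n0(2) r G2 by (simp add: add.commute)
    qed
  qed
qed

lemma gpt_eq_iff:
  assumes "simplex2 x y" "simplex2 x' y'"
  shows "gpt j x y = gpt j' x' y' \<longleftrightarrow> lattice_eq (j, tri_point x y) (j', tri_point x' y')"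
  using gpt_eqI[OF assms] glue_lattice_eq glue_self unfolding gpt_def by metis

lemma image_glue_triangle: "glue ` (UNIV \<times> triangle) = {gpt j x y | j x y. simplex2 x y}"
  by (force simp: gpt_def triangle_eq)

lemma gpt_in_Edge:
  assumes s: "simplex2 x y"
  shows "gpt j x y \<in> Edge I1 \<longleftrightarrow> y \<in> \<int>" "gpt j x y \<in> Edge I2 \<longleftrightarrow> x + y \<in> \<int>" "gpt j x y \<in> Edge I3 \<longleftrightarrow> x \<in> \<int>"
proof -
  have E: "Edge I1 = {gpt j t 0 | j t. 0 \<le> t \<and> t \<le> 1}" "Edge I2 = {gpt j (1 - t) t | j t. 0 \<le> t \<and> t \<le> 1}"
    "Edge I3 = {gpt j 0 (1 - t) | j t. 0 \<le> t \<and> t \<le> 1}"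
    by (force simp: Edge_def gpt_def edge_point_tri)+
  have v: "gpt j x y = gpt G1 0 0" if "x \<in> \<int>" "y \<in> \<int>" using gpt_vertex[OF s that] .
  have V: "gpt G1 0 0 \<in> Edge I1" "gpt G1 0 0 \<in> Edge I2" "gpt G1 0 0 \<in> Edge I3"
  proof -
    have "gpt G1 0 0 = gpt G1 (1 - 0) 0" "gpt G1 0 0 = gpt G1 0 (1 - 1)" using gpt_vertices by simp_all
    then show "gpt G1 0 0 \<in> Edge I2" "gpt G1 0 0 \<in> Edge I3" "gpt G1 0 0 \<in> Edge I1" unfolding E
      by (metis (mono_tags, lifting) mem_Collect_eq order_refl zero_le_one)+
  qed
  have S: "simplex2 t 0" "simplex2 (1 - t) t" "simplex2 0 (1 - t)" if "0 \<le> t" "t \<le> 1" for t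
    using that by (auto simp: simplex2_def)
  have "y \<in> \<int>" if "gpt j x y \<in> Edge I1"
    using that gpt_eq_iff[OF s S(1)] lattice_eq_Ints(2) unfolding E by (smt (verit) Ints_0 mem_Collect_eq)
  moreover have "gpt j x y \<in> Edge I1" if y: "y \<in> \<int>"
  proof (cases "y = 0")
    case True
    then show ?thesis unfolding E using s by (auto simp: simplex2_def)
  next
    case False
    then show ?thesis using simplex2_Ints(2)[OF s y] v[OF _ y] V by auto
  qed
  ultimately show "gpt j x y \<in> Edge I1 \<longleftrightarrow> y \<in> \<int>" by blast
  have "x \<in> \<int>" if "gpt j x y \<in> Edge I3"
    using that gpt_eq_iff[OF s S(3)] lattice_eq_Ints(1) unfolding E by (smt (verit) Ints_0 mem_Collect_eq)
  moreover have "gpt j x y \<in> Edge I3" if x: "x \<in> \<int>"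
  proof (cases "x = 0")
    case True
    then show ?thesis unfolding E using s by (auto simp: simplex2_def intro!: exI[of _ j] exI[of _ "1 - y"])
  next
    case False
    then show ?thesis using simplex2_Ints(1)[OF s x] v[OF x] V by auto
  qed
  ultimately show "gpt j x y \<in> Edge I3 \<longleftrightarrow> x \<in> \<int>" by blast
  have "x + y \<in> \<int>" if "gpt j x y \<in> Edge I2"
    using that gpt_eq_iff[OF s S(2)] lattice_eq_Ints(3) unfolding E by (smt (verit) Ints_1 mem_Collect_eq)
  moreover have "gpt j x y \<in> Edge I2" if x: "x + y \<in> \<int>"
  proof (cases "x + y = 1")
    case True
    then have "x = 1 - y" by simp
    then show ?thesis unfolding E using s by (auto simp: simplex2_def)
  next
    case False
    then show ?thesis using simplex2_Ints(3)[OF s x] v V by auto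
  qed
  ultimately show "gpt j x y \<in> Edge I2 \<longleftrightarrow> x + y \<in> \<int>" by blast
qed

lemma gpt_in_Edges:
  assumes "simplex2 x y"
  shows "gpt j x y \<in> Edges \<longleftrightarrow> x \<in> \<int> \<or> y \<in> \<int> \<or> x + y \<in> \<int>"
proof -
  have U: "UNIV = {I1, I2, I3}" using idx.exhaust by auto
  have "Edges = Edge I1 \<union> Edge I2 \<union> Edge I3" unfolding Edges_def U by auto
  then show ?thesis using gpt_in_Edge[OF assms] by auto
qed

lemma gpt_in_Vertices:
  assumes s: "simplex2 x y"
  shows "gpt j x y \<in> Vertices \<longleftrightarrow> x \<in> \<int> \<and> y \<in> \<int>"
proof -
  have V: "Vertices = {gpt G1 0 0}"
  proof -
    have "Vertices = (\<Union>j. {gpt j 0 0, gpt j 1 0, gpt j 0 1})"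
      by (auto simp: Vertices_def gpt_def range_tri_vertex tri_vertex_tri simp del: tri_vertex.simps)
    moreover have "{gpt j 0 0, gpt j 1 0, gpt j 0 1} = {gpt G1 0 0}" for j
      using gpt_vertices by (cases j) auto
    ultimately show ?thesis by simp
  qed
  have "simplex2 0 0" by (simp add: simplex2_def)
  then have "gpt j x y = gpt G1 0 0 \<Longrightarrow> x \<in> \<int> \<and> y \<in> \<int>"
    using lattice_eq_Ints[of j x y G1 0 0] gpt_eq_iff[OF s, of 0 0 j G1] by simp
  then show ?thesis unfolding V using gpt_vertex[OF s] by blast
qed

lemma gpt_in_Face:
  assumes s: "simplex2 x y"
  shows "gpt j x y \<in> Face j' \<longleftrightarrow> j = j' \<and> 0 < x \<and> 0 < y \<and> x + y < 1"
proof
  assume "gpt j x y \<in> Face j'"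
  then obtain z where z: "gpt j x y = glue (j', z)" "z \<in> interior triangle" unfolding Face_def by blast
  define x' where "x' = tri_x z"
  define y' where "y' = tri_y z"
  have z': "z = tri_point x' y'" by (simp add: x'_def y'_def)
  have i: "0 < x'" "0 < y'" "x' + y' < 1" using z(2) interior_triangle unfolding z' by auto
  then have s': "simplex2 x' y'" by (simp add: simplex2_def)
  have "gpt j x y = gpt j' x' y'" using z(1) z' by (simp add: gpt_def)
  then have l: "lattice_eq (j, tri_point x y) (j', tri_point x' y')" using gpt_eq_iff[OF s s'] by blast
  have ni: "x' \<notin> \<int>" "y' \<notin> \<int>" "x' + y' \<notin> \<int>" using i by (auto elim!: Ints_cases)
  then have "x \<noteq> 0" "y \<noteq> 0" "x + y \<noteq> 1" using lattice_eq_Ints[OF l] by auto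
  then have i': "0 < x" "0 < y" "x + y < 1" using s by (auto simp: simplex2_def)
  moreover have "j = j'"
  proof (rule ccontr)
    assume ne: "j \<noteq> j'"
    have "x + x' \<in> \<int>" "y + y' \<in> \<int>" by (rule lattice_eq_opposite[OF l ne])+
    then obtain a b :: int where "x + x' = a" "y + y' = b" by (auto elim!: Ints_cases)
    then have "0 < a" "0 < b" "a + b < 2" using i i' by linarith+
    then show False by linarith
  qed
  ultimately show "j = j' \<and> 0 < x \<and> 0 < y \<and> x + y < 1" by blast
next
  assume "j = j' \<and> 0 < x \<and> 0 < y \<and> x + y < 1"
  then show "gpt j x y \<in> Face j'" using interior_triangle unfolding Face_def gpt_def by blast
qed

lemma topspace_Sigma: "topspace Sigma_top = {gpt j x y | j x y. simplex2 x y}"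
proof -
  let ?X = "sum_topology (\<lambda>_::sheet. top_of_set triangle) UNIV"
  have t: "topspace ?X = UNIV \<times> triangle" by auto
  have "openin Sigma_top (glue ` topspace ?X)"
  proof -
    have "{x \<in> topspace ?X. glue x \<in> glue ` topspace ?X} = topspace ?X" by blast
    then show ?thesis unfolding Sigma_top_def openin_quotient_topology by (simp only: openin_topspace) simp
  qed
  moreover have "S \<subseteq> glue ` topspace ?X" if "openin Sigma_top S" for S
    using that unfolding Sigma_top_def openin_quotient_topology by blast
  ultimately have "topspace Sigma_top = glue ` topspace ?X"
    unfolding topspace_def by blast
  then show ?thesis unfolding t image_glue_triangle .
qed

section \<open>Disjoint arcs in a triangle do not interlace\<close>

text \<open>The point of the boundary with the parameter that \<open>bpos\<close> assigns to a crossing.\<close>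

definition bdry :: "real \<Rightarrow> complex" where
  "bdry p = (if p \<le> 1 then tri_point p 0 else if p \<le> 2 then tri_point (2 - p) (p - 1) else tri_point 0 (3 - p))"

text \<open>An affine image of the triangle in which \<open>T\<^sub>2\<close> lies on the line at height \<open>0\<close>. The theorem on
  interlaced arcs in a box requires all endpoints on one side of the box.\<close>

definition flat :: "complex \<Rightarrow> real ^ 2" where
  "flat z = vector [1 - tri_x z + tri_y z, 1 - tri_x z - tri_y z]"

definition foot :: "real \<Rightarrow> real ^ 2" where
  "foot p = vector [if p \<le> 1 then p - 1 else if p \<le> 2 then 2 * (p - 1) else p, 0]"

lemma flat_inj: "flat z = flat z' \<Longrightarrow> z = z'"
proof -
  assume "flat z = flat z'"
  then have "flat z $ 1 = flat z' $ 1" "flat z $ 2 = flat z' $ 2" by simp_all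
  then have "tri_x z = tri_x z'" "tri_y z = tri_y z'" by (simp_all add: flat_def)
  then show ?thesis by (metis tri_point_xy)
qed

lemma continuous_on_tri_xy: "continuous_on S tri_x" "continuous_on S tri_y"
  unfolding tri_x_def tri_y_def by (intro continuous_intros; simp)+

lemma vec2_eq_iff: "(v :: real ^ 2) = w \<longleftrightarrow> v $ 1 = w $ 1 \<and> v $ 2 = w $ 2"
  by (simp add: vec_eq_iff forall_2)

lemma continuous_on_flat: "continuous_on S flat"
proof -
  have "flat = (\<lambda>z. (1 - tri_x z + tri_y z) *\<^sub>R axis 1 1 + (1 - tri_x z - tri_y z) *\<^sub>R axis 2 1)"
    by (rule ext) (simp add: flat_def vec2_eq_iff axis_def)
  moreover have "continuous_on S (\<lambda>z. (1 - tri_x z + tri_y z) *\<^sub>R (axis 1 1 :: real ^ 2) + (1 - tri_x z - tri_y z) *\<^sub>R axis 2 1)"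
    by (intro continuous_intros continuous_on_tri_xy)
  ultimately show ?thesis by (simp only:)
qed

lemma flat_triangle:
  assumes "z \<in> triangle"
  shows "0 \<le> flat z $ 2" "flat z $ 2 \<le> 1" "flat z $ 2 \<le> flat z $ 1" "flat z $ 1 + flat z $ 2 \<le> 2"
  using assms by (auto simp: in_triangle_iff simplex2_def flat_def)

lemma flat_boundary:
  "flat (bdry p) = vector [if p \<le> 1 then 1 - p else if p \<le> 2 then 2 * (p - 1) else 4 - p,
     if p \<le> 1 then 1 - p else if p \<le> 2 then 0 else p - 2]"
  by (simp add: bdry_def flat_def vec2_eq_iff)

text \<open>From each boundary point a segment leads out of the triangle to the base line, and these
  segments are disjoint; they carry the cyclic order of the boundary to the linear order of the line.\<close>

lemma foot_seg:
  assumes "z \<in> closed_segment (foot p) (flat (bdry p))" "0 \<le> p" "p < 3"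
  shows "0 \<le> z $ 2" "z $ 2 \<le> 1" "-1 \<le> z $ 1" "z $ 1 \<le> 3"
    "p \<le> 1 \<and> z $ 1 = 2 * z $ 2 + p - 1 \<and> z $ 2 \<le> 1 - p \<or>
     1 < p \<and> p \<le> 2 \<and> z $ 1 = 2 * (p - 1) \<and> z $ 2 = 0 \<or>
     2 < p \<and> z $ 1 = p - 2 * z $ 2 \<and> z $ 2 \<le> p - 2"
proof -
  obtain u where u: "0 \<le> u" "u \<le> 1" "z = (1 - u) *\<^sub>R foot p + u *\<^sub>R flat (bdry p)"
    using assms(1) by (auto simp: in_segment)
  have z1: "z $ 1 = (1 - u) * foot p $ 1 + u * flat (bdry p) $ 1"
    and z2: "z $ 2 = (1 - u) * foot p $ 2 + u * flat (bdry p) $ 2"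
    by (simp_all add: u(3))
  have m: "u * (1 - p) \<le> 1 - p" "0 \<le> u * (1 - p)" if "p \<le> 1"
    using that u by (auto intro: mult_left_le_one_le)
  have n: "u * (p - 2) \<le> p - 2" "0 \<le> u * (p - 2)" if "2 < p"
    using that u by (auto intro: mult_left_le_one_le)
  have A: "z $ 2 = u * (1 - p) \<and> z $ 1 = 2 * (u * (1 - p)) + p - 1" if "p \<le> 1"
    using that by (simp add: z1 z2 foot_def flat_boundary algebra_simps)
  have B: "z $ 2 = 0 \<and> z $ 1 = 2 * (p - 1)" if "1 < p" "p \<le> 2"
    using that by (simp add: z1 z2 foot_def flat_boundary algebra_simps)
  have C: "z $ 2 = u * (p - 2) \<and> z $ 1 = p - 2 * (u * (p - 2))" if "2 < p"
    using that by (simp add: z1 z2 foot_def flat_boundary algebra_simps)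
  have "(p \<le> 1 \<and> z $ 1 = 2 * z $ 2 + p - 1 \<and> z $ 2 \<le> 1 - p \<or>
     1 < p \<and> p \<le> 2 \<and> z $ 1 = 2 * (p - 1) \<and> z $ 2 = 0 \<or>
     2 < p \<and> z $ 1 = p - 2 * z $ 2 \<and> z $ 2 \<le> p - 2) \<and> 0 \<le> z $ 2 \<and> z $ 2 \<le> 1 \<and> -1 \<le> z $ 1 \<and> z $ 1 \<le> 3"
  proof -
    consider "p \<le> 1" | "1 < p" "p \<le> 2" | "2 < p" by linarith
    then show ?thesis
    proof cases
      case 1
      show ?thesis using A[OF 1] m[OF 1] 1 assms(2,3) by linarith
    next
      case 2
      show ?thesis using B[OF 2] 2 by auto
    next
      case 3
      show ?thesis using C[OF 3] n[OF 3] 3 assms(2,3) by linarith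
    qed
  qed
  then show "p \<le> 1 \<and> z $ 1 = 2 * z $ 2 + p - 1 \<and> z $ 2 \<le> 1 - p \<or>
     1 < p \<and> p \<le> 2 \<and> z $ 1 = 2 * (p - 1) \<and> z $ 2 = 0 \<or>
     2 < p \<and> z $ 1 = p - 2 * z $ 2 \<and> z $ 2 \<le> p - 2"
    "0 \<le> z $ 2" "z $ 2 \<le> 1" "-1 \<le> z $ 1" "z $ 1 \<le> 3" by blast+
qed

lemma foot_coords_unique:
  fixes x y p q :: real
  assumes "0 \<le> y" "0 \<le> p" "p < 3" "0 \<le> q" "q < 3"
    and p: "p \<le> 1 \<and> x = 2 * y + p - 1 \<and> y \<le> 1 - p \<or>
     1 < p \<and> p \<le> 2 \<and> x = 2 * (p - 1) \<and> y = 0 \<or> 2 < p \<and> x = p - 2 * y \<and> y \<le> p - 2"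
    and q: "q \<le> 1 \<and> x = 2 * y + q - 1 \<and> y \<le> 1 - q \<or>
     1 < q \<and> q \<le> 2 \<and> x = 2 * (q - 1) \<and> y = 0 \<or> 2 < q \<and> x = q - 2 * y \<and> y \<le> q - 2"
  shows "p = q"
  using assms by (smt (verit))

lemma foot_segs_disjoint:
  assumes "z \<in> closed_segment (foot p) (flat (bdry p))" "0 \<le> p" "p < 3"
    "z \<in> closed_segment (foot q) (flat (bdry q))" "0 \<le> q" "q < 3"
  shows "p = q"
  by (rule foot_coords_unique[OF foot_seg(1)[OF assms(1-3)] assms(2,3,5,6) foot_seg(5)[OF assms(1-3)]
    foot_seg(5)[OF assms(4-6)]])

lemma foot_seg_triangle:
  assumes z: "flat z \<in> closed_segment (foot p) (flat (bdry p))" "0 \<le> p" "p < 3" and t: "z \<in> triangle"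
  shows "z = bdry p"
proof -
  have "flat z = flat (bdry p)"
    using foot_seg(1,2,5)[OF z] flat_triangle[OF t] unfolding vec2_eq_iff flat_boundary
    by (elim disjE conjE) simp_all
  then show ?thesis by (rule flat_inj)
qed

lemma foot_less: "0 \<le> p \<Longrightarrow> p < q \<Longrightarrow> q < 3 \<Longrightarrow> foot p $ 1 < foot q $ 1"
  by (auto simp: foot_def)

text \<open>Prolong both arcs by the segments to their feet. The prolonged arcs have interlaced ends on
  the bottom of a box, so they meet; the added segments meet neither each other nor the other arc.\<close>

lemma interlaced_arcs_meet:
  fixes g h :: "real \<Rightarrow> complex"
  assumes g: "path g" "path_image g \<subseteq> triangle" "pathstart g = bdry a" "pathfinish g = bdry b"
    and h: "path h" "path_image h \<subseteq> triangle" "pathstart h = bdry c" "pathfinish h = bdry d"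
    and o: "0 \<le> a" "a < c" "c < b" "b < d" "d < 3"
  shows "path_image g \<inter> path_image h \<noteq> {}"
proof
  assume disj: "path_image g \<inter> path_image h = {}"
  define E where "E p = closed_segment (foot p) (flat (bdry p))" for p
  define G where "G f p q = (linepath (foot p) (flat (bdry p)) +++ (flat \<circ> f)) +++
    linepath (flat (bdry q)) (foot q)" for f :: "real \<Rightarrow> complex" and p q
  have *: "path (G f p q) \<and> path_image (G f p q) = E p \<union> flat ` path_image f \<union> E q \<and>
      pathstart (G f p q) = foot p \<and> pathfinish (G f p q) = foot q"
    if "path f" "pathstart f = bdry p" "pathfinish f = bdry q" for f p q
  proof -
    have 1: "path (flat \<circ> f)" "pathstart (flat \<circ> f) = flat (bdry p)"
      "pathfinish (flat \<circ> f) = flat (bdry q)"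
      using that path_continuous_image[OF that(1) continuous_on_flat]
      by (auto simp: pathstart_def pathfinish_def)
    then show ?thesis unfolding G_def E_def
      by (auto simp: path_image_join path_image_compose closed_segment_commute)
  qed
  note Gg = *[OF g(1,3,4)] and Gh = *[OF h(1,3,4)]
  define lo where "lo = (vector [- 1, 0] :: real ^ 2)"
  define hi where "hi = (vector [3, 1] :: real ^ 2)"
  have box: "z \<in> cbox lo hi \<longleftrightarrow> - 1 \<le> z $ 1 \<and> z $ 1 \<le> 3 \<and> 0 \<le> z $ 2 \<and> z $ 2 \<le> 1" for z
    by (auto simp: mem_box_cart forall_2 lo_def hi_def)
  have Ebox: "E p \<subseteq> cbox lo hi" if "0 \<le> p" "p < 3" for p
    using foot_seg(1-4)[OF _ that] unfolding E_def box subset_eq by blast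
  have Tbox: "flat z \<in> cbox lo hi" if "z \<in> triangle" for z
    using flat_triangle[OF that] unfolding box by linarith
  have r: "0 \<le> a" "a < 3" "0 \<le> b" "b < 3" "0 \<le> c" "c < 3" "0 \<le> d" "d < 3" using o by auto
  have foot2: "foot p $ 2 = lo $ 2" for p by (simp add: foot_def lo_def)
  obtain z where z: "z \<in> path_image (G g a b)" "z \<in> path_image (G h c d)"
  proof (rule fashoda_interlace[of "G g a b" "G h c d" lo hi])
    show "path (G g a b)" "path (G h c d)" using Gg Gh by auto
    show "path_image (G g a b) \<subseteq> cbox lo hi" using Gg Ebox r Tbox g(2) by auto
    show "path_image (G h c d) \<subseteq> cbox lo hi" using Gh Ebox r Tbox h(2) by auto
    show "pathstart (G g a b) $ 2 = lo $ 2" "pathfinish (G g a b) $ 2 = lo $ 2"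
      "pathstart (G h c d) $ 2 = lo $ 2" "pathfinish (G h c d) $ 2 = lo $ 2"
      using Gg Gh foot2 by auto
    show "pathstart (G g a b) $ 1 < pathstart (G h c d) $ 1" "pathstart (G h c d) $ 1 < pathfinish (G g a b) $ 1"
      "pathfinish (G g a b) $ 1 < pathfinish (G h c d) $ 1"
      using Gg Gh foot_less o by auto
  qed auto
  have EE: "False" if "z \<in> E p" "z \<in> E q" "p \<in> {a, b}" "q \<in> {c, d}" for p q
    using foot_segs_disjoint[of z p q] that r o unfolding E_def by auto
  have ET: "y = bdry p" if "flat y \<in> E p" "y \<in> triangle" "p \<in> {a, b, c, d}" for p y
    using foot_seg_triangle[of y p] that r unfolding E_def by auto
  have ends: "bdry a \<in> path_image g" "bdry b \<in> path_image g"
    "bdry c \<in> path_image h" "bdry d \<in> path_image h"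
    using g h pathstart_in_path_image pathfinish_in_path_image by metis+
  consider (1) "z \<in> E a \<union> E b" "z \<in> E c \<union> E d" | (2) "z \<in> E a \<union> E b" "z \<in> flat ` path_image h"
    | (3) "z \<in> flat ` path_image g" "z \<in> E c \<union> E d" | (4) "z \<in> flat ` path_image g" "z \<in> flat ` path_image h"
    using z Gg Gh by blast
  then show False
  proof cases
    case 1
    then show False using EE by blast
  next
    case 2
    then obtain y where "y \<in> path_image h" "z = flat y" by blast
    then have "y = bdry a \<or> y = bdry b" using 2 ET h(2) by blast
    then show False using ends \<open>y \<in> path_image h\<close> disj by blast
  next
    case 3
    then obtain y where "y \<in> path_image g" "z = flat y" by blast
    then have "y = bdry c \<or> y = bdry d" using 3 ET g(2) by blast
    then show False using ends \<open>y \<in> path_image g\<close> disj by blast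
  next
    case 4
    then obtain y y' where "y \<in> path_image g" "z = flat y" "y' \<in> path_image h" "z = flat y'" by blast
    then show False using flat_inj disj by blast
  qed
qed

lemma disjoint_arcs_non_interlaced:
  fixes g h :: "real \<Rightarrow> complex"
  assumes g: "path g" "path_image g \<subseteq> triangle" "pathstart g = bdry a" "pathfinish g = bdry b"
    and h: "path h" "path_image h \<subseteq> triangle" "pathstart h = bdry c" "pathfinish h = bdry d"
    and disj: "path_image g \<inter> path_image h = {}"
    and r: "0 \<le> a" "a < 3" "0 \<le> b" "b < 3" "0 \<le> c" "c < 3" "0 \<le> d" "d < 3"
  shows "non_interlaced a b c d"
proof (rule ccontr)
  assume n: "\<not> non_interlaced a b c d"
  have ends: "bdry a \<in> path_image g" "bdry b \<in> path_image g"
    "bdry c \<in> path_image h" "bdry d \<in> path_image h"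
    using g h pathstart_in_path_image pathfinish_in_path_image by metis+
  have ne: "a \<noteq> c" "a \<noteq> d" "b \<noteq> c" "b \<noteq> d" using ends disj by auto
  have orient: "\<exists>f'. path f' \<and> path_image f' = path_image f \<and> pathstart f' = bdry (min p q) \<and>
      pathfinish f' = bdry (max p q)"
    if "path f" "pathstart f = bdry p" "pathfinish f = bdry q" for f p q
  proof (cases "p \<le> q")
    case True
    then show ?thesis using that by (intro exI[of _ f]) auto
  next
    case False
    then show ?thesis using that by (intro exI[of _ "reversepath f"]) auto
  qed
  obtain g' where g': "path g'" "path_image g' = path_image g" "pathstart g' = bdry (min a b)"
    "pathfinish g' = bdry (max a b)" using orient[OF g(1,3,4)] by blast
  obtain h' where h': "path h'" "path_image h' = path_image h" "pathstart h' = bdry (min c d)"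
    "pathfinish h' = bdry (max c d)" using orient[OF h(1,3,4)] by blast
  have "(min a b < min c d \<and> min c d < max a b \<and> max a b < max c d) \<or>
      (min c d < min a b \<and> min a b < max c d \<and> max c d < max a b)"
    using n ne unfolding non_interlaced_def by (auto simp: min_def max_def)
  then show False
  proof
    assume "min a b < min c d \<and> min c d < max a b \<and> max a b < max c d"
    then have "path_image g' \<inter> path_image h' \<noteq> {}"
      using g(2) h(2) g' h' r by (intro interlaced_arcs_meet[of g' "min a b" "max a b" h' "min c d" "max c d"]) auto
    then show False using g'(2) h'(2) disj by simp
  next
    assume "min c d < min a b \<and> min a b < max c d \<and> max c d < max a b"
    then have "path_image h' \<inter> path_image g' \<noteq> {}"
      using g(2) h(2) g' h' r by (intro interlaced_arcs_meet[of h' "min c d" "max c d" g' "min a b" "max a b"]) auto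
    then show False using g'(2) h'(2) disj by (simp add: Int_commute)
  qed
qed

section \<open>Lifting the pieces of a curve to the triangles\<close>

text \<open>The torus inside \<open>\<complex>\<^sup>2\<close>, on which continuity can be checked in coordinates.\<close>

definition torus_point :: "sheet \<times> complex \<Rightarrow> complex \<times> complex" where
  "torus_point p = (cis (2 * pi * (plane_sign (fst p) * tri_x (snd p))),
                    cis (2 * pi * (plane_sign (fst p) * tri_y (snd p))))"

definition torus_embed :: "(sheet \<times> complex) set \<Rightarrow> complex \<times> complex" where
  "torus_embed c = torus_point (SOME p. p \<in> c)"

lemma cis_eq_iff_Ints: "cis (2 * pi * u) = cis (2 * pi * v) \<longleftrightarrow> u - v \<in> \<int>"
proof -
  have "cis (2 * pi * u) = cis (2 * pi * v) \<longleftrightarrow> cis (2 * pi * u) / cis (2 * pi * v) = 1"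
    by (simp add: cis_neq_zero divide_eq_1_iff)
  also have "\<dots> \<longleftrightarrow> cis (2 * pi * (u - v)) = 1"
    by (simp add: cis_divide right_diff_distrib)
  also have "\<dots> \<longleftrightarrow> u - v \<in> \<int>"
  proof
    assume "cis (2 * pi * (u - v)) = 1"
    then have "cos (2 * pi * (u - v)) = 1" by (metis cis.sel(1) one_complex.sel(1))
    then obtain n :: int where "2 * pi * (u - v) = of_int n * 2 * pi" by (auto simp: cos_one_2pi_int)
    then have "u - v = n" by simp
    then show "u - v \<in> \<int>" by simp
  qed (rule cis_multiple_2pi)
  finally show ?thesis .
qed

lemma torus_point_eq_iff: "torus_point p = torus_point q \<longleftrightarrow> lattice_eq p q"
  by (simp add: torus_point_def lattice_eq_def cis_eq_iff_Ints)

lemma torus_embed_glue: "torus_embed (glue p) = torus_point p"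
proof -
  have "(SOME q. q \<in> glue p) \<in> glue p" by (rule someI[of _ p]) (rule glue_self)
  then have "lattice_eq p (SOME q. q \<in> glue p)" by (rule glue_lattice_eq)
  then show ?thesis unfolding torus_embed_def using torus_point_eq_iff lattice_eq_sym by blast
qed

text \<open>The quotient topology is tested in each of the two triangles separately.\<close>

lemma openin_Sigma:
  assumes "U \<subseteq> topspace Sigma_top" "\<And>j. openin (top_of_set triangle) {z \<in> triangle. glue (j, z) \<in> U}"
  shows "openin Sigma_top U"
proof -
  let ?X = "sum_topology (\<lambda>_::sheet. top_of_set triangle) UNIV"
  have t: "topspace ?X = UNIV \<times> triangle" by auto
  have "U \<subseteq> glue ` topspace ?X" using assms(1) unfolding t topspace_Sigma image_glue_triangle .
  moreover have "openin ?X {p \<in> topspace ?X. glue p \<in> U}"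
  proof -
    have "{z. (j, z) \<in> {p \<in> UNIV \<times> triangle. glue p \<in> U}} = {z \<in> triangle. glue (j, z) \<in> U}" for j by auto
    then show ?thesis unfolding openin_sum_topology t using assms(2) by auto
  qed
  ultimately show ?thesis unfolding Sigma_top_def openin_quotient_topology by blast
qed

lemma continuous_on_torus_point: "continuous_on S (\<lambda>z. torus_point (j, z))"
  unfolding torus_point_def fst_conv snd_conv
  by (intro continuous_intros continuous_on_tri_xy continuous_on_cis)

lemma glue_in_topspace: "z \<in> triangle \<Longrightarrow> glue (j, z) \<in> topspace Sigma_top"
proof -
  assume "z \<in> triangle"
  then have "simplex2 (tri_x z) (tri_y z)" by (simp add: in_triangle_iff)
  moreover have "glue (j, z) = gpt j (tri_x z) (tri_y z)" by (simp add: gpt_def)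
  ultimately show ?thesis unfolding topspace_Sigma by blast
qed

lemma topspace_SigmaE:
  assumes "c \<in> topspace Sigma_top"
  obtains j x y where "c = gpt j x y" "simplex2 x y"
  using assms unfolding topspace_Sigma by blast

lemma continuous_torus_embed: "continuous_map Sigma_top euclidean torus_embed"
  unfolding continuous_map_def
proof (intro conjI allI impI)
  fix U :: "(complex \<times> complex) set" assume "openin euclidean U"
  then have U: "open U" by simp
  show "openin Sigma_top {c \<in> topspace Sigma_top. torus_embed c \<in> U}"
  proof (rule openin_Sigma)
    fix j
    have "{z \<in> triangle. glue (j, z) \<in> {c \<in> topspace Sigma_top. torus_embed c \<in> U}} =
        triangle \<inter> (\<lambda>z. torus_point (j, z)) -` U"
      using glue_in_topspace by (auto simp: torus_embed_glue)
    then show "openin (top_of_set triangle) {z \<in> triangle. glue (j, z) \<in> {c \<in> topspace Sigma_top. torus_embed c \<in> U}}"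
      using continuous_openin_preimage_gen[OF continuous_on_torus_point U] by simp
  qed blast
qed auto

lemma openin_Face: "openin Sigma_top (Face j)"
proof (rule openin_Sigma)
  show "Face j \<subseteq> topspace Sigma_top"
    unfolding Face_def using glue_in_topspace interior_subset by blast
  fix i
  have "{z \<in> triangle. glue (i, z) \<in> Face j} = (if i = j then interior triangle else {})"
  proof -
    have "glue (i, z) \<in> Face j \<longleftrightarrow> i = j \<and> z \<in> interior triangle" if "z \<in> triangle" for z
      using gpt_in_Face[of "tri_x z" "tri_y z" i j] interior_triangle[of "tri_x z" "tri_y z"] that
      by (simp add: gpt_def in_triangle_iff)
    then show ?thesis using interior_subset[of triangle] by auto
  qed
  then show "openin (top_of_set triangle) {z \<in> triangle. glue (i, z) \<in> Face j}"
    using open_subset[OF interior_subset[of triangle] open_interior] by (simp only: openin_empty if_True if_False split: if_split) simp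
qed

lemma Face_disjoint: "c \<in> Face j \<Longrightarrow> c \<in> Face k \<Longrightarrow> j = k"
proof -
  assume c: "c \<in> Face j" "c \<in> Face k"
  have "c \<in> topspace Sigma_top" using openin_subset[OF openin_Face[of j]] c by blast
  then obtain i x y where p: "c = gpt i x y" "simplex2 x y" by (rule topspace_SigmaE)
  show ?thesis using gpt_in_Face[OF p(2), of i j] gpt_in_Face[OF p(2), of i k] c p(1) by simp
qed

lemma not_Edges_Face:
  assumes "c \<in> topspace Sigma_top" "c \<notin> Edges"
  obtains j where "c \<in> Face j"
proof -
  obtain j x y where c: "c = gpt j x y" "simplex2 x y" using assms(1) by (rule topspace_SigmaE)
  then have "x \<notin> \<int>" "y \<notin> \<int>" "x + y \<notin> \<int>" using gpt_in_Edges[OF c(2), of j] assms(2) by auto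
  then have "x \<noteq> 0" "y \<noteq> 0" "x + y \<noteq> 1" by auto
  then have "0 < x" "0 < y" "x + y < 1" using c(2) by (auto simp: simplex2_def)
  then have "c \<in> Face j" using gpt_in_Face[OF c(2), of j j] c(1) by simp
  then show thesis by (rule that)
qed

text \<open>Within one triangle only the vertices are identified with each other.\<close>

lemma lattice_eq_same_sheet:
  assumes s: "z \<in> triangle" "z' \<in> triangle" and l: "lattice_eq (j, z) (j, z')"
    and v: "\<not> (tri_x z \<in> \<int> \<and> tri_y z \<in> \<int>)"
  shows "z = z'"
proof -
  have d: "tri_x z - tri_x z' \<in> \<int>" "tri_y z - tri_y z' \<in> \<int>"
    using l by (cases j; auto simp: lattice_eq_def intro: Ints_diff_sym)+
  have v': "\<not> (tri_x z' \<in> \<int> \<and> tri_y z' \<in> \<int>)" using v d Ints_diff_iff by blast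
  have s': "simplex2 (tri_x z) (tri_y z)" "simplex2 (tri_x z') (tri_y z')" using s by (simp_all add: in_triangle_iff)
  have "tri_x z - tri_x z' = 0" "tri_y z - tri_y z' = 0"
    using simplex2_less_1[OF s'(1) v] simplex2_less_1[OF s'(2) v'] s' d
    by (intro Ints_small; simp add: simplex2_def)+
  then have "tri_x z = tri_x z'" "tri_y z = tri_y z'" by auto
  then show ?thesis by (metis tri_point_xy)
qed

lemma glue_in_Vertices: "z \<in> triangle \<Longrightarrow> glue (j, z) \<in> Vertices \<longleftrightarrow> tri_x z \<in> \<int> \<and> tri_y z \<in> \<int>"
  using gpt_in_Vertices[of "tri_x z" "tri_y z" j] by (simp add: gpt_def in_triangle_iff)

lemma glue_inj_sheet:
  assumes "z \<in> triangle" "z' \<in> triangle" "glue (j, z) = glue (j, z')" "glue (j, z) \<notin> Vertices"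
  shows "z = z'"
proof (rule lattice_eq_same_sheet[OF assms(1,2)])
  have "(j, z') \<in> glue (j, z)" using glue_self[of "(j, z')"] assms(3) by simp
  then show "lattice_eq (j, z) (j, z')" by (rule glue_lattice_eq)
  show "\<not> (tri_x z \<in> \<int> \<and> tri_y z \<in> \<int>)" using glue_in_Vertices[OF assms(1)] assms(4) by simp
qed

text \<open>The preimage of a value under a continuous map on a compact set moves continuously wherever it
  is unique, because the part of the compact set outside a neighbourhood has compact image.\<close>

lemma continuous_lift:
  fixes \<gamma> :: "real \<Rightarrow> complex" and f :: "complex \<Rightarrow> complex \<times> complex"
  assumes K: "compact K" "continuous_on K f" and t0: "t0 \<in> I"
    and lift: "\<And>t. t \<in> I \<Longrightarrow> \<gamma> t \<in> K \<and> f (\<gamma> t) = g t" and g: "continuous (at t0 within I) g"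
    and unique: "\<And>z. z \<in> K \<Longrightarrow> f z = f (\<gamma> t0) \<Longrightarrow> z = \<gamma> t0"
  shows "continuous (at t0 within I) \<gamma>"
  unfolding continuous_within tendsto_def
proof (intro allI impI)
  fix S assume S: "open S" "\<gamma> t0 \<in> S"
  have "compact (K - S)" by (rule compact_diff[OF K(1) S(1)])
  then have "compact (f ` (K - S))"
    by (intro compact_continuous_image continuous_on_subset[OF K(2)]) auto
  then have "open (- f ` (K - S))" using compact_imp_closed by blast
  moreover have "g t0 \<in> - f ` (K - S)"
  proof
    assume "g t0 \<in> f ` (K - S)"
    then obtain z where z: "z \<in> K" "z \<notin> S" "g t0 = f z" by blast
    have "f z = f (\<gamma> t0)" using z(3) lift[OF t0] by simp
    then show False using unique[OF z(1)] z(2) S(2) by simp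
  qed
  ultimately have "eventually (\<lambda>t. g t \<in> - f ` (K - S)) (at t0 within I)"
    using g unfolding continuous_within tendsto_def by blast
  then show "eventually (\<lambda>t. \<gamma> t \<in> S) (at t0 within I)"
    unfolding eventually_at_filter
  proof (rule eventually_mono)
    fix t assume a: "t \<noteq> t0 \<longrightarrow> t \<in> I \<longrightarrow> g t \<in> - f ` (K - S)"
    show "t \<noteq> t0 \<longrightarrow> t \<in> I \<longrightarrow> \<gamma> t \<in> S"
    proof (intro impI)
      assume t: "t \<noteq> t0" "t \<in> I"
      have "f (\<gamma> t) \<notin> f ` (K - S)" using a t lift[OF t(2)] by simp
      then show "\<gamma> t \<in> S" using lift[OF t(2)] by blast
    qed
  qed
qed

lemma bdry_edge:
  assumes "0 < t" "t < 1"
  shows "bdry (edge_num i + t) = edge_point i t"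
  using assms by (cases i) (auto simp: bdry_def edge_point_tri)

lemma Edge_cases:
  assumes "c \<in> Edge i" "c \<notin> Vertices"
  obtains t where "0 < t" "t < 1" "c = glue (G1, edge_point i t)" "c = glue (G2, edge_point i (1 - t))"
proof -
  have g: "glue (G1, edge_point i t) = glue (G2, edge_point i (1 - t))" if "0 \<le> t" "t \<le> 1" for t
  proof -
    have "(oriented_edge G1 i t, oriented_edge G2 i t) \<in> glue_rel" using that by (auto simp: glue_rel_def)
    then show ?thesis using glue_eqI by fastforce
  qed
  obtain j u where u: "0 \<le> u" "u \<le> 1" "c = glue (j, edge_point i u)"
    using assms(1) by (auto simp: Edge_def)
  define t where "t = (if j = G1 then u else 1 - u)"
  have t: "0 \<le> t" "t \<le> 1" using u by (auto simp: t_def)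
  have c: "c = glue (G1, edge_point i t)"
    using u g[OF t] by (cases j) (auto simp: t_def)
  have "tri_vertex k \<in> range tri_vertex" for k by simp
  then have vv: "glue (j, tri_vertex k) \<in> Vertices" for j k unfolding Vertices_def by blast
  have "t \<noteq> 0" "t \<noteq> 1"
    using assms(2) vv c by (auto simp: edge_point_def simp del: tri_vertex.simps)
  then show thesis using that[of t] t c g[OF t] by auto
qed

lemma edge_point_triangle: "0 \<le> t \<Longrightarrow> t \<le> 1 \<Longrightarrow> edge_point i t \<in> triangle"
  by (cases i) (auto simp: edge_point_tri simplex2_def)

lemma Lseg_points: "Lseg j = {gpt j r r | r. 0 \<le> r \<and> r \<le> 1 / 3}"
proof -
  have c: "0 = tri_point (1/3) (1/3)" by (simp add: complex_eq_iff tri_point_Re_Im)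
  have "closed_segment 0 (tri_vertex I1) = {tri_point r r | r. 0 \<le> r \<and> r \<le> 1 / 3}"
  proof (intro equalityI subsetI)
    fix z assume "z \<in> closed_segment 0 (tri_vertex I1)"
    then obtain u where u: "0 \<le> u" "u \<le> 1" "z = u *\<^sub>R 1" by (auto simp: in_segment)
    have "z = tri_point ((1 - u) / 3) ((1 - u) / 3)"
      by (simp add: u(3) complex_eq_iff tri_point_Re_Im field_simps)
    moreover have "0 \<le> (1 - u) / 3" "(1 - u) / 3 \<le> 1 / 3" using u by auto
    ultimately show "z \<in> {tri_point r r | r. 0 \<le> r \<and> r \<le> 1 / 3}" by blast
  next
    fix z assume "z \<in> {tri_point r r | r. 0 \<le> r \<and> r \<le> 1 / 3}"
    then obtain r where r: "z = tri_point r r" "0 \<le> r" "r \<le> 1 / 3" by blast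
    have "z = (1 - 3 * r) *\<^sub>R 1" by (simp add: r(1) complex_eq_iff tri_point_Re_Im field_simps)
    then show "z \<in> closed_segment 0 (tri_vertex I1)"
      using r unfolding in_segment by (intro exI[of _ "1 - 3 * r"]) auto
  qed
  then show ?thesis unfolding Lseg_def gpt_def by auto
qed

text \<open>At the ends of the curve the lift to the triangle is not unique, since all three vertices have
  the same image; that the curve stays on the prescribed segment there singles one out.\<close>

lemma continuous_lift_vertex:
  fixes \<gamma> :: "real \<Rightarrow> complex"
  assumes t0: "t0 \<in> I" "\<gamma> t0 = tri_point 0 0"
    and lift: "\<And>t. t \<in> I \<Longrightarrow> (\<exists>r. 0 \<le> r \<and> r \<le> 1 / 3 \<and> \<gamma> t = tri_point r r) \<and> torus_point (j, \<gamma> t) = g t"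
    and g: "continuous (at t0 within I) g"
  shows "continuous (at t0 within I) \<gamma>"
proof (rule continuous_lift[where K = "(\<lambda>r. tri_point r r) ` {0..1/3}" and f = "\<lambda>z. torus_point (j, z)" and g = g])
  have "continuous_on {0..1/3} (\<lambda>r. tri_point r r)"
    unfolding tri_point_def by (intro continuous_intros)
  then show "compact ((\<lambda>r. tri_point r r) ` {0..1/3})"
    by (rule compact_continuous_image) simp
  show "continuous_on ((\<lambda>r. tri_point r r) ` {0..1/3}) (\<lambda>z. torus_point (j, z))"
    by (rule continuous_on_torus_point)
  show "\<gamma> t \<in> (\<lambda>r. tri_point r r) ` {0..1/3} \<and> torus_point (j, \<gamma> t) = g t" if "t \<in> I" for t
    using lift[OF that] by auto
  fix z assume "z \<in> (\<lambda>r. tri_point r r) ` {0..1/3}" and e: "torus_point (j, z) = torus_point (j, \<gamma> t0)"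
  then obtain r where r: "z = tri_point r r" "0 \<le> r" "r \<le> 1 / 3" by auto
  have "lattice_eq (j, tri_point r r) (j, tri_point 0 0)" using e r t0(2) torus_point_eq_iff by simp
  then have "r \<in> \<int>" using lattice_eq_Ints(1) Ints_0 by blast
  then have "r = 0" using r by (auto elim!: Ints_cases)
  then show "z = \<gamma> t0" using r t0 by simp
qed (use t0 g in auto)

section \<open>The chord diagram of an admissible curve\<close>

definition sheet_of :: "nat \<Rightarrow> sheet" where
  "sheet_of i = (if even i then G1 else G2)"

lemma sheet_of_Suc: "j \<noteq> sheet_of i \<longleftrightarrow> j = sheet_of (Suc i)"
  by (cases j) (auto simp: sheet_of_def)

text \<open>Between two consecutive crossings the curve stays in one open triangle by connectedness, and
  transversality makes the triangles alternate. Each piece lifts to an arc in the closed triangle;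
  lifts of different pieces in the same triangle are disjoint because the curve is injective. The
  two ends of the curve meet at the vertex, but they lie in different triangles as the number of
  crossings is odd.\<close>

theorem admissible_curve_diagram:
  assumes adm: "admissible \<eta>" and simple: "non_self_crossing \<eta>" and w: "curve_word \<eta> w"
    and odd: "odd (length w)"
  obtains D where "diagram D" "map fst D = w"
proof -
  have cont: "continuous_map (top_of_set {0..1}) Sigma_top \<eta>"
    and vert: "\<And>x. x \<in> {0..1} \<Longrightarrow> \<eta> x \<in> Vertices \<longleftrightarrow> x = 0 \<or> x = 1"
    and trans: "\<And>x. x \<in> {0..1} \<Longrightarrow> \<eta> x \<in> Edges - Vertices \<Longrightarrow> transversal_at \<eta> x"
    using adm unfolding admissible_def by blast+
  obtain \<epsilon> where \<epsilon>: "0 < \<epsilon>" "\<epsilon> \<le> 1" "\<eta> ` {0..\<epsilon>} \<subseteq> Lseg G1" "\<eta> ` {1 - \<epsilon>..1} \<subseteq> Lseg G2"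
    using adm unfolding admissible_def by blast
  have inj: "s = t" if "\<eta> s = \<eta> t" "0 \<le> s" "s < 1" "0 \<le> t" "t < 1" for s t
    using simple that unfolding non_self_crossing_def inj_on_def by simp
  obtain ts where ts: "sorted_wrt (<) ts" "set ts = {x \<in> {0<..<1}. \<eta> x \<in> Edges}"
    "list_all2 (\<lambda>t i. \<eta> t \<in> Edge i) ts w"
    using w unfolding curve_word_def by blast
  define k where "k = length w"
  have lts: "length ts = k" using ts(3) list_all2_lengthD unfolding k_def by blast
  have k0: "0 < k" using odd odd_pos unfolding k_def by blast
  have top: "\<eta> x \<in> topspace Sigma_top" if "0 \<le> x" "x \<le> 1" for x
    using continuous_map_image_subset_topspace[OF cont] that by auto
  have g: "continuous_on {0..1} (torus_embed \<circ> \<eta>)"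
    using continuous_map_compose[OF cont continuous_torus_embed] by simp
  \<comment> \<open>The times of the stops: the crossings, preceded by \<open>0\<close> and followed by \<open>1\<close>.\<close>
  define T where "T i = (if i = 0 then 0 else if i \<le> k then ts ! (i - 1) else 1)" for i
  have T0: "T 0 = 0" "T (Suc k) = 1" by (simp_all add: T_def)
  have Tmid: "T i = ts ! (i - 1)" "0 < T i" "T i < 1" "\<eta> (T i) \<in> Edge (w ! (i - 1))"
    if "0 < i" "i \<le> k" for i
  proof -
    show e: "T i = ts ! (i - 1)" using that by (simp add: T_def)
    have "ts ! (i - 1) \<in> set ts" using that lts by simp
    then show "0 < T i" "T i < 1" unfolding e ts(2) by auto
    show "\<eta> (T i) \<in> Edge (w ! (i - 1))"
      unfolding e using list_all2_nthD[OF ts(3), of "i - 1"] that lts by simp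
  qed
  have Tstep: "T i < T (Suc i)" if "i \<le> k" for i
  proof (cases "i = 0 \<or> i = k")
    case True
    then show ?thesis using Tmid[of 1] Tmid[of k] k0 T0 by auto
  next
    case False
    then have "ts ! (i - 1) < ts ! i" using sorted_wrt_nth_less[OF ts(1), of "i - 1" i] that lts by auto
    then show ?thesis using False that Tmid(1)[of i] Tmid(1)[of "Suc i"] by auto
  qed
  have Tless: "T i < T j" if "i < j" "j \<le> Suc k" for i j
    using that
  proof (induction j)
    case (Suc j)
    then show ?case using Tstep[of j] by (cases "i = j") auto
  qed simp
  have Tle: "T i \<le> T j" if "i \<le> j" "j \<le> Suc k" for i j
    using Tless[of i j] that by (cases "i = j") auto
  have Tr: "0 \<le> T i" "T i \<le> 1" if "i \<le> Suc k" for i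
    using Tle[of 0 i] Tle[of i "Suc k"] that T0 by auto
  have nocross: "\<eta> t \<notin> Edges" if i: "i \<le> k" and t: "T i < t" "t < T (Suc i)" for i t
  proof
    assume "\<eta> t \<in> Edges"
    then have "t \<in> set ts" using ts(2) t Tr[of i] Tr[of "Suc i"] i by auto
    then obtain l where l: "l < k" "t = ts ! l" using lts by (metis in_set_conv_nth)
    then have tl: "t = T (Suc l)" using Tmid(1)[of "Suc l"] by simp
    show False
    proof (cases "Suc l \<le> i")
      case True
      then show False using Tle[of "Suc l" i] tl t i by simp
    next
      case False
      then show False using Tle[of "Suc i" "Suc l"] tl t l by simp
    qed
  qed
  have conn: "\<eta> t \<in> Face j" if i: "i \<le> k" and u: "T i < u" "u < T (Suc i)" "\<eta> u \<in> Face j"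
    and t: "T i < t" "t < T (Suc i)" for i j u t
  proof (rule ccontr)
    assume nj: "\<eta> t \<notin> Face j"
    define S where "S = {T i<..<T (Suc i)}"
    have S01: "S \<subseteq> {0..1}" using Tr[of i] Tr[of "Suc i"] i unfolding S_def by auto
    define A where "A = {x \<in> S. \<eta> x \<in> Face j}"
    define B where "B = {x \<in> S. \<eta> x \<in> Face (if j = G1 then G2 else G1)}"
    have op: "openin (top_of_set S) {x \<in> S. \<eta> x \<in> Face i'}" for i'
    proof -
      have "openin (top_of_set {0..1}) {x \<in> {0..1}. \<eta> x \<in> Face i'}"
        using openin_continuous_map_preimage[OF cont openin_Face] by simp
      then obtain V where V: "open V" "{x \<in> {0..1}. \<eta> x \<in> Face i'} = {0..1} \<inter> V"
        unfolding openin_open by blast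
      have "{x \<in> S. \<eta> x \<in> Face i'} = S \<inter> V" using V(2) S01 by blast
      then show ?thesis using V(1) unfolding openin_open by blast
    qed
    have AB: "A \<union> B = S"
    proof -
      have "x \<in> A \<union> B" if x: "x \<in> S" for x
      proof -
        have "\<eta> x \<notin> Edges" using nocross[OF i] x by (auto simp: S_def)
        then obtain j' where "\<eta> x \<in> Face j'" using not_Edges_Face top x S01 by (metis atLeastAtMost_iff subsetD)
        then show ?thesis using x by (cases j; cases j') (auto simp: A_def B_def)
      qed
      moreover have "A \<union> B \<subseteq> S" by (auto simp: A_def B_def)
      ultimately show ?thesis by blast
    qed
    have disj: "A \<inter> B = {}"
    proof -
      have "j \<noteq> (if j = G1 then G2 else G1)" by (cases j) auto
      then show ?thesis using Face_disjoint unfolding A_def B_def by blast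
    qed
    have "u \<in> A" using u by (simp add: A_def S_def)
    moreover have "t \<in> B"
    proof -
      have "t \<in> S" using t by (simp add: S_def)
      moreover have "t \<notin> A" using nj by (simp add: A_def)
      ultimately show ?thesis using AB by blast
    qed
    moreover have "connected S" unfolding S_def by simp
    moreover have "openin (top_of_set S) A" "openin (top_of_set S) B" unfolding A_def B_def by (rule op)+
    ultimately show False using AB disj unfolding connected_openin by blast
  qed
  have near: "\<exists>r. 0 < r \<and> r \<le> 1 / 3 \<and> \<eta> t = gpt j r r" if "\<eta> t \<in> Lseg j" "0 < t" "t < 1" for j t
  proof -
    from that(1) obtain r where r: "\<eta> t = gpt j r r" "0 \<le> r" "r \<le> 1 / 3" unfolding Lseg_points by blast
    have "\<eta> t \<notin> Vertices" using vert[of t] that by auto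
    then have "r \<noteq> 0" using r(1) gpt_in_Vertices[of 0 0 j] by (auto simp: simplex2_def)
    then show ?thesis using r by (intro exI[of _ r]) simp
  qed
  have face: "\<eta> t \<in> Face (sheet_of i)" if "i \<le> k" "T i < t" "t < T (Suc i)" for i t
    using that
  proof (induction i arbitrary: t)
    case 0
    define u where "u = min \<epsilon> (T 1) / 2"
    have u: "0 < u" "u \<le> \<epsilon>" "u < T 1" "u < 1"
      using \<epsilon> Tmid[of 1] k0 by (auto simp: u_def min_def)
    have "\<eta> u \<in> Lseg G1" using \<epsilon>(3) u by auto
    then obtain r where "0 < r" "r \<le> 1 / 3" "\<eta> u = gpt G1 r r" using near u by blast
    then have "\<eta> u \<in> Face G1" using gpt_in_Face[of r r G1 G1] by (auto simp: simplex2_def)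
    then show ?case using conn[of 0 u G1 t] 0 u T0 by (simp add: sheet_of_def)
  next
    case (Suc i)
    define s where "s = T (Suc i)"
    have s: "0 < s" "s < 1" "\<eta> s \<in> Edge (w ! i)" using Tmid[of "Suc i"] Suc.prems by (auto simp: s_def)
    have "\<eta> s \<in> Edges - Vertices" using s vert[of s] unfolding Edges_def by auto
    moreover have "s \<in> {0..1}" using s by simp
    ultimately have "transversal_at \<eta> s" using trans by blast
    then obtain \<delta> j j' where \<delta>: "0 < \<delta>" "j \<noteq> j'" "\<eta> ` {s - \<delta>..<s} \<subseteq> Face j" "\<eta> ` {s<..s + \<delta>} \<subseteq> Face j'"
      unfolding transversal_at_def by (elim exE conjE) (rule that)
    define u where "u = max (s - \<delta>) ((T i + s) / 2)"
    have Ts: "T i < s" "s < T (Suc (Suc i))" using Tstep[of i] Tstep[of "Suc i"] Suc.prems by (auto simp: s_def)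
    have u: "s - \<delta> \<le> u" "u < s" "T i < u" using \<delta>(1) Ts by (auto simp: u_def max_def)
    have "\<eta> u \<in> Face j" using \<delta>(3) u by auto
    moreover have "\<eta> u \<in> Face (sheet_of i)" using Suc.IH[of u] u Suc.prems by (simp add: s_def)
    ultimately have "j = sheet_of i" by (rule Face_disjoint)
    then have j': "j' = sheet_of (Suc i)" using \<delta>(2) sheet_of_Suc[of j' i] by simp
    define v where "v = min (s + \<delta>) ((T (Suc (Suc i)) + s) / 2)"
    have v: "v \<le> s + \<delta>" "s < v" "v < T (Suc (Suc i))" using \<delta>(1) Ts by (auto simp: v_def min_def)
    have "\<eta> v \<in> Face (sheet_of (Suc i))" using \<delta>(4) v j' by auto
    then show ?case using conn[of "Suc i" v _ t] v Suc.prems by (simp add: s_def)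
  qed
  have "\<exists>x. 0 < x \<and> x < 1 \<and> \<eta> (T (Suc l)) = glue (G1, edge_point (w ! l) x) \<and>
      \<eta> (T (Suc l)) = glue (G2, edge_point (w ! l) (1 - x))" if "l < k" for l
  proof -
    have "\<eta> (T (Suc l)) \<notin> Vertices" using vert[of "T (Suc l)"] Tmid[of "Suc l"] that by auto
    moreover have "\<eta> (T (Suc l)) \<in> Edge (w ! l)" using Tmid(4)[of "Suc l"] that by simp
    ultimately show ?thesis using Edge_cases by metis
  qed
  then obtain \<tau> where \<tau>: "\<And>l. l < k \<Longrightarrow> 0 < \<tau> l" "\<And>l. l < k \<Longrightarrow> \<tau> l < 1"
    "\<And>l. l < k \<Longrightarrow> \<eta> (T (Suc l)) = glue (G1, edge_point (w ! l) (\<tau> l))"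
    "\<And>l. l < k \<Longrightarrow> \<eta> (T (Suc l)) = glue (G2, edge_point (w ! l) (1 - \<tau> l))" by metis
  define D where "D = map (\<lambda>l. (w ! l, \<tau> l)) [0..<k]"
  have lenD: "length D = k" by (simp add: D_def)
  have Dnth: "D ! l = (w ! l, \<tau> l)" if "l < k" for l using that by (simp add: D_def)
  have fstD: "map fst D = w" by (rule nth_equalityI) (simp_all add: lenD Dnth k_def)
  have bp: "bdry (bpos s None) = tri_point 0 0" for s by (simp add: bdry_def)
  have bps: "bdry (bpos s (Some (e, x))) = edge_point e (if s then x else 1 - x)"
    if "0 < x" "x < 1" for s e x
    using bdry_edge[of x e] bdry_edge[of "1 - x" e] that by simp
  have vert0: "\<eta> t = glue (j, tri_point 0 0)" if "t = 0 \<or> t = 1" for t j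
  proof -
    have t: "0 \<le> t" "t \<le> 1" using that by auto
    obtain j' x y where p: "\<eta> t = gpt j' x y" "simplex2 x y" using topspace_SigmaE[OF top[OF t]] .
    have "\<eta> t \<in> Vertices" using vert[of t] that by auto
    then have "x \<in> \<int>" "y \<in> \<int>" using gpt_in_Vertices[OF p(2)] p(1) by auto
    then have "\<eta> t = gpt G1 0 0" using gpt_vertex[OF p(2)] p(1) by simp
    also have "\<dots> = gpt j 0 0" using gpt_vertex[of 0 0 j] by (simp add: simplex2_def)
    finally show ?thesis by (simp add: gpt_def)
  qed
  \<comment> \<open>The lift of the piece \<open>i\<close>; at the two ends it is fixed to be the vertex on the segments \<open>L\<^sub>1\<close>, \<open>L\<^sub>2\<close>.\<close>
  define \<gamma> where "\<gamma> i t = (if t = 0 \<or> t = 1 then tri_point 0 0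
      else SOME z. z \<in> triangle \<and> \<eta> t = glue (sheet_of i, z))" for i t
  have lift: "\<gamma> i t \<in> triangle \<and> \<eta> t = glue (sheet_of i, \<gamma> i t)"
    if i: "i \<le> k" and t: "T i \<le> t" "t \<le> T (Suc i)" for i t
  proof (cases "t = 0 \<or> t = 1")
    case True
    then have "\<gamma> i t = tri_point 0 0" by (simp add: \<gamma>_def)
    then show ?thesis using vert0[OF True, of "sheet_of i"] by (simp add: simplex2_def)
  next
    case False
    have "\<exists>z. z \<in> triangle \<and> \<eta> t = glue (sheet_of i, z)"
    proof (cases "t = T i \<or> t = T (Suc i)")
      case True
      have "\<exists>l. t = T (Suc l) \<and> l < k"
      proof (cases "t = T i")
        case True
        have "i \<noteq> 0"
        proof
          assume "i = 0"
          then show False using True T0 \<open>\<not> (t = 0 \<or> t = 1)\<close> by simp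
        qed
        then obtain l where "i = Suc l" by (cases i) auto
        then show ?thesis using True i by auto
      next
        case False
        then have "t = T (Suc i)" using \<open>t = T i \<or> t = T (Suc i)\<close> by simp
        moreover have "i \<noteq> k"
        proof
          assume "i = k"
          then show False using \<open>t = T (Suc i)\<close> T0 \<open>\<not> (t = 0 \<or> t = 1)\<close> by simp
        qed
        ultimately show ?thesis using i by auto
      qed
      then obtain l where l: "t = T (Suc l)" "l < k" by blast
      have "\<eta> t = glue (sheet_of i, edge_point (w ! l) (if even i then \<tau> l else 1 - \<tau> l))"
        using \<tau>(3,4)[OF l(2)] l(1) by (auto simp: sheet_of_def)
      moreover have "edge_point (w ! l) (if even i then \<tau> l else 1 - \<tau> l) \<in> triangle"
        using \<tau>(1,2)[OF l(2)] by (auto intro!: edge_point_triangle)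
      ultimately show ?thesis by blast
    next
      case False
      then have "\<eta> t \<in> Face (sheet_of i)" using face[OF i, of t] t by simp
      then show ?thesis unfolding Face_def using interior_subset[of triangle] by blast
    qed
    then have "(SOME z. z \<in> triangle \<and> \<eta> t = glue (sheet_of i, z)) \<in> triangle \<and>
        \<eta> t = glue (sheet_of i, SOME z. z \<in> triangle \<and> \<eta> t = glue (sheet_of i, z))" by (rule someI_ex)
    then show ?thesis using False by (simp add: \<gamma>_def)
  qed
  have nonv: "\<eta> t \<notin> Vertices" if "0 < t" "t < 1" for t using vert[of t] that by auto
  have lift_unique: "\<gamma> i t = z"
    if i: "i \<le> k" and t: "T i \<le> t" "t \<le> T (Suc i)" "0 < t" "t < 1" and z: "z \<in> triangle" "\<eta> t = glue (sheet_of i, z)"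
    for i t z
  proof (rule glue_inj_sheet[where j = "sheet_of i"])
    show "\<gamma> i t \<in> triangle" using lift[OF i t(1,2)] by blast
    show "z \<in> triangle" by (rule z(1))
    show "glue (sheet_of i, \<gamma> i t) = glue (sheet_of i, z)" using lift[OF i t(1,2)] z(2) by metis
    show "glue (sheet_of i, \<gamma> i t) \<notin> Vertices" using lift[OF i t(1,2)] nonv[OF t(3,4)] by metis
  qed
  have sub: "{T i..T (Suc i)} \<subseteq> {0..1}" if "i \<le> k" for i
    using Tr[of i] Tr[of "Suc i"] that by auto
  have gt: "continuous (at t within I) (torus_embed \<circ> \<eta>)" if "t \<in> I" "I \<subseteq> {0..1}" for t I
    using continuous_on_subset[OF g that(2)] that(1) unfolding continuous_on_eq_continuous_within by blast
  have gl: "torus_point (sheet_of i, \<gamma> i x) = (torus_embed \<circ> \<eta>) x" if "i \<le> k" "x \<in> {T i..T (Suc i)}" for i x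
  proof -
    have e: "\<eta> x = glue (sheet_of i, \<gamma> i x)" using lift[OF that(1)] that(2) by auto
    show ?thesis unfolding o_def arg_cong[OF e, of torus_embed] torus_embed_glue ..
  qed
  have inner: "continuous (at t within {T i..T (Suc i)}) (\<gamma> i)"
    if i: "i \<le> k" and t: "t \<in> {T i..T (Suc i)}" "0 < t" "t < 1" for i t
  proof (rule continuous_lift[where K = triangle and f = "\<lambda>z. torus_point (sheet_of i, z)" and g = "torus_embed \<circ> \<eta>"])
    show "\<gamma> i x \<in> triangle \<and> torus_point (sheet_of i, \<gamma> i x) = (torus_embed \<circ> \<eta>) x" if "x \<in> {T i..T (Suc i)}" for x
      using gl[OF i that] lift[OF i] that by auto
    fix z assume z: "z \<in> triangle" "torus_point (sheet_of i, z) = torus_point (sheet_of i, \<gamma> i t)"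
    have gam: "\<gamma> i t \<in> triangle" "\<eta> t = glue (sheet_of i, \<gamma> i t)" using lift[OF i] t(1) by auto
    have "lattice_eq (sheet_of i, \<gamma> i t) (sheet_of i, z)" using z(2) torus_point_eq_iff by metis
    then have "\<gamma> i t = z"
      by (rule lattice_eq_same_sheet[OF gam(1) z(1)])
        (use nonv[OF t(2,3)] gam glue_in_Vertices[OF gam(1), of "sheet_of i"] in simp)
    then show "z = \<gamma> i t" by simp
  qed (fact compact_triangle continuous_on_torus_point t(1) gt[OF t(1) sub[OF i]])+
  have outer: "continuous (at t within I) (\<gamma> i)"
    if i: "i \<le> k" and t: "t = 0 \<or> t = 1" "t \<in> I" and I: "I \<subseteq> {T i..T (Suc i)}"
      and seg: "\<And>x. x \<in> I \<Longrightarrow> x \<noteq> t \<Longrightarrow> 0 < x \<and> x < 1 \<and> \<eta> x \<in> Lseg (sheet_of i)" for i t I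
  proof (rule continuous_lift_vertex[where j = "sheet_of i" and g = "torus_embed \<circ> \<eta>"])
    show "t \<in> I" "\<gamma> i t = tri_point 0 0" using t by (auto simp: \<gamma>_def)
    show "continuous (at t within I) (torus_embed \<circ> \<eta>)" by (rule gt[OF t(2) order.trans[OF I sub[OF i]]])
    fix x assume x: "x \<in> I"
    have "\<exists>r. 0 \<le> r \<and> r \<le> 1 / 3 \<and> \<gamma> i x = tri_point r r"
    proof (cases "x = t")
      case True
      then show ?thesis using t by (intro exI[of _ 0]) (simp add: \<gamma>_def)
    next
      case False
      note s = seg[OF x False]
      obtain r where r: "0 < r" "r \<le> 1 / 3" "\<eta> x = gpt (sheet_of i) r r" using near[of x "sheet_of i"] s by blast
      have "\<gamma> i x = tri_point r r"
        by (rule lift_unique[OF i]) (use s r x I in \<open>auto simp: simplex2_def gpt_def\<close>)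
      then show ?thesis using r by (intro exI[of _ r]) simp
    qed
    moreover have "torus_point (sheet_of i, \<gamma> i x) = (torus_embed \<circ> \<eta>) x" by (rule gl[OF i]) (use x I in auto)
    ultimately show "(\<exists>r. 0 \<le> r \<and> r \<le> 1 / 3 \<and> \<gamma> i x = tri_point r r) \<and>
        torus_point (sheet_of i, \<gamma> i x) = (torus_embed \<circ> \<eta>) x" by blast
  qed
  have cl: "continuous (at t within {T i..T (Suc i)}) (\<gamma> i)" if i: "i \<le> k" and t: "t \<in> {T i..T (Suc i)}" for i t
  proof -
    consider "0 < t" "t < 1" | "t = 0" | "t = 1" using t sub[OF i] by fastforce
    then show ?thesis
    proof cases
      case 1
      then show ?thesis by (rule inner[OF i t])
    next
      case 2
      have i0: "i = 0" by (rule ccontr) (use Tmid(2)[of i] i t 2 in simp)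
      define \<delta> where "\<delta> = min \<epsilon> (T 1)"
      have d: "0 < \<delta>" "\<delta> \<le> \<epsilon>" "\<delta> \<le> T 1" "T 1 < 1" using \<epsilon> Tmid[of 1] k0 by (auto simp: \<delta>_def)
      have "continuous (at t within {0..\<delta>}) (\<gamma> i)"
      proof (rule outer[OF i])
        fix x assume "x \<in> {0..\<delta>}" "x \<noteq> t"
        then show "0 < x \<and> x < 1 \<and> \<eta> x \<in> Lseg (sheet_of i)" using 2 d i0 \<epsilon>(3) by (auto simp: sheet_of_def)
      qed (use 2 d i0 T0 in auto)
      moreover have "at t within {0..\<delta>} = at t within {T i..T (Suc i)}"
        by (rule at_within_nhd[where S = "{..<\<delta>}"]) (use 2 d i0 T0 in auto)
      ultimately show ?thesis by simp
    next
      case 3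
      have ik: "i = k" by (rule ccontr) (use Tmid(3)[of "Suc i"] i t 3 in simp)
      define \<delta> where "\<delta> = max (1 - \<epsilon>) (T k)"
      have d: "\<delta> < 1" "1 - \<epsilon> \<le> \<delta>" "T k \<le> \<delta>" "0 < \<delta>" using \<epsilon> Tmid[of k] k0 by (auto simp: \<delta>_def)
      have sk: "sheet_of i = G2" using odd ik by (simp add: sheet_of_def k_def)
      have "continuous (at t within {\<delta>..1}) (\<gamma> i)"
      proof (rule outer[OF i])
        fix x assume "x \<in> {\<delta>..1}" "x \<noteq> t"
        then show "0 < x \<and> x < 1 \<and> \<eta> x \<in> Lseg (sheet_of i)" using 3 d sk \<epsilon>(4) by auto
      qed (use 3 d ik T0 in auto)
      moreover have "at t within {\<delta>..1} = at t within {T i..T (Suc i)}"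
        by (rule at_within_nhd[where S = "{\<delta><..}"]) (use 3 d ik T0 in auto)
      ultimately show ?thesis by simp
    qed
  qed
  define arc where "arc i x = \<gamma> i (T i + x * (T (Suc i) - T i))" for i and x :: real
  have time: "T i \<le> T i + x * (T (Suc i) - T i) \<and> T i + x * (T (Suc i) - T i) \<le> T (Suc i)"
    if "i \<le> k" "0 \<le> x" "x \<le> 1" for i x
  proof -
    have "0 \<le> x * (T (Suc i) - T i)" "x * (T (Suc i) - T i) \<le> 1 * (T (Suc i) - T i)"
      using Tstep[OF that(1)] that by (auto intro: mult_right_mono)
    then show ?thesis by simp
  qed
  have path: "path (arc i)" if "i \<le> k" for i
  proof -
    have c: "continuous_on {T i..T (Suc i)} (\<gamma> i)"
      unfolding continuous_on_eq_continuous_within using cl[OF that] by auto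
    have l: "continuous_on {0..1} (\<lambda>x. T i + x * (T (Suc i) - T i))" by (intro continuous_intros)
    have "(\<lambda>x. T i + x * (T (Suc i) - T i)) ` {0..1} \<subseteq> {T i..T (Suc i)}" using time[OF that] by auto
    from continuous_on_compose2[OF c l this] show ?thesis unfolding path_def arc_def .
  qed
  have img: "path_image (arc i) \<subseteq> \<gamma> i ` {T i..T (Suc i)}" if "i \<le> k" for i
    using time[OF that] unfolding path_image_def arc_def by auto
  have ends: "\<gamma> i (T i') = bdry (arc_pos D i i')" if i: "i \<le> k" "i' = i \<or> i' = Suc i" for i i'
  proof (cases "i' = 0 \<or> i' = Suc k")
    case True
    then have "T i' = 0 \<or> T i' = 1" using T0 by auto
    moreover have "stops D ! i' = None" using True lenD stops_0 stops_last by metis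
    ultimately show ?thesis using bp[of "even i"] by (auto simp: \<gamma>_def arc_pos_def)
  next
    case False
    then obtain l where l: "i' = Suc l" "l < k" using i by (cases i') auto
    have "stops D ! i' = Some (w ! l, \<tau> l)" using l lenD Dnth by (simp add: stops_Suc)
    then have e: "bdry (arc_pos D i i') = edge_point (w ! l) (if even i then \<tau> l else 1 - \<tau> l)"
      unfolding arc_pos_def using bps[OF \<tau>(1,2)[OF l(2)]] by simp
    have "\<gamma> i (T i') = edge_point (w ! l) (if even i then \<tau> l else 1 - \<tau> l)"
    proof (rule lift_unique[OF i(1)])
      show "T i \<le> T i'" "T i' \<le> T (Suc i)" using i Tstep[OF i(1)] by auto
      show "0 < T i'" "T i' < 1" using Tmid[of i'] l by auto
      show "edge_point (w ! l) (if even i then \<tau> l else 1 - \<tau> l) \<in> triangle"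
        using \<tau>(1,2)[OF l(2)] by (auto intro!: edge_point_triangle)
      show "\<eta> (T i') = glue (sheet_of i, edge_point (w ! l) (if even i then \<tau> l else 1 - \<tau> l))"
        using \<tau>(3,4)[OF l(2)] l(1) by (auto simp: sheet_of_def)
    qed
    then show ?thesis using e by simp
  qed
  have disj: "path_image (arc i) \<inter> path_image (arc i') = {}"
    if i: "i \<le> k" "i' \<le> k" "i < i'" "even i = even i'" for i i'
  proof (rule ccontr)
    assume "path_image (arc i) \<inter> path_image (arc i') \<noteq> {}"
    then obtain z where "z \<in> \<gamma> i ` {T i..T (Suc i)}" "z \<in> \<gamma> i' ` {T i'..T (Suc i')}"
      using img[OF i(1)] img[OF i(2)] by blast
    then obtain t t' where t: "T i \<le> t" "t \<le> T (Suc i)" "T i' \<le> t'" "t' \<le> T (Suc i')" "\<gamma> i t = \<gamma> i' t'" by auto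
    have "sheet_of i = sheet_of i'" using i by (simp add: sheet_of_def)
    then have eq: "\<eta> t = \<eta> t'" using lift[OF i(1) t(1,2)] lift[OF i(2) t(3,4)] t(5) by simp
    have "Suc i < i'" using i by (metis Suc_lessI even_Suc)
    then have lt: "T (Suc i) < T i'" using Tless i by simp
    then have "t < t'" using t by simp
    have r: "0 \<le> t" "t' \<le> 1" using t Tr[of i] Tr[of "Suc i'"] i by auto
    show False
    proof (cases "t' = 1")
      case False
      then show False using inj[OF eq] r \<open>t < t'\<close> by auto
    next
      case True
      then have "\<eta> t \<in> Vertices" using eq vert[of t'] by simp
      then have "t = 0" using vert[of t] r \<open>t < t'\<close> by auto
      then have "i = 0" using Tmid(2)[of i] i t by (cases "i = 0") auto
      moreover have "i' = k" using Tmid(3)[of "Suc i'"] i t True by (cases "i' = k") auto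
      ultimately show False using i(4) odd by (simp add: k_def)
    qed
  qed
  have Drange: "\<forall>(e, x) \<in> set D. 0 < x \<and> x < 1" using \<tau> by (auto simp: D_def)
  have apr: "0 \<le> arc_pos D l i \<and> arc_pos D l i < 3" if ik: "i \<le> Suc k" for l i
  proof (cases "i = 0 \<or> i = Suc k")
    case True
    then show ?thesis using arc_pos_ends[of D l] lenD by auto
  next
    case False
    then obtain j where j: "i = Suc j" "j < k" using ik by (cases i) auto
    have "arc_pos D l i = bpos (even l) (Some (w ! j, \<tau> j))"
      using j lenD Dnth by (simp add: arc_pos_def stops_Suc)
    then show ?thesis using \<tau>(1,2)[OF j(2)] by (cases "w ! j") auto
  qed
  have nc: "non_interlaced (arc_pos D l l) (arc_pos D l (Suc l)) (arc_pos D l l') (arc_pos D l (Suc l'))"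
    if l: "l \<le> k" "l' \<le> k" "l \<noteq> l'" "even l = even l'" for l l'
  proof -
    have st: "pathstart (arc i) = bdry (arc_pos D i i)" "pathfinish (arc i) = bdry (arc_pos D i (Suc i))"
      if "i \<le> k" for i
      using ends[OF that] by (simp_all add: pathstart_def pathfinish_def arc_def)
    have tri: "path_image (arc i) \<subseteq> triangle" if "i \<le> k" for i
      using img[OF that] lift[OF that] by fastforce
    have par: "arc_pos D l' = arc_pos D l" using arc_pos_parity[of l' l D] l(4) by blast
    have dj: "path_image (arc l) \<inter> path_image (arc l') = {}"
      using disj[of l l'] disj[of l' l] l by (cases "l < l'") auto
    show ?thesis
    proof (rule disjoint_arcs_non_interlaced[of "arc l" _ _ "arc l'"])
      show "path (arc l)" "path (arc l')" using path l by auto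
      show "path_image (arc l) \<subseteq> triangle" "path_image (arc l') \<subseteq> triangle" using tri l by auto
      show "pathstart (arc l) = bdry (arc_pos D l l)" "pathfinish (arc l) = bdry (arc_pos D l (Suc l))"
        using st[OF l(1)] by auto
      show "pathstart (arc l') = bdry (arc_pos D l l')" "pathfinish (arc l') = bdry (arc_pos D l (Suc l'))"
        using st[OF l(2)] unfolding par by auto
    qed (use dj apr l in auto)
  qed
  have "distinct D"
    unfolding distinct_conv_nth
  proof (intro allI impI)
    fix i j assume ij: "i < length D" "j < length D" "i \<noteq> j"
    show "D ! i \<noteq> D ! j"
    proof
      assume "D ! i = D ! j"
      then have "w ! i = w ! j" "\<tau> i = \<tau> j" using ij lenD Dnth by auto
      then have "\<eta> (T (Suc i)) = \<eta> (T (Suc j))" using \<tau>(3)[of i] \<tau>(3)[of j] ij lenD by simp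
      then have "T (Suc i) = T (Suc j)"
        by (rule inj) (use Tmid[of "Suc i"] Tmid[of "Suc j"] ij lenD in auto)
      then show False using Tless[of "Suc i" "Suc j"] Tless[of "Suc j" "Suc i"] ij lenD
        by (cases "i < j") auto
    qed
  qed
  moreover have "odd (length D)" using odd by (simp add: lenD k_def)
  ultimately have "diagram D" unfolding diagram_def lenD using Drange nc by blast
  then show thesis using that fstD by blast
qed

section \<open>The torus as a quotient of the plane\<close>

text \<open>The image of a point of the plane: the unit square is divided into two triangles by its
  diagonal.\<close>

definition torus_class :: "real \<Rightarrow> real \<Rightarrow> (sheet \<times> complex) set" where
  "torus_class x y = (if frac x + frac y \<le> 1 then gpt G1 (frac x) (frac y) else gpt G2 (1 - frac x) (1 - frac y))"

lemma Ints_frac: "x - frac x \<in> \<int>" "x - (frac x - 1) \<in> \<int>" for x :: real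
proof -
  have "x - frac x = of_int \<lfloor>x\<rfloor>" "x - (frac x - 1) = of_int (\<lfloor>x\<rfloor> + 1)" by (simp_all add: frac_def)
  then show "x - frac x \<in> \<int>" "x - (frac x - 1) \<in> \<int>" by (simp_all only: Ints_of_int)
qed

lemma torus_class_rep:
  obtains j u v where "simplex2 u v" "torus_class x y = gpt j u v" "x - plane_sign j * u \<in> \<int>" "y - plane_sign j * v \<in> \<int>"
proof (cases "frac x + frac y \<le> 1")
  case True
  then show thesis using that[of "frac x" "frac y" G1] Ints_frac(1)
    by (simp add: torus_class_def simplex2_def)
next
  case False
  then show thesis using that[of "1 - frac x" "1 - frac y" G2] Ints_frac(2)
    by (simp add: torus_class_def simplex2_def frac_lt_1 less_imp_le)
qed

lemma torus_class_eqI: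
  assumes "simplex2 u v" "x - plane_sign j * u \<in> \<int>" "y - plane_sign j * v \<in> \<int>"
  shows "torus_class x y = gpt j u v"
proof -
  obtain j' u' v' where r: "simplex2 u' v'" "torus_class x y = gpt j' u' v'"
    "x - plane_sign j' * u' \<in> \<int>" "y - plane_sign j' * v' \<in> \<int>" by (rule torus_class_rep)
  have "lattice_eq (j', tri_point u' v') (j, tri_point u v)"
    using Ints_diff_trans[OF Ints_diff_sym[OF r(3)] assms(2)] Ints_diff_trans[OF Ints_diff_sym[OF r(4)] assms(3)]
    by (simp add: lattice_eq_def)
  then show ?thesis using gpt_eqI[OF r(1) assms(1)] r(2) by simp
qed

lemma torus_class_eq_iff: "torus_class x y = torus_class x' y' \<longleftrightarrow> x - x' \<in> \<int> \<and> y - y' \<in> \<int>"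
proof -
  obtain j u v where r: "simplex2 u v" "torus_class x y = gpt j u v"
    "x - plane_sign j * u \<in> \<int>" "y - plane_sign j * v \<in> \<int>" by (rule torus_class_rep)
  obtain j' u' v' where r': "simplex2 u' v'" "torus_class x' y' = gpt j' u' v'"
    "x' - plane_sign j' * u' \<in> \<int>" "y' - plane_sign j' * v' \<in> \<int>" by (rule torus_class_rep)
  have *: "p - p' \<in> \<int> \<longleftrightarrow> q - q' \<in> \<int>" if "p - q \<in> \<int>" "p' - q' \<in> \<int>" for p p' q q' :: real
  proof -
    have "(p - p') - (q - q') \<in> \<int>" using Ints_diff[OF that] by (simp add: algebra_simps)
    then show ?thesis by (rule Ints_diff_iff)
  qed
  have "torus_class x y = torus_class x' y' \<longleftrightarrow> lattice_eq (j, tri_point u v) (j', tri_point u' v')"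
    unfolding r(2) r'(2) by (rule gpt_eq_iff[OF r(1) r'(1)])
  also have "\<dots> \<longleftrightarrow> x - x' \<in> \<int> \<and> y - y' \<in> \<int>"
    unfolding lattice_eq_def using *[OF r(3) r'(3)] *[OF r(4) r'(4)] by simp
  finally show ?thesis .
qed

lemma torus_class_membership:
  shows "torus_class x y \<in> Edge I1 \<longleftrightarrow> y \<in> \<int>" "torus_class x y \<in> Edge I2 \<longleftrightarrow> x + y \<in> \<int>"
    "torus_class x y \<in> Edge I3 \<longleftrightarrow> x \<in> \<int>" "torus_class x y \<in> Vertices \<longleftrightarrow> x \<in> \<int> \<and> y \<in> \<int>"
    "torus_class x y \<in> Edges \<longleftrightarrow> x \<in> \<int> \<or> y \<in> \<int> \<or> x + y \<in> \<int>"
proof -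
  obtain j u v where r: "simplex2 u v" "torus_class x y = gpt j u v"
    "x - plane_sign j * u \<in> \<int>" "y - plane_sign j * v \<in> \<int>" by (rule torus_class_rep)
  have s: "plane_sign j * p \<in> \<int> \<longleftrightarrow> p \<in> \<int>" for p by (cases j) auto
  have xy: "x \<in> \<int> \<longleftrightarrow> u \<in> \<int>" "y \<in> \<int> \<longleftrightarrow> v \<in> \<int>" "x + y \<in> \<int> \<longleftrightarrow> u + v \<in> \<int>"
  proof -
    show "x \<in> \<int> \<longleftrightarrow> u \<in> \<int>" using Ints_diff_iff[OF r(3)] s[of u] by blast
    show "y \<in> \<int> \<longleftrightarrow> v \<in> \<int>" using Ints_diff_iff[OF r(4)] s[of v] by blast
    have "x + y - plane_sign j * (u + v) \<in> \<int>" using Ints_add[OF r(3,4)] by (simp add: algebra_simps)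
    then show "x + y \<in> \<int> \<longleftrightarrow> u + v \<in> \<int>" using Ints_diff_iff s[of "u + v"] by blast
  qed
  show "torus_class x y \<in> Edge I1 \<longleftrightarrow> y \<in> \<int>" "torus_class x y \<in> Edge I2 \<longleftrightarrow> x + y \<in> \<int>"
    "torus_class x y \<in> Edge I3 \<longleftrightarrow> x \<in> \<int>" "torus_class x y \<in> Vertices \<longleftrightarrow> x \<in> \<int> \<and> y \<in> \<int>"
    "torus_class x y \<in> Edges \<longleftrightarrow> x \<in> \<int> \<or> y \<in> \<int> \<or> x + y \<in> \<int>"
    unfolding r(2) gpt_in_Edge[OF r(1)] gpt_in_Vertices[OF r(1)] gpt_in_Edges[OF r(1)] xy by auto
qed

text \<open>The segment \<open>x + y = 1\<close> divides the unit square, so \<open>\<lfloor>x + y\<rfloor> - \<lfloor>x\<rfloor> - \<lfloor>y\<rfloor>\<close> tells the two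
  triangles apart.\<close>

lemma torus_class_Face:
  assumes "x \<notin> \<int>" "y \<notin> \<int>" "x + y \<notin> \<int>"
  shows "torus_class x y \<in> Face (if \<lfloor>x + y\<rfloor> = \<lfloor>x\<rfloor> + \<lfloor>y\<rfloor> then G1 else G2)"
proof -
  have f: "0 < frac x" "0 < frac y" "frac x < 1" "frac y < 1"
    using assms by (auto simp: frac_gt_0_iff frac_lt_1)
  have e: "x = of_int \<lfloor>x\<rfloor> + frac x" "y = of_int \<lfloor>y\<rfloor> + frac y" by (simp_all add: frac_def)
  have ne: "frac x + frac y \<noteq> 1"
  proof
    assume "frac x + frac y = 1"
    then have "x + y = of_int (\<lfloor>x\<rfloor> + \<lfloor>y\<rfloor> + 1)" using e by simp
    then show False using assms(3) Ints_of_int by metis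
  qed
  show ?thesis
  proof (cases "frac x + frac y < 1")
    case True
    then have "\<lfloor>x + y\<rfloor> = \<lfloor>x\<rfloor> + \<lfloor>y\<rfloor>" using e f by linarith
    then show ?thesis
      using True f gpt_in_Face[of "frac x" "frac y" G1 G1] by (simp add: torus_class_def simplex2_def)
  next
    case False
    then have "1 < frac x + frac y" using ne by simp
    then have "\<lfloor>x + y\<rfloor> = \<lfloor>x\<rfloor> + \<lfloor>y\<rfloor> + 1" using e f by linarith
    then show ?thesis
      using \<open>1 < frac x + frac y\<close> f gpt_in_Face[of "1 - frac x" "1 - frac y" G2 G2]
      by (simp add: torus_class_def simplex2_def)
  qed
qed

lemma continuous_glue: "continuous_map (top_of_set triangle) Sigma_top (\<lambda>z. glue (j, z))"
  unfolding continuous_map_def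
proof (intro conjI allI impI)
  show "(\<lambda>z. glue (j, z)) \<in> topspace (top_of_set triangle) \<rightarrow> topspace Sigma_top"
    using glue_in_topspace by auto
  fix U assume "openin Sigma_top U"
  then have "openin (sum_topology (\<lambda>_::sheet. top_of_set triangle) UNIV) {p \<in> UNIV \<times> triangle. glue p \<in> U}"
    unfolding Sigma_top_def openin_quotient_topology by simp
  then have "openin (top_of_set triangle) {z. (j, z) \<in> {p \<in> UNIV \<times> triangle. glue p \<in> U}}"
    unfolding openin_sum_topology by blast
  moreover have "{z. (j, z) \<in> {p \<in> UNIV \<times> triangle. glue p \<in> U}} = {z \<in> topspace (top_of_set triangle). glue (j, z) \<in> U}"
    by auto
  ultimately show "openin (top_of_set triangle) {z \<in> topspace (top_of_set triangle). glue (j, z) \<in> U}" by simp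
qed

definition tile_point :: "int \<times> int \<times> sheet \<Rightarrow> real \<times> real \<Rightarrow> real \<times> real" where
  "tile_point i p = (case i of (m, n, j) \<Rightarrow> (plane_sign j * (fst p - of_int m), plane_sign j * (snd p - of_int n)))"

text \<open>The plane is tiled by the translates of the two triangles; \<open>torus_class\<close> is continuous on each
  closed tile.\<close>

definition tile :: "int \<times> int \<times> sheet \<Rightarrow> (real \<times> real) set" where
  "tile i = {p. simplex2 (fst (tile_point i p)) (snd (tile_point i p))}"

lemma torus_class_tile:
  assumes "p \<in> tile i"
  shows "torus_class (fst p) (snd p) = gpt (snd (snd i)) (fst (tile_point i p)) (snd (tile_point i p))"
proof -
  obtain m n j where i: "i = (m, n, j)" by (cases i)
  show ?thesis using assms unfolding i tile_def tile_point_def by (intro torus_class_eqI) (cases j; auto)+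
qed

lemma continuous_torus_class: "continuous_map euclidean Sigma_top (\<lambda>p. torus_class (fst p) (snd p))"
proof (rule pasting_lemma_locally_finite[where I = UNIV and T = tile and
    f = "\<lambda>i p. gpt (snd (snd i)) (fst (tile_point i p)) (snd (tile_point i p))"])
  fix p :: "real \<times> real"
  let ?V = "{fst p - 1<..<fst p + 1} \<times> {snd p - 1<..<snd p + 1}"
  let ?B = "{\<lfloor>fst p\<rfloor> - 3..\<lfloor>fst p\<rfloor> + 3} \<times> {\<lfloor>snd p\<rfloor> - 3..\<lfloor>snd p\<rfloor> + 3} \<times> {G1, G2}"
  have "{i \<in> UNIV. tile i \<inter> ?V \<noteq> {}} \<subseteq> ?B"
  proof (rule subsetI)
    fix i assume i_in: "i \<in> {i \<in> UNIV. tile i \<inter> ?V \<noteq> {}}"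
    obtain m n j where i: "i = (m, n, j)" by (cases i)
    obtain q where q: "q \<in> tile i" "q \<in> ?V" using i_in by blast
    define u where "u = fst q"
    define v where "v = snd q"
    have s: "simplex2 (plane_sign j * (u - of_int m)) (plane_sign j * (v - of_int n))"
      using q(1) unfolding i u_def v_def by (simp add: tile_def tile_point_def)
    have uv: "u \<in> {fst p - 1<..<fst p + 1}" "v \<in> {snd p - 1<..<snd p + 1}"
      using q(2) unfolding u_def v_def by (simp_all add: mem_Times_iff)
    have b: "\<bar>u - of_int m\<bar> \<le> 1" "\<bar>v - of_int n\<bar> \<le> 1"
      using s by (cases j; auto simp: simplex2_def abs_if)+
    have "of_int m \<le> fst p + 2" "fst p - 2 \<le> of_int m" "of_int n \<le> snd p + 2" "snd p - 2 \<le> of_int n"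
      using b uv by (auto simp: abs_if split: if_splits)
    then have "m \<in> {\<lfloor>fst p\<rfloor> - 3..\<lfloor>fst p\<rfloor> + 3}" "n \<in> {\<lfloor>snd p\<rfloor> - 3..\<lfloor>snd p\<rfloor> + 3}"
      by (simp_all; linarith)+
    moreover have "j \<in> {G1, G2}" by (cases j) auto
    ultimately show "i \<in> ?B" unfolding i by simp
  qed
  then have "finite {i \<in> UNIV. tile i \<inter> ?V \<noteq> {}}" by (rule finite_subset) simp
  moreover have "openin euclidean ?V" by (simp add: open_Times)
  moreover have "p \<in> ?V" by (cases p) simp
  ultimately show "\<exists>V. openin euclidean V \<and> p \<in> V \<and> finite {i \<in> UNIV. tile i \<inter> V \<noteq> {}}" by blast
  show "\<exists>i. i \<in> UNIV \<and> p \<in> tile i \<and> torus_class (fst p) (snd p) =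
      gpt (snd (snd i)) (fst (tile_point i p)) (snd (tile_point i p))"
  proof -
    have "p \<in> tile (if frac (fst p) + frac (snd p) \<le> 1 then (\<lfloor>fst p\<rfloor>, \<lfloor>snd p\<rfloor>, G1)
        else (\<lfloor>fst p\<rfloor> + 1, \<lfloor>snd p\<rfloor> + 1, G2))"
      using frac_lt_1[of "fst p"] frac_lt_1[of "snd p"]
      by (auto simp: tile_def tile_point_def simplex2_def frac_def)
    then show ?thesis using torus_class_tile by blast
  qed
next
  fix i :: "int \<times> int \<times> sheet"
  have cont: "continuous_on S (\<lambda>p. fst (tile_point i p))" "continuous_on S (\<lambda>p. snd (tile_point i p))" for S
    unfolding tile_point_def case_prod_unfold fst_conv snd_conv by (intro continuous_intros)+
  have "closed (tile i)"
    unfolding tile_def simplex2_def by (intro closed_Collect_conj closed_Collect_le continuous_intros cont)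
  then show "closedin euclidean (tile i)" by simp
  have "continuous_on (tile i) (\<lambda>p. tri_point (fst (tile_point i p)) (snd (tile_point i p)))"
    unfolding tri_point_def by (intro continuous_intros cont)
  then have "continuous_map (top_of_set (tile i)) (top_of_set triangle)
      (\<lambda>p. tri_point (fst (tile_point i p)) (snd (tile_point i p)))"
    by (auto simp: continuous_map_in_subtopology tile_def)
  from continuous_map_compose[OF this continuous_glue[of "snd (snd i)"]]
  show "continuous_map (top_of_set (tile i)) Sigma_top
      (\<lambda>p. gpt (snd (snd i)) (fst (tile_point i p)) (snd (tile_point i p)))"
    by (simp add: o_def gpt_def)
next
  fix i i' :: "int \<times> int \<times> sheet" and p :: "real \<times> real"
  assume "p \<in> topspace euclidean \<inter> tile i \<inter> tile i'"
  then show "gpt (snd (snd i)) (fst (tile_point i p)) (snd (tile_point i p)) =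
      gpt (snd (snd i')) (fst (tile_point i' p)) (snd (tile_point i' p))"
    using torus_class_tile[of p i] torus_class_tile[of p i'] by simp
qed

section \<open>The closed line of coprime slope as an admissible curve\<close>

text \<open>Near its ends the line is replaced by the diagonal, that is by the segments \<open>L\<^sub>1\<close> and \<open>L\<^sub>2\<close>.
  It is back on its course at distance \<open>c = 1 / (a + b)\<close> from the ends of the parameter interval,
  where the first and the last crossing take place.\<close>

definition bump :: "real \<Rightarrow> real \<Rightarrow> real" where
  "bump c t = max 0 (min t (c - t))"

definition bend :: "real \<Rightarrow> real \<Rightarrow> real" where
  "bend c t = bump c t - bump c (1 - t)"

definition bent_line :: "real \<Rightarrow> real \<Rightarrow> real \<Rightarrow> real" where
  "bent_line c a t = a * t + (1 - a) * bend c t"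

lemma bend_facts:
  assumes "0 < c" "c \<le> 1 / 2"
  shows "s < t \<Longrightarrow> \<bar>bend c t - bend c s\<bar> \<le> t - s" "c \<le> t \<Longrightarrow> t \<le> 1 - c \<Longrightarrow> bend c t = 0"
    "0 \<le> t \<Longrightarrow> t \<le> c / 2 \<Longrightarrow> bend c t = t" "bend c (1 - t) = - bend c t" "\<bar>bend c t\<bar> \<le> c / 2"
proof -
  have half: "bump c u = 0" if "1 / 2 \<le> u" for u using that assms by (simp add: bump_def)
  have lip: "\<bar>bump c u - bump c v\<bar> \<le> \<bar>u - v\<bar>" for u v by (auto simp: bump_def max_def min_def)
  have lo: "\<bar>bend c u - bend c v\<bar> \<le> \<bar>u - v\<bar>" if "u \<le> 1 / 2" "v \<le> 1 / 2" for u v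
    using lip[of u v] half[of "1 - u"] half[of "1 - v"] that by (simp add: bend_def)
  have hi: "\<bar>bend c u - bend c v\<bar> \<le> \<bar>u - v\<bar>" if "1 / 2 \<le> u" "1 / 2 \<le> v" for u v
    using lip[of "1 - u" "1 - v"] half[of u] half[of v] that by (simp add: bend_def)
  show "s < t \<Longrightarrow> \<bar>bend c t - bend c s\<bar> \<le> t - s"
    using lo[of s t] hi[of s t] lo[of s "1/2"] hi[of "1/2" t] by (cases "t \<le> 1/2"; cases "1/2 \<le> s") auto
  show "c \<le> t \<Longrightarrow> t \<le> 1 - c \<Longrightarrow> bend c t = 0" by (auto simp: bend_def bump_def)
  show "0 \<le> t \<Longrightarrow> t \<le> c / 2 \<Longrightarrow> bend c t = t"
    using half[of "1 - t"] assms by (auto simp: bend_def bump_def)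
  show "bend c (1 - t) = - bend c t" by (simp add: bend_def)
  have b: "0 \<le> bump c u" "bump c u \<le> c / 2" for u using assms by (auto simp: bump_def max_def min_def)
  show "\<bar>bend c t\<bar> \<le> c / 2" using b[of t] b[of "1 - t"] by (auto simp: bend_def abs_if)
qed

lemma continuous_bent_line: "continuous_on S (bent_line c a)"
  unfolding bent_line_def bend_def bump_def by (intro continuous_intros)

lemma bent_line_mono:
  assumes c: "0 < c" "c \<le> 1 / 2" and a: "1 \<le> a" and st: "s < t"
  shows "bent_line c a s < bent_line c a t"
proof -
  have "(a - 1) * (bend c t - bend c s) \<le> (a - 1) * (t - s)"
    using bend_facts(1)[OF c st] a by (intro mult_left_mono) auto
  then show ?thesis using st by (simp add: bent_line_def algebra_simps)
qed

lemma floor_near_nonint: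
  fixes f :: "real \<Rightarrow> real"
  assumes "continuous (at t) f" "f t \<notin> \<int>"
  shows "eventually (\<lambda>s. \<lfloor>f s\<rfloor> = \<lfloor>f t\<rfloor> \<and> f s \<notin> \<int>) (nhds t)"
proof -
  have lt: "of_int \<lfloor>f t\<rfloor> < f t" "f t < of_int \<lfloor>f t\<rfloor> + 1"
    using assms(2) by (auto simp: le_less) (metis Ints_of_int of_int_floor_le le_less)
  have "eventually (\<lambda>s. f s \<in> {of_int \<lfloor>f t\<rfloor><..<of_int \<lfloor>f t\<rfloor> + 1}) (nhds t)"
    using assms(1) lt unfolding continuous_at tendsto_def eventually_nhds_conv_at
    by (metis greaterThanLessThan_iff open_greaterThanLessThan)
  then show ?thesis
  proof (rule eventually_mono)
    fix s assume s: "f s \<in> {of_int \<lfloor>f t\<rfloor><..<of_int \<lfloor>f t\<rfloor> + 1}"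
    then have "\<lfloor>f s\<rfloor> = \<lfloor>f t\<rfloor>" by (simp add: floor_eq_iff)
    moreover have "f s \<notin> \<int>"
    proof
      assume "f s \<in> \<int>"
      then obtain n :: int where "f s = n" by (auto elim: Ints_cases)
      then show False using s by auto
    qed
    ultimately show "\<lfloor>f s\<rfloor> = \<lfloor>f t\<rfloor> \<and> f s \<notin> \<int>" by simp
  qed
qed

text \<open>A continuous increasing function passes to the next integer part exactly where it takes an
  integer value.\<close>

lemma floor_near_int:
  fixes f :: "real \<Rightarrow> real"
  assumes "continuous (at t) f" "f t = of_int n" and mono: "\<And>u v. u < v \<Longrightarrow> f u < f v"
  shows "eventually (\<lambda>s. f s \<notin> \<int> \<or> s = t) (nhds t)"
    "eventually (\<lambda>s. \<lfloor>f s\<rfloor> = (if s < t then n - 1 else n)) (nhds t)"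
proof -
  have ev: "eventually (\<lambda>s. f s \<in> {of_int n - 1<..<of_int n + 1}) (nhds t)"
  proof -
    have "f t \<in> {of_int n - 1<..<of_int n + 1}" using assms(2) by simp
    then show ?thesis
      using assms(1) unfolding continuous_at tendsto_def eventually_nhds_conv_at
      by (metis open_greaterThanLessThan)
  qed
  show "eventually (\<lambda>s. f s \<notin> \<int> \<or> s = t) (nhds t)"
    using ev
  proof (rule eventually_mono)
    fix s assume s: "f s \<in> {of_int n - 1<..<of_int n + 1}"
    show "f s \<notin> \<int> \<or> s = t"
    proof (rule ccontr)
      assume "\<not> (f s \<notin> \<int> \<or> s = t)"
      then obtain k :: int where k: "f s = k" "s \<noteq> t" by (auto elim: Ints_cases)
      then have "k = n" using s by simp
      then show False using k assms(2) mono[of s t] mono[of t s] by (cases "s < t") auto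
    qed
  qed
  show "eventually (\<lambda>s. \<lfloor>f s\<rfloor> = (if s < t then n - 1 else n)) (nhds t)"
    using ev
  proof (rule eventually_mono)
    fix s assume s: "f s \<in> {of_int n - 1<..<of_int n + 1}"
    consider "s < t" | "s = t" | "t < s" by linarith
    then show "\<lfloor>f s\<rfloor> = (if s < t then n - 1 else n)"
    proof cases
      case 1
      then show ?thesis using s assms(2) mono[of s t] by (simp add: floor_eq_iff)
    next
      case 2
      then show ?thesis using assms(2) by simp
    next
      case 3
      then show ?thesis using s assms(2) mono[of t s] by (simp add: floor_eq_iff)
    qed
  qed
qed

lemma finite_crossing_times:
  assumes "0 < a" "0 < b"
  shows "finite (crossing_times (int a, int b))"
proof -
  have "finite {t \<in> {0<..<1::real}. t * real n \<in> \<int>}" if "0 < n" for n :: nat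
  proof -
    have "{t \<in> {0<..<1::real}. t * real n \<in> \<int>} \<subseteq> (\<lambda>k. of_int k / real n) ` {0..int n}"
    proof
      fix t :: real assume "t \<in> {t \<in> {0<..<1::real}. t * real n \<in> \<int>}"
      then obtain k :: int where k: "t * real n = k" "0 < t" "t < 1" by (auto elim: Ints_cases)
      have "0 < real_of_int k" "real_of_int k < real n"
        unfolding k(1)[symmetric] using k(2,3) that by simp_all
      then have "k \<in> {0..int n}" by simp
      moreover have "t = of_int k / real n" using k that by (simp add: field_simps)
      ultimately show "t \<in> (\<lambda>k. of_int k / real n) ` {0..int n}" by blast
    qed
    then show ?thesis by (rule finite_subset) simp
  qed
  from this[of a] this[of b] this[of "a + b"]
  have "finite ({t \<in> {0<..<1::real}. t * real a \<in> \<int>} \<union> {t \<in> {0<..<1}. t * real b \<in> \<int>} \<union> {t \<in> {0<..<1}. t * real (a + b) \<in> \<int>})"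
    using assms by simp
  then show ?thesis by (rule finite_subset[rotated]) (auto simp: crossing_times_def algebra_simps)
qed

text \<open>The open segment to a coprime pair contains no lattice point.\<close>

lemma coprime_times_Ints:
  assumes cop: "coprime a b" and ab: "0 < a" "0 < b" and t: "0 < t" "t < 1" "t * real a \<in> \<int>"
  shows "t * real b \<notin> \<int>"
proof
  assume "t * real b \<in> \<int>"
  then obtain i j :: int where ij: "t * real a = i" "t * real b = j" using t(3) by (auto elim!: Ints_cases)
  have "real_of_int i * real b = real_of_int j * real a" using ij by (metis mult.assoc mult.commute)
  then have "i * int b = j * int a" by (metis of_int_eq_iff of_int_mult of_int_of_nat_eq)
  then have "int a dvd i * int b" by simp
  then have "int a dvd i" using cop coprime_dvd_mult_left_iff[of "int a" "int b" i] by simp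
  moreover have "0 < i" "i < int a"
  proof -
    have "0 < t * real a" "t * real a < real a" using t ab by simp_all
    then show "0 < i" "i < int a" using ij by simp_all
  qed
  ultimately show False using zdvd_not_zless by blast
qed

text \<open>The bending changes \<open>b X - a Y\<close> by less than \<open>1 / 2\<close>. So if two points of the curve agree
  modulo the lattice, this linear form agrees on them, their difference is a multiple of \<open>(a, b)\<close>,
  and they can only be the two ends. Transversality holds because exactly one of \<open>X\<close>, \<open>Y\<close>, \<open>X + Y\<close>
  is an integer at a crossing, and all three increase.\<close>

theorem line_admissible_curve:
  assumes ab: "0 < a" "0 < b" and cop: "coprime a b"
  obtains \<eta> where "admissible \<eta>" "non_self_crossing \<eta>" "curve_word \<eta> (s_word (int a, int b))"
proof -
  define N where "N = real (a + b)"
  define c where "c = 1 / N"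
  have N2: "2 \<le> N" using ab by (simp add: N_def)
  have c: "0 < c" "c \<le> 1 / 2" "N * c = 1" using N2 by (auto simp: c_def field_simps)
  define X where "X = bent_line c (real a)"
  define Y where "Y = bent_line c (real b)"
  define \<eta> where "\<eta> t = torus_class (X t) (Y t)" for t
  have ra: "1 \<le> real a" "1 \<le> real b" using ab by simp_all
  have Xm: "X s < X t" and Ym: "Y s < Y t" if "s < t" for s t
    using bent_line_mono[OF c(1,2) _ that] ra unfolding X_def Y_def by auto
  have contX: "continuous (at t) X" and contY: "continuous (at t) Y" for t
    using continuous_bent_line[of UNIV] unfolding X_def Y_def by (simp_all add: continuous_on_eq_continuous_at)
  have start: "X t = t" "Y t = t" if "0 \<le> t" "t \<le> c / 2" for t
    using bend_facts(3)[OF c(1,2) that] by (simp_all add: X_def Y_def bent_line_def algebra_simps)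
  have mid: "X t = t * real a" "Y t = t * real b" if "c \<le> t" "t \<le> 1 - c" for t
    using bend_facts(2)[OF c(1,2) that] by (simp_all add: X_def Y_def bent_line_def)
  have sym: "X (1 - t) = real a - X t" "Y (1 - t) = real b - Y t" for t
    using bend_facts(4)[OF c(1,2), of t] by (simp_all add: X_def Y_def bent_line_def algebra_simps)
  have X01: "X 0 = 0" "Y 0 = 0" "X 1 = real a" "Y 1 = real b"
    using start[of 0] sym[of 0] c by simp_all
  have cN: "c * real a + c * real b = 1" using c(3) by (simp add: N_def algebra_simps)
  have small: "X t \<notin> \<int>" "Y t \<notin> \<int>" "X t + Y t \<notin> \<int>" "t * real a \<notin> \<int>" "t * real b \<notin> \<int>"
    "t * real a + t * real b \<notin> \<int>" if t: "0 < t" "t < c" for t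
  proof -
    have "0 < X t" "0 < Y t" using Xm[OF t(1)] Ym[OF t(1)] X01 by auto
    moreover have "X t < c * real a" "Y t < c * real b" using Xm[OF t(2)] Ym[OF t(2)] mid[of c] c by auto
    moreover have "0 < t * real a" "0 < t * real b" "t * real a < c * real a" "t * real b < c * real b"
      using t ab by simp_all
    moreover have "0 < c * real a" "0 < c * real b" using c ab by simp_all
    moreover have ni: "x \<notin> \<int>" if "0 < x" "x < 1" for x :: real using that by (auto elim!: Ints_cases)
    ultimately show "X t \<notin> \<int>" "Y t \<notin> \<int>" "X t + Y t \<notin> \<int>" "t * real a \<notin> \<int>" "t * real b \<notin> \<int>"
      "t * real a + t * real b \<notin> \<int>"
      using cN by (intro ni; linarith)+
  qed
  have Iflip: "real n - x \<in> \<int> \<longleftrightarrow> x \<in> \<int>" for n :: nat and x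
    using Ints_diff[of "real n" "real n - x"] Ints_diff[of "real n" x] by auto
  have Iff: "X t \<in> \<int> \<longleftrightarrow> t * real a \<in> \<int>" "Y t \<in> \<int> \<longleftrightarrow> t * real b \<in> \<int>"
    "X t + Y t \<in> \<int> \<longleftrightarrow> t * real a + t * real b \<in> \<int>" if t: "0 < t" "t < 1" for t
  proof -
    consider "t < c" | "c \<le> t" "t \<le> 1 - c" | "1 - c < t" by linarith
    then have "(X t \<in> \<int> \<longleftrightarrow> t * real a \<in> \<int>) \<and> (Y t \<in> \<int> \<longleftrightarrow> t * real b \<in> \<int>) \<and>
      (X t + Y t \<in> \<int> \<longleftrightarrow> t * real a + t * real b \<in> \<int>)"
    proof cases
      case 1
      then show ?thesis using small t by blast
    next
      case 2
      then show ?thesis using mid by simp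
    next
      case 3
      define s where "s = 1 - t"
      have s: "0 < s" "s < c" "t = 1 - s" using 3 t by (auto simp: s_def)
      have "X t = real a - X s" "Y t = real b - Y s" using sym s by auto
      moreover have "t * real a = real a - s * real a" "t * real b = real b - s * real b"
        by (simp_all add: s(3) left_diff_distrib)
      moreover have "X t + Y t = real (a + b) - (X s + Y s)" using calculation by simp
      moreover have "t * real a + t * real b = real (a + b) - (s * real a + s * real b)" using calculation by simp
      ultimately show ?thesis using small[OF s(1,2)] by (simp only: Iflip)
    qed
    then show "X t \<in> \<int> \<longleftrightarrow> t * real a \<in> \<int>" "Y t \<in> \<int> \<longleftrightarrow> t * real b \<in> \<int>"
      "X t + Y t \<in> \<int> \<longleftrightarrow> t * real a + t * real b \<in> \<int>" by blast+
  qed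
  have noV: "\<not> (X t \<in> \<int> \<and> Y t \<in> \<int>)" if t: "0 < t" "t < 1" for t
    using coprime_times_Ints[OF cop ab t] Iff[OF t] by blast
  have cont: "continuous_map (top_of_set {0..1}) Sigma_top \<eta>"
  proof -
    have "continuous_map (top_of_set {0..1}) euclidean (\<lambda>t. (X t, Y t))"
      unfolding X_def Y_def by (simp add: continuous_on_Pair continuous_bent_line)
    from continuous_map_compose[OF this continuous_torus_class] show ?thesis
      by (simp add: o_def \<eta>_def[abs_def])
  qed
  have vert: "\<eta> t \<in> Vertices \<longleftrightarrow> t \<in> {0, 1}" if "t \<in> {0..1}" for t
  proof -
    have "t = 0 \<or> t = 1 \<or> 0 < t \<and> t < 1" using that by auto
    then show ?thesis unfolding \<eta>_def torus_class_membership using noV[of t] X01 by auto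
  qed
  have segs: "\<eta> ` {0..c / 2} \<subseteq> Lseg G1" "\<eta> ` {1 - c / 2..1} \<subseteq> Lseg G2"
  proof -
    have s: "simplex2 t t" "t \<le> 1 / 3" if "0 \<le> t" "t \<le> c / 2" for t using that c by (auto simp: simplex2_def)
    have "\<eta> t \<in> Lseg G1" if t: "0 \<le> t" "t \<le> c / 2" for t
    proof -
      have "\<eta> t = gpt G1 t t" unfolding \<eta>_def start[OF t] by (rule torus_class_eqI) (use s[OF t] in auto)
      then show ?thesis unfolding Lseg_points using s[OF t] t by blast
    qed
    then show "\<eta> ` {0..c / 2} \<subseteq> Lseg G1" by auto
    have "\<eta> (1 - t) \<in> Lseg G2" if t: "0 \<le> t" "t \<le> c / 2" for t
    proof -
      have "\<eta> (1 - t) = gpt G2 t t" unfolding \<eta>_def sym start[OF t] by (rule torus_class_eqI) (use s[OF t] in auto)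
      then show ?thesis unfolding Lseg_points using s[OF t] t by blast
    qed
    from this[of "1 - t" for t] show "\<eta> ` {1 - c / 2..1} \<subseteq> Lseg G2" by auto
  qed
  have trans: "transversal_at \<eta> t" if t: "t \<in> {0..1}" and e: "\<eta> t \<in> Edges - Vertices" for t
  proof -
    have t01: "0 < t" "t < 1" using t vert[OF t] e by auto
    define Z where "Z s = X s + Y s" for s
    have Zm: "Z s < Z u" if "s < u" for s u using Xm[OF that] Ym[OF that] by (simp add: Z_def)
    have contZ: "continuous (at s) Z" for s unfolding Z_def by (intro continuous_intros contX contY)
    have int: "X t \<in> \<int> \<or> Y t \<in> \<int> \<or> Z t \<in> \<int>"
      using DiffD1[OF e] unfolding \<eta>_def torus_class_membership Z_def by auto
    have two: "X t \<in> \<int> \<Longrightarrow> Y t \<notin> \<int>" "X t \<in> \<int> \<Longrightarrow> Z t \<notin> \<int>" "Y t \<in> \<int> \<Longrightarrow> Z t \<notin> \<int>"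
      using noV[OF t01] Ints_diff[of "Z t" "X t"] Ints_diff[of "Z t" "Y t"] by (auto simp: Z_def)
    \<comment> \<open>By \<open>torus_class_Face\<close> this is \<open>0\<close> in the first triangle and \<open>1\<close> in the second one.\<close>
    define d where "d s = \<lfloor>Z s\<rfloor> - \<lfloor>X s\<rfloor> - \<lfloor>Y s\<rfloor>" for s
    have d01: "d s = 0 \<or> d s = 1" for s unfolding d_def Z_def by linarith
    obtain p q :: int where pq: "p \<noteq> q"
      and ev: "eventually (\<lambda>s. s \<noteq> t \<longrightarrow> X s \<notin> \<int> \<and> Y s \<notin> \<int> \<and> Z s \<notin> \<int> \<and> d s = (if s < t then p else q)) (nhds t)"
    proof -
      have Iev: "eventually (\<lambda>s. s \<noteq> t \<longrightarrow> f s \<notin> \<int> \<and> \<lfloor>f s\<rfloor> = (if s < t then \<lfloor>f t\<rfloor> - 1 else \<lfloor>f t\<rfloor>)) (nhds t)"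
        if "f t \<in> \<int>" "continuous (at t) f" "\<And>u v. u < v \<Longrightarrow> f u < f v" for f :: "real \<Rightarrow> real"
      proof -
        have "f t = of_int \<lfloor>f t\<rfloor>" using that(1) by (auto elim: Ints_cases)
        from floor_near_int[OF that(2) this that(3)] show ?thesis
          by (rule eventually_elim2) auto
      qed
      have Nev: "eventually (\<lambda>s. s \<noteq> t \<longrightarrow> f s \<notin> \<int> \<and> \<lfloor>f s\<rfloor> = \<lfloor>f t\<rfloor>) (nhds t)"
        if "f t \<notin> \<int>" "continuous (at t) f" for f :: "real \<Rightarrow> real"
        using floor_near_nonint[OF that(2,1)] by (rule eventually_mono) auto
      consider (x) "X t \<in> \<int>" "Y t \<notin> \<int>" "Z t \<notin> \<int>" | (y) "X t \<notin> \<int>" "Y t \<in> \<int>" "Z t \<notin> \<int>"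
        | (z) "X t \<notin> \<int>" "Y t \<notin> \<int>" "Z t \<in> \<int>" using int two by blast
      then show thesis
      proof cases
        case x
        show thesis
          by (rule that[of "d t + 1" "d t"], simp, rule eventually_elim2[OF Iev[OF x(1) contX Xm]
              eventually_conj[OF Nev[OF x(2) contY] Nev[OF x(3) contZ]]]) (auto simp: d_def)
      next
        case y
        show thesis
          by (rule that[of "d t + 1" "d t"], simp, rule eventually_elim2[OF Iev[OF y(2) contY Ym]
              eventually_conj[OF Nev[OF y(1) contX] Nev[OF y(3) contZ]]]) (auto simp: d_def)
      next
        case z
        show thesis
          by (rule that[of "d t - 1" "d t"], simp, rule eventually_elim2[OF Iev[OF z(3) contZ Zm]
              eventually_conj[OF Nev[OF z(1) contX] Nev[OF z(2) contY]]]) (auto simp: d_def)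
      qed
    qed
    then obtain \<delta> where \<delta>: "0 < \<delta>" "\<And>s. dist s t < \<delta> \<Longrightarrow> s \<noteq> t \<Longrightarrow>
        X s \<notin> \<int> \<and> Y s \<notin> \<int> \<and> Z s \<notin> \<int> \<and> d s = (if s < t then p else q)"
      unfolding eventually_nhds_metric by blast
    define \<epsilon> where "\<epsilon> = min (\<delta> / 2) (min t (1 - t))"
    have \<epsilon>: "0 < \<epsilon>" "\<epsilon> < \<delta>" "\<epsilon> \<le> t" "\<epsilon> \<le> 1 - t" using \<delta>(1) t01 by (auto simp: \<epsilon>_def min_def)
    define F where "F r = (if r = 0 then G1 else G2)" for r :: int
    have face: "\<eta> s \<in> Face (F (if s < t then p else q))" if s: "t - \<epsilon> \<le> s" "s \<le> t + \<epsilon>" "s \<noteq> t" for s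
    proof -
      have "dist s t < \<delta>" using s \<epsilon> by (auto simp: dist_real_def abs_if)
      note k = \<delta>(2)[OF this s(3)]
      have "\<eta> s \<in> Face (if \<lfloor>Z s\<rfloor> = \<lfloor>X s\<rfloor> + \<lfloor>Y s\<rfloor> then G1 else G2)"
        unfolding \<eta>_def Z_def by (rule torus_class_Face) (use k in \<open>auto simp: Z_def\<close>)
      moreover have "(\<lfloor>Z s\<rfloor> = \<lfloor>X s\<rfloor> + \<lfloor>Y s\<rfloor>) = (d s = 0)" by (auto simp: d_def)
      ultimately show ?thesis using k unfolding F_def by simp
    qed
    have pq01: "p \<in> {0, 1}" "q \<in> {0, 1}"
    proof -
      have "dist (t - \<epsilon>) t < \<delta>" "dist (t + \<epsilon>) t < \<delta>" using \<epsilon> by (auto simp: dist_real_def)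
      from \<delta>(2)[OF this(1)] \<delta>(2)[OF this(2)] have "d (t - \<epsilon>) = p" "d (t + \<epsilon>) = q" using \<epsilon> by auto
      then show "p \<in> {0, 1}" "q \<in> {0, 1}" using d01[of "t - \<epsilon>"] d01[of "t + \<epsilon>"] by auto
    qed
    have "F p \<noteq> F q" using pq pq01 by (auto simp: F_def)
    moreover have "\<eta> ` {t - \<epsilon>..<t} \<subseteq> Face (F p)" using face \<epsilon> by force
    moreover have "\<eta> ` {t<..t + \<epsilon>} \<subseteq> Face (F q)"
    proof
      fix x assume "x \<in> \<eta> ` {t<..t + \<epsilon>}"
      then obtain s where s: "x = \<eta> s" "t < s" "s \<le> t + \<epsilon>" by auto
      then show "x \<in> Face (F q)" using face[of s] \<epsilon> by simp
    qed
    moreover have "{t - \<epsilon>..t + \<epsilon>} \<subseteq> {0..1}" using \<epsilon> by auto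
    ultimately show ?thesis unfolding transversal_at_def using \<epsilon>(1) by blast
  qed
  have adm: "admissible \<eta>"
    unfolding admissible_def
  proof (intro conjI)
    show "\<exists>\<epsilon>>0. \<epsilon> \<le> 1 \<and> \<eta> ` {0..\<epsilon>} \<subseteq> Lseg G1 \<and> \<eta> ` {1 - \<epsilon>..1} \<subseteq> Lseg G2"
      using segs c by (intro exI[of _ "c / 2"]) auto
  qed (use cont vert trans in auto)
  have simple: "non_self_crossing \<eta>"
    unfolding non_self_crossing_def
  proof (rule linorder_inj_onI')
    fix s t :: real assume st: "s \<in> {0..<1}" "t \<in> {0..<1}" "s < t"
    show "\<eta> s \<noteq> \<eta> t"
    proof
      assume "\<eta> s = \<eta> t"
      then have "X t - X s \<in> \<int>" "Y t - Y s \<in> \<int>"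
        unfolding \<eta>_def torus_class_eq_iff using Ints_diff_sym by blast+
      then obtain i j :: int where ij: "X t - X s = i" "Y t - Y s = j" by (auto elim!: Ints_cases)
      \<comment> \<open>It vanishes on the straight line.\<close>
      define F where "F u = real b * X u - real a * Y u" for u
      have F: "F u = (real b - real a) * bend c u" for u
        by (simp add: F_def X_def Y_def bent_line_def algebra_simps)
      have Fb: "\<bar>F u\<bar> < 1 / 2" for u
      proof -
        have "\<bar>F u\<bar> = \<bar>real b - real a\<bar> * \<bar>bend c u\<bar>" by (simp add: F abs_mult)
        also have "\<dots> \<le> \<bar>real b - real a\<bar> * (c / 2)" by (intro mult_left_mono bend_facts(5)[OF c(1,2)]) simp
        also have "\<dots> < N * (c / 2)"
          using c ab by (intro mult_strict_right_mono) (auto simp: N_def)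
        finally show ?thesis using c(3) by simp
      qed
      have "F t - F s = real_of_int (int b * i - int a * j)"
        by (simp add: F_def algebra_simps flip: ij)
      moreover have "\<bar>F t - F s\<bar> < 1" using Fb[of t] Fb[of s] by linarith
      ultimately have "int b * i - int a * j = 0" by linarith
      then have eq: "int b * i = int a * j" by simp
      then have "int a dvd int b * i" by simp
      then have "int a dvd i" using cop coprime_dvd_mult_right_iff[of "int a" "int b" i] by simp
      from this obtain l where l: "i = int a * l" by (elim dvdE)
      then have j: "j = int b * l" using eq ab by simp
      have pos: "0 < i" using Xm[OF st(3)] ij by linarith
      have "X t - X s < real a"
      proof -
        have "X t < X 1" "X 0 \<le> X s" using Xm[of t 1] Xm[of 0 s] st by (auto simp: le_less)
        then show ?thesis using X01 by simp
      qed
      then have "i < int a" using ij by simp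
      then show False using pos zdvd_imp_le[OF \<open>int a dvd i\<close> pos] by simp
    qed
  qed
  have word: "curve_word \<eta> (s_word (int a, int b))"
    unfolding curve_word_def
  proof (intro exI conjI)
    let ?C = "crossing_times (int a, int b)"
    have fin: "finite ?C" by (rule finite_crossing_times[OF ab])
    show "sorted_wrt (<) (sorted_list_of_set ?C)" by simp
    have "?C = {x \<in> {0<..<1}. \<eta> x \<in> Edges}"
      unfolding crossing_times_def \<eta>_def torus_class_membership using Iff by auto
    then show "set (sorted_list_of_set ?C) = {x \<in> {0<..<1}. \<eta> x \<in> Edges}" using fin by simp
    have "\<eta> t \<in> Edge (crossing_label (int a, int b) t)" if "t \<in> ?C" for t
    proof -
      have "0 < t" "t < 1" "t * real a \<in> \<int> \<or> t * real b \<in> \<int> \<or> t * real a + t * real b \<in> \<int>"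
        using that by (auto simp: crossing_times_def)
      then show ?thesis
        using Iff[of t] unfolding crossing_label_def \<eta>_def by (auto simp: torus_class_membership)
    qed
    then show "list_all2 (\<lambda>t i. \<eta> t \<in> Edge i) (sorted_list_of_set ?C) (s_word (int a, int b))"
      unfolding s_word_def list_all2_conv_all_nth using fin
      by (auto simp: set_conv_nth[of "sorted_list_of_set ?C", symmetric] intro!: bspec[of _ "_ ! _"]) (metis fin nth_mem set_sorted_list_of_set length_sorted_list_of_set)
  qed
  show thesis using that adm simple word by blast
qed

section \<open>The word of a line\<close>

lemma cut_letter_succ:
  assumes ab: "0 < a" "0 < b" and cop: "coprime a b" and j: "1 \<le> j" "j < a + b - 1"
    and l: "cut_letter a b j = I3"
  defines "q \<equiv> Suc j * a div (a + b)"
  shows "real j / real (a + b) < real q / real a" "real q / real a < real (Suc j) / real (a + b)" "0 < q" "q < a"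
proof -
  define N where "N = a + b"
  have cN: "coprime N a" using cop coprime_add_self[of a b] unfolding N_def by (simp add: coprime_commute)
  have "q \<noteq> j * a div N" using l unfolding cut_letter_def q_def N_def by (auto split: if_splits)
  moreover have "j * a div N \<le> q" unfolding q_def N_def by (intro div_le_mono) simp
  ultimately have "j * a div N < q" by simp
  then have lt: "j * a < q * N" using ab unfolding N_def by (simp add: div_less_iff_less_mult)
  have le: "q * N \<le> Suc j * a" unfolding q_def N_def by (rule div_times_less_eq_dividend)
  have "q * N \<noteq> Suc j * a"
  proof
    assume "q * N = Suc j * a"
    then have "N dvd Suc j * a" by (metis dvd_triv_right)
    then have "N dvd Suc j" using cN coprime_dvd_mult_left_iff by blast
    then show False using j dvd_imp_le[of N "Suc j"] unfolding N_def by auto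
  qed
  then have lt2: "q * N < Suc j * a" using le by simp
  have N0: "0 < N" using ab by (simp add: N_def)
  have r: "real j * real a < real q * real N" "real q * real N < real (Suc j) * real a"
    using lt lt2 by (metis of_nat_less_iff of_nat_mult)+
  show "real j / real (a + b) < real q / real a" "real q / real a < real (Suc j) / real (a + b)"
    using r ab N0 unfolding N_def[symmetric] by (simp_all add: field_simps)
  show "0 < q" using lt by (cases q) auto
  have "Suc j * a < N * a" using j ab unfolding N_def by (intro mult_strict_right_mono) auto
  from less_trans[OF lt2 this] have "q * N < a * N" by (simp only: mult.commute)
  then show "q < a" using mult_less_cancel2 by blast
qed

lemma crossing_between:
  assumes ab: "0 < a" "0 < b" and cop: "coprime a b" and t: "0 < t" "t < 1" "t * real a \<in> \<int>"
  obtains j where "1 \<le> j" "j < a + b - 1" "cut_letter a b j = I3" "t = real (Suc j * a div (a + b)) / real a"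
proof -
  define N where "N = a + b"
  have N0: "0 < N" using ab by (simp add: N_def)
  obtain k :: int where k: "t * real a = k" using t(3) by (auto elim: Ints_cases)
  have kr: "0 < real_of_int k" "real_of_int k < real a" unfolding k[symmetric] using t ab by simp_all
  define q where "q = nat k"
  have q: "t * real a = real q" "0 < q" "q < a" using kr k by (simp_all add: q_def)
  define j where "j = q * N div a"
  have nd: "\<not> a dvd q * N"
  proof
    assume "a dvd q * N"
    moreover have "coprime a N" using cop coprime_add_self[of a b] by (simp add: N_def)
    ultimately have "a dvd q" using coprime_dvd_mult_left_iff by blast
    then show False using q dvd_imp_le[of a q] by simp
  qed
  have "j * a \<le> q * N" unfolding j_def by (rule div_times_less_eq_dividend)
  moreover have "j * a \<noteq> q * N" using nd by (metis dvd_triv_right)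
  ultimately have lt: "j * a < q * N" by simp
  have lt2: "q * N < Suc j * a" unfolding j_def using dividend_less_div_times[of a "q * N"] ab by simp
  have j1: "1 \<le> j"
  proof -
    have "1 * a \<le> q * N" using q by (intro mult_le_mono) (auto simp: N_def)
    then show ?thesis unfolding j_def using ab div_le_mono[of "1 * a" "q * N" a] by simp
  qed
  have jN: "j < N - 1"
  proof -
    have "q * N \<le> (a - 1) * N" using q by (intro mult_le_mono1) simp
    also have "\<dots> = a * N - N" by (simp add: diff_mult_distrib)
    also have "\<dots> < a * N - a" using ab by (intro diff_less_mono2) (auto simp: N_def)
    also have "\<dots> = (N - 1) * a" by (simp only: diff_mult_distrib mult_1 mult.commute[of a N])
    finally have "q * N < (N - 1) * a" .
    from less_trans[OF lt this] show ?thesis using mult_less_cancel2 by blast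
  qed
  have d1: "j * a div N < q" using lt N0 by (simp add: div_less_iff_less_mult)
  have d2: "q \<le> Suc j * a div N" using lt2 N0 by (simp add: less_eq_div_iff_mult_less_eq)
  have "Suc j * a div N \<le> j * a div N + 1" unfolding N_def using div_Suc_cases[OF ab(2), of j a] by linarith
  then have qe: "q = Suc j * a div N" "Suc j * a div N \<noteq> j * a div N" using d1 d2 by linarith+
  show thesis
  proof (rule that[of j])
    show "cut_letter a b j = I3" using qe(2) by (simp add: cut_letter_def N_def)
    show "t = real (Suc j * a div (a + b)) / real a"
      using q(1) qe(1) ab by (simp add: field_simps N_def)
  qed (use j1 jN in \<open>auto simp: N_def\<close>)
qed

text \<open>The times \<open>j / (a + b)\<close> at which diagonals are crossed alternate with the others.\<close>

definition crossing_time :: "nat \<Rightarrow> nat \<Rightarrow> nat \<Rightarrow> real" where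
  "crossing_time a b n = (let j = n div 2 + 1 in
     if even n then real j / real (a + b)
     else if cut_letter a b j = I3 then real (Suc j * a div (a + b)) / real a
     else real (Suc j * b div (a + b)) / real b)"

lemma cut_letter_cases: "cut_letter a b j = I1 \<or> cut_letter a b j = I3"
  by (simp add: cut_letter_def)

theorem s_word_line_word:
  assumes ab: "0 < a" "0 < b" and cop: "coprime a b"
  shows "s_word (int a, int b) = line_word a b"
proof -
  define N where "N = a + b"
  define M where "M = 2 * N - 3"
  have N2: "2 \<le> N" using ab by (simp add: N_def)
  let ?C = "crossing_times (int a, int b)"
  let ?t = "crossing_time a b"
  have cop': "coprime b a" using cop by (simp add: coprime_commute)
  have even_t: "?t (2 * i) = real (i + 1) / real N" for i
    by (simp add: crossing_time_def N_def)
  have odd_t: "real (i + 1) / real N < ?t (2 * i + 1) \<and> ?t (2 * i + 1) < real (i + 2) / real N \<and>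
      (if cut_letter a b (i + 1) = I3
       then \<exists>q. 0 < q \<and> q < a \<and> ?t (2 * i + 1) = real q / real a
       else \<exists>q. 0 < q \<and> q < b \<and> ?t (2 * i + 1) = real q / real b)"
    if i: "i + 1 < N - 1" for i
  proof (cases "cut_letter a b (i + 1) = I3")
    case True
    have "1 \<le> i + 1" "i + 1 < a + b - 1" using i by (auto simp: N_def)
    note s = cut_letter_succ[OF ab cop this True]
    have "?t (2 * i + 1) = real (Suc (i + 1) * a div (a + b)) / real a"
      using True by (simp add: crossing_time_def)
    then show ?thesis using s True by (auto simp: N_def)
  next
    case False
    have j: "1 \<le> i + 1" "i + 1 < a + b - 1" "i + 1 < b + a - 1" using i by (auto simp: N_def)
    have "cut_letter a b (i + 1) = I1" using False cut_letter_cases by metis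
    then have "cut_letter b a (i + 1) = I3" using cut_letter_mirror[OF ab cop j(1,2)] by simp
    note s = cut_letter_succ[OF ab(2,1) cop' j(1,3) this]
    have "?t (2 * i + 1) = real (Suc (i + 1) * b div (b + a)) / real b"
      using False by (simp add: crossing_time_def add.commute)
    then show ?thesis using s False by (auto simp: N_def add.commute)
  qed
  have step: "?t n < ?t (Suc n)" if "Suc n < M" for n
  proof (cases "even n")
    case True
    then obtain i where i: "n = 2 * i" by blast
    then have "i + 1 < N - 1" using that by (auto simp: M_def)
    from odd_t[OF this] show ?thesis unfolding i even_t by simp
  next
    case False
    then obtain i where i: "n = 2 * i + 1" by (rule oddE)
    then have "i + 1 < N - 1" using that by (auto simp: M_def)
    moreover have "?t (Suc n) = real (i + 2) / real N" using even_t[of "i + 1"] i by simp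
    ultimately show ?thesis using odd_t[of i] i by simp
  qed
  have less: "?t m < ?t n" if "m < n" "n < M" for m n
    using that
  proof (induction n)
    case (Suc n)
    then show ?case using step[of n] by (cases "m = n") auto
  qed simp
  define L where "L = map ?t [0..<M]"
  have sorted: "sorted_wrt (<) L" unfolding L_def sorted_wrt_map
    by (rule sorted_wrt_mono_rel[of _ "(<)"]) (auto intro: less)
  have inC: "t \<in> ?C \<longleftrightarrow> 0 < t \<and> t < 1 \<and> (t * real a \<in> \<int> \<or> t * real b \<in> \<int> \<or> t * real a + t * real b \<in> \<int>)" for t
    by (auto simp: crossing_times_def)
  have set: "set L = ?C"
  proof (intro equalityI subsetI)
    fix t assume "t \<in> set L"
    then obtain n where n: "n < M" "t = ?t n" by (auto simp: L_def)
    show "t \<in> ?C"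
    proof (cases "even n")
      case True
      then obtain i where i: "n = 2 * i" by blast
      have "t = real (i + 1) / real N" using n i even_t by simp
      moreover have "i + 1 < N" using n i by (auto simp: M_def)
      moreover have "t * real a + t * real b = t * real N" by (simp add: N_def algebra_simps)
      ultimately show ?thesis unfolding inC by simp
    next
      case False
      then obtain i where i: "n = 2 * i + 1" by (rule oddE)
      then have "i + 1 < N - 1" using n by (auto simp: M_def)
      note o = odd_t[OF this]
      show ?thesis
      proof (cases "cut_letter a b (i + 1) = I3")
        case True
        then obtain q where "0 < q" "q < a" "t = real q / real a" using o n i by auto
        then show ?thesis unfolding inC using ab by simp
      next
        case False
        then obtain q where "0 < q" "q < b" "t = real q / real b" using o n i by auto
        then show ?thesis unfolding inC using ab by simp
      qed
    qed
  next
    fix t assume "t \<in> ?C"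
    then have t: "0 < t" "t < 1" and d: "t * real a \<in> \<int> \<or> t * real b \<in> \<int> \<or> t * real a + t * real b \<in> \<int>"
      unfolding inC by auto
    have memL: "?t n \<in> set L" if "n < M" for n using that by (simp add: L_def)
    from d show "t \<in> set L"
    proof (elim disjE)
      assume "t * real a \<in> \<int>"
      then obtain j where j: "1 \<le> j" "j < a + b - 1" "cut_letter a b j = I3" "t = real (Suc j * a div (a + b)) / real a"
        using crossing_between[OF ab cop t] by metis
      then have "t = ?t (2 * (j - 1) + 1)" by (simp add: crossing_time_def)
      moreover have "2 * (j - 1) + 1 < M" using j by (auto simp: M_def N_def)
      ultimately show ?thesis using memL by simp
    next
      assume "t * real b \<in> \<int>"
      then obtain j where j: "1 \<le> j" "j < b + a - 1" "cut_letter b a j = I3" "t = real (Suc j * b div (b + a)) / real b"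
        using crossing_between[OF ab(2,1) cop' t] by metis
      have "cut_letter a b j = I1"
        using cut_letter_mirror[OF ab(2,1) cop' j(1,2)] j(3) by simp
      then have "t = ?t (2 * (j - 1) + 1)" using j by (simp add: crossing_time_def add.commute)
      moreover have "2 * (j - 1) + 1 < M" using j by (auto simp: M_def N_def)
      ultimately show ?thesis using memL by simp
    next
      assume "t * real a + t * real b \<in> \<int>"
      then have "t * real N \<in> \<int>" by (simp add: N_def algebra_simps)
      then obtain k :: int where k: "t * real N = k" by (auto elim: Ints_cases)
      have kr: "0 < real_of_int k" "real_of_int k < real N" unfolding k[symmetric] using t N2 by simp_all
      then have kk: "1 \<le> k" "k < int N" by simp_all
      have "t = real_of_int k / real N" using k N2 by (simp add: field_simps)
      then have "t = ?t (2 * nat (k - 1))" unfolding even_t using kk by simp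
      moreover have "2 * nat (k - 1) < M" using kk N2 by (simp add: M_def)
      ultimately show ?thesis using memL by simp
    qed
  qed
  have sl: "sorted_list_of_set ?C = L"
    using sorted set by (metis strict_sorted_equal sorted_list_of_set.set_sorted_key_list_of_set
      finite_set set_sorted_list_of_set strict_sorted_list_of_set)
  show ?thesis
  proof (rule interleave_eqI[of _ "N - 2"])
    have len: "length (s_word (int a, int b)) = M" by (simp add: s_word_def sl L_def)
    then show "length (s_word (int a, int b)) = 2 * (N - 2) + 1" using N2 by (simp add: M_def)
    show lc: "length (cut_word a b) = N - 2" by (simp add: cut_word_def N_def)
    have nth: "s_word (int a, int b) ! n = crossing_label (int a, int b) (?t n)" if "n < M" for n
      using that by (simp add: s_word_def sl L_def)
    have r: "0 < ?t n" "?t n < 1" if "n < M" for n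
    proof -
      have "?t n \<in> ?C" using that unfolding set[symmetric] L_def by simp
      then show "0 < ?t n" "?t n < 1" unfolding inC by auto
    qed
    have lab: "crossing_label (int a, int b) t =
      (if t * real a \<in> \<int> then I3 else if t * real b \<in> \<int> then I1 else I2)" for t
      by (simp add: crossing_label_def)
    show "s_word (int a, int b) ! (2 * i) = I2" if "i \<le> N - 2" for i
    proof -
      have iM: "2 * i < M" using that N2 by (auto simp: M_def)
      define t where "t = ?t (2 * i)"
      have t: "0 < t" "t < 1" using r[OF iM] by (auto simp: t_def)
      have "t * real N = real (i + 1)" using N2 by (simp add: t_def even_t)
      then have "t * real a + t * real b = real (i + 1)" by (simp add: N_def distrib_left)
      then have sum: "t * real a + t * real b \<in> \<int>" by (metis Ints_of_nat)
      have "t * real a \<notin> \<int>"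
      proof
        assume a: "t * real a \<in> \<int>"
        then have "t * real b \<in> \<int>" using Ints_diff[OF sum a] by simp
        then show False using coprime_times_Ints[OF cop ab t a] by simp
      qed
      moreover have "t * real b \<notin> \<int>"
      proof
        assume b: "t * real b \<in> \<int>"
        then have "t * real a \<in> \<int>" using Ints_diff[OF sum b] by simp
        then show False using coprime_times_Ints[OF cop ab t] b by simp
      qed
      ultimately show ?thesis using nth[OF iM] lab by (simp add: t_def)
    qed
    show "s_word (int a, int b) ! (2 * i + 1) = cut_word a b ! i" if i: "i < N - 2" for i
    proof -
      have iM: "2 * i + 1 < M" using i by (auto simp: M_def)
      have i': "i + 1 < N - 1" using i by simp
      define t where "t = ?t (2 * i + 1)"
      have t: "0 < t" "t < 1" using r[OF iM] by (auto simp: t_def)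
      have cw: "cut_word a b ! i = cut_letter a b (i + 1)" using i by (simp add: cut_word_def N_def)
      show ?thesis
      proof (cases "cut_letter a b (i + 1) = I3")
        case True
        then obtain q where "t = real q / real a" using odd_t[OF i'] by (auto simp: t_def)
        then have "t * real a \<in> \<int>" using ab by simp
        then show ?thesis using nth[OF iM] lab[of t] True cw by (simp add: t_def)
      next
        case False
        then obtain q where "t = real q / real b" using odd_t[OF i'] by (auto simp: t_def)
        then have b: "t * real b \<in> \<int>" using ab by simp
        then have "t * real a \<notin> \<int>" using coprime_times_Ints[OF cop ab t] by blast
        then show ?thesis using nth[OF iM] lab[of t] b False cw cut_letter_cases[of a b "i + 1"] by (simp add: t_def)
      qed
    qed
  qed
qed

text \<open>The half turn about the midpoint of the segment preserves the lattice.\<close>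

lemma cut_letter_reflect:
  assumes ab: "0 < a" "0 < b" and cop: "coprime a b" and j: "1 \<le> j" "j < a + b - 1"
  shows "cut_letter a b (a + b - 1 - j) = cut_letter a b j"
proof -
  define N where "N = a + b"
  have cN: "coprime N a" using cop coprime_add_self[of a b] unfolding N_def by (simp add: coprime_commute)
  have c: "(N - i) * a div N + i * a div N + 1 = a" if "0 < i" "i < N" for i
    using div_complement[of N i 1 a] coprime_not_dvd[OF cN that] that by (simp add: mult.commute)
  have e: "Suc (N - 1 - j) = N - j" "N - 1 - j = N - Suc j" using j by (auto simp: N_def)
  have "(N - j) * a div N + j * a div N + 1 = a" "(N - Suc j) * a div N + Suc j * a div N + 1 = a"
    by (intro c; use j in \<open>auto simp: N_def\<close>)+
  then have "Suc (N - 1 - j) * a div N = (N - 1 - j) * a div N \<longleftrightarrow> Suc j * a div N = j * a div N"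
    unfolding e(1) unfolding e(2) by linarith
  then show ?thesis by (simp only: cut_letter_def N_def[symmetric])
qed

lemma rev_cut_word:
  assumes "0 < a" "0 < b" "coprime a b"
  shows "rev (cut_word a b) = cut_word a b"
proof (rule nth_equalityI)
  show "rev (cut_word a b) ! i = cut_word a b ! i" if "i < length (rev (cut_word a b))" for i
  proof -
    have i: "i < a + b - 2" using that by (simp add: cut_word_def)
    then have e: "Suc (a + b - Suc (Suc (Suc i))) = a + b - 1 - Suc i" by arith
    show ?thesis using i cut_letter_reflect[OF assms, of "Suc i"] by (simp add: cut_word_def rev_nth e)
  qed
qed simp

lemma rev_interleave: "rev (interleave u) = interleave (rev u)"
  by (induction u rule: rev_induct) (simp_all add: interleave_def)

lemma line_word_palindromic:
  assumes "0 < a" "0 < b" "coprime a b"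
  shows "line_word a b \<in> palindromic_words"
proof -
  have "length (interleave u) = 2 * length u + 1" for u by (induction u) (simp_all add: interleave_def)
  then show ?thesis using rev_cut_word[OF assms] by (simp add: palindromic_words_def rev_interleave)
qed

section \<open>Words representing the same element of the Coxeter group\<close>

definition weq :: "nat \<Rightarrow> idx list \<Rightarrow> idx list \<Rightarrow> bool" where
  "weq m u v \<longleftrightarrow> pres_cong (W_relators m) (gen_word u) (gen_word v)"

lemma W_prod_class: "W_prod m w = pres_class (W_relators m) (gen_word w)"
proof (induction w)
  case Nil
  show ?case by (simp add: W_prod_def W_group_def presented_group_def)
next
  case (Cons i w)
  have "W_prod m (i # w) = W_gen m i \<otimes>\<^bsub>W_group m\<^esub> W_prod m w" by (simp add: W_prod_def)
  then show ?case by (simp add: Cons W_gen_def W_group_def mult_presented_group)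
qed

lemma W_prod_eq_iff: "W_prod m u = W_prod m v \<longleftrightarrow> weq m u v"
  by (simp add: W_prod_class weq_def pres_class_eq_iff)

lemma W_prod_carrier: "W_prod m w \<in> carrier (W_group m)"
  by (simp add: W_prod_class W_group_def presented_group_def)

lemma weq_refl [simp]: "weq m u u"
  by (simp add: weq_def pres_cong.pc_refl)

lemma weq_sym: "weq m u v \<Longrightarrow> weq m v u"
  by (simp add: weq_def pres_cong.pc_sym)

lemma weq_trans [trans]: "weq m u v \<Longrightarrow> weq m v w \<Longrightarrow> weq m u w"
  unfolding weq_def by (rule pres_cong.pc_trans)

lemma weq_append: "weq m u v \<Longrightarrow> weq m u' v' \<Longrightarrow> weq m (u @ u') (v @ v')"
  unfolding weq_def map_append
  by (rule pres_cong.pc_trans[OF pres_cong_append_right pres_cong_append_left])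

lemma weq_cong3: "weq m u v \<Longrightarrow> weq m (x @ u @ y) (x @ v @ y)"
  by (intro weq_append weq_refl)

lemma weq_relator:
  assumes "gen_word r \<in> W_relators m"
  shows "weq m (x @ r @ y) (x @ y)"
  using pres_cong.pc_relator[OF assms, of "gen_word x" "gen_word y"] by (simp add: weq_def)

lemma weq_square: "weq m (x @ [i, i] @ y) (x @ y)"
  by (rule weq_relator) (cases i; simp add: W_relators_def)

lemma weq_deletes: "deletes u v \<Longrightarrow> weq m u v"
proof (induction rule: deletes.induct)
  case (deletes_step w xs i ys)
  then show ?case using weq_trans weq_square by blast
qed simp

lemma weq_free_red: "free_red u = free_red v \<Longrightarrow> weq m u v"
  using weq_deletes[OF deletes_free_red[of u]] weq_deletes[OF deletes_free_red[of v]] weq_trans weq_sym by metis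

definition wpow :: "'a list \<Rightarrow> nat \<Rightarrow> 'a list" where
  "wpow X n = concat (replicate n X)"

lemma wpow_simps [simp]: "wpow X 0 = []" "wpow X (Suc n) = X @ wpow X n"
  by (simp_all add: wpow_def)

lemma wpow_add: "wpow X (n + k) = wpow X n @ wpow X k"
  by (induction n) simp_all

lemma wpow_Suc_right: "wpow X (Suc n) = wpow X n @ X"
  using wpow_add[of X n 1] by simp

abbreviation "w12 \<equiv> [I1, I2]"
abbreviation "w21 \<equiv> [I2, I1]"
abbreviation "w23 \<equiv> [I2, I3]"
abbreviation "w32 \<equiv> [I3, I2]"

lemma wpow_inverse: "free_red (X @ Y) = [] \<Longrightarrow> weq m (wpow X n @ wpow Y n) []"
proof (induction n)
  case (Suc n)
  have "free_red ([] :: idx list) = []" by (simp add: free_red_def)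
  then have XY: "weq m (X @ Y) []" using weq_free_red[of "X @ Y" "[]"] Suc.prems by simp
  have "weq m (X @ (wpow X n @ wpow Y n) @ Y) (X @ [] @ Y)" by (rule weq_cong3) (use Suc in blast)
  then have "weq m (X @ wpow X n @ wpow Y n @ Y) []" using weq_trans XY by fastforce
  then show ?case using wpow_Suc_right[of Y n] by simp
qed simp

lemma weq_order: "weq m (wpow w12 m) []" "weq m (wpow w23 m) []" "weq m (wpow w21 m) []" "weq m (wpow w32 m) []"
proof -
  have g: "gen_word (wpow X n) = concat (replicate n (gen_word X))" for X n
    by (induction n) simp_all
  show 1: "weq m (wpow w12 m) []"
    using weq_relator[where r = "wpow w12 m" and m = m and x = "[]" and y = "[]"] g[of w12 m] by (simp add: W_relators_def)
  show 2: "weq m (wpow w23 m) []"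
    using weq_relator[where r = "wpow w23 m" and m = m and x = "[]" and y = "[]"] g[of w23 m] by (simp add: W_relators_def)
  have inv: "weq m (wpow Y m) []" if "weq m (wpow X m) []" "free_red (X @ Y) = []" for X Y
  proof -
    have "weq m (wpow X m @ wpow Y m) (wpow Y m)" using weq_append[OF that(1) weq_refl[of m "wpow Y m"]] by simp
    then show ?thesis using wpow_inverse[OF that(2)] weq_trans weq_sym by metis
  qed
  show "weq m (wpow w21 m) []" by (rule inv[OF 1]) (simp add: free_red_def)
  show "weq m (wpow w32 m) []" by (rule inv[OF 2]) (simp add: free_red_def)
qed

text \<open>For an element of order dividing \<open>m\<close> an exponent may be replaced by the complementary exponent
  of the inverse.\<close>

lemma weq_complement:
  assumes "weq m (wpow X m) []" "free_red (X @ Y) = []" "n + k = m"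
  shows "weq m (wpow X n) (wpow Y k)"
proof -
  have "weq m (wpow X n @ (wpow X k @ wpow Y k)) (wpow X n @ [])"
    by (intro weq_append weq_refl wpow_inverse assms)
  moreover have "weq m (wpow X m @ wpow Y k) ([] @ wpow Y k)"
    by (intro weq_append weq_refl assms)
  moreover have "wpow X n @ (wpow X k @ wpow Y k) = wpow X m @ wpow Y k"
    using assms(3) by (metis append.assoc wpow_add)
  ultimately show ?thesis using weq_trans weq_sym by (metis append_Nil append_Nil2)
qed

section \<open>Syllables of cutting words\<close>

fun syl_word :: "'a list \<Rightarrow> 'a list \<Rightarrow> nat list \<Rightarrow> 'a list" where
  "syl_word X Y [] = []"
| "syl_word X Y [n] = wpow X n"
| "syl_word X Y (n # ns) = wpow X n @ Y @ syl_word X Y ns"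

lemma syl_word_Cons: "ns \<noteq> [] \<Longrightarrow> syl_word X Y (n # ns) = wpow X n @ Y @ syl_word X Y ns"
  by (cases ns) auto

lemma syl_word_snoc: "ns \<noteq> [] \<Longrightarrow> syl_word X Y (ns @ [n]) = syl_word X Y ns @ Y @ wpow X n"
proof (induction ns)
  case (Cons k ns)
  then show ?case by (cases ns) (auto simp: syl_word_Cons)
qed simp

definition subst_word :: "idx list \<Rightarrow> idx list \<Rightarrow> idx list \<Rightarrow> idx list" where
  "subst_word X Y u = concat (map (\<lambda>i. if i = I3 then X else Y) u)"

lemma subst_word_simps [simp]: "subst_word X Y [] = []" "subst_word X Y (i # u) = (if i = I3 then X else Y) @ subst_word X Y u"
  "subst_word X Y (u @ v) = subst_word X Y u @ subst_word X Y v"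
  by (simp_all add: subst_word_def)

lemma subst_word_wpow: "subst_word X Y (wpow u n) = wpow (subst_word X Y u) n"
  by (induction n) simp_all

lemma subst_syl_word: "subst_word X Y (syl_word U V ns) = syl_word (subst_word X Y U) (subst_word X Y V) ns"
  by (induction U V ns rule: syl_word.induct) (simp_all add: subst_word_wpow)

lemma interleave_subst: "set u \<subseteq> {I1, I3} \<Longrightarrow> interleave u = subst_word w23 w21 u @ [I2]"
  by (induction u) (auto simp: interleave_def)

text \<open>The number of vertical lines crossed strictly between the horizontal lines \<open>y = j\<close> and \<open>y = j + 1\<close>.\<close>

definition syl_count :: "nat \<Rightarrow> nat \<Rightarrow> nat \<Rightarrow> nat" where
  "syl_count a b j = (if Suc j = b then a - 1 else Suc j * a div b) - j * a div b"

definition syl_counts :: "nat \<Rightarrow> nat \<Rightarrow> nat list" where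
  "syl_counts a b = map (syl_count a b) [0..<b]"

lemma div_le_pred: "j < b \<Longrightarrow> 0 < a \<Longrightarrow> j * a div b \<le> a - 1" for a b j :: nat
  using div_less_iff_less_mult[of b "j * a" a] mult_less_mono1[of j b a] by (simp add: mult.commute)

lemma cut_letter_I1_iff:
  assumes ab: "0 < a" "0 < b" and cop: "coprime a b" and k: "1 \<le> k" "k < a + b - 1"
  shows "cut_letter a b k = I1 \<longleftrightarrow> (\<exists>j. 0 < j \<and> j < b \<and> k = j + j * a div b)"
proof -
  define N where "N = a + b"
  have N0: "0 < N" using ab by (simp add: N_def)
  have cop': "coprime b a" using cop by (simp add: coprime_commute)
  have kN: "k < b + a - 1" using k by simp
  have "cut_letter a b k = I1 \<longleftrightarrow> cut_letter b a k = I3"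
    using cut_letter_mirror[OF ab cop k] cut_letter_cases[of a b k] by auto
  also have "\<dots> \<longleftrightarrow> (\<exists>j. 0 < j \<and> j < b \<and> k * b < j * N \<and> j * N < Suc k * b)"
  proof
    assume I3: "cut_letter b a k = I3"
    note s = cut_letter_succ[OF ab(2,1) cop' k(1) kN I3]
    define j where "j = Suc k * b div (b + a)"
    have "real k * real b < real j * real N" "real j * real N < real (Suc k) * real b"
      using s(1,2) ab unfolding j_def[symmetric] N_def by (simp_all add: field_simps)
    then have "k * b < j * N" "j * N < Suc k * b" by (metis of_nat_less_iff of_nat_mult)+
    then show "\<exists>j. 0 < j \<and> j < b \<and> k * b < j * N \<and> j * N < Suc k * b"
      using s(3,4) unfolding j_def[symmetric] by blast
  next
    assume "\<exists>j. 0 < j \<and> j < b \<and> k * b < j * N \<and> j * N < Suc k * b"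
    then obtain j where j: "k * b < j * N" "j * N < Suc k * b" by blast
    have "k * b div N < j" using j(1) N0 by (simp add: div_less_iff_less_mult)
    moreover have "j \<le> Suc k * b div N" using j(2) N0 by (simp add: less_eq_div_iff_mult_less_eq)
    ultimately have "Suc k * b div N \<noteq> k * b div N" by linarith
    then show "cut_letter b a k = I3" by (simp add: cut_letter_def N_def add.commute)
  qed
  also have "\<dots> \<longleftrightarrow> (\<exists>j. 0 < j \<and> j < b \<and> k = j + j * a div b)"
  proof -
    have "k * b < j * N \<and> j * N < Suc k * b \<longleftrightarrow> k = j + j * a div b" if j: "0 < j" "j < b" for j
    proof -
      have nd: "\<not> b dvd j * a" by (rule coprime_not_dvd[OF cop' j])
      have e: "j * N = j * b + (b * (j * a div b) + j * a mod b)" by (simp add: N_def algebra_simps)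
      have r: "0 < j * a mod b" "j * a mod b < b" using nd ab by (simp_all add: mod_greater_zero_iff_not_dvd)
      define d where "d = j + j * a div b"
      have e': "j * N = d * b + j * a mod b" using e by (simp add: d_def algebra_simps)
      have "k * b < j * N \<longleftrightarrow> k \<le> d"
      proof
        assume "k * b < j * N"
        then have "k * b < Suc d * b" using e' r by simp
        then show "k \<le> d" using mult_less_cancel2 less_Suc_eq_le by blast
      next
        assume "k \<le> d"
        then have "k * b \<le> d * b" by (rule mult_le_mono1)
        then show "k * b < j * N" using e' r(1) by linarith
      qed
      moreover have "j * N < Suc k * b \<longleftrightarrow> d \<le> k"
      proof
        assume "j * N < Suc k * b"
        then have "d * b < Suc k * b" using e' by simp
        then show "d \<le> k" using mult_less_cancel2 less_Suc_eq_le by blast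
      next
        assume "d \<le> k"
        then have "d * b \<le> k * b" by (rule mult_le_mono1)
        moreover have "Suc k * b = k * b + b" by simp
        ultimately show "j * N < Suc k * b" using e' r(2) by linarith
      qed
      ultimately show ?thesis unfolding d_def by auto
    qed
    then show ?thesis by blast
  qed
  finally show ?thesis .
qed

lemma cut_word_syllables:
  assumes ab: "0 < a" "0 < b" and cop: "coprime a b"
  shows "cut_word a b = syl_word [I3] [I1] (syl_counts a b)"
proof -
  \<comment> \<open>The position of the horizontal line \<open>y = j\<close> among the letters.\<close>
  define s where "s j = j + j * a div b" for j
  have smono: "s j < s (Suc j)" for j
    unfolding s_def using div_le_mono[of "j * a" "Suc j * a" b] by simp
  have smono': "s i < s j" if "i < j" for i j using lift_Suc_mono_less[of s, OF smono that] .
  have rep: "map (cut_letter a b) [l..<l + n] = replicate n I3" if "\<And>k. l \<le> k \<Longrightarrow> k < l + n \<Longrightarrow> cut_letter a b k = I3" for l n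
    using that by (intro replicate_eqI) auto
  have wp: "wpow [x] n = replicate n x" for x :: idx and n by (induction n) simp_all
  have sb: "s j \<le> a + b - 2" if "j < b" for j
    using div_le_pred[OF that ab(1)] that ab by (simp add: s_def)
  have I1: "cut_letter a b (s j) = I1" if j: "0 < j" "j < b" for j
  proof -
    have "1 \<le> s j" "s j < a + b - 1" using sb[OF j(2)] j ab by (auto simp: s_def)
    then show ?thesis using cut_letter_I1_iff[OF ab cop] j unfolding s_def by blast
  qed
  have I3: "cut_letter a b k = I3" if k: "s j < k" "k < s (Suc j) \<or> Suc j = b" "k < a + b - 1" "j < b" for k j
  proof -
    have "\<not> (\<exists>i. 0 < i \<and> i < b \<and> k = i + i * a div b)"
    proof
      assume "\<exists>i. 0 < i \<and> i < b \<and> k = i + i * a div b"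
      then obtain i where i: "i < b" "k = s i" unfolding s_def by blast
      show False
      proof (cases "i \<le> j")
        case True
        then show False using k(1) i smono'[of i j] by (cases "i = j") auto
      next
        case False
        then have "s (Suc j) \<le> s i" using smono'[of "Suc j" i] by (cases "Suc j = i") auto
        then show False using k i False by auto
      qed
    qed
    then have "cut_letter a b k \<noteq> I1" using cut_letter_I1_iff[OF ab cop, of k] k by simp
    then show ?thesis using cut_letter_cases by blast
  qed
  have "map (cut_letter a b) [s j + 1..<a + b - 1] = syl_word [I3] [I1] (map (syl_count a b) [j..<b])" if "j < b" for j
    using that
  proof (induction "b - j" arbitrary: j rule: less_induct)
    case less
    show ?case
    proof (cases "Suc j = b")
      case True
      have "a + b - 1 = (s j + 1) + syl_count a b j"
      proof -
        have "j * a div b \<le> a - 1" by (rule div_le_pred[OF less.prems ab(1)])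
        then show ?thesis using True ab by (simp add: syl_count_def s_def)
      qed
      then have "map (cut_letter a b) [s j + 1..<a + b - 1] = replicate (syl_count a b j) I3"
        using rep[of "s j + 1" "syl_count a b j"] I3[of j] True less.prems by simp
      moreover have "[j..<b] = [j]" unfolding True[symmetric] by simp
      ultimately show ?thesis by (simp add: wp)
    next
      case False
      then have j: "Suc j < b" using less.prems by simp
      have sc: "s (Suc j) = s j + 1 + syl_count a b j"
        using False smono[of j] unfolding s_def syl_count_def
        using div_le_mono[of "j * a" "Suc j * a" b] by simp
      have le: "s (Suc j) < a + b - 1" using sb[OF j] ab by linarith
      have "[s j + 1..<a + b - 1] = [s j + 1..<s (Suc j)] @ s (Suc j) # [s (Suc j) + 1..<a + b - 1]"
      proof -
        have "s (Suc j) + (a + b - 1 - s (Suc j)) = a + b - 1" using le by simp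
        then have "[s j + 1..<a + b - 1] = [s j + 1..<s (Suc j)] @ [s (Suc j)..<a + b - 1]"
          using upt_add_eq_append[of "s j + 1" "s (Suc j)" "a + b - 1 - s (Suc j)"] smono[of j] by simp
        then show ?thesis using upt_conv_Cons[OF le] by simp
      qed
      then have "map (cut_letter a b) [s j + 1..<a + b - 1] =
          map (cut_letter a b) [s j + 1..<s (Suc j)] @ cut_letter a b (s (Suc j)) # map (cut_letter a b) [s (Suc j) + 1..<a + b - 1]"
        by simp
      moreover have "map (cut_letter a b) [s j + 1..<s (Suc j)] = replicate (syl_count a b j) I3"
        unfolding sc by (rule rep) (use I3[of j] sc le less.prems in auto)
      moreover have "cut_letter a b (s (Suc j)) = I1" using I1[of "Suc j"] j by simp
      moreover have "map (cut_letter a b) [s (Suc j) + 1..<a + b - 1] = syl_word [I3] [I1] (map (syl_count a b) [Suc j..<b])"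
        using less.hyps[of "Suc j"] j by simp
      moreover have "[j..<b] = j # [Suc j..<b]" using less.prems by (rule upt_conv_Cons)
      moreover have "map (syl_count a b) [Suc j..<b] \<noteq> []" using j by simp
      ultimately show ?thesis by (simp add: syl_word_Cons wp)
    qed
  qed
  from this[OF ab(2)] show ?thesis by (simp add: cut_word_def syl_counts_def s_def)
qed

lemma set_cut_word: "set (cut_word a b) \<subseteq> {I1, I3}"
  using cut_letter_cases by (auto simp: cut_word_def)

lemma cut_word_mirror:
  assumes "0 < a" "0 < b" "coprime a b"
  shows "cut_word b a = map mirror_idx (cut_word a b)"
  using cut_letter_mirror[OF assms] by (auto simp: cut_word_def add.commute)

lemma subst_mirror: "set u \<subseteq> {I1, I3} \<Longrightarrow> subst_word X Y (map mirror_idx u) = subst_word Y X u"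
  by (induction u) auto

lemma subst_cut_word_mirror:
  assumes "0 < a" "0 < b" "coprime a b"
  shows "subst_word X Y (cut_word b a) = subst_word Y X (cut_word a b)"
  unfolding cut_word_mirror[OF assms] by (rule subst_mirror[OF set_cut_word])

lemma subst_cut_word:
  assumes "0 < a" "0 < b" "coprime a b"
  shows "subst_word X Y (cut_word a b) = syl_word X Y (syl_counts a b)"
  unfolding cut_word_syllables[OF assms] by (simp add: subst_syl_word)

lemma syl_word_shift: "ns \<noteq> [] \<Longrightarrow> X @ syl_word X (Y @ X) ns = syl_word X Y (map Suc ns)"
proof (induction ns)
  case (Cons n ns)
  show ?case
  proof (cases "ns = []")
    case True
    then show ?thesis by simp
  next
    case False
    then have "X @ syl_word X (Y @ X) (n # ns) = wpow X (Suc n) @ Y @ (X @ syl_word X (Y @ X) ns)"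
      by (simp add: syl_word_Cons)
    also have "\<dots> = syl_word X Y (map Suc (n # ns))" using Cons.IH[OF False] False by (simp add: syl_word_Cons)
    finally show ?thesis .
  qed
qed simp

text \<open>The map \<open>(x, y) \<mapsto> (x + y, x)\<close> permutes the lattice points; on cutting words it acts as a
  substitution.\<close>

lemma cut_word_sector:
  assumes ab: "0 < a" "0 < b" and cop: "coprime a b"
  shows "subst_word X Y (cut_word (a + b) a) = X @ subst_word (Y @ X) X (cut_word a b)"
proof -
  have cop1: "coprime (a + b) a" using coprime_add_self[of a b] cop by (simp add: coprime_commute)
  have cop2: "coprime b a" using cop by (simp add: coprime_commute)
  have le: "j * b div a \<le> b - 1" if "Suc j = a" for j
    by (rule div_le_pred) (use that ab in auto)
  have "syl_count (a + b) a j = Suc (syl_count b a j)" if "j < a" for j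
  proof -
    have d: "i * (a + b) div a = i + i * b div a" for i
      using ab by (simp add: distrib_left)
    have "j * b div a \<le> Suc j * b div a" by (rule div_le_mono) simp
    then show ?thesis unfolding syl_count_def d using le[of j] ab by auto
  qed
  then have "syl_counts (a + b) a = map Suc (syl_counts b a)" by (simp add: syl_counts_def)
  then have "subst_word X Y (cut_word (a + b) a) = syl_word X Y (map Suc (syl_counts b a))"
    using subst_cut_word[OF _ ab(1) cop1] ab by simp
  also have "\<dots> = X @ syl_word X (Y @ X) (syl_counts b a)"
    by (rule syl_word_shift[symmetric]) (use ab in \<open>simp add: syl_counts_def\<close>)
  also have "syl_word X (Y @ X) (syl_counts b a) = subst_word X (Y @ X) (cut_word b a)"
    using subst_cut_word[OF ab(2,1) cop2] by simp
  also have "\<dots> = subst_word (Y @ X) X (cut_word a b)" by (rule subst_cut_word_mirror[OF ab cop])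
  finally show ?thesis .
qed

lemma weq_syl_word:
  "list_all2 (\<lambda>n k. weq m (wpow X n) (wpow X' k)) ns ks \<Longrightarrow> weq m (syl_word X Y ns) (syl_word X' Y ks)"
proof (induction rule: list_all2_induct)
  case (Cons n ns k ks)
  then show ?case
    by (cases "ns = []"; cases "ks = []") (auto simp: syl_word_Cons intro!: weq_append)
qed simp

lemma syl_word_ends:
  assumes "0 < b"
  shows "X @ syl_word X Y (map f [0..<b]) @ X =
    syl_word X Y (map (\<lambda>j. f j + (if j = 0 then 1 else 0) + (if Suc j = b then 1 else 0)) [0..<b])"
proof (cases "b = 1")
  case True
  then show ?thesis using wpow_Suc_right[of X "f 0"] by simp
next
  case False
  then obtain c where b: "b = Suc (Suc c)" using assms by (metis One_nat_def gr0_implies_Suc not_gr_zero)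
  have u: "[0..<b] = 0 # ([1..<Suc c] @ [Suc c])" unfolding b by (simp add: upt_conv_Cons)
  have mid: "map (\<lambda>j. f j + (if j = 0 then 1 else 0) + (if Suc j = b then 1 else 0)) [1..<Suc c] = map f [1..<Suc c]"
    using b by auto
  show ?thesis
    unfolding u list.map map_append mid
    using b wpow_Suc_right[of X "f (Suc c)"]
    by (cases "c = 0") (simp_all add: syl_word_Cons syl_word_snoc del: upt_Suc)
qed

lemma coprime_reflect: "coprime a b \<Longrightarrow> a < m * b \<Longrightarrow> coprime (m * b - a) b" for a b m :: nat
proof -
  assume cop: "coprime a b" and lt: "a < m * b"
  have "gcd (m * b - a) b dvd m * b" "gcd (m * b - a) b dvd m * b - a" by simp_all
  then have "gcd (m * b - a) b dvd a" using lt by (metis dvd_diffD1 less_imp_le_nat)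
  then have "gcd (m * b - a) b dvd gcd a b" by simp
  moreover have "gcd a b = 1" using cop by (simp only: coprime_iff_gcd_eq_1)
  ultimately show ?thesis by (simp only: coprime_iff_gcd_eq_1 nat_dvd_1_iff_1)
qed

text \<open>By \<open>div_complement\<close> the numbers of vertical lines between two neighbouring horizontal lines add up to \<open>m\<close> for
  the lines to \<open>(a, b)\<close> and \<open>(m b - a, b)\<close>. At the two ends one is missing, which the factors \<open>X\<close> supply.\<close>

lemma cut_word_reflect:
  assumes ab: "0 < a" "0 < b" "a < m * b" and cop: "coprime a b"
    and X: "weq m (wpow X m) []" "free_red (X @ X') = []"
  shows "weq m (X @ subst_word X Y (cut_word (m * b - a) b) @ X) (subst_word X' Y (cut_word a b))"
proof -
  define a' where "a' = m * b - a"
  have a': "0 < a'" "a' + a = m * b" using ab by (auto simp: a'_def)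
  have cop': "coprime a' b" unfolding a'_def by (rule coprime_reflect[OF cop ab(3)])
  have nd: "\<not> b dvd j * a" if "0 < j" "j < b" for j
    using coprime_not_dvd[of b a j] that cop by (simp add: coprime_commute)
  have dc: "j * a' div b + j * a div b + 1 = j * m" if "0 < j" "j < b" for j
    using div_complement[OF ab(2,3) nd[OF that]] by (simp add: a'_def)
  \<comment> \<open>The two corrections are the factors \<open>X\<close> at the ends.\<close>
  have cnt: "(syl_count a' b j + (if j = 0 then 1 else 0) + (if Suc j = b then 1 else 0)) + syl_count a b j = m"
    if j: "j < b" for j
  proof -
    have mono: "j * a div b \<le> Suc j * a div b" "j * a' div b \<le> Suc j * a' div b" by (simp_all add: div_le_mono)
    have last: "j * a div b \<le> a - 1" "j * a' div b \<le> a' - 1" by (intro div_le_pred j ab a')+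
    consider "j = 0" "Suc j = b" | "j = 0" "Suc j < b" | "0 < j" "Suc j = b" | "0 < j" "Suc j < b" using j by linarith
    then show ?thesis
    proof cases
      case 1
      then have "a' + a = m" using a' by auto
      then show ?thesis using 1 ab a' by (auto simp: syl_count_def)
    next
      case 2
      then show ?thesis using dc[of 1] by (simp add: syl_count_def)
    next
      case 3
      have "b * m = j * m + m" using 3(2) by auto
      then have "a' + a = j * m + m" using a'(2) by (simp add: mult.commute)
      moreover have "j * a' div b + j * a div b + 1 = j * m" using dc[of j] 3 by simp
      ultimately show ?thesis using 3 last ab a' by (simp add: syl_count_def)
    next
      case 4
      have "j * a' div b + j * a div b + 1 = j * m" "Suc j * a' div b + Suc j * a div b + 1 = Suc j * m"
        using dc[of j] dc[of "Suc j"] 4 by simp_all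
      then show ?thesis using 4 mono by (simp add: syl_count_def)
    qed
  qed
  have "X @ subst_word X Y (cut_word a' b) @ X =
      syl_word X Y (map (\<lambda>j. syl_count a' b j + (if j = 0 then 1 else 0) + (if Suc j = b then 1 else 0)) [0..<b])"
    unfolding subst_cut_word[OF a'(1) ab(2) cop'] syl_counts_def by (rule syl_word_ends[OF ab(2)])
  moreover have "weq m \<dots> (syl_word X' Y (map (syl_count a b) [0..<b]))"
    by (rule weq_syl_word) (use cnt weq_complement[OF X] in \<open>auto simp: list_all2_conv_all_nth\<close>)
  ultimately show ?thesis
    unfolding a'_def[symmetric] using subst_cut_word[OF ab(1,2) cop] by (simp add: syl_counts_def)
qed

text \<open>Only the exponents modulo \<open>m\<close> matter, and adding \<open>m b\<close> to \<open>a\<close> adds \<open>m\<close> to all of them.\<close>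

lemma cut_word_translate:
  assumes ab: "0 < a" "0 < b" and cop: "coprime a b" and X: "weq m (wpow X m) []"
  shows "weq m (subst_word X Y (cut_word (a + m * b) b)) (subst_word X Y (cut_word a b))"
proof -
  have cop': "coprime (a + m * b) b"
  proof -
    have "gcd (a + m * b) b = gcd a b" by (metis add.commute gcd.commute gcd_add_mult)
    then show ?thesis using cop by (simp add: coprime_iff_gcd_eq_1)
  qed
  have d: "j * (a + m * b) div b = j * a div b + j * m" for j
    using ab by (simp add: distrib_left flip: mult.assoc)
  have "syl_count (a + m * b) b j = m + syl_count a b j" if "j < b" for j
  proof -
    have mono: "j * a div b \<le> Suc j * a div b" by (simp add: div_le_mono)
    have last: "j * a div b \<le> a - 1" by (rule div_le_pred[OF that ab(1)])
    show ?thesis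
    proof (cases "Suc j = b")
      case True
      have "m * b = m + j * m" using True by (metis mult.commute mult_Suc)
      then show ?thesis using True last ab unfolding syl_count_def d by simp
    next
      case False
      then show ?thesis using mono unfolding syl_count_def d by simp
    qed
  qed
  then have c: "syl_counts (a + m * b) b = map (\<lambda>j. m + syl_count a b j) [0..<b]" by (simp add: syl_counts_def)
  have w: "weq m (wpow X (m + n)) (wpow X n)" for n
    using weq_append[OF X weq_refl[of m "wpow X n"]] by (simp add: wpow_add)
  have "weq m (syl_word X Y (syl_counts (a + m * b) b)) (syl_word X Y (syl_counts a b))"
    unfolding c by (rule weq_syl_word) (use w in \<open>auto simp: list_all2_conv_all_nth syl_counts_def\<close>)
  then show ?thesis using subst_cut_word[OF ab cop] subst_cut_word[OF _ ab(2) cop'] ab by simp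
qed

section \<open>Every spiral word represents the reflection of a root\<close>

definition is_root :: "nat \<Rightarrow> nat \<Rightarrow> nat \<Rightarrow> bool" where
  "is_root m a b \<longleftrightarrow> 0 < a \<and> 0 < b \<and> coprime a b \<and> a * a + b * b \<le> m * a * b + 1"

definition root_element :: "nat \<Rightarrow> idx list \<Rightarrow> bool" where
  "root_element m w \<longleftrightarrow> (\<exists>a b. is_root m a b \<and> weq m w (line_word a b))"

lemma weq_conj_subst:
  assumes "weq m ([I2] @ X @ [I2]) X'" "weq m ([I2] @ Y @ [I2]) Y'"
  shows "weq m ([I2] @ subst_word X Y u @ [I2]) (subst_word X' Y' u)"
proof (induction u)
  case Nil
  show ?case by (rule weq_free_red) (simp add: free_red_def)
next
  case (Cons i u)
  define Z where "Z = (if i = I3 then X else Y)"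
  define Z' where "Z' = (if i = I3 then X' else Y')"
  have Z: "weq m ([I2] @ Z @ [I2]) Z'" using assms by (simp add: Z_def Z'_def)
  have "weq m (([I2] @ Z) @ [I2, I2] @ (subst_word X Y u @ [I2])) (([I2] @ Z) @ (subst_word X Y u @ [I2]))"
    by (rule weq_square)
  then have "weq m ([I2] @ subst_word X Y (i # u) @ [I2]) (([I2] @ Z @ [I2]) @ ([I2] @ subst_word X Y u @ [I2]))"
    using weq_sym by (simp add: Z_def)
  also have "weq m \<dots> (Z' @ subst_word X' Y' u)" by (rule weq_append[OF Z Cons])
  finally show ?case by (simp add: Z'_def)
qed

lemma weq_subst_word:
  assumes "weq m X X'" "weq m Y Y'"
  shows "weq m (subst_word X Y u) (subst_word X' Y' u)"
  using assms by (induction u) (auto intro: weq_append)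

text \<open>\<open>v0 a b\<close> is the word of the line to \<open>(a, b)\<close>, and \<open>v1 a b\<close> represents the same element as the
  word of the line to \<open>(m b - a, b)\<close>, but makes sense for all \<open>a\<close> and \<open>b\<close>.\<close>

definition v0 :: "nat \<Rightarrow> nat \<Rightarrow> idx list" where
  "v0 a b = subst_word w23 w21 (cut_word a b) @ [I2]"

definition v1 :: "nat \<Rightarrow> nat \<Rightarrow> idx list" where
  "v1 a b = w32 @ subst_word w32 w21 (cut_word a b) @ w32 @ [I2]"

lemma v0_line_word: "v0 a b = line_word a b"
  unfolding v0_def by (rule interleave_subst[OF set_cut_word, symmetric])

definition cox_power :: "int \<Rightarrow> idx list" where
  "cox_power n = (if 0 \<le> n then wpow [I3, I2, I1] (nat n) else wpow [I1, I2, I3] (nat (- n)))"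

text \<open>The images of the positive quadrant under the infinite dihedral group generated by the two
  simple reflections are numbered by \<open>(n, e)\<close>; crossing a wall changes \<open>e\<close>, crossing two of them
  conjugates by the Coxeter element \<open>s\<^sub>3 s\<^sub>2 s\<^sub>1\<close>. The word belongs to the point of this sector with
  coordinates \<open>a\<close> and \<open>b\<close>.\<close>

definition qword :: "int \<Rightarrow> bool \<Rightarrow> nat \<Rightarrow> nat \<Rightarrow> idx list" where
  "qword n e a b = cox_power n @ (if e then v1 a b else v0 a b) @ rev (cox_power n)"

lemma deletes_once: "deletes (xs @ [i, i] @ ys) (xs @ ys)"
  by (rule deletes_step[OF deletes_refl])

lemma deletes_123: "deletes (u @ [I1, I2, I3] @ [I3, I2, I1] @ v) (u @ v)" "deletes (u @ [I3, I2, I1] @ [I1, I2, I3] @ v) (u @ v)"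
proof -
  have *: "deletes (u @ [i, j, k] @ [k, j, i] @ v) (u @ v)" for i j k
  proof -
    have 1: "deletes (u @ [i, j, k] @ [k, j, i] @ v) (u @ [i, j] @ [j, i] @ v)"
      using deletes_once[of "u @ [i, j]" k "[j, i] @ v"] by simp
    have 2: "deletes (u @ [i, j] @ [j, i] @ v) (u @ [i] @ [i] @ v)"
      using deletes_once[of "u @ [i]" j "[i] @ v"] by simp
    have 3: "deletes (u @ [i] @ [i] @ v) (u @ v)" using deletes_once[of u i v] by simp
    show ?thesis using deletes_trans[OF 3 deletes_trans[OF 2 1]] .
  qed
  show "deletes (u @ [I1, I2, I3] @ [I3, I2, I1] @ v) (u @ v)" "deletes (u @ [I3, I2, I1] @ [I1, I2, I3] @ v) (u @ v)"
    by (rule *)+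
qed

lemma cox_power_step:
  "deletes (cox_power n @ [I3, I2, I1]) (cox_power (n + 1))"
  "deletes ([I3, I2, I1] @ cox_power n) (cox_power (n + 1))"
  "deletes ([I1, I2, I3] @ cox_power n) (cox_power (n - 1))"
proof -
  let ?c = "[I3, I2, I1]" and ?d = "[I1, I2, I3]"
  show "deletes (cox_power n @ ?c) (cox_power (n + 1))" "deletes (?c @ cox_power n) (cox_power (n + 1))"
  proof -
    have "deletes (cox_power n @ ?c) (cox_power (n + 1)) \<and> deletes (?c @ cox_power n) (cox_power (n + 1))"
    proof (cases "0 \<le> n")
      case True
      then have "nat (n + 1) = Suc (nat n)" by simp
      then show ?thesis using True wpow_Suc_right[of ?c "nat n"] by (simp add: cox_power_def deletes_refl)
    next
      case False
      define k where "k = nat (- n - 1)"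
      have n: "cox_power n = wpow ?d (Suc k)" using False by (simp add: cox_power_def k_def Suc_nat_eq_nat_zadd1 flip: wpow_simps(2))
      have n1: "cox_power (n + 1) = wpow ?d k"
      proof (cases "n = -1")
        case True
        then show ?thesis by (simp add: cox_power_def k_def)
      next
        case 2: False
        then show ?thesis using False by (simp add: cox_power_def k_def)
      qed
      show ?thesis unfolding n1 using deletes_123(1)[of "wpow ?d k" "[]"] deletes_123(2)[of "[]" "wpow ?d k"]
          wpow_Suc_right[of ?d k] by (simp add: n)
    qed
    then show "deletes (cox_power n @ ?c) (cox_power (n + 1))" "deletes (?c @ cox_power n) (cox_power (n + 1))" by auto
  qed
  show "deletes (?d @ cox_power n) (cox_power (n - 1))"
  proof (cases "0 < n")
    case True
    define k where "k = nat (n - 1)"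
    have "cox_power n = wpow ?c (Suc k)" "cox_power (n - 1) = wpow ?c k"
      using True by (simp_all add: cox_power_def k_def Suc_nat_eq_nat_zadd1 flip: wpow_simps(2))
    then show ?thesis using deletes_123(1)[of "[]" "wpow ?c k"] by simp
  next
    case False
    then have "cox_power n = wpow ?d (nat (- n))" by (simp add: cox_power_def)
    moreover have "nat (- (n - 1)) = Suc (nat (- n))" using False by simp
    ultimately show ?thesis using False by (simp add: cox_power_def deletes_refl del: diff_minus_eq_add)
  qed
qed

lemma weq_conj: "weq m u v \<Longrightarrow> weq m (x @ u @ rev x) (x @ v @ rev x)"
  by (rule weq_cong3)

lemma weq_conj_deletes:
  assumes "deletes x y"
  shows "weq m (x @ w @ rev x) (y @ w @ rev y)"
  by (intro weq_append weq_refl weq_deletes assms deletes_rev)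

lemma quadrant_step:
  assumes "weq m w ([I3, I2, I1] @ (if e then v1 a b else v0 a b) @ [I1, I2, I3])"
  shows "weq m (cox_power n @ w @ rev (cox_power n)) (qword (n + 1) e a b)"
proof -
  have "weq m (cox_power n @ w @ rev (cox_power n))
     ((cox_power n @ [I3, I2, I1]) @ (if e then v1 a b else v0 a b) @ rev (cox_power n @ [I3, I2, I1]))"
    using weq_conj[OF assms, of "cox_power n"] by simp
  also have "weq m \<dots> (qword (n + 1) e a b)"
    unfolding qword_def by (rule weq_conj_deletes[OF cox_power_step(1)])
  finally show ?thesis .
qed

lemma quadrant_step_v0:
  assumes "weq m w ([I3, I2, I1] @ v0 a b @ [I1, I2, I3])"
  shows "weq m (cox_power n @ w @ rev (cox_power n)) (qword (n + 1) False a b)"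
  by (rule quadrant_step) (use assms in simp)

lemma quadrant_conj:
  assumes "weq m w (qword n e a b)"
  shows "weq m ([I3, I2, I1] @ w @ [I1, I2, I3]) (qword (n + 1) e a b)"
    "weq m ([I1, I2, I3] @ w @ [I3, I2, I1]) (qword (n - 1) e a b)"
proof -
  let ?v = "if e then v1 a b else v0 a b"
  have "weq m ([I3, I2, I1] @ w @ [I1, I2, I3]) (([I3, I2, I1] @ cox_power n) @ ?v @ rev ([I3, I2, I1] @ cox_power n))"
    using weq_conj[OF assms, of "[I3, I2, I1]"] by (simp add: qword_def)
  also have "weq m \<dots> (qword (n + 1) e a b)"
    unfolding qword_def by (rule weq_conj_deletes[OF cox_power_step(2)])
  finally show "weq m ([I3, I2, I1] @ w @ [I1, I2, I3]) (qword (n + 1) e a b)" .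
  have "weq m ([I1, I2, I3] @ w @ [I3, I2, I1]) (([I1, I2, I3] @ cox_power n) @ ?v @ rev ([I1, I2, I3] @ cox_power n))"
    using weq_conj[OF assms, of "[I1, I2, I3]"] by (simp add: qword_def)
  also have "weq m \<dots> (qword (n - 1) e a b)"
    unfolding qword_def by (rule weq_conj_deletes[OF cox_power_step(3)])
  finally show "weq m ([I1, I2, I3] @ w @ [I3, I2, I1]) (qword (n - 1) e a b)" .
qed

lemma free_red_pairs:
  "free_red (w23 @ w32) = []" "free_red (w21 @ w12) = []" "free_red (w32 @ w23) = []" "free_red (w12 @ w21) = []"
  by (simp_all add: free_red_def)

lemma weq_cancel_both:
  assumes "weq m (X @ u @ X) v" "weq m (X' @ X) []" "weq m (X @ X') []"
  shows "weq m u (X' @ v @ X')"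
proof -
  have 1: "weq m (X' @ (X @ u @ X) @ X') (X' @ v @ X')" by (rule weq_cong3[OF assms(1)])
  have "weq m ((X' @ X) @ u @ (X @ X')) ([] @ u @ [])"
    by (intro weq_append weq_refl assms)
  then have 2: "weq m (X' @ (X @ u @ X) @ X') u" by simp
  show ?thesis by (rule weq_trans[OF weq_sym[OF 2] 1])
qed

lemma weq_inverse_pairs: "weq m (w32 @ w23) []" "weq m (w23 @ w32) []" "weq m (w12 @ w21) []" "weq m (w21 @ w12) []"
  by (rule weq_free_red; simp add: free_red_def)+

lemma v0_v1_reflect:
  assumes "0 < a" "0 < b" "a < m * b" "coprime a b"
  shows "weq m (v0 (m * b - a) b) (v1 a b)"
proof -
  have "weq m (w23 @ subst_word w23 w21 (cut_word (m * b - a) b) @ w23) (subst_word w32 w21 (cut_word a b))"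
    by (rule cut_word_reflect[OF assms weq_order(2) free_red_pairs(1)])
  then have "weq m (subst_word w23 w21 (cut_word (m * b - a) b)) (w32 @ subst_word w32 w21 (cut_word a b) @ w32)"
    by (rule weq_cancel_both) (rule weq_inverse_pairs)+
  from weq_append[OF this weq_refl, of "[I2]"] show ?thesis by (simp add: v0_def v1_def)
qed

lemma v0_conj: "weq m ([I3, I2, I1] @ v0 a b @ [I1, I2, I3])
    (w32 @ w12 @ subst_word w32 w12 (cut_word a b) @ w12 @ w32 @ [I2])"
proof -
  have s: "weq m ([I2] @ subst_word w23 w21 (cut_word a b) @ [I2]) (subst_word w32 w12 (cut_word a b))"
    by (rule weq_conj_subst; rule weq_free_red; simp add: free_red_def)
  have "weq m ([I3, I2, I1] @ v0 a b @ [I1, I2, I3])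
      ([I3, I2, I1, I2] @ ([I2] @ subst_word w23 w21 (cut_word a b) @ [I2]) @ [I1, I2, I3])"
    using weq_sym[OF weq_square[of m "[I3, I2, I1]" I2 "v0 a b @ [I1, I2, I3]"]] by (simp add: v0_def)
  also have "weq m \<dots> ([I3, I2, I1, I2] @ subst_word w32 w12 (cut_word a b) @ [I1, I2, I3])"
    by (rule weq_cong3[OF s])
  also have "weq m \<dots> ([I3, I2, I1, I2] @ subst_word w32 w12 (cut_word a b) @ [I1, I2, I3, I2, I2])"
    by (intro weq_append weq_refl weq_free_red) (simp add: free_red_def)
  finally show ?thesis by simp
qed

lemma v1_v0_reflect:
  assumes ab: "0 < a" "0 < b" "b < m * a" "coprime a b"
  shows "weq m (v1 a (m * a - b)) ([I3, I2, I1] @ v0 a b @ [I1, I2, I3])"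
proof -
  have cop: "coprime b a" using ab by (simp add: coprime_commute)
  have cop': "coprime (m * a - b) a" by (rule coprime_reflect[OF cop ab(3)])
  have pos: "0 < m * a - b" using ab by simp
  have e1: "subst_word w32 w21 (cut_word a (m * a - b)) = subst_word w21 w32 (cut_word (m * a - b) a)"
    by (rule subst_cut_word_mirror[OF pos ab(1) cop'])
  have e2: "subst_word w12 w32 (cut_word b a) = subst_word w32 w12 (cut_word a b)"
    by (rule subst_cut_word_mirror[OF ab(1,2,4)])
  have "weq m (w21 @ subst_word w21 w32 (cut_word (m * a - b) a) @ w21) (subst_word w12 w32 (cut_word b a))"
    by (rule cut_word_reflect[OF ab(2,1,3) cop weq_order(3) free_red_pairs(2)])
  then have "weq m (subst_word w21 w32 (cut_word (m * a - b) a)) (w12 @ subst_word w12 w32 (cut_word b a) @ w12)"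
    by (rule weq_cancel_both) (rule weq_inverse_pairs)+
  from weq_cong3[OF this, of w32 "w32 @ [I2]"]
  have "weq m (v1 a (m * a - b)) (w32 @ w12 @ subst_word w32 w12 (cut_word a b) @ w12 @ w32 @ [I2])"
    by (simp add: v1_def e1 e2)
  then show ?thesis by (rule weq_trans[OF _ weq_sym[OF v0_conj]])
qed

lemma cut_word_single: "subst_word X Y (cut_word a 1) = wpow X (a - 1)" if "0 < a"
  using subst_cut_word[OF that, of 1 X Y] by (simp add: syl_counts_def syl_count_def)

lemma cut_word_single': "subst_word X Y (cut_word 1 a) = wpow Y (a - 1)" if "0 < a"
  using subst_cut_word_mirror[OF that, of 1 X Y] cut_word_single[OF that, of Y X] by simp

text \<open>For these pairs one coordinate of the reflected vector is \<open>0\<close>, so that \<open>quadrant_reflect\<close> does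
  not apply.\<close>

lemma simple_root_words:
  assumes "0 < m"
  shows "weq m (v0 m 1) [I3]" "weq m (v1 m 1) [I3]" "weq m (v0 1 m) [I1]" "weq m (v1 1 m) [I3, I2, I1, I2, I3]"
proof -
  have X: "weq m (wpow w23 (m - 1)) w32" "weq m (wpow w32 (m - 1)) w23" "weq m (wpow w21 (m - 1)) w12"
    using weq_complement[OF weq_order(2) free_red_pairs(1), where n = "m - 1" and k = 1]
      weq_complement[OF weq_order(4) free_red_pairs(3), where n = "m - 1" and k = 1]
      weq_complement[OF weq_order(3) free_red_pairs(2), where n = "m - 1" and k = 1] assms by simp_all
  have "weq m (v0 m 1) (w32 @ [I2])"
    unfolding v0_def cut_word_single[OF assms] by (rule weq_append[OF X(1) weq_refl])
  also have "weq m \<dots> [I3]" by (rule weq_free_red) (simp add: free_red_def)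
  finally show "weq m (v0 m 1) [I3]" .
  have "weq m (v1 m 1) (w32 @ w23 @ w32 @ [I2])"
    unfolding v1_def cut_word_single[OF assms] by (rule weq_cong3[OF X(2)])
  also have "weq m \<dots> [I3]" by (rule weq_free_red) (simp add: free_red_def)
  finally show "weq m (v1 m 1) [I3]" .
  have "weq m (v0 1 m) (w12 @ [I2])"
    unfolding v0_def cut_word_single'[OF assms] by (rule weq_append[OF X(3) weq_refl])
  also have "weq m \<dots> [I1]" by (rule weq_free_red) (simp add: free_red_def)
  finally show "weq m (v0 1 m) [I1]" .
  have "weq m (v1 1 m) (w32 @ w12 @ w32 @ [I2])"
    unfolding v1_def cut_word_single'[OF assms] by (rule weq_cong3[OF X(3)])
  also have "weq m \<dots> [I3, I2, I1, I2, I3]" by (rule weq_free_red) (simp add: free_red_def)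
  finally show "weq m (v1 1 m) [I3, I2, I1, I2, I3]" .
qed

lemma is_root_int: "is_root m a b \<longleftrightarrow> 0 < a \<and> 0 < b \<and> coprime a b \<and>
    int a * int a + int b * int b - int m * int a * int b \<le> 1"
proof -
  have "a * a + b * b \<le> m * a * b + 1 \<longleftrightarrow> int (a * a + b * b) \<le> int (m * a * b + 1)" by (simp only: of_nat_le_iff)
  also have "\<dots> \<longleftrightarrow> int a * int a + int b * int b - int m * int a * int b \<le> 1" by (simp add: algebra_simps)
  finally show ?thesis by (simp add: is_root_def)
qed

lemma is_root_reflect:
  assumes "is_root m a b" "a < m * b"
  shows "is_root m (m * b - a) b"
proof -
  have e: "int (m * b - a) = int m * int b - int a" using assms(2) by (simp add: of_nat_diff)
  show ?thesis
    using assms coprime_reflect[of a b m] unfolding is_root_int e by (simp add: algebra_simps)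
qed

lemma is_root_sym: "is_root m a b \<Longrightarrow> is_root m b a"
  unfolding is_root_int by (simp add: algebra_simps coprime_commute)

text \<open>Outside the wedge \<open>a < m b\<close> the norm exceeds \<open>1\<close>, except at the reflection of a simple root.\<close>

lemma is_root_large: "is_root m a b \<Longrightarrow> m * b \<le> a \<Longrightarrow> a = m \<and> b = 1"
proof -
  assume r: "is_root m a b" and le: "m * b \<le> a"
  \<comment> \<open>With \<open>a = m b + d\<close> the norm is \<open>a d + b\<^sup>2\<close>.\<close>
  define d where "d = a - m * b"
  have a: "a = m * b + d" using le by (simp add: d_def)
  have le1: "a * d + b * b \<le> 1" using r unfolding is_root_def a by (simp add: algebra_simps)
  have pos: "0 < a" "0 < b" using r by (auto simp: is_root_def)
  have "b * b \<le> 1" using le1 by simp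
  then have b: "b = 1" using pos by (cases b) auto
  then have "a * d = 0" using le1 by simp
  then have "d = 0" using pos(1) by simp
  then show ?thesis using a b by simp
qed

lemma is_root_simple: "0 < m \<Longrightarrow> is_root m m 1" "0 < m \<Longrightarrow> is_root m 1 m"
  by (simp_all add: is_root_def)

lemma quadrant_reflect:
  assumes ab: "0 < a" "0 < b" "coprime a b"
  shows "a < m * b \<Longrightarrow> weq m (qword n e a b) (qword n (\<not> e) (m * b - a) b)"
    "b < m * a \<Longrightarrow> weq m (qword n e a b) (qword (if e then n + 1 else n - 1) (\<not> e) a (m * a - b))"
proof -
  assume lt: "a < m * b"
  have p: "0 < m * b - a" "m * b - a < m * b" "m * b - (m * b - a) = a" using ab lt by auto
  show "weq m (qword n e a b) (qword n (\<not> e) (m * b - a) b)"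
    using weq_conj[OF weq_sym[OF v0_v1_reflect[OF ab(1,2) lt ab(3)]]]
      weq_conj[OF v0_v1_reflect[OF p(1) ab(2) p(2) coprime_reflect[OF ab(3) lt]]] p(3)
    by (cases e) (simp_all add: qword_def)
next
  assume lt: "b < m * a"
  have p: "0 < m * a - b" "m * a - b < m * a" "m * a - (m * a - b) = b" using ab lt by auto
  have cop: "coprime a (m * a - b)" using coprime_reflect[of b a m] ab lt by (simp add: coprime_commute)
  show "weq m (qword n e a b) (qword (if e then n + 1 else n - 1) (\<not> e) a (m * a - b))"
    using quadrant_step_v0[OF v1_v0_reflect[OF ab(1) p(1,2) cop], of n] p(3)
      weq_sym[OF quadrant_step_v0[OF v1_v0_reflect[OF ab(1,2) lt ab(3)], of "n - 1"]]
    by (cases e) (simp_all add: qword_def)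
qed

lemma root_reflections:
  assumes r: "is_root m a b" and m: "0 < m"
  obtains a' b' where "is_root m a' b'" "\<And>n e. weq m (qword n e a b) (qword n (\<not> e) a' b')"
proof (cases "a < m * b")
  case True
  have ab: "0 < a" "0 < b" "coprime a b" using r by (auto simp: is_root_def)
  show thesis by (rule that[OF is_root_reflect[OF r True] quadrant_reflect(1)[OF ab True]])
next
  case False
  then have e: "a = m" "b = 1" using is_root_large[OF r] by auto
  have "weq m (v0 m 1) (v1 m 1)" by (rule weq_trans[OF simple_root_words(1)[OF m] weq_sym[OF simple_root_words(2)[OF m]]])
  from weq_conj[OF this] weq_conj[OF weq_sym[OF this]]
  have "weq m (qword n e' a b) (qword n (\<not> e') m 1)" for n e'
    using e by (cases e') (simp_all add: qword_def)
  then show thesis by (rule that[OF is_root_simple(1)[OF m]])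
qed

lemma root_reflections':
  assumes r: "is_root m a b" and m: "0 < m"
  obtains a' b' where "is_root m a' b'"
    "\<And>n e. weq m (qword n e a b) (qword (if e then n + 1 else n - 1) (\<not> e) a' b')"
proof (cases "b < m * a")
  case True
  have ab: "0 < a" "0 < b" "coprime a b" using r by (auto simp: is_root_def)
  show thesis
    by (rule that[OF is_root_sym[OF is_root_reflect[OF is_root_sym[OF r] True]] quadrant_reflect(2)[OF ab True]])
next
  case False
  then have e: "b = m" "a = 1" using is_root_large[OF is_root_sym[OF r]] by auto
  have "weq m ([I3, I2, I1] @ v0 1 m @ [I1, I2, I3]) ([I3, I2, I1] @ [I1] @ [I1, I2, I3])"
    by (rule weq_cong3[OF simple_root_words(3)[OF m]])
  also have "weq m \<dots> [I3, I2, I1, I2, I3]" by (rule weq_free_red) (simp add: free_red_def)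
  finally have w: "weq m (v1 1 m) ([I3, I2, I1] @ v0 1 m @ [I1, I2, I3])"
    by (rule weq_trans[OF simple_root_words(4)[OF m] weq_sym])
  have "weq m (qword n e' a b) (qword (if e' then n + 1 else n - 1) (\<not> e') 1 m)" for n e'
    using quadrant_step_v0[OF w, of n] weq_sym[OF quadrant_step_v0[OF w, of "n - 1"]] e
    by (cases e') (simp_all add: qword_def)
  then show thesis by (rule that[OF is_root_simple(2)[OF m]])
qed

lemma root_element_weq: "weq m u v \<Longrightarrow> root_element m v \<Longrightarrow> root_element m u"
  unfolding root_element_def by (blast intro: weq_trans)

text \<open>The two walls of a sector are crossed by replacing the root by its reflections, until the
  sector is the quadrant itself.\<close>

lemma root_quadrant:
  assumes m: "0 < m"
  shows "\<forall>a b e. is_root m a b \<longrightarrow> root_element m (qword n e a b)"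
proof -
  have both: "root_element m (qword k e a b)"
    if e': "\<And>a b. is_root m a b \<Longrightarrow> root_element m (qword k e' a b)" and r: "is_root m a b" for k e e' a b
  proof (cases "e = e'")
    case False
    obtain a' b' where r': "is_root m a' b'" "\<And>n e. weq m (qword n e a b) (qword n (\<not> e) a' b')"
      by (rule root_reflections[OF r m]) blast
    have "(\<not> e) = e'" using False by simp
    then show ?thesis using root_element_weq[OF r'(2)] e'[OF r'(1)] by simp
  qed (use that in simp)
  show ?thesis
  proof (induction n rule: int_induct[of _ 0])
    case base
    have "root_element m (qword 0 False a b)" if "is_root m a b" for a b
    proof -
      have "qword 0 False a b = line_word a b" by (simp add: qword_def cox_power_def v0_line_word)
      then show ?thesis unfolding root_element_def using that weq_refl by metis
    qed
    then show ?case using both by blast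
  next
    case (step1 n)
    have "root_element m (qword (n + 1) False a b)" if r: "is_root m a b" for a b
    proof -
      obtain a' b' where r': "is_root m a' b'"
        "\<And>n e. weq m (qword n e a b) (qword (if e then n + 1 else n - 1) (\<not> e) a' b')"
        by (rule root_reflections'[OF r m]) blast
      then show ?thesis using root_element_weq[OF r'(2)[of "n + 1" False]] step1 by simp
    qed
    then show ?case using both by blast
  next
    case (step2 n)
    have "root_element m (qword (n - 1) True a b)" if r: "is_root m a b" for a b
    proof -
      obtain a' b' where r': "is_root m a' b'"
        "\<And>n e. weq m (qword n e a b) (qword (if e then n + 1 else n - 1) (\<not> e) a' b')"
        by (rule root_reflections'[OF r m]) blast
      then show ?thesis using root_element_weq[OF r'(2)[of "n - 1" True]] step2 by simp
    qed
    then show ?case using both by blast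
  qed
qed

lemma quadrant_translate:
  assumes "0 < a" "0 < b" "coprime a b"
  shows "weq m (qword n e (a + m * b) b) (qword n e a b)"
    "weq m (qword n e a (b + m * a)) (qword n e a b)"
proof -
  have cop: "coprime b a" using assms by (simp add: coprime_commute)
  have c1: "coprime (b + m * a) a"
  proof -
    have "gcd (b + m * a) a = gcd b a" by (metis add.commute gcd.commute gcd_add_mult)
    then show ?thesis using cop by (simp add: coprime_iff_gcd_eq_1)
  qed
  have t2: "weq m (subst_word X Y (cut_word a (b + m * a))) (subst_word X Y (cut_word a b))"
    if "weq m (wpow Y m) []" for X Y
    using cut_word_translate[OF assms(2,1) cop that, of X]
      subst_cut_word_mirror[OF _ assms(1) c1, of X Y] subst_cut_word_mirror[OF assms(2,1) cop, of X Y] assms by simp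
  have "weq m (v0 (a + m * b) b) (v0 a b)" unfolding v0_def
    by (intro weq_append weq_refl cut_word_translate assms weq_order)
  moreover have "weq m (v1 (a + m * b) b) (v1 a b)" unfolding v1_def
    by (intro weq_append weq_refl cut_word_translate assms weq_order)
  ultimately show "weq m (qword n e (a + m * b) b) (qword n e a b)"
    unfolding qword_def using weq_conj by (cases e) auto
  have "weq m (v0 a (b + m * a)) (v0 a b)" unfolding v0_def
    by (intro weq_append weq_refl t2 weq_order)
  moreover have "weq m (v1 a (b + m * a)) (v1 a b)" unfolding v1_def
    by (intro weq_append weq_refl t2 weq_order)
  ultimately show "weq m (qword n e a (b + m * a)) (qword n e a b)"
    unfolding qword_def using weq_conj by (cases e) auto
qed

text \<open>A pair that is not a root is shortened: by a translation if one coordinate exceeds \<open>m\<close> times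
  the other, and otherwise by the reflection that moves the larger coordinate, since the norm is
  positive. All sectors have to be treated together, because a reflection changes the sector.\<close>

lemma quadrant_root_element:
  assumes m: "2 \<le> m"
  shows "0 < a \<Longrightarrow> 0 < b \<Longrightarrow> coprime a b \<Longrightarrow> root_element m (qword n e a b)"
proof (induction "a + b" arbitrary: a b n e rule: less_induct)
  case less
  note ab = less.prems
  have m0: "0 < m" using m by simp
  have copd: "coprime (x - m * y) y" if "coprime x y" "m * y < x" for x y
  proof -
    have "gcd x y = gcd (x - m * y) y"
      using that(2) gcd_add_mult[of y m "x - m * y"] by (simp add: gcd.commute)
    then show ?thesis using that(1) by (simp add: coprime_iff_gcd_eq_1)
  qed
  show ?case
  proof (cases "is_root m a b")
    case True
    then show ?thesis using root_quadrant[OF m0, of n] by blast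
  next
    case nr: False
    have "x = 1" if "y = m * x" "coprime x y" for x y using that by simp
    then have ne: "a \<noteq> m * b" "b \<noteq> m * a"
      using nr ab is_root_simple[OF m0] by (metis coprime_commute mult.right_neutral)+
    consider "m * b < a" | "m * a < b" | "a < m * b" "b < m * a" using ne by linarith
    then show ?thesis
    proof cases
      case 1
      have c: "coprime (a - m * b) b" by (rule copd[OF ab(3) 1])
      have "0 < m * b" using m ab by simp
      then have "root_element m (qword n e (a - m * b) b)"
        using less.hyps[of "a - m * b" b n e] 1 ab c by simp
      moreover have "weq m (qword n e a b) (qword n e (a - m * b) b)"
        using quadrant_translate(1)[of "a - m * b" b m n e] 1 ab c by simp
      ultimately show ?thesis using root_element_weq by blast
    next
      case 2
      have c: "coprime (b - m * a) a" by (rule copd[OF _ 2]) (use ab in \<open>simp add: coprime_commute\<close>)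
      then have c': "coprime a (b - m * a)" by (simp add: coprime_commute)
      have "0 < m * a" using m ab by simp
      then have "root_element m (qword n e a (b - m * a))"
        using less.hyps[of a "b - m * a" n e] 2 ab c' by simp
      moreover have "weq m (qword n e a b) (qword n e a (b - m * a))"
        using quadrant_translate(2)[of a "b - m * a" m n e] 2 ab c' by simp
      ultimately show ?thesis using root_element_weq by blast
    next
      case 3
      have q: "int m * int a * int b + 1 < int a * int a + int b * int b"
        using nr ab by (simp add: is_root_int)
      have small: "int m * int y - int x < int x" if "int y \<le> int x" "0 < x" "int m * int x * int y + 1 < int x * int x + int y * int y" for x y
      proof -
        have "int x * (int m * int y - int x) < int y * int y" using that(3) by (simp add: algebra_simps)
        also have "\<dots> \<le> int x * int x" using that(1) by (intro mult_mono) auto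
        finally show ?thesis using that(2) by (simp add: mult_less_cancel_left)
      qed
      show ?thesis
      proof (cases "b \<le> a")
        case True
        have lt: "m * b - a < a"
          using small[of b a] True ab q 3 by (simp add: of_nat_diff flip: of_nat_mult)
        have "root_element m (qword n' e' (m * b - a) b)" for n' e'
          by (rule less.hyps) (use lt 3 ab coprime_reflect in auto)
        then show ?thesis using quadrant_reflect(1)[OF ab 3(1)] root_element_weq by blast
      next
        case False
        have q': "int m * int b * int a + 1 < int b * int b + int a * int a" using q by (simp add: algebra_simps)
        have lt: "m * a - b < b"
          using small[of a b] False ab q' 3 by (simp add: of_nat_diff flip: of_nat_mult)
        have "root_element m (qword n' e' a (m * a - b))" for n' e'
          by (rule less.hyps) (use lt 3 ab coprime_reflect[of b a m] in \<open>auto simp: coprime_commute\<close>)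
        then show ?thesis using quadrant_reflect(2)[OF ab 3(2)] root_element_weq by blast
      qed
    qed
  qed
qed

definition in_quadrant :: "nat \<Rightarrow> idx list \<Rightarrow> bool" where
  "in_quadrant m w \<longleftrightarrow> (\<exists>n e a b. 0 < a \<and> 0 < b \<and> coprime a b \<and> weq m w (qword n e a b))"

lemma in_quadrant_weq: "weq m u v \<Longrightarrow> in_quadrant m v \<Longrightarrow> in_quadrant m u"
proof -
  assume uv: "weq m u v" and "in_quadrant m v"
  then obtain n e a b where q: "0 < a" "0 < b" "coprime a b" "weq m v (qword n e a b)"
    unfolding in_quadrant_def by blast
  then show "in_quadrant m u" unfolding in_quadrant_def using weq_trans[OF uv q(4)] by blast
qed

lemma in_quadrant_conj:
  assumes "in_quadrant m w"
  shows "in_quadrant m ([I3, I2, I1] @ w @ [I1, I2, I3])" "in_quadrant m ([I1, I2, I3] @ w @ [I3, I2, I1])"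
proof -
  obtain n e a b where q: "0 < a" "0 < b" "coprime a b" "weq m w (qword n e a b)"
    using assms unfolding in_quadrant_def by blast
  show "in_quadrant m ([I3, I2, I1] @ w @ [I1, I2, I3])" "in_quadrant m ([I1, I2, I3] @ w @ [I3, I2, I1])"
    unfolding in_quadrant_def using q(1-3) quadrant_conj[OF q(4)] by blast+
qed

lemma v1_conj: "weq m (qword (- 1) True a b) ([I1, I2] @ subst_word w23 w12 (cut_word a b) @ [I1])"
proof -
  have s: "weq m ([I2] @ subst_word w32 w21 (cut_word a b) @ [I2]) (subst_word w23 w12 (cut_word a b))"
    by (rule weq_conj_subst; rule weq_free_red; simp add: free_red_def)
  have "weq m (qword (- 1) True a b) ([I1, I2, I3, I3, I2] @ subst_word w32 w21 (cut_word a b) @ [I3, I2, I2, I3, I2, I1])"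
    by (simp add: qword_def cox_power_def v1_def)
  also have "weq m \<dots> ([I1, I2, I2] @ subst_word w32 w21 (cut_word a b) @ [I2, I1])"
    by (intro weq_append weq_refl weq_free_red) (simp_all add: free_red_def)
  also have "\<dots> = [I1, I2] @ ([I2] @ subst_word w32 w21 (cut_word a b) @ [I2]) @ [I1]" by simp
  also have "weq m \<dots> ([I1, I2] @ subst_word w23 w12 (cut_word a b) @ [I1])" by (rule weq_cong3[OF s])
  finally show ?thesis .
qed

lemma next_interleave:
  assumes "set u \<subseteq> {I1, I3}"
  shows "map next_idx (interleave u) = [I3] @ subst_word [I1, I3] [I2, I3] u"
    "map next_idx (map next_idx (interleave u)) = [I1] @ subst_word [I2, I1] [I3, I1] u"
  using assms by (induction u) (auto simp: interleave_def)

text \<open>By \<open>cut_word_sector\<close> the word with rotated labels is, up to its ends, a substitution instance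
  of the cutting word of \<open>(a + b, a)\<close>; after two rotations it is one of that of \<open>(b, a + b)\<close>.\<close>

lemma sector_right:
  assumes ab: "0 < a" "0 < b" "coprime a b"
  shows "weq m (I1 # map next_idx (line_word a b) @ [I1]) (qword (- 1) True (a + b) a)"
proof -
  have "weq m (qword (- 1) True (a + b) a) ([I1, I2] @ subst_word w23 w12 (cut_word (a + b) a) @ [I1])"
    by (rule v1_conj)
  also have "subst_word w23 w12 (cut_word (a + b) a) = w23 @ subst_word (w12 @ w23) w23 (cut_word a b)"
    by (rule cut_word_sector[OF ab])
  also have "weq m ([I1, I2] @ (w23 @ subst_word (w12 @ w23) w23 (cut_word a b)) @ [I1])
      ([I1, I2] @ (w23 @ subst_word [I1, I3] [I2, I3] (cut_word a b)) @ [I1])"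
    by (intro weq_append weq_refl weq_subst_word weq_free_red) (simp add: free_red_def)
  also have "\<dots> = [I1, I2, I2, I3] @ subst_word [I1, I3] [I2, I3] (cut_word a b) @ [I1]" by simp
  also have "weq m \<dots> ([I1, I3] @ subst_word [I1, I3] [I2, I3] (cut_word a b) @ [I1])"
    by (intro weq_append weq_refl weq_free_red) (simp add: free_red_def)
  finally show ?thesis using next_interleave(1)[OF set_cut_word] weq_sym by simp
qed

lemma sector_right2:
  assumes ab: "0 < a" "0 < b" "coprime a b"
  shows "weq m ([I1, I2] @ map next_idx (map next_idx (line_word a b)) @ [I2, I1]) (qword (- 1) True b (a + b))"
proof -
  have cop: "coprime b a" using ab by (simp add: coprime_commute)
  have cop': "coprime (a + b) b" using cop coprime_add_self[of b a] by (simp add: coprime_commute add.commute)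
  have pos: "0 < a + b" using ab by simp
  have s: "weq m ([I2] @ subst_word [I2, I1] [I3, I1] (cut_word a b) @ [I2]) (subst_word w12 (w23 @ w12) (cut_word a b))"
    by (rule weq_conj_subst; rule weq_free_red; simp add: free_red_def)
  have "weq m (qword (- 1) True b (a + b)) ([I1, I2] @ subst_word w23 w12 (cut_word b (a + b)) @ [I1])"
    by (rule v1_conj)
  also have "subst_word w23 w12 (cut_word b (a + b)) = subst_word w12 w23 (cut_word (a + b) b)"
    by (rule subst_cut_word_mirror[OF pos ab(2) cop'])
  also have "\<dots> = w12 @ subst_word (w23 @ w12) w12 (cut_word b a)"
    using cut_word_sector[OF ab(2,1) cop] by (simp add: add.commute)
  also have "subst_word (w23 @ w12) w12 (cut_word b a) = subst_word w12 (w23 @ w12) (cut_word a b)"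
    by (rule subst_cut_word_mirror[OF ab])
  also have "weq m ([I1, I2] @ (w12 @ subst_word w12 (w23 @ w12) (cut_word a b)) @ [I1])
     ([I1, I2] @ (w12 @ ([I2] @ subst_word [I2, I1] [I3, I1] (cut_word a b) @ [I2])) @ [I1])"
    by (intro weq_append weq_refl weq_sym[OF s])
  also have "\<dots> = [I1, I2, I1, I2, I2] @ subst_word [I2, I1] [I3, I1] (cut_word a b) @ [I2, I1]" by simp
  also have "weq m \<dots> ([I1, I2, I1] @ subst_word [I2, I1] [I3, I1] (cut_word a b) @ [I2, I1])"
    by (intro weq_append weq_refl weq_free_red) (simp add: free_red_def)
  finally show ?thesis using next_interleave(2)[OF set_cut_word] weq_sym by simp
qed

lemma next_idx_cube: "map next_idx (map next_idx (map next_idx w)) = w"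
proof -
  have "next_idx (next_idx (next_idx i)) = i" for i by (cases i) simp_all
  then show ?thesis by (simp add: map_idI o_def)
qed

text \<open>Three rotations of the labels amount to a conjugation by \<open>s\<^sub>1 s\<^sub>2 s\<^sub>3\<close>, which permutes the
  sectors. So only the lines and their images under one and two rotations need to be placed.\<close>

lemma spiral_in_quadrant:
  assumes m: "0 < m"
  shows "spiral w \<Longrightarrow> in_quadrant m w \<and> in_quadrant m (I1 # map next_idx w @ [I1]) \<and>
    in_quadrant m ([I1, I2] @ map next_idx (map next_idx w) @ [I2, I1])"
proof (induction rule: spiral.induct)
  case (spiral_line a b)
  have "weq m (line_word a b) (qword 0 False a b)"
    by (simp add: qword_def cox_power_def v0_line_word)
  moreover have "coprime (a + b) a" "coprime b (a + b)"
    using spiral_line coprime_add_self[of a b] coprime_add_self[of b a] by (simp_all add: coprime_commute add.commute)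
  moreover have "0 < a + b" using spiral_line by simp
  ultimately show ?case
    using sector_right[OF spiral_line, of m] sector_right2[OF spiral_line, of m] spiral_line
    unfolding in_quadrant_def by blast
next
  have i3: "in_quadrant m [I3]"
  proof -
    have "weq m [I3] (qword 0 False m 1)"
      using weq_sym[OF simple_root_words(1)[OF m]] by (simp add: qword_def cox_power_def)
    then show ?thesis unfolding in_quadrant_def using m by (metis coprime_1_right zero_less_one)
  qed
  have i1: "in_quadrant m [I1]"
  proof -
    have "weq m [I1] (qword 0 False 1 m)"
      using weq_sym[OF simple_root_words(3)[OF m]] by (simp add: qword_def cox_power_def)
    then show ?thesis unfolding in_quadrant_def using m by (metis coprime_1_left zero_less_one)
  qed
  have i121: "in_quadrant m [I1, I2, I1]"
  proof -
    have "weq m (qword (- 1) True 1 1) ([I1, I2] @ subst_word w23 w12 (cut_word 1 1) @ [I1])" by (rule v1_conj)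
    then have "weq m [I1, I2, I1] (qword (- 1) True 1 1)" using weq_sym by (simp add: cut_word_def)
    then show ?thesis unfolding in_quadrant_def by (metis coprime_1_left zero_less_one)
  qed
  have i12321: "in_quadrant m [I1, I2, I3, I2, I1]"
  proof -
    have "weq m [I1, I2, I3, I2, I1] ([I1, I2, I3] @ [I3] @ [I3, I2, I1])"
      by (rule weq_free_red) (simp add: free_red_def)
    then show ?thesis using in_quadrant_conj(2)[OF i3] in_quadrant_weq by blast
  qed
  {
    case spiral_I1
    show ?case using i1 i121 i12321 by simp
  next
    case spiral_I3
    have "weq m [I1, I1, I1] [I1]" "weq m [I1, I2, I2, I2, I1] [I1, I2, I1]"
      by (rule weq_free_red, simp add: free_red_def)+
    then show ?case using i1 i3 i121 in_quadrant_weq by auto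
  }
next
  case (spiral_right w)
  have "[I1, I2] @ map next_idx (map next_idx (I1 # map next_idx w @ [I1])) @ [I2, I1] = [I1, I2, I3] @ w @ [I3, I2, I1]"
    using next_idx_cube[of w] by simp
  moreover have "I1 # map next_idx (I1 # map next_idx w @ [I1]) @ [I1] = [I1, I2] @ map next_idx (map next_idx w) @ [I2, I1]"
    by simp
  ultimately show ?case using spiral_right in_quadrant_conj(2)[of m w] by simp
next
  case (spiral_left w)
  let ?L = "I3 # map prev_idx w @ [I3]"
  have np: "map next_idx (map prev_idx w) = w" by (simp add: o_def)
  have 1: "weq m (I1 # map next_idx ?L @ [I1]) w"
  proof -
    have "I1 # map next_idx ?L @ [I1] = [I1, I1] @ w @ [I1, I1]"
      by (simp only: list.map map_append np next_idx.simps append.simps append_assoc)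
    moreover have "weq m ([I1, I1] @ w @ [I1, I1]) ([] @ w @ [])"
      by (intro weq_append weq_refl weq_free_red) (simp_all add: free_red_def)
    ultimately show ?thesis by simp
  qed
  have 2: "weq m ([I1, I2] @ map next_idx (map next_idx ?L) @ [I2, I1]) (I1 # map next_idx w @ [I1])"
  proof -
    have "[I1, I2] @ map next_idx (map next_idx ?L) @ [I2, I1] = [I1, I2, I2] @ map next_idx w @ [I2, I2, I1]"
      by (simp only: list.map map_append np next_idx.simps append.simps append_assoc)
    moreover have "weq m ([I1, I2, I2] @ map next_idx w @ [I2, I2, I1]) ([I1] @ map next_idx w @ [I1])"
      by (intro weq_append weq_refl weq_free_red) (simp_all add: free_red_def)
    ultimately show ?thesis by (simp only: append.simps)
  qed
  have 3: "weq m ?L ([I3, I2, I1] @ ([I1, I2] @ map next_idx (map next_idx w) @ [I2, I1]) @ [I1, I2, I3])"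
  proof -
    have "map prev_idx w = map next_idx (map next_idx w)"
    proof -
      have "prev_idx i = next_idx (next_idx i)" for i by (cases i) simp_all
      then show ?thesis by simp
    qed
    then have "?L = [I3] @ map next_idx (map next_idx w) @ [I3]" by simp
    also have "weq m \<dots> ([I3, I2, I1, I1, I2] @ map next_idx (map next_idx w) @ [I2, I1, I1, I2, I3])"
      by (intro weq_append weq_refl weq_free_red) (simp_all add: free_red_def)
    finally show ?thesis by simp
  qed
  show ?case
    using in_quadrant_weq[OF 1] in_quadrant_weq[OF 2] in_quadrant_weq[OF 3] in_quadrant_conj(1) spiral_left by blast
qed

theorem spiral_root_element:
  assumes m: "2 \<le> m" and w: "spiral w"
  shows "root_element m w"
proof -
  have "in_quadrant m w" using spiral_in_quadrant[OF _ w, of m] m by simp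
  then show ?thesis unfolding in_quadrant_def using quadrant_root_element[OF m] root_element_weq by blast
qed

section \<open>Distinct roots have distinct reflections\<close>

text \<open>Normal forms in the free product of two cyclic groups of order \<open>m\<close>: lists of syllables.\<close>

fun push_syl :: "nat \<Rightarrow> 'a \<Rightarrow> ('a \<times> nat) list \<Rightarrow> ('a \<times> nat) list" where
  "push_syl m x [] = [(x, 1)]"
| "push_syl m x ((y, n) # s) = (if x = y then if Suc n = m then s else (x, Suc n) # s else (x, 1) # (y, n) # s)"

definition syl_normal :: "nat \<Rightarrow> ('a \<times> nat) list \<Rightarrow> bool" where
  "syl_normal m s \<longleftrightarrow> distinct_adj (map fst s) \<and> (\<forall>(x, n) \<in> set s. 0 < n \<and> n < m)"

text \<open>The inverse of \<open>push_syl m x\<close>, which is a permutation of order \<open>m\<close> of the normal forms.\<close>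

definition pop_syl :: "nat \<Rightarrow> 'a \<Rightarrow> ('a \<times> nat) list \<Rightarrow> ('a \<times> nat) list" where
  "pop_syl m x = push_syl m x ^^ (m - 1)"

definition expand_syl :: "('a \<times> nat) list \<Rightarrow> 'a list" where
  "expand_syl s = concat (map (\<lambda>(x, n). replicate n x) s)"

lemma syl_normal_Nil [simp]: "syl_normal m []"
  by (simp add: syl_normal_def)

lemma syl_normal_Cons: "syl_normal m ((x, n) # s) \<longleftrightarrow>
   0 < n \<and> n < m \<and> syl_normal m s \<and> (s = [] \<or> fst (hd s) \<noteq> x)"
  by (cases s) (auto simp: syl_normal_def distinct_adj_Cons)

lemma push_syl_normal: "2 \<le> m \<Longrightarrow> syl_normal m s \<Longrightarrow> syl_normal m (push_syl m x s)"
  by (cases s) (auto simp: syl_normal_Cons)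

lemma push_syl_funpow_normal: "2 \<le> m \<Longrightarrow> syl_normal m s \<Longrightarrow> syl_normal m ((push_syl m x ^^ n) s)"
  by (induction n) (auto intro: push_syl_normal)

lemma push_syl_funpow:
  assumes "2 \<le> m" "s = [] \<or> fst (hd s) \<noteq> x" "0 < n" "n < m"
  shows "(push_syl m x ^^ n) s = (x, n) # s"
  using assms(3,4)
proof (induction n)
  case (Suc n)
  have one: "push_syl m x s = (x, 1) # s" using assms(2) by (cases s) auto
  show ?case using Suc one by (cases "n = 0") auto
qed simp

lemma push_syl_order:
  assumes m: "2 \<le> m" and s: "syl_normal m s"
  shows "(push_syl m x ^^ m) s = s"
proof -
  have full: "(push_syl m x ^^ m) t = t" if "t = [] \<or> fst (hd t) \<noteq> x" for t
  proof -
    have e: "Suc (m - 1) = m" using m by simp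
    have "(push_syl m x ^^ Suc (m - 1)) t = push_syl m x ((push_syl m x ^^ (m - 1)) t)"
      by (simp only: funpow.simps o_apply)
    also have "\<dots> = push_syl m x ((x, m - 1) # t)"
      using push_syl_funpow[OF m that, of "m - 1"] m by simp
    also have "\<dots> = t" using e by simp
    finally show ?thesis unfolding e .
  qed
  show ?thesis
  proof (cases "s = [] \<or> fst (hd s) \<noteq> x")
    case True
    then show ?thesis by (rule full)
  next
    case False
    then obtain n t where st: "s = (x, n) # t" by (cases s) auto
    have n: "0 < n" "n < m" "t = [] \<or> fst (hd t) \<noteq> x" using s unfolding st syl_normal_Cons by auto
    have "(push_syl m x ^^ m) s = (push_syl m x ^^ m) ((push_syl m x ^^ n) t)"
      using push_syl_funpow[OF m n(3,1,2)] st by simp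
    also have "\<dots> = (push_syl m x ^^ n) ((push_syl m x ^^ m) t)"
      by (metis add.commute comp_apply funpow_add)
    also have "\<dots> = s" using full[OF n(3)] push_syl_funpow[OF m n(3,1,2)] st by simp
    finally show ?thesis .
  qed
qed

lemma push_pop_syl:
  assumes "2 \<le> m" "syl_normal m s"
  shows "push_syl m x (pop_syl m x s) = s" "pop_syl m x (push_syl m x s) = s" "(pop_syl m x ^^ m) s = s"
proof -
  have e: "Suc (m - 1) = m" using assms by simp
  have "(push_syl m x ^^ Suc (m - 1)) s = s" using push_syl_order[OF assms] e by simp
  then show "push_syl m x (pop_syl m x s) = s" by (simp add: pop_syl_def)
  have "(push_syl m x ^^ Suc (m - 1)) s = s" using push_syl_order[OF assms] e by simp
  then show "pop_syl m x (push_syl m x s) = s" by (simp add: pop_syl_def funpow_swap1)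
  have "(push_syl m x ^^ (m * n)) s = s" for n
  proof (induction n)
    case (Suc n)
    have "(push_syl m x ^^ (m * Suc n)) s = (push_syl m x ^^ m) ((push_syl m x ^^ (m * n)) s)"
      by (simp add: funpow_add)
    then show ?case using Suc push_syl_order[OF assms] by simp
  qed simp
  then have "(push_syl m x ^^ (m * (m - 1))) s = s" .
  then show "(pop_syl m x ^^ m) s = s" by (simp add: pop_syl_def funpow_mult mult.commute)
qed

text \<open>The Coxeter group acts on two copies of the normal forms; \<open>s\<^sub>2\<close> exchanges the copies, and
  \<open>s\<^sub>2 s\<^sub>1\<close>, \<open>s\<^sub>2 s\<^sub>3\<close> multiply by the two generators on one copy and by their inverses on the other.\<close>

fun syl_act :: "nat \<Rightarrow> idx \<Rightarrow> (idx \<times> nat) list \<times> bool \<Rightarrow> (idx \<times> nat) list \<times> bool" where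
  "syl_act m I2 (s, e) = (s, \<not> e)"
| "syl_act m i (s, True) = (push_syl m i s, False)"
| "syl_act m i (s, False) = (pop_syl m i s, True)"

definition syl_state :: "nat \<Rightarrow> (idx \<times> nat) list \<times> bool \<Rightarrow> bool" where
  "syl_state m p \<longleftrightarrow> syl_normal m (fst p)"

lemma syl_act_state: "2 \<le> m \<Longrightarrow> syl_state m p \<Longrightarrow> syl_state m (syl_act m i p)"
  by (cases p; cases i; cases "snd p")
    (auto simp: syl_state_def pop_syl_def intro: push_syl_normal push_syl_funpow_normal)

lemma syl_act_word_state: "2 \<le> m \<Longrightarrow> syl_state m p \<Longrightarrow> syl_state m (foldr (syl_act m) u p)"
  by (induction u) (auto intro: syl_act_state)

lemma syl_act_involution: "2 \<le> m \<Longrightarrow> syl_state m p \<Longrightarrow> syl_act m i (syl_act m i p) = p"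
  by (cases p; cases i; cases "snd p") (auto simp: syl_state_def push_pop_syl)

lemma syl_act_order:
  assumes m: "2 \<le> m" and p: "syl_state m p" and i: "i \<noteq> I2"
  shows "foldr (syl_act m) (wpow [i, I2] n) p =
      (if snd p then ((pop_syl m i ^^ n) (fst p), True) else ((push_syl m i ^^ n) (fst p), False))"
proof (induction n)
  case (Suc n)
  then show ?case using i by (cases i) (auto simp: funpow_swap1)
qed (cases p, simp)

lemma syl_act_order':
  assumes m: "2 \<le> m" and p: "syl_state m p" and i: "i \<noteq> I2"
  shows "foldr (syl_act m) (wpow [I2, i] n) p =
      (if snd p then ((push_syl m i ^^ n) (fst p), True) else ((pop_syl m i ^^ n) (fst p), False))"
proof (induction n)
  case (Suc n)
  then show ?case using i by (cases i) (auto simp: funpow_swap1)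
qed (cases p, simp)

lemma syl_act_pres_cong:
  assumes m: "2 \<le> m"
  shows "pres_cong (W_relators m) u v \<Longrightarrow> syl_state m p \<Longrightarrow>
     foldr (syl_act m) (map fst u) p = foldr (syl_act m) (map fst v) p"
proof (induction arbitrary: p rule: pres_cong.induct)
  case (pc_cancel u x e v)
  have "syl_state m (foldr (syl_act m) (map fst v) p)" by (rule syl_act_word_state[OF m pc_cancel])
  then show ?case by (simp add: syl_act_involution[OF m])
next
  case (pc_relator r u v)
  define q where "q = foldr (syl_act m) (map fst v) p"
  have q: "syl_state m q" unfolding q_def by (rule syl_act_word_state[OF m pc_relator(2)])
  have g: "map fst (concat (replicate n (gen_word w))) = wpow w n" for n w
    by (induction n) (simp_all add: o_def)
  have "foldr (syl_act m) (map fst r) q = q"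
  proof -
    have "r \<in> {gen_word [I1, I1], gen_word [I2, I2], gen_word [I3, I3]} \<or>
        r = concat (replicate m (gen_word [I1, I2])) \<or> r = concat (replicate m (gen_word [I2, I3]))"
      using pc_relator(1) unfolding W_relators_def by blast
    then show ?thesis
    proof (elim disjE)
      assume "r \<in> {gen_word [I1, I1], gen_word [I2, I2], gen_word [I3, I3]}"
      then show ?thesis using syl_act_involution[OF m q] by auto
    next
      assume r: "r = concat (replicate m (gen_word [I1, I2]))"
      have "foldr (syl_act m) (map fst r) q = foldr (syl_act m) (wpow [I1, I2] m) q"
        unfolding r g ..
      also have "\<dots> = q"
        using syl_act_order[OF m q, of I1 m] push_syl_order[OF m] push_pop_syl(3)[OF m] q
        by (cases q) (auto simp: syl_state_def)
      finally show ?thesis .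
    next
      assume r: "r = concat (replicate m (gen_word [I2, I3]))"
      have "foldr (syl_act m) (map fst r) q = foldr (syl_act m) (wpow [I2, I3] m) q"
        unfolding r g ..
      also have "\<dots> = q"
        using syl_act_order'[OF m q, of I3 m] push_syl_order[OF m] push_pop_syl(3)[OF m] q
        by (cases q) (auto simp: syl_state_def)
      finally show ?thesis .
    qed
  qed
  then show ?case by (simp add: q_def)
qed auto

lemma syl_act_weq:
  assumes "2 \<le> m" "weq m u v" "syl_state m p"
  shows "foldr (syl_act m) u p = foldr (syl_act m) v p"
  using syl_act_pres_cong[OF assms(1), of "gen_word u" "gen_word v" p] assms by (simp add: weq_def o_def)

definition nf :: "nat \<Rightarrow> 'a list \<Rightarrow> ('a \<times> nat) list" where
  "nf m u = foldr (push_syl m) u []"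

lemma nf_normal: "2 \<le> m \<Longrightarrow> syl_normal m (nf m u)"
  by (induction u) (auto simp: nf_def intro: push_syl_normal)

lemma syl_act_subst:
  assumes "set u \<subseteq> {I1, I3}"
  shows "foldr (syl_act m) (subst_word w23 w21 u @ [I2]) ([], False) = (nf m u, True)"
  using assms by (induction u) (auto simp: nf_def)

text \<open>The action on the empty normal form recovers the normal form of a word from the group element.\<close>

lemma nf_weq:
  assumes "2 \<le> m" "set u \<subseteq> {I1, I3}" "set v \<subseteq> {I1, I3}"
    "weq m (subst_word w23 w21 u @ [I2]) (subst_word w23 w21 v @ [I2])"
  shows "nf m u = nf m v"
  using syl_act_weq[OF assms(1,4), of "([], False)"] syl_act_subst[OF assms(2), of m] syl_act_subst[OF assms(3), of m]
  by (simp add: syl_state_def)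

lemma expand_syl_simps [simp]: "expand_syl [] = []" "expand_syl ((x, n) # s) = replicate n x @ expand_syl s"
  "expand_syl (s @ t) = expand_syl s @ expand_syl t"
  by (simp_all add: expand_syl_def)

lemma nf_expand: "2 \<le> m \<Longrightarrow> syl_normal m s \<Longrightarrow> nf m (expand_syl s) = s"
proof (induction s)
  case (Cons p s)
  obtain x n where p: "p = (x, n)" by (cases p)
  have n: "0 < n" "n < m" "syl_normal m s" "s = [] \<or> fst (hd s) \<noteq> x" using Cons.prems unfolding p syl_normal_Cons by auto
  have "foldr (push_syl m) (replicate n x) t = (push_syl m x ^^ n) t" for t by (induction n) simp_all
  then have "nf m (expand_syl (p # s)) = (push_syl m x ^^ n) (nf m (expand_syl s))" by (simp add: p nf_def)
  also have "\<dots> = p # s" using push_syl_funpow[OF Cons.prems(1) n(4,1,2)] Cons.IH[OF Cons.prems(1) n(3)] p by simp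
  finally show ?case .
qed (simp add: nf_def)

text \<open>Only a run of \<open>m\<close> equal letters is cancelled when the normal form is built.\<close>

lemma expand_nf:
  assumes m: "2 \<le> m"
  shows "\<forall>xs ys x. u \<noteq> xs @ replicate m x @ ys \<Longrightarrow> expand_syl (nf m u) = u"
proof (induction u)
  case (Cons a u)
  have nr: "\<forall>xs ys x. u \<noteq> xs @ replicate m x @ ys"
    using Cons.prems by (metis append_Cons)
  have IH: "expand_syl (nf m u) = u" using Cons.IH[OF nr] .
  have e: "nf m (a # u) = push_syl m a (nf m u)" by (simp add: nf_def)
  show ?case
  proof (cases "nf m u")
    case Nil
    then show ?thesis using e IH by simp
  next
    case (Cons p t)
    obtain y n where p: "p = (y, n)" by (cases p)
    have u: "u = replicate n y @ expand_syl t" using IH Cons p by simp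
    have "\<not> (a = y \<and> Suc n = m)"
    proof
      assume "a = y \<and> Suc n = m"
      then have "a # u = [] @ replicate m y @ expand_syl t" using u by auto
      then show False using Cons.prems by metis
    qed
    then show ?thesis using e Cons p u by auto
  qed
qed (simp add: nf_def)

lemma count_cut_word:
  assumes "0 < a" "0 < b" "coprime a b"
  shows "count_list (cut_word a b) I1 = b - 1" "length (cut_word a b) = a + b - 2"
proof -
  have c: "count_list (syl_word [I3] [I1] ns) I1 = length ns - 1" for ns
  proof (induction ns)
    case (Cons n ns)
    have w: "count_list (wpow [I3] n) I1 = 0" by (induction n) simp_all
    then show ?case using Cons by (cases "ns = []") (simp_all add: syl_word_Cons)
  qed simp
  show "count_list (cut_word a b) I1 = b - 1"
    unfolding cut_word_syllables[OF assms] c by (simp add: syl_counts_def)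
  show "length (cut_word a b) = a + b - 2" by (simp add: cut_word_def)
qed

text \<open>A run of \<open>n\<close> vertical lines lets the integer part of the abscissa grow by \<open>n\<close>.\<close>

lemma cut_letters_run:
  assumes ab: "0 < a" "0 < b" and run: "\<And>i. i < n \<Longrightarrow> cut_letter a b (j + i) = I3"
  shows "(j + n) * a div (a + b) = j * a div (a + b) + n"
  using run
proof (induction n)
  case (Suc n)
  have N: "0 < a + b" using ab by simp
  have ne: "Suc (j + n) * a div (a + b) \<noteq> (j + n) * a div (a + b)"
    using Suc.prems[of n] by (auto simp: cut_letter_def)
  have "Suc (j + n) * a \<le> (j + n) * a + (a + b) * 1" by simp
  then have "Suc (j + n) * a div (a + b) \<le> ((j + n) * a + (a + b) * 1) div (a + b)" by (rule div_le_mono)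
  also have "\<dots> = (j + n) * a div (a + b) + 1" using N by simp
  finally have "Suc (j + n) * a div (a + b) = (j + n) * a div (a + b) + 1"
    using ne div_le_mono[of "(j + n) * a" "Suc (j + n) * a" "a + b"] by simp
  then show ?case using Suc by simp
qed simp

text \<open>Between the first and the last of \<open>m\<close> consecutive vertical lines the segment rises by \<open>(m - 1)
  b / a \<ge> 1\<close>, so a horizontal line comes in between.\<close>

lemma cut_word_no_run:
  assumes ab: "0 < a" "0 < b" and cop: "coprime a b" and small: "a \<le> (m - 1) * b" and m: "2 \<le> m"
  shows "cut_word a b \<noteq> xs @ replicate m I3 @ ys"
proof
  assume e: "cut_word a b = xs @ replicate m I3 @ ys"
  define N where "N = a + b"
  define j where "j = Suc (length xs)"
  have len: "length xs + m \<le> N - 2" using arg_cong[OF e, of length] count_cut_word(2)[OF ab cop] by (simp add: N_def)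
  have "cut_letter a b (j + i) = I3" if "i < m" for i
  proof -
    have "cut_word a b ! (length xs + i) = I3" unfolding e using that by (simp add: nth_append)
    then show ?thesis using that len by (simp add: cut_word_def j_def N_def)
  qed
  then have r: "(j + m) * a div N = j * a div N + m" unfolding N_def by (rule cut_letters_run[OF ab])
  have N0: "0 < N" using ab by (simp add: N_def)
  have "(j * a div N + m) * N \<le> (j + m) * a" using r by (metis div_times_less_eq_dividend)
  moreover have "j * a < (j * a div N) * N + N" using dividend_less_div_times[OF N0, of "j * a"] by simp
  ultimately have "m * N < m * a + N" by (simp add: algebra_simps)
  then have "m * b < a + b" by (simp add: N_def algebra_simps)
  moreover have "m * b = (m - 1) * b + b" using m by (metis Suc_pred' add.commute mult_Suc pos2 less_le_trans)
  ultimately show False using small by simp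
qed

lemma cut_word_no_start:
  assumes ab: "0 < a" "0 < b" and cop: "coprime a b" and small: "a \<le> (m - 1) * b" and m: "2 \<le> m"
  shows "cut_word a b \<noteq> replicate (m - 1) I3 @ ys"
proof
  assume e: "cut_word a b = replicate (m - 1) I3 @ ys"
  define N where "N = a + b"
  have len: "m - 1 \<le> N - 2" using arg_cong[OF e, of length] count_cut_word(2)[OF ab cop] by (simp add: N_def)
  have "cut_letter a b (1 + i) = I3" if "i < m - 1" for i
  proof -
    have "cut_word a b ! i = I3" unfolding e using that by (simp add: nth_append)
    then show ?thesis using that len by (simp add: cut_word_def N_def)
  qed
  then have r: "(1 + (m - 1)) * a div N = 1 * a div N + (m - 1)" unfolding N_def by (rule cut_letters_run[OF ab])
  moreover have "1 * a div N = 0" using ab by (simp add: N_def)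
  moreover have "1 + (m - 1) = m" using m by simp
  ultimately have "m * a div N = m - 1" by simp
  then have le: "(m - 1) * N \<le> m * a" by (metis div_times_less_eq_dividend)
  moreover have "m * a = (m - 1) * a + a" using m by (metis Suc_pred' add.commute mult_Suc pos2 less_le_trans)
  ultimately have "(m - 1) * b \<le> a" by (simp add: N_def distrib_left)
  then have a: "a = (m - 1) * b" using small by simp
  then have "b dvd gcd a b" by simp
  then have "b = 1" using cop by (simp add: coprime_iff_gcd_eq_1)
  then have "N = m" using a m by (simp add: N_def)
  then show False using len m by simp
qed

lemma cut_word_first:
  assumes ab: "0 < b" "b < a" and cop: "coprime a b"
  obtains u where "cut_word a b = I3 # u" "cut_word a b \<noteq> []" "last (cut_word a b) = I3"
proof -
  have a0: "0 < a" using ab by simp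
  have l: "1 < a + b - 1" using ab by simp
  then have c: "cut_word a b = cut_letter a b 1 # map (cut_letter a b) [2..<a + b - 1]"
    unfolding cut_word_def using upt_conv_Cons[OF l] by (simp add: numeral_2_eq_2)
  have "1 * a mod (a + b) = a" using ab by simp
  then have "cut_letter a b 1 = I3" using cut_letter_alt[of b a 1] ab by simp
  then have 1: "cut_word a b = I3 # map (cut_letter a b) [2..<a + b - 1]" using c by simp
  moreover have "last (cut_word a b) = hd (rev (cut_word a b))" using 1 by (simp add: hd_rev)
  then have "last (cut_word a b) = I3" using rev_cut_word[OF a0 ab(1) cop] 1 by simp
  ultimately show thesis using that by simp
qed

definition root_nf :: "nat \<Rightarrow> nat \<Rightarrow> nat \<Rightarrow> (idx \<times> nat) list" where
  "root_nf m a b = nf m (cut_word a b)"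

lemma subst_word_replicate: "subst_word X Y (replicate n x) = wpow (if x = I3 then X else Y) n"
  by (induction n) simp_all

lemma weq_push_syl:
  assumes m: "2 \<le> m" and XY: "weq m (wpow X m) []" "weq m (wpow Y m) []"
  shows "weq m (subst_word X Y (expand_syl (push_syl m x s))) (subst_word X Y (x # expand_syl s))"
proof (cases s)
  case Nil
  then show ?thesis by simp
next
  case (Cons p t)
  obtain y n where p: "p = (y, n)" by (cases p)
  define Z where "Z = (if y = I3 then X else Y)"
  show ?thesis
  proof (cases "x = y \<and> Suc n = m")
    case True
    have "weq m (wpow Z m @ subst_word X Y (expand_syl t)) ([] @ subst_word X Y (expand_syl t))"
      using XY by (intro weq_append weq_refl) (simp add: Z_def)
    then have 1: "weq m (subst_word X Y (expand_syl t)) (wpow Z m @ subst_word X Y (expand_syl t))"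
      by (simp add: weq_sym)
    have "wpow Z m = Z @ wpow Z n" using True by (metis wpow_simps(2))
    then have 2: "subst_word X Y (x # expand_syl s) = wpow Z m @ subst_word X Y (expand_syl t)"
      using True by (simp add: Cons p subst_word_replicate Z_def)
    have 3: "push_syl m x s = t" using True by (simp add: Cons p)
    show ?thesis unfolding 2 3 by (rule 1)
  next
    case False
    then show ?thesis by (auto simp: Cons p)
  qed
qed

lemma weq_nf:
  assumes m: "2 \<le> m" and XY: "weq m (wpow X m) []" "weq m (wpow Y m) []"
  shows "weq m (subst_word X Y (expand_syl (nf m u))) (subst_word X Y u)"
proof (induction u)
  case (Cons x u)
  have "weq m (subst_word X Y (expand_syl (nf m (x # u)))) (subst_word X Y (x # expand_syl (nf m u)))"
    using weq_push_syl[OF m XY] by (simp add: nf_def)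
  also have "weq m \<dots> (subst_word X Y (x # u))"
    using weq_append[OF weq_refl Cons] by simp
  finally show ?case .
qed (simp add: nf_def)

lemma nf_map: "inj f \<Longrightarrow> nf m (map f u) = map (map_prod f id) (nf m u)"
proof (induction u)
  case (Cons x u)
  have "push_syl m (f x) (map (map_prod f id) s) = map (map_prod f id) (push_syl m x s)" for s
    using Cons.prems by (cases s) (auto dest: injD)
  from this[of "nf m u"] show ?case using Cons by (simp add: nf_def id_def)
qed (simp add: nf_def)

lemma nf_letters: "fst ` set (nf m u) \<subseteq> set u"
proof (induction u)
  case (Cons x u)
  have "fst ` set (push_syl m x s) \<subseteq> insert x (fst ` set s)" for s
    by (cases s) (auto split: if_splits)
  from this[of "nf m u"] have "fst ` set (nf m (x # u)) \<subseteq> insert x (fst ` set (nf m u))" by (simp add: nf_def)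
  then show ?case using Cons by auto
qed (simp add: nf_def)

lemma set_expand_syl: "set (expand_syl s) \<subseteq> fst ` set s"
  by (induction s) auto

lemma root_nf_mirror:
  assumes "0 < a" "0 < b" "coprime a b"
  shows "root_nf m b a = map (map_prod mirror_idx id) (root_nf m a b)"
proof -
  have "inj mirror_idx" by (rule injI) (metis idx_inverses(3))
  then show ?thesis unfolding root_nf_def cut_word_mirror[OF assms] by (rule nf_map)
qed

lemma syl_normal_append: "syl_normal m (s @ t) \<longleftrightarrow>
   syl_normal m s \<and> syl_normal m t \<and> (s = [] \<or> t = [] \<or> fst (last s) \<noteq> fst (hd t))"
  by (auto simp: syl_normal_def distinct_adj_append_iff last_map hd_map)

text \<open>The effect on normal forms of inverting the generator \<open>s\<^sub>2 s\<^sub>3\<close>.\<close>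

definition flip_syl :: "nat \<Rightarrow> (idx \<times> nat) list \<Rightarrow> (idx \<times> nat) list" where
  "flip_syl m = map (\<lambda>(x, n). (x, if x = I3 then m - n else n))"

lemma fst_flip_syl: "map fst (flip_syl m s) = map fst s"
  by (simp add: flip_syl_def case_prod_unfold)

lemma flip_syl_normal: "syl_normal m s \<Longrightarrow> syl_normal m (flip_syl m s)"
  unfolding syl_normal_def fst_flip_syl by (auto simp: flip_syl_def)

lemma flip_syl_flip: "syl_normal m s \<Longrightarrow> flip_syl m (flip_syl m s) = s"
  unfolding syl_normal_def by (auto simp: flip_syl_def intro!: map_idI)

lemma weq_flip_syl:
  assumes "syl_normal m s"
  shows "weq m (subst_word w23 w21 (expand_syl (flip_syl m s))) (subst_word w32 w21 (expand_syl s))"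
  using assms
proof (induction s)
  case (Cons p s)
  obtain x n where p: "p = (x, n)" by (cases p)
  have n: "n < m" "syl_normal m s" using Cons.prems by (auto simp: p syl_normal_Cons)
  have "weq m (wpow w23 (m - n)) (wpow w32 n)"
    by (rule weq_complement[OF weq_order(2) free_red_pairs(1)]) (use n in simp)
  then have "weq m (subst_word w23 w21 (replicate (if x = I3 then m - n else n) x)) (subst_word w32 w21 (replicate n x))"
    by (simp add: subst_word_replicate)
  from weq_append[OF this Cons.IH[OF n(2)]] show ?case by (simp add: p flip_syl_def)
qed (simp add: flip_syl_def)

text \<open>\<open>cut_word_reflect\<close> on normal forms. Nothing cancels at the two ends because the inner normal
  form begins and ends with the other generator.\<close>

lemma root_nf_reflect:
  assumes m: "2 \<le> m" and ab: "0 < a" "0 < b" "coprime a b" "a < m * b"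
    and t: "t = root_nf m (m * b - a) b" "t \<noteq> []" "fst (hd t) \<noteq> I3" "fst (last t) \<noteq> I3"
  shows "root_nf m a b = (I3, m - 1) # flip_syl m t @ [(I3, m - 1)]"
proof -
  define c where "c = m * b - a"
  define s where "s = (I3, m - 1) # flip_syl m t @ [(I3, m - 1)]"
  have c: "0 < c" "c < m * b" "coprime c b" "m * b - c = a" using ab coprime_reflect[OF ab(3,4)] by (auto simp: c_def)
  have tn: "syl_normal m t" unfolding t(1) root_nf_def by (rule nf_normal[OF m])
  have "weq m (w23 @ subst_word w23 w21 (cut_word (m * b - c) b) @ w23) (subst_word w32 w21 (cut_word c b))"
    by (rule cut_word_reflect[OF c(1) ab(2) c(2,3) weq_order(2) free_red_pairs(1)])
  then have "weq m (subst_word w23 w21 (cut_word a b)) (w32 @ subst_word w32 w21 (cut_word c b) @ w32)"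
    unfolding c(4) by (rule weq_cancel_both) (rule weq_inverse_pairs)+
  also have "weq m \<dots> (wpow w23 (m - 1) @ subst_word w23 w21 (expand_syl (flip_syl m t)) @ wpow w23 (m - 1))"
  proof (intro weq_append)
    have "weq m (wpow w23 (m - 1)) (wpow w32 1)"
      by (rule weq_complement[OF weq_order(2) free_red_pairs(1)]) (use m in simp)
    then show "weq m w32 (wpow w23 (m - 1))" "weq m w32 (wpow w23 (m - 1))" by (simp_all add: weq_sym)
    have "weq m (subst_word w23 w21 (expand_syl (flip_syl m t))) (subst_word w32 w21 (cut_word c b))"
      using weq_trans[OF weq_flip_syl[OF tn] weq_nf[OF m weq_order(4) weq_order(3), of "cut_word c b", folded root_nf_def t(1)[folded c_def]]]
      .
    then show "weq m (subst_word w32 w21 (cut_word c b)) (subst_word w23 w21 (expand_syl (flip_syl m t)))" by (rule weq_sym)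
  qed
  also have "\<dots> = subst_word w23 w21 (expand_syl s)" by (simp add: s_def subst_word_replicate)
  finally have "weq m (subst_word w23 w21 (cut_word a b) @ [I2]) (subst_word w23 w21 (expand_syl s) @ [I2])"
    by (intro weq_append weq_refl)
  moreover have "set (expand_syl s) \<subseteq> {I1, I3}"
  proof -
    have "fst ` set (flip_syl m t) = fst ` set t" using arg_cong[OF fst_flip_syl[of m t], of set] by simp
    also have "\<dots> \<subseteq> {I1, I3}" unfolding t(1) root_nf_def by (rule order.trans[OF nf_letters set_cut_word])
    finally have "fst ` set s \<subseteq> {I1, I3}" by (auto simp: s_def)
    then show ?thesis by (rule order.trans[OF set_expand_syl])
  qed
  ultimately have "root_nf m a b = nf m (expand_syl s)"
    unfolding root_nf_def by (rule nf_weq[OF m set_cut_word, rotated -1])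
  also have "\<dots> = s"
  proof (rule nf_expand[OF m])
    have "fst (hd (flip_syl m t)) = fst (hd t)" "fst (last (flip_syl m t)) = fst (last t)" "flip_syl m t \<noteq> []"
      using t(2) by (auto simp: flip_syl_def hd_map last_map case_prod_unfold)
    then show "syl_normal m s" using t(2-4) m flip_syl_normal[OF tn]
      unfolding s_def by (simp add: syl_normal_Cons syl_normal_append hd_append)
  qed
  finally show ?thesis unfolding s_def .
qed

lemma root_nf_multiple: "2 \<le> m \<Longrightarrow> root_nf m m 1 = [(I3, m - 1)]"
proof -
  assume m: "2 \<le> m"
  have w: "cut_word m 1 = replicate (m - 1) I3"
  proof -
    have "wpow [x] n = replicate n x" for x :: idx and n by (induction n) simp_all
    moreover have "syl_counts m 1 = [m - 1]" by (simp add: syl_counts_def syl_count_def)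
    ultimately show ?thesis using cut_word_syllables[of m 1] m by simp
  qed
  have "nf m (expand_syl [(I3, m - 1)]) = [(I3, m - 1)]"
    by (rule nf_expand[OF m]) (use m in \<open>simp add: syl_normal_Cons\<close>)
  then show ?thesis by (simp add: root_nf_def w del: One_nat_def)
qed

lemma expand_root_nf:
  assumes m: "2 \<le> m" and ab: "0 < a" "0 < b" "coprime a b" and small: "a \<le> (m - 1) * b" "b \<le> (m - 1) * a"
  shows "expand_syl (root_nf m a b) = cut_word a b"
  unfolding root_nf_def
proof (rule expand_nf[OF m], intro allI notI)
  fix xs ys x
  assume e: "cut_word a b = xs @ replicate m x @ ys"
  have "x \<in> set (cut_word a b)" unfolding e using m by simp
  then consider "x = I3" | "x = I1" using set_cut_word by blast
  then show False
  proof cases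
    case 1
    then show False using cut_word_no_run[OF ab small(1) m] e by blast
  next
    case 2
    have "cut_word b a = map mirror_idx xs @ replicate m I3 @ map mirror_idx ys"
      unfolding cut_word_mirror[OF ab] e 2 by (simp add: map_replicate_const)
    then show False using cut_word_no_run[OF ab(2,1) _ small(2) m] ab(3) by (simp add: coprime_commute)
  qed
qed

text \<open>For \<open>a \<le> (m - 1) b\<close> the cutting word has no run of \<open>m\<close> letters and does not begin with \<open>m - 1\<close> equal ones.
  Beyond this line the normal form comes from the reflected pair, which satisfies the mirrored
  statement by induction.\<close>

lemma root_nf_shape:
  assumes m: "2 \<le> m"
  shows "is_root m a b \<Longrightarrow> b < a \<Longrightarrow> root_nf m a b \<noteq> [] \<and> fst (hd (root_nf m a b)) = I3 \<and>
    fst (last (root_nf m a b)) = I3 \<and> (snd (hd (root_nf m a b)) = m - 1 \<longleftrightarrow> (m - 1) * b < a)"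
proof (induction "a + b" arbitrary: a b rule: less_induct)
  case less
  have ab: "0 < a" "0 < b" "coprime a b" using less.prems by (auto simp: is_root_def)
  let ?s = "root_nf m a b"
  show ?case
  proof (cases "(m - 1) * b < a")
    case False
    then have s1: "a \<le> (m - 1) * b" by simp
    have "1 * a \<le> (m - 1) * a" using m by (intro mult_le_mono1) linarith
    then have s2: "b \<le> (m - 1) * a" using less.prems(2) by linarith
    have e: "expand_syl ?s = cut_word a b" by (rule expand_root_nf[OF m ab s1 s2])
    have n: "syl_normal m ?s" unfolding root_nf_def by (rule nf_normal[OF m])
    obtain u where u: "cut_word a b = I3 # u" "last (cut_word a b) = I3"
      by (rule cut_word_first[OF ab(2) less.prems(2) ab(3)])
    have ne: "?s \<noteq> []" using e u by auto
    obtain x k t where s: "?s = (x, k) # t" using ne by (metis list.exhaust surj_pair)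
    have k: "0 < k" using n unfolding s syl_normal_Cons by simp
    obtain y l r where s': "?s = r @ [(y, l)]" using ne by (metis rev_exhaust surj_pair)
    have l: "0 < l" using n unfolding s' syl_normal_append by (simp add: syl_normal_Cons)
    have "x = I3" using e u(1) k unfolding s by (cases k) auto
    moreover have "y = I3" using u(2) l unfolding e[symmetric] s' by (cases l) (auto simp: replicate_append_same[symmetric])
    moreover have "k \<noteq> m - 1"
    proof
      assume "k = m - 1"
      then have "cut_word a b = replicate (m - 1) I3 @ expand_syl t" using e s \<open>x = I3\<close> by simp
      then show False using cut_word_no_start[OF ab s1 m] by blast
    qed
    moreover have "hd ?s = (x, k)" "last ?s = (y, l)" using s s' by (metis list.sel(1), metis last_snoc)
    ultimately show ?thesis using False ne by simp
  next
    case large: True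
    show ?thesis
    proof (cases "a < m * b")
      case False
      then have "a = m \<and> b = 1" using is_root_large[OF less.prems(1)] by simp
      then show ?thesis using root_nf_multiple[OF m] m by simp
    next
      case True
      define c where "c = m * b - a"
      have "m * b = (m - 1) * b + b" using m by (metis Suc_pred' add.commute mult_Suc pos2 less_le_trans)
      then have cb: "c < b" using large True unfolding c_def by linarith
      have rc: "is_root m c b" unfolding c_def by (rule is_root_reflect[OF less.prems(1) True])
      then have c: "0 < b" "0 < c" "coprime b c" by (auto simp: is_root_def coprime_commute)
      define s where "s = root_nf m b c"
      have IH: "s \<noteq> []" "fst (hd s) = I3" "fst (last s) = I3"
        using less.hyps[OF _ is_root_sym[OF rc] cb] cb less.prems(2) unfolding s_def by auto
      have cs: "root_nf m c b = map (map_prod mirror_idx id) s" unfolding s_def by (rule root_nf_mirror[OF c])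
      have "?s = (I3, m - 1) # flip_syl m (root_nf m c b) @ [(I3, m - 1)]"
        by (rule root_nf_reflect[OF m ab True]) (use IH cs in \<open>auto simp: c_def hd_map last_map\<close>)
      then show ?thesis using large by simp
    qed
  qed
qed

lemma root_nf_large:
  assumes m: "2 \<le> m" and r: "is_root m a b" and large: "(m - 1) * b < a" and lt: "a < m * b"
  shows "root_nf m a b = (I3, m - 1) # flip_syl m (root_nf m (m * b - a) b) @ [(I3, m - 1)]"
proof -
  have ab: "0 < a" "0 < b" "coprime a b" using r by (auto simp: is_root_def)
  define c where "c = m * b - a"
  have "m * b = (m - 1) * b + b" using m by (metis Suc_pred' add.commute mult_Suc pos2 less_le_trans)
  then have cb: "c < b" using large lt unfolding c_def by linarith
  have rc: "is_root m c b" unfolding c_def by (rule is_root_reflect[OF r lt])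
  then have c: "0 < b" "0 < c" "coprime b c" by (auto simp: is_root_def coprime_commute)
  have cs: "root_nf m c b = map (map_prod mirror_idx id) (root_nf m b c)" by (rule root_nf_mirror[OF c])
  show ?thesis
    by (rule root_nf_reflect[OF m ab lt])
      (use root_nf_shape[OF m is_root_sym[OF rc] cb] cs in \<open>auto simp: c_def hd_map last_map\<close>)
qed

lemma root_nf_order:
  assumes m: "2 \<le> m" and r: "is_root m a b"
  shows "a = b \<longleftrightarrow> root_nf m a b = []" "b < a \<longleftrightarrow> root_nf m a b \<noteq> [] \<and> fst (hd (root_nf m a b)) = I3"
proof -
  have ab: "0 < a" "0 < b" "coprime a b" using r by (auto simp: is_root_def)
  have eq: "root_nf m a b = []" if "a = b"
  proof -
    have "a = 1" "b = 1" using that ab by auto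
    then show ?thesis by (simp add: root_nf_def nf_def cut_word_def)
  qed
  have gt: "root_nf m a b \<noteq> [] \<and> fst (hd (root_nf m a b)) = I3" if "b < a"
    using root_nf_shape[OF m r that] by simp
  have lt: "root_nf m a b \<noteq> [] \<and> fst (hd (root_nf m a b)) = I1" if "a < b"
    using root_nf_shape[OF m is_root_sym[OF r] that] root_nf_mirror[OF ab(2,1)] ab(3)
    by (auto simp: coprime_commute hd_map)
  show "a = b \<longleftrightarrow> root_nf m a b = []" "b < a \<longleftrightarrow> root_nf m a b \<noteq> [] \<and> fst (hd (root_nf m a b)) = I3"
    using eq gt lt by (metis idx.distinct(3) linorder_less_linear)+
qed

text \<open>The normal form tells whether the root is large, that is beyond the line \<open>a = (m - 1) b\<close>. If
  so, both roots can be replaced by their smaller reflections; if not, the normal form is the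
  cutting word itself, which determines the root by counting letters.\<close>

lemma root_nf_inj:
  assumes m: "2 \<le> m"
  shows "is_root m a b \<Longrightarrow> is_root m c d \<Longrightarrow> root_nf m a b = root_nf m c d \<Longrightarrow> a = c \<and> b = d"
proof (induction "a + b" arbitrary: a b c d rule: less_induct)
  case less
  have pos: "is_root m a b \<Longrightarrow> is_root m c d \<Longrightarrow> root_nf m a b = root_nf m c d \<Longrightarrow> b < a \<Longrightarrow>
     (\<And>a' b' c' d'. a' + b' < a + b \<Longrightarrow> is_root m a' b' \<Longrightarrow> is_root m c' d' \<Longrightarrow>
       root_nf m a' b' = root_nf m c' d' \<Longrightarrow> a' = c' \<and> b' = d') \<Longrightarrow> a = c \<and> b = d" for a b c d
  proof -
    assume r: "is_root m a b" and r': "is_root m c d" and e: "root_nf m a b = root_nf m c d" and lt: "b < a"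
      and IH: "\<And>a' b' c' d'. a' + b' < a + b \<Longrightarrow> is_root m a' b' \<Longrightarrow> is_root m c' d' \<Longrightarrow>
       root_nf m a' b' = root_nf m c' d' \<Longrightarrow> a' = c' \<and> b' = d'"
    have ab: "0 < a" "0 < b" "coprime a b" and cd: "0 < c" "0 < d" "coprime c d"
      using r r' by (auto simp: is_root_def)
    have lt': "d < c" using lt e root_nf_order(2)[OF m r] root_nf_order(2)[OF m r'] by simp
    have reg: "(m - 1) * b < a \<longleftrightarrow> (m - 1) * d < c"
      using root_nf_shape[OF m r lt] root_nf_shape[OF m r' lt'] e by simp
    have less_mult: "y \<le> (m - 1) * x" if "y < x" for x y :: nat
    proof -
      have "1 * x \<le> (m - 1) * x" using m by (intro mult_le_mono1) linarith
      then show ?thesis using that by linarith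
    qed
    show "a = c \<and> b = d"
    proof (cases "(m - 1) * b < a")
      case False
      have "cut_word a b = cut_word c d"
        using expand_root_nf[OF m ab _ less_mult[OF lt]] expand_root_nf[OF m cd _ less_mult[OF lt']] False reg e by simp
      then have "b - 1 = d - 1" "a + b - 2 = c + d - 2"
        using count_cut_word[OF ab] count_cut_word[OF cd] by simp_all
      then have "b = d" "a + b = c + d" using ab(1,2) cd(1,2) by linarith+
      then show ?thesis by simp
    next
      case large: True
      have large': "(m - 1) * d < c" using large reg by simp
      have len: "a < m * b \<longleftrightarrow> length (root_nf m a b) \<noteq> 1" if "is_root m a b" "(m - 1) * b < a" for a b
      proof (cases "a < m * b")
        case True
        then show ?thesis using root_nf_large[OF m that] by simp
      next
        case False
        then have "a = m \<and> b = 1" using is_root_large[OF that(1)] by simp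
        then show ?thesis using root_nf_multiple[OF m] by simp
      qed
      show ?thesis
      proof (cases "a < m * b")
        case False
        then have "\<not> c < m * d" using len[OF r large] len[OF r' large'] e by simp
        then show ?thesis using is_root_large[OF r] is_root_large[OF r'] False by simp
      next
        case True
        then have True': "c < m * d" using len[OF r large] len[OF r' large'] e by simp
        have nn: "syl_normal m (root_nf m x y)" for x y unfolding root_nf_def by (rule nf_normal[OF m])
        have "flip_syl m (root_nf m (m * b - a) b) = flip_syl m (root_nf m (m * d - c) d)"
          using e root_nf_large[OF m r large True] root_nf_large[OF m r' large' True'] by simp
        then have "root_nf m (m * b - a) b = root_nf m (m * d - c) d"
          using flip_syl_flip[OF nn] by metis
        moreover have "m * b = (m - 1) * b + b" using m by (metis Suc_pred' add.commute mult_Suc pos2 less_le_trans)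
        then have "m * b - a + b < a + b" using large lt by simp
        ultimately have "m * b - a = m * d - c \<and> b = d"
          using IH is_root_reflect[OF r True] is_root_reflect[OF r' True'] by blast
        then show ?thesis using True True' by (metis diff_diff_cancel less_imp_le_nat)
      qed
    qed
  qed
  have ab: "0 < a" "0 < b" "coprime a b" and cd: "0 < c" "0 < d" "coprime c d"
    using less.prems by (auto simp: is_root_def)
  consider "a = b" | "b < a" | "a < b" by linarith
  then show ?case
  proof cases
    case 1
    then have "c = d" using root_nf_order(1)[OF m less.prems(1)] root_nf_order(1)[OF m less.prems(2)] less.prems(3) by simp
    then show ?thesis using 1 ab cd by simp
  next
    case 2
    show ?thesis by (rule pos[OF less.prems 2]) (rule less.hyps)
  next
    case 3
    have e: "root_nf m b a = root_nf m d c"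
      unfolding root_nf_mirror[OF ab] root_nf_mirror[OF cd] less.prems(3) ..
    have "b = d \<and> a = c"
      by (rule pos[OF is_root_sym[OF less.prems(1)] is_root_sym[OF less.prems(2)] e 3])
        (rule less.hyps, simp add: add.commute)
    then show ?thesis by simp
  qed
qed

theorem line_word_inj:
  assumes m: "2 \<le> m" and r: "is_root m a b" "is_root m c d" and e: "weq m (line_word a b) (line_word c d)"
  shows "a = c \<and> b = d"
proof (rule root_nf_inj[OF m r])
  show "root_nf m a b = root_nf m c d"
    unfolding root_nf_def
    by (rule nf_weq[OF m set_cut_word set_cut_word]) (use e in \<open>simp flip: v0_line_word add: v0_def\<close>)
qed

section \<open>The Kac--Moody algebras as vector spaces\<close>

text \<open>A type cannot depend on \<open>m\<close>, so the product of all the algebras \<open>H(m)\<close> is formed at once.\<close>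

quotient_type km_product = "nat \<Rightarrow> km_gen lie_term" / "\<lambda>x y. \<forall>m. km_eq m (x m) (y m)"
proof (rule equivpI)
  show "reflp (\<lambda>x y. \<forall>m. km_eq m (x m) (y m))" by (rule reflpI) (simp add: lc_refl)
  show "symp (\<lambda>x y. \<forall>m. km_eq m (x m) (y m))" by (rule sympI) (blast intro: lc_sym)
  show "transp (\<lambda>x y. \<forall>m. km_eq m (x m) (y m))" by (rule transpI) (blast intro: lc_trans)
qed

lemma lie_cong_add_neg: "lie_cong R (LAdd (LScale (- 1) x) x) LZero"
  by (rule lc_trans[OF lc_add_commute lc_add_neg])

instantiation km_product :: ab_group_add
begin

lift_definition zero_km_product :: km_product is "\<lambda>m. LZero" .
lift_definition plus_km_product :: "km_product \<Rightarrow> km_product \<Rightarrow> km_product" is "\<lambda>x y m. LAdd (x m) (y m)"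
  by (simp add: lc_add)
lift_definition uminus_km_product :: "km_product \<Rightarrow> km_product" is "\<lambda>x m. LScale (- 1) (x m)"
  by (simp add: lc_scale)
definition minus_km_product :: "km_product \<Rightarrow> km_product \<Rightarrow> km_product" where
  "minus_km_product x y = x + - y"

instance
proof
  fix a b c :: km_product
  show "a + b + c = a + (b + c)" by transfer (simp add: lc_add_assoc)
  show "a + b = b + a" by transfer (simp add: lc_add_commute)
  show "0 + a = a" by transfer (blast intro: lc_trans lc_add_commute lc_add_zero)
  show "- a + a = 0" by transfer (simp add: lie_cong_add_neg)
  show "a - b = a + - b" by (rule minus_km_product_def)
qed

end

lift_definition km_scale :: "complex \<Rightarrow> km_product \<Rightarrow> km_product" (infixr "*\<^sub>L" 75) is "\<lambda>c x m. LScale c (x m)"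
  by (simp add: lc_scale)

lift_definition km_br :: "km_product \<Rightarrow> km_product \<Rightarrow> km_product" is "\<lambda>x y m. LBr (x m) (y m)"
  by (simp add: lc_br)

interpretation km: vector_space km_scale
proof
  fix a b :: complex and x y :: km_product
  show "a *\<^sub>L (x + y) = a *\<^sub>L x + a *\<^sub>L y" by transfer (simp add: lc_scale_add)
  show "(a + b) *\<^sub>L x = a *\<^sub>L x + b *\<^sub>L x" by transfer (simp add: lc_add_scale)
  show "a *\<^sub>L b *\<^sub>L x = (a * b) *\<^sub>L x" by transfer (simp add: lc_scale_scale)
  show "1 *\<^sub>L x = x" by transfer (simp add: lc_scale_one)
qed

lemma km_br_linear:
  "km_br (x + y) z = km_br x z + km_br y z"
  "km_br x (y + z) = km_br x y + km_br x z"
  "km_br (c *\<^sub>L x) y = c *\<^sub>L km_br x y"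
  "km_br x (c *\<^sub>L y) = c *\<^sub>L km_br x y"
  by (transfer; simp add: lc_br_add_left lc_br_add_right lc_br_scale_left lc_br_scale_right)+

lemma km_br_zero [simp]: "km_br 0 x = 0" "km_br x 0 = 0"
  using km_br_linear(3)[of 0 x x] km_br_linear(4)[of x 0 x] by simp_all

lemma km_br_self [simp]: "km_br x x = 0"
  by transfer (simp add: lc_br_self)

lemma km_br_skew: "km_br x y = - km_br y x"
proof -
  have "km_br (x + y) (x + y) = km_br x y + km_br y x"
    unfolding km_br_linear(1,2) by simp
  then have "km_br x y + km_br y x = 0" by (metis km_br_self)
  then show ?thesis by (simp add: eq_neg_iff_add_eq_0)
qed

lemma km_br_minus: "km_br x (- y) = - km_br x y" "km_br (- x) y = - km_br x y"
  using km_br_linear(4)[of x "-1" y] km_br_linear(3)[of "-1" x y] by simp_all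

lemma km_jacobi_cyclic: "km_br x (km_br y z) + (km_br y (km_br z x) + km_br z (km_br x y)) = 0"
  by transfer (simp add: lc_jacobi)

lemma km_jacobi: "km_br x (km_br y z) = km_br (km_br x y) z + km_br y (km_br x z)"
proof -
  have "km_br y (km_br z x) = - km_br y (km_br x z)"
    "km_br z (km_br x y) = - km_br (km_br x y) z"
    using km_br_skew[of z x] km_br_skew[of z "km_br x y"] by (simp_all add: km_br_minus)
  then have "km_br x (km_br y z) - (km_br (km_br x y) z + km_br y (km_br x z)) = 0"
    using km_jacobi_cyclic[of x y z] by (simp only: diff_conv_add_uminus minus_add_distrib add.commute)
  then show ?thesis by (simp only: right_minus_eq)
qed

text \<open>\<open>H(m)\<close> as a factor of the product.\<close>

lift_definition km_in :: "nat \<Rightarrow> km_gen lie_term \<Rightarrow> km_product" is "\<lambda>m x n. if n = m then x else LZero" .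

lemma km_eq_zero: "km_eq m (LAdd LZero LZero) LZero" "km_eq m (LScale c LZero) LZero" "km_eq m (LBr LZero LZero) LZero"
proof -
  show "km_eq m (LAdd LZero LZero) LZero" by (rule lc_add_zero)
  show "km_eq m (LBr LZero LZero) LZero" by (rule lc_br_self)
  have "c *\<^sub>L (0 :: km_product) = 0" by simp
  then show "km_eq m (LScale c LZero) LZero" by transfer simp
qed

lemma km_in_simps:
  "km_in m LZero = 0" "km_in m (LAdd x y) = km_in m x + km_in m y"
  "km_in m (LScale c x) = c *\<^sub>L km_in m x" "km_in m (LBr x y) = km_br (km_in m x) (km_in m y)"
  by (transfer; simp add: lc_refl km_eq_zero lc_sym[OF km_eq_zero(1)] lc_sym[OF km_eq_zero(2)] lc_sym[OF km_eq_zero(3)])+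

lemma km_in_eq_iff: "km_in m x = km_in m y \<longleftrightarrow> km_eq m x y"
  by transfer (auto simp: lc_refl)

section \<open>Representations of \<open>sl\<^sub>2\<close>\<close>

text \<open>A linear representation of \<open>sl\<^sub>2\<close> on the subspace \<open>S\<close>; the operators may act on a larger space
  without satisfying the relations there.\<close>

locale sl2_module = vector_space scale
  for scale :: "complex \<Rightarrow> 'b::ab_group_add \<Rightarrow> 'b" (infixr "\<odot>" 75) +
  fixes S :: "'b set" and e f h :: "'b \<Rightarrow> 'b"
  assumes stable: "x \<in> S \<Longrightarrow> e x \<in> S" "x \<in> S \<Longrightarrow> f x \<in> S"
    and e_linear: "e (x + y) = e x + e y" "e (c \<odot> x) = c \<odot> e x"
    and f_linear: "f (x + y) = f x + f y" "f (c \<odot> x) = c \<odot> f x"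
    and e_f: "x \<in> S \<Longrightarrow> e (f x) = f (e x) + h x"
    and h_e: "x \<in> S \<Longrightarrow> h (e x) = e (h x) + 2 \<odot> e x"
    and h_f: "x \<in> S \<Longrightarrow> h (f x) = f (h x) + (- 2) \<odot> f x"
begin

lemma f_zero [simp]: "f 0 = 0"
  using f_linear(2)[of 0 0] by simp

lemma stable_funpow: "x \<in> S \<Longrightarrow> (e ^^ n) x \<in> S" "x \<in> S \<Longrightarrow> (f ^^ n) x \<in> S"
  by (induction n) (auto intro: stable)

lemma weight_raise:
  assumes S: "y \<in> S" and y: "h y = w \<odot> y"
  shows "h ((e ^^ n) y) = (w + 2 * of_nat n) \<odot> (e ^^ n) y"
proof (induction n)
  case (Suc n)
  have "h ((e ^^ Suc n) y) = (w + 2 * of_nat n) \<odot> e ((e ^^ n) y) + 2 \<odot> e ((e ^^ n) y)"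
    by (simp only: funpow.simps o_apply h_e[OF stable_funpow(1)[OF S]] Suc e_linear)
  also have "\<dots> = ((w + 2 * of_nat n) + 2) \<odot> e ((e ^^ n) y)" by (simp only: scale_left_distrib)
  finally show ?case by (simp add: algebra_simps)
qed (simp add: y)

lemma weight_lower:
  assumes S: "y \<in> S" and y: "h y = w \<odot> y"
  shows "h ((f ^^ n) y) = (w - 2 * of_nat n) \<odot> (f ^^ n) y"
proof (induction n)
  case (Suc n)
  have "h ((f ^^ Suc n) y) = (w - 2 * of_nat n) \<odot> f ((f ^^ n) y) + (- 2) \<odot> f ((f ^^ n) y)"
    by (simp only: funpow.simps o_apply h_f[OF stable_funpow(2)[OF S]] Suc f_linear)
  also have "\<dots> = ((w - 2 * of_nat n) + - 2) \<odot> f ((f ^^ n) y)" by (simp only: scale_left_distrib)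
  finally show ?case by (simp add: algebra_simps)
qed (simp add: y)

text \<open>The factor vanishes exactly if \<open>w = - n\<close>. Both uses of this formula depend on it: below that
  bound raising a lowest weight vector is injective, and at the bound it produces a vector that is
  annihilated by lowering.\<close>

lemma lower_raise:
  assumes S: "y \<in> S" and y: "f y = 0" "h y = w \<odot> y"
  shows "f ((e ^^ Suc n) y) = (- of_nat (Suc n) * (w + of_nat n)) \<odot> (e ^^ n) y"
proof (induction n)
  case 0
  have "f (e y) = e (f y) - h y" by (simp add: e_f S)
  also have "e (f y) = 0" using e_linear(2)[of 0 0] y by simp
  finally show ?case using y by simp
next
  case (Suc n)
  have "f ((e ^^ Suc (Suc n)) y) = e (f ((e ^^ Suc n) y)) - h ((e ^^ Suc n) y)"
    using e_f[OF stable_funpow(1)[OF S], of "Suc n"] by simp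
  also have "\<dots> = (- of_nat (Suc n) * (w + of_nat n)) \<odot> (e ^^ Suc n) y - (w + 2 * of_nat (Suc n)) \<odot> (e ^^ Suc n) y"
    unfolding Suc weight_raise[OF S y(2)] by (simp add: e_linear)
  also have "\<dots> = (- of_nat (Suc n) * (w + of_nat n) - (w + 2 * of_nat (Suc n))) \<odot> (e ^^ Suc n) y"
    by (simp only: scale_left_diff_distrib)
  also have "- of_nat (Suc n) * (w + of_nat n) - (w + 2 * of_nat (Suc n)) = - of_nat (Suc (Suc n)) * (w + of_nat (Suc n))"
    by (simp add: algebra_simps)
  finally show ?case .
qed

text \<open>A weight \<open>- r \<le> 0\<close> of a locally nilpotent representation can be raised at least \<open>r\<close> times:
  descend to a lowest weight vector first.\<close>

lemma weight_string:
  assumes S: "v \<in> S" and v: "v \<noteq> 0" "(f ^^ k) v = 0" and h: "h v = (- of_nat r) \<odot> v" and q: "q \<le> r"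
  obtains p where "(e ^^ (p + q)) ((f ^^ p) v) \<noteq> 0"
proof -
  \<comment> \<open>The number of steps down to a lowest weight vector.\<close>
  define p where "p = (LEAST k. (f ^^ k) v = 0) - 1"
  have least: "(f ^^ (LEAST k. (f ^^ k) v = 0)) v = 0" by (rule LeastI[of "\<lambda>k. (f ^^ k) v = 0", OF v(2)])
  have "(LEAST k. (f ^^ k) v = 0) \<noteq> 0" using least v(1) by (metis funpow_0)
  then have Sp: "(LEAST k. (f ^^ k) v = 0) = Suc p" by (simp add: p_def)
  define y where "y = (f ^^ p) v"
  have y0: "y \<noteq> 0" unfolding y_def using not_less_Least[of p "\<lambda>k. (f ^^ k) v = 0"] Sp by auto
  have fy: "f y = 0" using least unfolding Sp y_def by simp
  define w :: complex where "w = - of_nat r - 2 * of_nat p"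
  have hy: "h y = w \<odot> y" unfolding y_def w_def by (rule weight_lower[OF S h])
  have yS: "y \<in> S" unfolding y_def by (rule stable_funpow(2)[OF S])
  have "(e ^^ n) y \<noteq> 0" if "n \<le> r + 2 * p" for n
    using that
  proof (induction n)
    case (Suc n)
    have "w + of_nat n = - of_nat (r + 2 * p - n)" using Suc.prems by (simp add: w_def of_nat_diff)
    then have c: "- of_nat (Suc n) * (w + of_nat n) \<noteq> 0" using Suc.prems by (simp del: of_nat_Suc of_nat_diff of_nat_add of_nat_mult)
    have "f ((e ^^ Suc n) y) \<noteq> 0"
      unfolding lower_raise[OF yS fy hy] scale_eq_0_iff using c Suc by simp
    then show ?case by (metis f_zero)
  qed (simp add: y0)
  from this[of "p + q"] show thesis using q that unfolding y_def by simp
qed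

end

section \<open>Weights of the Kac--Moody algebra\<close>

text \<open>The generators \<open>e\<^sub>i\<close> and \<open>f\<^sub>i\<close> are treated alike; \<open>s\<close> is the sign of the root.\<close>

definition km_gen_at :: "nat \<Rightarrow> bool \<Rightarrow> node \<Rightarrow> km_product" where
  "km_gen_at m s i = km_in m (if s then kE i else kF i)"

definition km_cartan :: "nat \<Rightarrow> cartan_gen \<Rightarrow> km_product" where
  "km_cartan m c = km_in m (kC c)"

definition sgn_of :: "bool \<Rightarrow> int" where
  "sgn_of s = (if s then 1 else - 1)"

lemma sgn_of_simps [simp]: "sgn_of True = 1" "sgn_of False = - 1" "sgn_of (\<not> s) = - sgn_of s" "sgn_of s * sgn_of s = 1"
  by (simp_all add: sgn_of_def)

lemma km_in_rel: "(x, y) \<in> km_relations m \<Longrightarrow> km_in m x = km_in m y"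
  by (simp add: km_in_eq_iff lc_rel)

lemma km_in_funpow: "km_in m ((LBr x ^^ n) y) = (km_br (km_in m x) ^^ n) (km_in m y)"
  by (induction n) (simp_all add: km_in_simps)

lemma km_relation_simps:
  "km_br (km_cartan m c) (km_cartan m c') = 0"
  "km_br (km_gen_at m s i) (km_gen_at m (\<not> s) i) = of_int (sgn_of s) *\<^sub>L km_cartan m (CH i)"
  "i \<noteq> j \<Longrightarrow> km_br (km_gen_at m s i) (km_gen_at m (\<not> s) j) = 0"
  "km_br (km_cartan m c) (km_gen_at m s j) = of_int (sgn_of s * simple_root m j c) *\<^sub>L km_gen_at m s j"
  "i \<noteq> j \<Longrightarrow> (km_br (km_gen_at m s i) ^^ Suc m) (km_gen_at m s j) = 0"
proof -
  have ef: "km_br (km_in m (kE i)) (km_in m (kF i)) = km_cartan m (CH i)" for i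
    unfolding km_cartan_def km_in_simps(4)[symmetric] by (rule km_in_rel) (auto simp: km_relations_def)
  have ef': "km_br (km_in m (kE i)) (km_in m (kF j)) = 0" if "i \<noteq> j" for i j
    unfolding km_in_simps[symmetric] by (rule trans[OF km_in_rel km_in_simps(1)]) (use that in \<open>auto simp: km_relations_def\<close>)
  show "km_br (km_cartan m c) (km_cartan m c') = 0"
    unfolding km_cartan_def km_in_simps(4)[symmetric]
    by (rule trans[OF km_in_rel km_in_simps(1)]) (auto simp: km_relations_def)
  show "km_br (km_gen_at m s i) (km_gen_at m (\<not> s) i) = of_int (sgn_of s) *\<^sub>L km_cartan m (CH i)"
    using ef[of i] km_br_skew[of "km_in m (kF i)" "km_in m (kE i)"] by (cases s) (simp_all add: km_gen_at_def)
  show "km_br (km_gen_at m s i) (km_gen_at m (\<not> s) j) = 0" if "i \<noteq> j"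
    using ef'[OF that] ef'[OF that[symmetric]] km_br_skew[of "km_in m (kF i)" "km_in m (kE j)"]
    by (cases s) (simp_all add: km_gen_at_def)
  show "km_br (km_cartan m c) (km_gen_at m s j) = of_int (sgn_of s * simple_root m j c) *\<^sub>L km_gen_at m s j"
  proof (cases s)
    case True
    have "km_in m (LBr (kC c) (kE j)) = km_in m (LScale (of_int (simple_root m j c)) (kE j))"
      by (rule km_in_rel) (auto simp: km_relations_def)
    then show ?thesis using True by (simp add: km_gen_at_def km_cartan_def km_in_simps)
  next
    case False
    have "km_in m (LBr (kC c) (kF j)) = km_in m (LScale (- of_int (simple_root m j c)) (kF j))"
      by (rule km_in_rel) (auto simp: km_relations_def)
    then show ?thesis using False by (simp add: km_gen_at_def km_cartan_def km_in_simps)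
  qed
  show "(km_br (km_gen_at m s i) ^^ Suc m) (km_gen_at m s j) = 0" if ij: "i \<noteq> j"
  proof -
    have n: "nat (1 - cartan m i j) = Suc m" using ij by (simp add: cartan_def)
    have "km_in m ((LBr (kE i) ^^ nat (1 - cartan m i j)) (kE j)) = km_in m LZero"
      "km_in m ((LBr (kF i) ^^ nat (1 - cartan m i j)) (kF j)) = km_in m LZero"
      by (rule km_in_rel; use ij in \<open>unfold km_relations_def; blast\<close>)+
    then show ?thesis unfolding n km_in_funpow km_in_simps(1) by (cases s) (simp_all add: km_gen_at_def)
  qed
qed

lemma km_sl2_module:
  "sl2_module km_scale UNIV (km_br (km_gen_at m s i)) (km_br (km_gen_at m (\<not> s) i))
     (km_br (of_int (sgn_of s) *\<^sub>L km_cartan m (CH i)))"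
proof
  fix x y c
  let ?e = "km_gen_at m s i" and ?f = "km_gen_at m (\<not> s) i" and ?h = "of_int (sgn_of s) *\<^sub>L km_cartan m (CH i)"
  show "km_br ?e (x + y) = km_br ?e x + km_br ?e y" "km_br ?e (c *\<^sub>L x) = c *\<^sub>L km_br ?e x"
    "km_br ?f (x + y) = km_br ?f x + km_br ?f y" "km_br ?f (c *\<^sub>L x) = c *\<^sub>L km_br ?f x"
    by (rule km_br_linear)+
  show "km_br ?e x \<in> UNIV" "km_br ?f x \<in> UNIV" by simp_all
  show "km_br ?e (km_br ?f x) = km_br ?f (km_br ?e x) + km_br ?h x"
    using km_jacobi[of ?e ?f x] by (simp add: km_relation_simps add.commute)
  have w: "km_br ?h ?e = 2 *\<^sub>L ?e" "km_br ?h ?f = (- 2) *\<^sub>L ?f"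
    by (simp_all add: km_br_linear(3) km_relation_simps cartan_def sgn_of_def)
  show "km_br ?h (km_br ?e x) = km_br ?e (km_br ?h x) + 2 *\<^sub>L km_br ?e x"
    using km_jacobi[of ?h ?e x] unfolding w km_br_linear(3)[of 2] by (simp only: add.commute)
  show "km_br ?h (km_br ?f x) = km_br ?f (km_br ?h x) + (- 2) *\<^sub>L km_br ?f x"
    using km_jacobi[of ?h ?f x] unfolding w km_br_linear(3)[of "-2"] by (simp only: add.commute)
qed

lemma km_br_funpow_linear:
  "(km_br x ^^ n) 0 = 0"
  "(km_br x ^^ n) (y + z) = (km_br x ^^ n) y + (km_br x ^^ n) z"
  "(km_br x ^^ n) (c *\<^sub>L y) = c *\<^sub>L (km_br x ^^ n) y"
  by (induction n) (simp_all add: km_br_linear)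

lemma km_br_funpow_mono: "(km_br x ^^ n) y = 0 \<Longrightarrow> n \<le> k \<Longrightarrow> (km_br x ^^ k) y = 0"
  by (metis add.commute comp_apply funpow_add km_br_funpow_linear(1) le_Suc_ex)

lemma km_br_funpow_bracket:
  "(km_br x ^^ n) y = 0 \<Longrightarrow> (km_br x ^^ k) z = 0 \<Longrightarrow> (km_br x ^^ (n + k)) (km_br y z) = 0"
proof (induction "n + k" arbitrary: n k y z)
  case (Suc l)
  show ?case
  proof (cases n)
    case 0
    then show ?thesis using Suc.prems by (simp add: km_br_funpow_linear)
  next
    case n: (Suc n')
    show ?thesis
    proof (cases k)
      case 0
      then show ?thesis using Suc.prems by (simp add: km_br_funpow_linear)
    next
      case k: (Suc k')
      have l: "l = n' + k" "l = n + k'" using Suc.hyps(2) n k by simp_all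
      have 1: "(km_br x ^^ (n' + k)) (km_br (km_br x y) z) = 0"
        by (rule Suc.hyps(1)[OF l(1)]) (use Suc.prems n in \<open>simp_all add: funpow_swap1\<close>)
      have 2: "(km_br x ^^ (n + k')) (km_br y (km_br x z)) = 0"
        by (rule Suc.hyps(1)[OF l(2)]) (use Suc.prems k in \<open>simp_all add: funpow_swap1\<close>)
      have "(km_br x ^^ Suc l) (km_br y z) = (km_br x ^^ l) (km_br x (km_br y z))"
        by (simp add: funpow_swap1)
      also have "\<dots> = 0" unfolding km_jacobi[of x y z] km_br_funpow_linear using 1 2 l by simp
      finally show ?thesis using Suc.hyps(2) by simp
    qed
  qed
qed simp

lemma node_neq: "i \<noteq> j \<Longrightarrow> k = i \<or> k = j" for i j k :: node
  by (cases i; cases j; cases k) auto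

text \<open>By the Leibniz rule the elements on which the adjoint action of a generator is nilpotent form
  a subalgebra, and the Serre relations put the generators into it.\<close>

lemma km_gen_nilpotent: "\<exists>n. (km_br (km_gen_at m s i) ^^ n) (km_in m x) = 0"
proof (induction x)
  case (LGen g)
  let ?e = "km_gen_at m s i"
  have gen: "\<exists>n. (km_br ?e ^^ n) (km_gen_at m t j) = 0" for t j
  proof -
    consider "t = s" "j = i" | "t = s" "j \<noteq> i" | "t = (\<not> s)" "j = i" | "t = (\<not> s)" "j \<noteq> i" by blast
    then show ?thesis
    proof cases
      case 1
      then show ?thesis by (intro exI[of _ 1]) simp
    next
      case 2
      then show ?thesis using km_relation_simps(5)[of i j m s] by blast
    next
      case 3
      have "km_br ?e (km_cartan m (CH i)) = - of_int (sgn_of s * simple_root m i (CH i)) *\<^sub>L ?e"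
        using km_br_skew[of ?e "km_cartan m (CH i)"] by (simp add: km_relation_simps)
      then have "(km_br ?e ^^ 3) (km_gen_at m t j) = 0"
        using 3 by (simp add: numeral_3_eq_3 km_relation_simps km_br_linear km_br_minus)
      then show ?thesis by blast
    next
      case 4
      then show ?thesis by (intro exI[of _ 1]) (simp add: km_relation_simps)
    qed
  qed
  show ?case
  proof (cases g)
    case (KE j)
    then show ?thesis using gen[of True j] by (simp add: km_gen_at_def)
  next
    case (KF j)
    then show ?thesis using gen[of False j] by (simp add: km_gen_at_def)
  next
    case (KC c)
    have "km_br ?e (km_cartan m c) = - of_int (sgn_of s * simple_root m i c) *\<^sub>L ?e"
      using km_br_skew[of ?e "km_cartan m c"] by (simp add: km_relation_simps)
    then have "(km_br ?e ^^ 2) (km_cartan m c) = 0"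
      by (simp add: numeral_2_eq_2 km_br_linear km_br_minus)
    then show ?thesis unfolding KC km_cartan_def by blast
  qed
next
  case LZero
  show ?case by (rule exI[of _ 0]) (simp add: km_in_simps)
next
  case (LAdd x y)
  then obtain n k where "(km_br (km_gen_at m s i) ^^ n) (km_in m x) = 0" "(km_br (km_gen_at m s i) ^^ k) (km_in m y) = 0"
    by blast
  then have "(km_br (km_gen_at m s i) ^^ max n k) (km_in m (LAdd x y)) = 0"
    using km_br_funpow_mono[OF _ max.cobounded1] km_br_funpow_mono[OF _ max.cobounded2]
    by (simp add: km_in_simps km_br_funpow_linear)
  then show ?case by blast
next
  case (LScale c x)
  then show ?case by (auto simp: km_in_simps km_br_funpow_linear)
next
  case (LBr x y)
  then show ?case unfolding km_in_simps using km_br_funpow_bracket by blast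
qed

definition shift :: "node \<Rightarrow> int \<Rightarrow> int \<times> int \<Rightarrow> int \<times> int" where
  "shift i k \<alpha> = (case i of N1 \<Rightarrow> (fst \<alpha> + k, snd \<alpha>) | N2 \<Rightarrow> (fst \<alpha>, snd \<alpha> + k))"

lemma shift_simps [simp]: "shift N1 k (a, b) = (a + k, b)" "shift N2 k (a, b) = (a, b + k)"
  "shift i k (shift i l \<alpha>) = shift i (k + l) \<alpha>" "shift i 0 \<alpha> = \<alpha>"
  by (simp_all add: shift_def split: node.split)

lemma lattice_weight_shift: "lattice_weight m (shift i k \<alpha>) c = lattice_weight m \<alpha> c + k * simple_root m i c"
  by (cases i) (simp_all add: lattice_weight_def shift_def algebra_simps)

definition km_weight :: "nat \<Rightarrow> int \<times> int \<Rightarrow> km_product \<Rightarrow> bool" where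
  "km_weight m \<alpha> v \<longleftrightarrow> v \<in> range (km_in m) \<and>
     (\<forall>c. km_br (km_cartan m c) v = of_int (lattice_weight m \<alpha> c) *\<^sub>L v)"

definition km_occurs :: "nat \<Rightarrow> int \<times> int \<Rightarrow> bool" where
  "km_occurs m \<alpha> \<longleftrightarrow> (\<exists>v. km_weight m \<alpha> v \<and> v \<noteq> 0)"

lemma km_root_iff: "km_root m \<alpha> \<longleftrightarrow> \<alpha> \<noteq> (0, 0) \<and> km_occurs m \<alpha>"
proof -
  have "x \<in> km_root_space m \<alpha> \<longleftrightarrow> km_weight m \<alpha> (km_in m x)" for x
    unfolding km_root_space_def km_weight_def km_cartan_def km_in_simps(3,4)[symmetric] km_in_eq_iff by blast
  moreover have "km_eq m x LZero \<longleftrightarrow> km_in m x = 0" for x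
    by (simp flip: km_in_eq_iff add: km_in_simps)
  moreover have "km_occurs m \<alpha> \<longleftrightarrow> (\<exists>x. km_weight m \<alpha> (km_in m x) \<and> km_in m x \<noteq> 0)"
    unfolding km_occurs_def by (auto simp: km_weight_def)
  ultimately show ?thesis unfolding km_root_def by blast
qed

lemma km_weight_gen: "km_weight m (shift i (sgn_of s) (0, 0)) (km_gen_at m s i)"
  unfolding km_weight_def lattice_weight_shift
  by (simp add: km_relation_simps lattice_weight_def) (simp add: km_gen_at_def)

lemma km_weight_bracket_gen:
  assumes "km_weight m \<alpha> v"
  shows "km_weight m (shift i (sgn_of s) \<alpha>) (km_br (km_gen_at m s i) v)"
proof -
  obtain x where x: "v = km_in m x" using assms by (auto simp: km_weight_def)
  have "km_br (km_gen_at m s i) v \<in> range (km_in m)"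
    unfolding x km_gen_at_def km_in_simps(4)[symmetric] by blast
  moreover have "km_br (km_cartan m c) (km_br (km_gen_at m s i) v)
      = of_int (lattice_weight m (shift i (sgn_of s) \<alpha>) c) *\<^sub>L km_br (km_gen_at m s i) v" for c
    using assms unfolding km_jacobi[of "km_cartan m c"] km_weight_def
    by (simp add: km_relation_simps km_br_linear lattice_weight_shift km.scale_left_distrib[symmetric] add.commute)
  ultimately show ?thesis by (simp add: km_weight_def)
qed

lemma km_weight_funpow:
  assumes "km_weight m \<alpha> v"
  shows "km_weight m (shift i (sgn_of s * int n) \<alpha>) ((km_br (km_gen_at m s i) ^^ n) v)"
proof (induction n)
  case (Suc n)
  have "shift i (sgn_of s) (shift i (sgn_of s * int n) \<alpha>) = shift i (sgn_of s * int (Suc n)) \<alpha>"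
    by (simp add: algebra_simps)
  then show ?case using km_weight_bracket_gen[OF Suc, of i s] by simp
qed (use assms in simp)

text \<open>Raising a weight vector \<open>q\<close> times more often than it was lowered adds \<open>q\<close> times the simple
  root.\<close>

lemma km_root_string:
  assumes occ: "km_occurs m \<alpha>" and r: "lattice_weight m \<alpha> (CH i) = - (sgn_of s * int r)" and q: "q \<le> r"
  shows "km_occurs m (shift i (sgn_of s * int q) \<alpha>)"
proof -
  obtain v where v: "km_weight m \<alpha> v" "v \<noteq> 0" using occ by (auto simp: km_occurs_def)
  obtain x where x: "v = km_in m x" using v by (auto simp: km_weight_def)
  interpret sl2_module km_scale UNIV "km_br (km_gen_at m s i)" "km_br (km_gen_at m (\<not> s) i)"
    "km_br (of_int (sgn_of s) *\<^sub>L km_cartan m (CH i))"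
    by (rule km_sl2_module)
  obtain k where k: "(km_br (km_gen_at m (\<not> s) i) ^^ k) v = 0"
    using km_gen_nilpotent unfolding x by blast
  have "sgn_of s * lattice_weight m \<alpha> (CH i) = - int r" unfolding r by (simp flip: mult.assoc)
  then have "of_int (sgn_of s) * of_int (lattice_weight m \<alpha> (CH i)) = (- of_nat r :: complex)"
    by (metis of_int_minus of_int_mult of_int_of_nat_eq)
  then have h: "km_br (of_int (sgn_of s) *\<^sub>L km_cartan m (CH i)) v = (- of_nat r) *\<^sub>L v"
    using v(1) by (simp add: km_br_linear km_weight_def)
  obtain p where p: "(km_br (km_gen_at m s i) ^^ (p + q)) ((km_br (km_gen_at m (\<not> s) i) ^^ p) v) \<noteq> 0"
    by (rule weight_string[OF UNIV_I v(2) k h q])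
  have "km_weight m (shift i (sgn_of s * int (p + q)) (shift i (sgn_of (\<not> s) * int p) \<alpha>))
      ((km_br (km_gen_at m s i) ^^ (p + q)) ((km_br (km_gen_at m (\<not> s) i) ^^ p) v))"
    by (intro km_weight_funpow v)
  moreover have "shift i (sgn_of s * int (p + q)) (shift i (sgn_of (\<not> s) * int p) \<alpha>) = shift i (sgn_of s * int q) \<alpha>"
    by (simp add: algebra_simps)
  ultimately show ?thesis using p by (auto simp: km_occurs_def)
qed

section \<open>Roots have no mixed signs\<close>

lemma km_weight_scale: "km_weight m \<alpha> v \<Longrightarrow> km_weight m \<alpha> (c *\<^sub>L v)"
  unfolding km_weight_def by (auto simp: km_br_linear km.scale_left_commute simp flip: km_in_simps(3))

inductive km_monomial :: "nat \<Rightarrow> bool \<Rightarrow> int \<times> int \<Rightarrow> km_product \<Rightarrow> bool" for m s where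
  monomial_gen: "km_monomial m s (shift i (sgn_of s) (0, 0)) (km_gen_at m s i)"
| monomial_bracket: "km_monomial m s \<alpha> x \<Longrightarrow> km_monomial m s (shift i (sgn_of s) \<alpha>) (km_br (km_gen_at m s i) x)"
| monomial_scale: "km_monomial m s \<alpha> x \<Longrightarrow> km_monomial m s \<alpha> (c *\<^sub>L x)"

lemma km_monomial_weight: "km_monomial m s \<alpha> x \<Longrightarrow> km_weight m \<alpha> x"
  by (induction rule: km_monomial.induct) (auto intro: km_weight_gen km_weight_bracket_gen km_weight_scale)

lemma km_monomial_sign: "km_monomial m s \<alpha> x \<Longrightarrow> 0 \<le> sgn_of s * fst \<alpha> \<and> 0 \<le> sgn_of s * snd \<alpha>"
proof (induction rule: km_monomial.induct)
  case (monomial_gen i)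
  show ?case by (cases i) (simp_all add: shift_def)
next
  case (monomial_bracket \<alpha> x i)
  then show ?case by (cases i) (simp_all add: shift_def distrib_left)
qed

text \<open>The span of the Cartan subalgebra and of the brackets of generators of one sign. Both of these
  subspaces together are stable under all generators and therefore exhaust the algebra.\<close>

inductive km_borel :: "nat \<Rightarrow> bool \<Rightarrow> km_product \<Rightarrow> bool" for m s where
  borel_cartan: "km_borel m s (k *\<^sub>L km_cartan m c)"
| borel_monomial: "km_monomial m s \<alpha> x \<Longrightarrow> km_borel m s x"
| borel_add: "km_borel m s x \<Longrightarrow> km_borel m s y \<Longrightarrow> km_borel m s (x + y)"

lemma borel_zero: "km_borel m s 0"
  using borel_cartan[of m s 0 CD] by simp

lemma borel_scale: "km_borel m s x \<Longrightarrow> km_borel m s (c *\<^sub>L x)"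
proof (induction rule: km_borel.induct)
  case (borel_cartan k d)
  then show ?case using km_borel.borel_cartan[of m s "c * k" d] by simp
next
  case (borel_monomial \<alpha> x)
  then show ?case by (blast intro: km_borel.borel_monomial monomial_scale)
next
  case (borel_add x y)
  then show ?case by (simp add: km.scale_right_distrib km_borel.borel_add)
qed

lemma borel_gen: "km_borel m s x \<Longrightarrow> km_borel m s (km_br (km_gen_at m s i) x)"
proof (induction rule: km_borel.induct)
  case (borel_cartan k d)
  have "km_br (km_gen_at m s i) (km_cartan m d) = (- of_int (sgn_of s * simple_root m i d)) *\<^sub>L km_gen_at m s i"
    using km_br_skew[of "km_gen_at m s i" "km_cartan m d"] by (simp add: km_relation_simps)
  then have "km_br (km_gen_at m s i) (k *\<^sub>L km_cartan m d) = (k * (- of_int (sgn_of s * simple_root m i d))) *\<^sub>L km_gen_at m s i"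
    by (simp only: km_br_linear km.scale_scale)
  then show ?case by (simp only:) (rule borel_scale[OF km_borel.borel_monomial[OF monomial_gen]])
next
  case (borel_monomial \<alpha> x)
  then show ?case by (blast intro: km_borel.borel_monomial monomial_bracket)
next
  case (borel_add x y)
  then show ?case by (simp add: km_br_linear km_borel.borel_add)
qed

lemma borel_cartan_bracket: "km_borel m s x \<Longrightarrow> km_borel m s (km_br (km_cartan m c) x)"
proof (induction rule: km_borel.induct)
  case (borel_cartan k d)
  then show ?case by (simp add: km_br_linear km_relation_simps borel_zero)
next
  case (borel_monomial \<alpha> x)
  then have "km_br (km_cartan m c) x = of_int (lattice_weight m \<alpha> c) *\<^sub>L x"
    using km_monomial_weight by (auto simp: km_weight_def)
  then show ?case using borel_monomial by (simp add: borel_scale km_borel.borel_monomial)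
next
  case (borel_add x y)
  then show ?case by (simp add: km_br_linear km_borel.borel_add)
qed

text \<open>Moving the opposite generator inwards produces only Cartan elements, which act by scalars.\<close>

lemma opposite_gen_monomial: "km_monomial m s \<alpha> x \<Longrightarrow> km_borel m s (km_br (km_gen_at m (\<not> s) i) x)"
proof (induction rule: km_monomial.induct)
  case (monomial_gen j)
  show ?case
  proof (cases "i = j")
    case True
    have "km_br (km_gen_at m (\<not> s) i) (km_gen_at m s i) = of_int (sgn_of (\<not> s)) *\<^sub>L km_cartan m (CH i)"
      using km_relation_simps(2)[of m "\<not> s" i] by simp
    then show ?thesis using True borel_cartan by metis
  next
    case False
    then have "km_br (km_gen_at m (\<not> s) i) (km_gen_at m s j) = 0"
      using km_relation_simps(3)[of i j m "\<not> s"] by simp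
    then show ?thesis by (simp add: borel_zero)
  qed
next
  case (monomial_bracket \<alpha> x j)
  have "km_borel m s (km_br (km_br (km_gen_at m (\<not> s) i) (km_gen_at m s j)) x)"
  proof (cases "i = j")
    case True
    have "km_br (km_br (km_gen_at m (\<not> s) i) (km_gen_at m s i)) x
        = of_int (sgn_of (\<not> s)) *\<^sub>L km_br (km_cartan m (CH i)) x"
      using km_relation_simps(2)[of m "\<not> s" i] by (simp only: km_br_linear not_not)
    then show ?thesis using True borel_scale[OF borel_cartan_bracket[OF borel_monomial[OF monomial_bracket(1)]]]
      by metis
  next
    case False
    then have "km_br (km_gen_at m (\<not> s) i) (km_gen_at m s j) = 0"
      using km_relation_simps(3)[of i j m "\<not> s"] by simp
    then show ?thesis by (simp add: borel_zero)
  qed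
  then show ?case
    unfolding km_jacobi[of "km_gen_at m (\<not> s) i"] by (intro borel_add borel_gen monomial_bracket)
next
  case (monomial_scale \<alpha> x c)
  then show ?case by (simp add: km_br_linear borel_scale)
qed

lemma borel_opposite_gen: "km_borel m s x \<Longrightarrow> \<exists>y z. km_br (km_gen_at m (\<not> s) i) x = y + z \<and> km_borel m s y \<and> km_borel m (\<not> s) z"
proof (induction rule: km_borel.induct)
  case (borel_cartan k d)
  have "km_borel m (\<not> s) (km_br (km_gen_at m (\<not> s) i) (k *\<^sub>L km_cartan m d))"
    by (intro borel_gen km_borel.borel_cartan)
  then show ?case using borel_zero by (metis add_0)
next
  case (borel_monomial \<alpha> x)
  then show ?case using opposite_gen_monomial borel_zero by (metis add.right_neutral)
next
  case (borel_add x x')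
  then obtain y z y' z' where "km_br (km_gen_at m (\<not> s) i) x = y + z" "km_borel m s y" "km_borel m (\<not> s) z"
    "km_br (km_gen_at m (\<not> s) i) x' = y' + z'" "km_borel m s y'" "km_borel m (\<not> s) z'" by blast
  then have "km_br (km_gen_at m (\<not> s) i) (x + x') = (y + y') + (z + z')" "km_borel m s (y + y')" "km_borel m (\<not> s) (z + z')"
    by (simp_all add: km_br_linear algebra_simps km_borel.borel_add)
  then show ?case by blast
qed

definition km_triangular :: "nat \<Rightarrow> km_product \<Rightarrow> bool" where
  "km_triangular m x \<longleftrightarrow> (\<exists>y z. x = y + z \<and> km_borel m True y \<and> km_borel m False z)"

lemma triangular_add: "km_triangular m x \<Longrightarrow> km_triangular m y \<Longrightarrow> km_triangular m (x + y)"
proof -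
  assume "km_triangular m x" "km_triangular m y"
  then obtain a b c d where "x = a + b" "y = c + d" "km_borel m True a" "km_borel m False b" "km_borel m True c" "km_borel m False d"
    unfolding km_triangular_def by blast
  then have "x + y = (a + c) + (b + d)" "km_borel m True (a + c)" "km_borel m False (b + d)"
    by (simp_all add: borel_add algebra_simps)
  then show ?thesis unfolding km_triangular_def by blast
qed

lemma triangular_scale: "km_triangular m x \<Longrightarrow> km_triangular m (c *\<^sub>L x)"
  unfolding km_triangular_def using borel_scale km.scale_right_distrib by metis

lemma triangular_borel: "km_borel m s x \<Longrightarrow> km_triangular m x"
  unfolding km_triangular_def using borel_zero by (cases s) (metis add.right_neutral, metis add_0)

lemma triangular_gen:
  assumes "km_triangular m x"
  shows "km_triangular m (km_br (km_gen_at m s i) x)"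
proof -
  have "km_triangular m (km_br (km_gen_at m s i) y)" if "km_borel m t y" for t y
  proof (cases "s = t")
    case True
    then show ?thesis using that borel_gen triangular_borel by blast
  next
    case False
    then have s: "s = (\<not> t)" by simp
    obtain u v where "km_br (km_gen_at m s i) y = u + v" "km_borel m t u" "km_borel m s v"
      using borel_opposite_gen[OF \<open>km_borel m t y\<close>, of i] unfolding s by blast
    then show ?thesis using triangular_add triangular_borel by metis
  qed
  then show ?thesis using assms unfolding km_triangular_def[of m x]
    using triangular_add km_br_linear(2) by metis
qed

lemma triangular_cartan:
  assumes "km_triangular m x"
  shows "km_triangular m (km_br (km_cartan m c) x)"
  using assms unfolding km_triangular_def using borel_cartan_bracket km_br_linear(2) by metis

lemma km_in_gen_cases:
  obtains (gen) s i where "km_in m (LGen g) = km_gen_at m s i" | (cartan) c where "km_in m (LGen g) = km_cartan m c"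
proof (cases g)
  case (KE i)
  then show thesis using gen[of True i] by (simp add: km_gen_at_def)
next
  case (KF i)
  then show thesis using gen[of False i] by (simp add: km_gen_at_def)
next
  case (KC c)
  then show thesis using cartan[of c] by (simp add: km_cartan_def)
qed

lemma triangular_ad: "km_triangular m y \<Longrightarrow> km_triangular m (km_br (km_in m x) y)"
proof (induction x arbitrary: y)
  case (LGen g)
  then show ?case by (cases g rule: km_in_gen_cases[of m]) (simp_all add: triangular_gen triangular_cartan)
next
  case LZero
  show ?case using triangular_borel[OF borel_zero] by (simp add: km_in_simps)
next
  case (LAdd x z)
  then show ?case by (simp add: km_in_simps km_br_linear triangular_add)
next
  case (LScale c x)
  then show ?case by (simp add: km_in_simps km_br_linear triangular_scale)
next
  case (LBr x z)
  have "km_br (km_br (km_in m x) (km_in m z)) y =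
      km_br (km_in m x) (km_br (km_in m z) y) + (- 1) *\<^sub>L km_br (km_in m z) (km_br (km_in m x) y)"
    using km_jacobi[of "km_in m x" "km_in m z" y] by simp
  then show ?case unfolding km_in_simps by (simp only:) (intro triangular_add triangular_scale LBr)
qed

lemma km_in_triangular: "km_triangular m (km_in m x)"
proof (induction x)
  case (LGen g)
  show ?case
  proof (cases g rule: km_in_gen_cases[of m])
    case (gen s i)
    then show ?thesis using triangular_borel[OF borel_monomial[OF monomial_gen]] by metis
  next
    case (cartan c)
    then show ?thesis using triangular_borel[OF borel_cartan[of m True 1 c]] by simp
  qed
next
  case LZero
  show ?case using triangular_borel[OF borel_zero] by (simp add: km_in_simps)
next
  case (LBr x y)
  then show ?case unfolding km_in_simps by (intro triangular_ad)
qed (simp_all add: km_in_simps triangular_add triangular_scale)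

text \<open>The determinant \<open>4 - m\<^sup>2\<close> of the Cartan matrix vanishes only for \<open>m = 2\<close>, where the derivation
  separates the weights.\<close>

lemma lattice_weight_inj:
  assumes m: "2 \<le> m" and e: "\<And>c. lattice_weight m \<alpha> c = lattice_weight m \<beta> c"
  shows "\<alpha> = \<beta>"
proof -
  define a where "a = fst \<alpha> - fst \<beta>"
  define b where "b = snd \<alpha> - snd \<beta>"
  have 1: "2 * a = int m * b" "2 * b = int m * a"
    using e[of "CH N1"] e[of "CH N2"] by (simp_all add: lattice_weight_def cartan_def a_def b_def algebra_simps)
  have 2: "b = 0" if "m = 2" using e[of CD] that by (simp add: lattice_weight_def b_def)
  have "b = 0"
  proof (cases "m = 2")
    case False
    have "4 * b = 2 * (int m * a)" using 1 by simp
    also have "\<dots> = int m * (int m * b)" using 1(1) by simp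
    finally have "(int m * int m - 4) * b = 0" by (simp add: algebra_simps)
    moreover have "3 * 3 \<le> int m * int m" using m False by (intro mult_mono) auto
    ultimately show ?thesis by simp
  qed (use 2 in simp)
  then have "a = 0" using 1 by simp
  then show ?thesis using \<open>b = 0\<close> by (simp add: a_def b_def prod_eq_iff)
qed

definition cartan_shift :: "nat \<Rightarrow> (cartan_gen \<times> complex) \<Rightarrow> km_product \<Rightarrow> km_product" where
  "cartan_shift m p x = km_br (km_cartan m (fst p)) x + (- snd p) *\<^sub>L x"

text \<open>A vector is annihilated by a product of operators \<open>h - c\<close>, none of which has the eigenvalue
  \<open>0\<close> on vectors of weight \<open>\<alpha>\<close>. This replaces the projection to a weight space and the linear
  independence of weight spaces.\<close>

definition weight_killed :: "nat \<Rightarrow> int \<times> int \<Rightarrow> km_product \<Rightarrow> bool" where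
  "weight_killed m \<alpha> x \<longleftrightarrow> (\<exists>ps. (\<forall>p \<in> set ps. snd p \<noteq> of_int (lattice_weight m \<alpha> (fst p))) \<and>
     foldr (cartan_shift m) ps x = 0)"

lemma cartan_shift_add: "cartan_shift m p (x + y) = cartan_shift m p x + cartan_shift m p y"
  unfolding cartan_shift_def km_br_linear(2) km.scale_right_distrib by (simp only: ac_simps)

lemma cartan_shift_commute: "cartan_shift m p (cartan_shift m q x) = cartan_shift m q (cartan_shift m p x)"
proof -
  have "km_br (km_cartan m (fst p)) (km_br (km_cartan m (fst q)) x) =
     km_br (km_cartan m (fst q)) (km_br (km_cartan m (fst p)) x)"
    using km_jacobi[of "km_cartan m (fst p)"] by (simp add: km_relation_simps)
  then show ?thesis
    by (simp only: cartan_shift_def km_br_linear km.scale_right_distrib km.scale_scale mult.commute ac_simps)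
qed

lemma foldr_cartan_shift:
  "foldr (cartan_shift m) ps 0 = 0"
  "foldr (cartan_shift m) ps (x + y) = foldr (cartan_shift m) ps x + foldr (cartan_shift m) ps y"
  "foldr (cartan_shift m) ps (cartan_shift m p x) = cartan_shift m p (foldr (cartan_shift m) ps x)"
  by (induction ps) (simp_all add: cartan_shift_add cartan_shift_commute[of m p], simp add: cartan_shift_def)

lemma foldr_cartan_shift_commute:
  "foldr (cartan_shift m) ps (foldr (cartan_shift m) qs x) = foldr (cartan_shift m) qs (foldr (cartan_shift m) ps x)"
  by (induction qs) (simp_all add: foldr_cartan_shift(3))

lemma weight_killed_add:
  assumes "weight_killed m \<alpha> x" "weight_killed m \<alpha> y"
  shows "weight_killed m \<alpha> (x + y)"
proof -
  obtain ps qs where ps: "\<forall>p \<in> set ps. snd p \<noteq> of_int (lattice_weight m \<alpha> (fst p))" "foldr (cartan_shift m) ps x = 0"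
    and qs: "\<forall>p \<in> set qs. snd p \<noteq> of_int (lattice_weight m \<alpha> (fst p))" "foldr (cartan_shift m) qs y = 0"
    using assms unfolding weight_killed_def by blast
  have "foldr (cartan_shift m) (ps @ qs) (x + y) = 0"
    using foldr_cartan_shift_commute[of m ps qs x] ps(2) qs(2) by (simp add: foldr_cartan_shift)
  then show ?thesis using ps(1) qs(1) unfolding weight_killed_def by (intro exI[of _ "ps @ qs"]) auto
qed

lemma weight_killed_other:
  assumes m: "2 \<le> m" and x: "km_weight m \<beta> x" and ne: "\<alpha> \<noteq> \<beta>"
  shows "weight_killed m \<alpha> x"
proof -
  obtain c where c: "lattice_weight m \<beta> c \<noteq> lattice_weight m \<alpha> c"
    using lattice_weight_inj[OF m, of \<alpha> \<beta>] ne by metis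
  have "cartan_shift m (c, of_int (lattice_weight m \<beta> c)) x = 0"
    using x by (simp add: cartan_shift_def km_weight_def)
  then show ?thesis using c unfolding weight_killed_def
    by (intro exI[of _ "[(c, of_int (lattice_weight m \<beta> c))]"]) simp
qed

lemma weight_not_killed:
  assumes x: "km_weight m \<alpha> x" and k: "weight_killed m \<alpha> x"
  shows "x = 0"
proof -
  obtain ps where ps: "\<forall>p \<in> set ps. snd p \<noteq> of_int (lattice_weight m \<alpha> (fst p))" "foldr (cartan_shift m) ps x = 0"
    using k unfolding weight_killed_def by blast
  have "\<exists>d. d \<noteq> 0 \<and> foldr (cartan_shift m) ps x = d *\<^sub>L x"
    using ps(1)
  proof (induction ps)
    case Nil
    show ?case by (intro exI[of _ 1]) simp
  next
    case (Cons p ps)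
    then obtain d where d: "d \<noteq> 0" "foldr (cartan_shift m) ps x = d *\<^sub>L x" by auto
    have "foldr (cartan_shift m) (p # ps) x = d *\<^sub>L (of_int (lattice_weight m \<alpha> (fst p)) *\<^sub>L x) + (- snd p) *\<^sub>L (d *\<^sub>L x)"
      using x by (simp add: d(2) cartan_shift_def km_br_linear km_weight_def)
    also have "\<dots> = (d * of_int (lattice_weight m \<alpha> (fst p)) + (- snd p) * d) *\<^sub>L x"
      by (simp only: km.scale_scale km.scale_left_distrib)
    also have "d * of_int (lattice_weight m \<alpha> (fst p)) + (- snd p) * d = (of_int (lattice_weight m \<alpha> (fst p)) - snd p) * d"
      by (simp add: algebra_simps)
    finally show ?case using Cons.prems d(1)
      by (intro exI[of _ "(of_int (lattice_weight m \<alpha> (fst p)) - snd p) * d"]) auto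
  qed
  then show ?thesis using ps(2) by auto
qed

text \<open>By the triangular decomposition every element is a sum of vectors whose weights have no mixed
  signs.\<close>

theorem km_root_same_sign:
  assumes m: "2 \<le> m" and occ: "km_occurs m (a, b)"
  shows "0 \<le> a * b"
proof (rule ccontr)
  assume neg: "\<not> 0 \<le> a * b"
  have borel: "weight_killed m (a, b) y" if "km_borel m s y" for s y
    using that
  proof (induction rule: km_borel.induct)
    case (borel_cartan k c)
    have "km_weight m (0, 0) (km_cartan m c)"
      unfolding km_weight_def using km_relation_simps(1)[of m _ c] by (auto simp: lattice_weight_def) (simp add: km_cartan_def)
    then show ?case using neg by (intro weight_killed_other[OF m km_weight_scale]) auto
  next
    case (borel_monomial \<alpha> x)
    have "0 \<le> (sgn_of s * fst \<alpha>) * (sgn_of s * snd \<alpha>)" using km_monomial_sign[OF borel_monomial] by simp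
    also have "\<dots> = fst \<alpha> * snd \<alpha>" by (simp add: sgn_of_def)
    finally have "(a, b) \<noteq> \<alpha>" using neg by auto
    then show ?case by (rule weight_killed_other[OF m km_monomial_weight[OF borel_monomial]])
  qed (rule weight_killed_add)
  obtain v where v: "km_weight m (a, b) v" "v \<noteq> 0" using occ by (auto simp: km_occurs_def)
  obtain x where x: "v = km_in m x" using v by (auto simp: km_weight_def)
  have "weight_killed m (a, b) v"
    using km_in_triangular[of m x] borel weight_killed_add unfolding x km_triangular_def by metis
  then show False using weight_not_killed[OF v(1)] v(2) by simp
qed

section \<open>A representation in which the generators are non-zero\<close>

type_synonym vec = "node list \<Rightarrow> complex"

definition vec_scale :: "complex \<Rightarrow> vec \<Rightarrow> vec" where
  "vec_scale c \<phi> = (\<lambda>w. c * \<phi> w)"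

lemma vec_scale_apply: "vec_scale c \<phi> w = c * \<phi> w"
  by (simp add: vec_scale_def)

definition op_scale :: "complex \<Rightarrow> (vec \<Rightarrow> vec) \<Rightarrow> vec \<Rightarrow> vec" where
  "op_scale c A = (\<lambda>\<phi>. vec_scale c (A \<phi>))"

definition op_br :: "(vec \<Rightarrow> vec) \<Rightarrow> (vec \<Rightarrow> vec) \<Rightarrow> vec \<Rightarrow> vec" where
  "op_br A B = (\<lambda>\<phi>. A (B \<phi>) - B (A \<phi>))"

definition op_linear :: "(vec \<Rightarrow> vec) \<Rightarrow> bool" where
  "op_linear A \<longleftrightarrow> (\<forall>\<phi> \<psi>. A (\<phi> + \<psi>) = A \<phi> + A \<psi>) \<and> (\<forall>c \<phi>. A (vec_scale c \<phi>) = vec_scale c (A \<phi>))"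

interpretation vec: vector_space vec_scale
  by standard (auto simp: vec_scale_def fun_eq_iff algebra_simps)

lemma op_linearD:
  assumes "op_linear A"
  shows "A (\<phi> + \<psi>) = A \<phi> + A \<psi>" "A (vec_scale c \<phi>) = vec_scale c (A \<phi>)" "A 0 = 0" "A (\<phi> - \<psi>) = A \<phi> - A \<psi>"
proof -
  show 1: "A (\<phi> + \<psi>) = A \<phi> + A \<psi>" for \<phi> \<psi> using assms by (simp add: op_linear_def)
  show 2: "A (vec_scale c \<phi>) = vec_scale c (A \<phi>)" for c \<phi> using assms by (simp add: op_linear_def)
  show "A 0 = 0" using 2[of 0 0] by simp
  show "A (\<phi> - \<psi>) = A \<phi> - A \<psi>" using 1[of "\<phi> - \<psi>" \<psi>] by (simp add: algebra_simps)
qed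

lemma op_linear_bracket:
  assumes "op_linear A" "op_linear B"
  shows "op_linear (op_br A B)"
  unfolding op_linear_def op_br_def
  by (simp add: op_linearD[OF assms(1)] op_linearD[OF assms(2)] vec.scale_right_diff_distrib)

text \<open>The adjoint action on linear operators. For other maps the Jacobi identity fails, which is why
  the representation lives on a subspace.\<close>

lemma op_sl2_module:
  assumes lin: "op_linear A" "op_linear B" "op_linear H"
    and rel: "op_br A B = H" "op_br H A = op_scale 2 A" "op_br H B = op_scale (- 2) B"
  shows "sl2_module op_scale {X. op_linear X} (op_br A) (op_br B) (op_br H)"
proof
  note L = op_linearD[OF lin(1)] op_linearD[OF lin(2)] op_linearD[OF lin(3)]
  have r: "H \<phi> = A (B \<phi>) - B (A \<phi>)" "vec_scale 2 (A \<phi>) = H (A \<phi>) - A (H \<phi>)" "vec_scale (- 2) (B \<phi>) = H (B \<phi>) - B (H \<phi>)" for \<phi>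
    using fun_cong[OF rel(1), of \<phi>] fun_cong[OF rel(2), of \<phi>] fun_cong[OF rel(3), of \<phi>]
    by (simp_all add: op_br_def op_scale_def)
  fix a b :: complex and x y :: "vec \<Rightarrow> vec"
  show "op_scale a (x + y) = op_scale a x + op_scale a y" "op_scale (a + b) x = op_scale a x + op_scale b x"
    "op_scale a (op_scale b x) = op_scale (a * b) x" "op_scale 1 x = x"
    by (simp_all add: op_scale_def fun_eq_iff vec.scale_right_distrib vec.scale_left_distrib)
  show "op_br A (x + y) = op_br A x + op_br A y" "op_br B (x + y) = op_br B x + op_br B y"
    by (simp_all add: op_br_def fun_eq_iff L)
  show "op_br A (op_scale a x) = op_scale a (op_br A x)" "op_br B (op_scale a x) = op_scale a (op_br B x)"
    by (simp_all add: op_br_def op_scale_def L vec.scale_right_diff_distrib)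
  assume "x \<in> {X. op_linear X}"
  then have x: "op_linear x" by simp
  show "op_br A x \<in> {X. op_linear X}" "op_br B x \<in> {X. op_linear X}"
    using op_linear_bracket lin x by simp_all
  note X = op_linearD[OF x]
  show "op_br A (op_br B x) = op_br B (op_br A x) + op_br H x"
    by (rule ext) (simp add: op_br_def L X r(1))
  have s: "vec_scale 2 (A (x \<phi>)) = H (A (x \<phi>)) - A (H (x \<phi>))" "vec_scale 2 (x (A \<phi>)) = x (H (A \<phi>)) - x (A (H \<phi>))"
    "vec_scale (- 2) (B (x \<phi>)) = H (B (x \<phi>)) - B (H (x \<phi>))" "vec_scale (- 2) (x (B \<phi>)) = x (H (B \<phi>)) - x (B (H \<phi>))" for \<phi>
    unfolding X(2,4)[symmetric] r(2,3)[symmetric] by (rule refl)+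
  show "op_br H (op_br A x) = op_br A (op_br H x) + op_scale 2 (op_br A x)"
    by (rule ext) (simp add: op_br_def op_scale_def L X vec.scale_right_diff_distrib s)
  show "op_br H (op_br B x) = op_br B (op_br H x) + op_scale (- 2) (op_br B x)"
    by (rule ext) (simp add: op_br_def op_scale_def L X vec.scale_right_diff_distrib s del: vec.scale_minus_left)
qed

lemma op_linear_funpow_bracket: "op_linear A \<Longrightarrow> op_linear B \<Longrightarrow> op_linear ((op_br A ^^ n) B)"
  by (induction n) (auto intro: op_linear_bracket)

lemma op_commute: "op_br A B = 0 \<Longrightarrow> A (B \<phi>) = B (A \<phi>)"
  by (auto simp: op_br_def fun_eq_iff)

lemma op_commute_ad:
  assumes A: "op_linear A" and B: "op_linear B" and AB: "op_br B A = 0" and X: "op_linear X"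
  shows "op_br B ((op_br A ^^ n) X) = (op_br A ^^ n) (op_br B X)"
proof (induction n)
  case (Suc n)
  define Y where "Y = (op_br A ^^ n) X"
  have Y: "op_linear Y" unfolding Y_def by (rule op_linear_funpow_bracket[OF A X])
  have "op_br B (op_br A Y) = op_br A (op_br B Y)"
    by (rule ext) (simp add: op_br_def op_linearD[OF A] op_linearD[OF B] op_commute[OF AB])
  then show ?case using Suc by (simp add: Y_def)
qed simp

lemma op_br_zero: "op_linear A \<Longrightarrow> op_br A 0 = 0"
  by (rule ext) (simp add: op_br_def zero_fun_def op_linearD(3)[unfolded zero_fun_def] fun_eq_iff)

text \<open>For \<open>k = i\<close> this is \<open>lower_raise\<close>: \<open>A j\<close> is a lowest weight vector of weight \<open>- m\<close>, and raising it \<open>m + 1\<close> times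
  makes the factor vanish. For \<open>k = j\<close> the bracket with \<open>B j\<close> turns \<open>A j\<close> into a multiple of \<open>K j\<close>, which is
  annihilated by two brackets with \<open>A i\<close>.\<close>

lemma serre_commutes:
  fixes A B K :: "node \<Rightarrow> vec \<Rightarrow> vec"
  assumes m: "2 \<le> m" and lin: "\<And>i. op_linear (A i)" "\<And>i. op_linear (B i)" "\<And>i. op_linear (K i)"
    and AB: "\<And>i. op_br (A i) (B i) = K i" "\<And>i j. i \<noteq> j \<Longrightarrow> op_br (A i) (B j) = 0"
    and KA: "\<And>i j. op_br (K i) (A j) = op_scale (of_int (cartan m i j)) (A j)"
    and KB: "\<And>i j. op_br (K i) (B j) = op_scale (- of_int (cartan m i j)) (B j)"
    and ij: "i \<noteq> j"
  shows "op_br (B k) ((op_br (A i) ^^ Suc m) (A j)) = 0"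
proof -
  interpret sl2_module op_scale "{X. op_linear X}" "op_br (A i)" "op_br (B i)" "op_br (K i)"
    by (rule op_sl2_module) (simp_all add: lin AB KA KB cartan_def)
  have skew: "op_br X Y = - op_br Y X" for X Y by (simp add: op_br_def fun_eq_iff)
  show ?thesis
  proof (cases "k = i")
    case True
    have f: "op_br (B i) (A j) = 0" using AB(2)[of j i] ij skew[of "B i" "A j"] by simp
    have h: "op_br (K i) (A j) = op_scale (- of_nat m) (A j)" unfolding KA using ij by (simp add: cartan_def)
    have "op_br (B i) ((op_br (A i) ^^ Suc m) (A j)) = op_scale 0 ((op_br (A i) ^^ m) (A j))"
      using lower_raise[OF _ f h, of m] lin by simp
    then show ?thesis using True by simp
  next
    case False
    then have k: "k = j" using node_neq ij by metis
    have BA: "op_br (B j) (A i) = 0" using AB(2)[of i j] ij skew[of "B j" "A i"] by simp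
    have e1: "op_br (A i) (op_br (B j) (A j)) = op_scale (of_int (cartan m j i)) (A i)"
    proof -
      have "op_br (A i) (op_br (B j) (A j)) = op_br (K j) (A i)"
        unfolding AB(1)[symmetric] by (rule ext) (simp add: op_br_def op_linearD[OF lin(1)])
      then show ?thesis by (simp add: KA)
    qed
    have e2: "op_br (A i) (op_scale c (A i)) = 0" for c
      by (simp add: op_br_def op_scale_def op_linearD[OF lin(1)] fun_eq_iff)
    have Sm: "Suc m = (m - 1) + 2" using m by simp
    have "op_br (B j) ((op_br (A i) ^^ Suc m) (A j)) = (op_br (A i) ^^ Suc m) (op_br (B j) (A j))"
      by (rule op_commute_ad[OF lin(1) lin(2) BA lin(1)])
    also have "(op_br (A i) ^^ Suc m) (op_br (B j) (A j)) =
       (op_br (A i) ^^ (m - 1)) ((op_br (A i) ^^ 2) (op_br (B j) (A j)))"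
      unfolding Sm by (simp only: funpow_add o_apply)
    also have "(op_br (A i) ^^ 2) (op_br (B j) (A j)) = 0"
      by (simp add: numeral_2_eq_2 e1 e2)
    also have "(op_br (A i) ^^ n) 0 = 0" for n
      by (induction n) (simp_all only: funpow.simps o_apply id_apply op_br_zero[OF lin(1)])
    finally show ?thesis using k by simp
  qed
qed

text \<open>Functions on words in the nodes form the dual of a free algebra; \<open>E\<^sub>i\<close> acts by reading off a letter,
  and \<open>F\<^sub>i\<close> is determined by \<open>[E\<^sub>i, F\<^sub>j] = \<delta>\<^sub>i\<^sub>j H\<^sub>i\<close> together with the value \<open>0\<close> at the empty word.\<close>

definition word_weight :: "nat \<Rightarrow> cartan_gen \<Rightarrow> node list \<Rightarrow> int" where
  "word_weight m c w = (if c = CD then 0 else 1) - sum_list (map (\<lambda>j. simple_root m j c) w)"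

definition act_E :: "node \<Rightarrow> vec \<Rightarrow> vec" where
  "act_E i \<phi> = (\<lambda>w. \<phi> (i # w))"

definition act_C :: "nat \<Rightarrow> cartan_gen \<Rightarrow> vec \<Rightarrow> vec" where
  "act_C m c \<phi> = (\<lambda>w. of_int (word_weight m c w) * \<phi> w)"

primrec act_F_at :: "nat \<Rightarrow> node \<Rightarrow> node list \<Rightarrow> vec \<Rightarrow> complex" where
  "act_F_at m j [] \<phi> = 0"
| "act_F_at m j (i # w) \<phi> = (if i = j then act_C m (CH j) \<phi> w else 0) + act_F_at m j w (act_E i \<phi>)"

definition act_F :: "nat \<Rightarrow> node \<Rightarrow> vec \<Rightarrow> vec" where
  "act_F m j \<phi> = (\<lambda>w. act_F_at m j w \<phi>)"

lemma act_linear: "op_linear (act_E i)" "op_linear (act_C m c)" "op_linear (act_F m j)"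
proof -
  show E: "op_linear (act_E i)" for i by (simp add: op_linear_def act_E_def vec_scale_def fun_eq_iff)
  show C: "op_linear (act_C m c)" for c by (simp add: op_linear_def act_C_def vec_scale_def fun_eq_iff algebra_simps)
  have "act_F_at m j w (\<phi> + \<psi>) = act_F_at m j w \<phi> + act_F_at m j w \<psi>" for w \<phi> \<psi>
    by (induction w arbitrary: \<phi> \<psi>) (simp_all add: op_linearD(1)[OF E] op_linearD(1)[OF C])
  moreover have "act_F_at m j w (vec_scale c \<phi>) = c * act_F_at m j w \<phi>" for w \<phi> c
    by (induction w arbitrary: \<phi>) (simp_all add: op_linearD(2)[OF E] op_linearD(2)[OF C], simp_all add: vec_scale_def algebra_simps)
  ultimately show "op_linear (act_F m j)" by (simp add: op_linear_def act_F_def fun_eq_iff vec_scale_def)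
qed

lemma act_E_F: "act_E i (act_F m j \<phi>) = act_F m j (act_E i \<phi>) + (if i = j then act_C m (CH j) \<phi> else 0)"
  by (auto simp: act_E_def act_F_def fun_eq_iff)

lemma act_C_apply: "act_C m c \<phi> w = of_int (word_weight m c w) * \<phi> w"
  by (simp add: act_C_def)

lemma word_weight_Cons: "word_weight m c (j # w) = word_weight m c w - simple_root m j c"
  by (simp add: word_weight_def)

lemma act_C_E: "act_C m c (act_E j \<phi>) = act_E j (act_C m c \<phi>) + vec_scale (of_int (simple_root m j c)) (act_E j \<phi>)"
  by (simp add: act_E_def act_C_def fun_eq_iff vec_scale_def word_weight_Cons algebra_simps)

lemma act_C_F: "act_C m c (act_F m j \<phi>) = act_F m j (act_C m c \<phi>) + vec_scale (- of_int (simple_root m j c)) (act_F m j \<phi>)"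
proof -
  have "of_int (word_weight m c w) * act_F_at m j w \<phi> =
      act_F_at m j w (act_C m c \<phi>) - of_int (simple_root m j c) * act_F_at m j w \<phi>" for w
  proof (induction w arbitrary: \<phi>)
    case (Cons i w)
    have e: "act_E i (act_C m c \<phi>) = act_C m c (act_E i \<phi>) + vec_scale (- of_int (simple_root m i c)) (act_E i \<phi>)"
      unfolding act_C_E by simp
    have "act_F_at m j w (act_E i (act_C m c \<phi>)) =
        act_F_at m j w (act_C m c (act_E i \<phi>)) - of_int (simple_root m i c) * act_F_at m j w (act_E i \<phi>)"
    proof -
      have "act_F m j (act_E i (act_C m c \<phi>)) w =
          (act_F m j (act_C m c (act_E i \<phi>)) + vec_scale (- of_int (simple_root m i c)) (act_F m j (act_E i \<phi>))) w"
        unfolding e op_linearD(1,2)[OF act_linear(3)] ..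
      then show ?thesis by (simp only: plus_fun_apply vec_scale_apply) (simp add: act_F_def)
    qed
    then show ?case using Cons[of "act_E i \<phi>"]
      by (auto simp: word_weight_Cons act_C_apply[of _ _ _ w] ring_distribs)
  qed simp
  then show ?thesis by (simp add: act_C_apply act_F_def fun_eq_iff vec_scale_def)
qed


lemma act_brackets:
  "op_br (act_E i) (act_F m i) = act_C m (CH i)"
  "i \<noteq> j \<Longrightarrow> op_br (act_E i) (act_F m j) = 0"
  "op_br (act_C m c) (act_E j) = op_scale (of_int (simple_root m j c)) (act_E j)"
  "op_br (act_C m c) (act_F m j) = op_scale (- of_int (simple_root m j c)) (act_F m j)"
  by (rule ext; simp add: op_br_def op_scale_def act_E_F act_C_E act_C_F)+

text \<open>The Serre element commutes with all \<open>E\<^sub>k\<close>, and these read off letters; so its values on all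
  words reduce to its value at the empty word, where every \<open>F\<^sub>k\<close> yields \<open>0\<close>.\<close>

lemma act_serre_F:
  assumes "2 \<le> m" "i \<noteq> j"
  shows "(op_br (act_F m i) ^^ Suc m) (act_F m j) \<phi> = 0"
proof -
  define X where "X = (op_br (act_F m i) ^^ Suc m) (act_F m j)"
  have skew: "op_br Y Z = - op_br Z Y" for Y Z by (simp add: op_br_def fun_eq_iff)
  have neg: "op_br (op_scale (- 1) Y) Z = op_scale (- 1) (op_br Y Z)" if "op_linear Z" for Y Z
    by (rule ext) (simp add: op_br_def op_scale_def op_linearD[OF that] vec.scale_right_diff_distrib del: vec.scale_minus_left)
  have lin: "op_linear (op_scale (- 1) (act_C m (CH i)))" for i
    using op_linearD[OF act_linear(2), of m "CH i"] by (simp add: op_linear_def op_scale_def)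
  have "op_br (act_E k) X = 0" for k
    unfolding X_def
  proof (rule serre_commutes[where B = act_E and K = "\<lambda>i. op_scale (- 1) (act_C m (CH i))"])
    fix i j
    show "op_br (act_F m i) (act_E i) = op_scale (- 1) (act_C m (CH i))"
      unfolding skew[of "act_F m i"] act_brackets by (simp add: op_scale_def fun_eq_iff)
    show "i \<noteq> j \<Longrightarrow> op_br (act_F m i) (act_E j) = 0"
      unfolding skew[of "act_F m i"] using act_brackets(2)[of j i] by simp
    show "op_br (op_scale (- 1) (act_C m (CH i))) (act_F m j) = op_scale (of_int (cartan m i j)) (act_F m j)"
      unfolding neg[OF act_linear(3)] act_brackets by (simp add: op_scale_def)
    show "op_br (op_scale (- 1) (act_C m (CH i))) (act_E j) = op_scale (- of_int (cartan m i j)) (act_E j)"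
      unfolding neg[OF act_linear(1)] act_brackets by (simp add: op_scale_def)
  qed (fact assms act_linear lin)+
  then have E: "act_E k (X \<phi>) = X (act_E k \<phi>)" for k \<phi> by (rule op_commute)
  have nil: "(op_br (act_F m i) ^^ n) (act_F m j) \<phi> [] = 0" for n \<phi>
    by (induction n arbitrary: \<phi>) (simp_all add: op_br_def, simp_all add: act_F_def)
  have "X \<phi> w = 0" for w
  proof (induction w arbitrary: \<phi>)
    case Nil
    show ?case unfolding X_def by (rule nil)
  next
    case (Cons k w)
    have "X \<phi> (k # w) = act_E k (X \<phi>) w" by (simp add: act_E_def)
    then show ?case using Cons unfolding E by simp
  qed
  then show ?thesis by (simp add: X_def fun_eq_iff)
qed

text \<open>A function annihilated by all \<open>E\<^sub>i\<close>; it generates the submodule on which the positive Serre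
  relations hold.\<close>

definition vacuum :: vec where
  "vacuum = (\<lambda>w. if w = [] then 1 else 0)"

inductive vac_module :: "nat \<Rightarrow> vec \<Rightarrow> bool" for m where
  vac_gen: "vac_module m vacuum"
| vac_F: "vac_module m \<phi> \<Longrightarrow> vac_module m (act_F m i \<phi>)"
| vac_add: "vac_module m \<phi> \<Longrightarrow> vac_module m \<psi> \<Longrightarrow> vac_module m (\<phi> + \<psi>)"
| vac_scale: "vac_module m \<phi> \<Longrightarrow> vac_module m (vec_scale c \<phi>)"

lemma vac_zero: "vac_module m 0"
  using vac_scale[OF vac_gen, of m 0] by simp

lemma vac_diff: "vac_module m \<phi> \<Longrightarrow> vac_module m \<psi> \<Longrightarrow> vac_module m (\<phi> - \<psi>)"
  using vac_add[OF _ vac_scale[of m \<psi> "- 1"], of \<phi>] by simp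

lemma vacuum_E: "act_E i vacuum = 0"
  by (simp add: act_E_def vacuum_def fun_eq_iff)

lemma vac_C: "vac_module m \<phi> \<Longrightarrow> vac_module m (act_C m c \<phi>)"
proof (induction rule: vac_module.induct)
  case vac_gen
  have "act_C m c vacuum = vec_scale (of_int (word_weight m c [])) vacuum"
    by (simp add: act_C_def vec_scale_def vacuum_def fun_eq_iff)
  then show ?case by (simp add: vac_scale vac_module.vac_gen)
next
  case (vac_F \<phi> i)
  then show ?case unfolding act_C_F by (intro vac_module.intros)
qed (simp_all add: op_linearD[OF act_linear(2)] vac_add vac_scale del: plus_fun_apply)

lemma vac_E: "vac_module m \<phi> \<Longrightarrow> vac_module m (act_E i \<phi>)"
proof (induction rule: vac_module.induct)
  case vac_gen
  show ?case unfolding vacuum_E by (rule vac_zero)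
next
  case (vac_F \<phi> j)
  then show ?case unfolding act_E_F by (intro vac_module.intros) (simp_all add: vac_C vac_zero)
qed (simp_all add: op_linearD[OF act_linear(1)] vac_add vac_scale del: plus_fun_apply)

text \<open>The Serre element annihilates the vacuum and commutes with all \<open>F\<^sub>k\<close>.\<close>

lemma act_serre_E:
  assumes "2 \<le> m" "i \<noteq> j"
  shows "vac_module m \<phi> \<Longrightarrow> (op_br (act_E i) ^^ Suc m) (act_E j) \<phi> = 0"
proof -
  define X where "X = (op_br (act_E i) ^^ Suc m) (act_E j)"
  have X: "op_linear X" unfolding X_def by (rule op_linear_funpow_bracket[OF act_linear(1) act_linear(1)])
  have "op_br (act_F m k) X = 0" for k
    unfolding X_def
    by (rule serre_commutes[where K = "\<lambda>i. act_C m (CH i)"])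
      (simp_all add: assms act_linear act_brackets)
  then have F: "act_F m k (X \<phi>) = X (act_F m k \<phi>)" for k \<phi> by (rule op_commute)
  have vac: "(op_br (act_E i) ^^ n) (act_E j) vacuum = 0" for n
  proof (induction n)
    case (Suc n)
    define Y where "Y = (op_br (act_E i) ^^ n) (act_E j)"
    have Y: "op_linear Y" unfolding Y_def by (rule op_linear_funpow_bracket[OF act_linear(1) act_linear(1)])
    have "op_br (act_E i) Y vacuum = act_E i (Y vacuum) - Y (act_E i vacuum)" by (simp only: op_br_def)
    also have "\<dots> = 0"
      by (simp only: vacuum_E Suc[folded Y_def] op_linearD(3)[OF Y] op_linearD(3)[OF act_linear(1)] diff_self)
    finally show ?case by (simp only: Y_def funpow.simps o_apply)
  qed (simp add: vacuum_E)
  have "X \<phi> = 0" if "vac_module m \<phi>" for \<phi>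
    using that
  proof (induction rule: vac_module.induct)
    case vac_gen
    show ?case unfolding X_def by (rule vac)
  next
    case (vac_F \<phi> k)
    then show ?case by (simp only: F[symmetric] op_linearD(3)[OF act_linear(3)])
  qed (simp_all add: op_linearD[OF X] del: plus_fun_apply zero_fun_apply)
  then show "vac_module m \<phi> \<Longrightarrow> (op_br (act_E i) ^^ Suc m) (act_E j) \<phi> = 0" unfolding X_def .
qed

primrec act_gen :: "nat \<Rightarrow> km_gen \<Rightarrow> vec \<Rightarrow> vec" where
  "act_gen m (KE i) = act_E i"
| "act_gen m (KF i) = act_F m i"
| "act_gen m (KC c) = act_C m c"

primrec act_term :: "nat \<Rightarrow> km_gen lie_term \<Rightarrow> vec \<Rightarrow> vec" where
  "act_term m (LGen g) = act_gen m g"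
| "act_term m LZero = 0"
| "act_term m (LAdd x y) = act_term m x + act_term m y"
| "act_term m (LScale c x) = op_scale c (act_term m x)"
| "act_term m (LBr x y) = op_br (act_term m x) (act_term m y)"

lemma act_term_linear: "op_linear (act_term m x)"
proof (induction x)
  case (LGen g)
  show ?case by (cases g) (simp_all add: act_linear)
next
  case (LAdd x y)
  then show ?case unfolding op_linear_def act_term.simps plus_fun_apply[of "act_term m x" "act_term m y"]
    by (simp add: vec.scale_right_distrib ac_simps del: plus_fun_apply)
next
  case (LScale c x)
  then show ?case by (simp add: op_linear_def op_scale_def vec.scale_right_distrib mult.commute)
next
  case (LBr x y)
  then show ?case by (simp add: op_linear_bracket)
qed (simp add: op_linear_def fun_eq_iff vec_scale_def)

lemma act_term_vac: "vac_module m \<phi> \<Longrightarrow> vac_module m (act_term m x \<phi>)"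
proof (induction x arbitrary: \<phi>)
  case (LGen g)
  then show ?case by (cases g) (simp_all add: vac_E vac_C vac_F)
qed (simp_all add: vac_zero vac_add vac_scale vac_diff op_br_def op_scale_def)

lemma act_term_funpow: "act_term m ((LBr x ^^ n) y) = (op_br (act_term m x) ^^ n) (act_term m y)"
  by (induction n) simp_all

lemma act_term_cong:
  assumes m: "2 \<le> m"
  shows "km_eq m x y \<Longrightarrow> vac_module m \<phi> \<Longrightarrow> act_term m x \<phi> = act_term m y \<phi>"
proof (induction arbitrary: \<phi> rule: lie_cong.induct)
  case (lc_rel x y)
  have n: "nat (1 - cartan m i j) = Suc m" if "i \<noteq> j" for i j using that by (simp add: cartan_def)
  have CC: "op_br (act_C m c) (act_C m c') = 0" for c c'
    by (simp add: op_br_def act_C_def fun_eq_iff)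
  have CD: "act_C m CD \<phi> = 0" if "m \<noteq> 2"
    using that by (simp add: act_C_def word_weight_def fun_eq_iff)
  from lc_rel(1) show ?case unfolding km_relations_def
  proof (elim UnE, goal_cases)
    case 6
    then obtain i j where ij: "i \<noteq> j" "x = (LBr (kE i) ^^ nat (1 - cartan m i j)) (kE j)" "y = LZero" by blast
    show ?thesis unfolding ij n[OF ij(1)] act_term_funpow using act_serre_E[OF m ij(1) lc_rel(2)] by simp
  next
    case 7
    then obtain i j where ij: "i \<noteq> j" "x = (LBr (kF i) ^^ nat (1 - cartan m i j)) (kF j)" "y = LZero" by blast
    show ?thesis unfolding ij n[OF ij(1)] act_term_funpow using act_serre_F[OF m ij(1)] by simp
  next
    case 8
    then show ?thesis using CD by (auto split: if_splits)
  qed (auto simp: CC act_brackets)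
next
  case (lc_br x x' y y')
  have "act_term m x (act_term m y \<phi>) = act_term m x' (act_term m y' \<phi>)"
    using lc_br.IH(1)[OF act_term_vac[OF lc_br.prems], of y'] lc_br.IH(2)[OF lc_br.prems] by simp
  moreover have "act_term m y (act_term m x \<phi>) = act_term m y' (act_term m x' \<phi>)"
    using lc_br.IH(2)[OF act_term_vac[OF lc_br.prems], of x'] lc_br.IH(1)[OF lc_br.prems] by simp
  ultimately show ?case by (simp add: op_br_def)
qed (simp_all add: op_scale_def op_br_def op_linearD[OF act_term_linear] algebra_simps
  vec.scale_right_distrib vec.scale_left_distrib vec.scale_right_diff_distrib)

text \<open>\<open>E\<^sub>i F\<^sub>i\<close> multiplies the vacuum by the value \<open>1\<close> of its weight on the coroot.\<close>

theorem kE_nonzero: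
  assumes "2 \<le> m"
  shows "\<not> km_eq m (kE i) LZero"
proof
  assume "km_eq m (kE i) LZero"
  from act_term_cong[OF assms this vac_F[OF vac_gen]]
  have "act_E i (act_F m i vacuum) = 0" by simp
  then have "act_C m (CH i) vacuum = 0" by (simp add: act_E_F vacuum_E op_linearD(3)[OF act_linear(3)])
  then have "act_C m (CH i) vacuum [] = 0" by simp
  then show False by (simp add: act_C_def vacuum_def word_weight_def)
qed

section \<open>The reduced positive roots\<close>

lemma km_occurs_simple: "2 \<le> m \<Longrightarrow> km_occurs m (1, 0)" "2 \<le> m \<Longrightarrow> km_occurs m (0, 1)"
proof -
  have "km_occurs m (shift i 1 (0, 0))" if "2 \<le> m" for i
    using km_weight_gen[of m i True] kE_nonzero[OF that, of i]
    unfolding km_occurs_def km_gen_at_def km_in_eq_iff[symmetric] km_in_simps by auto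
  from this[of N1] this[of N2] show "2 \<le> m \<Longrightarrow> km_occurs m (1, 0)" "2 \<le> m \<Longrightarrow> km_occurs m (0, 1)" by simp_all
qed

lemma km_raise:
  assumes "km_occurs m (a, b)"
  shows "int q \<le> int m * b - 2 * a \<Longrightarrow> km_occurs m (a + int q, b)"
    "int q \<le> int m * a - 2 * b \<Longrightarrow> km_occurs m (a, b + int q)"
proof -
  show "km_occurs m (a + int q, b)" if "int q \<le> int m * b - 2 * a"
    using km_root_string[OF assms, of N1 True "nat (int m * b - 2 * a)" q] that
    by (simp add: lattice_weight_def cartan_def algebra_simps)
  show "km_occurs m (a, b + int q)" if "int q \<le> int m * a - 2 * b"
    using km_root_string[OF assms, of N2 True "nat (int m * a - 2 * b)" q] that
    by (simp add: lattice_weight_def cartan_def algebra_simps)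
qed

lemma km_reflect:
  assumes "km_occurs m (a, b)"
  shows "int m * b \<le> 2 * a \<Longrightarrow> km_occurs m (int m * b - a, b)"
    "int m * a \<le> 2 * b \<Longrightarrow> km_occurs m (a, int m * a - b)"
proof -
  show "km_occurs m (int m * b - a, b)" if "int m * b \<le> 2 * a"
    using km_root_string[OF assms, of N1 False "nat (2 * a - int m * b)" "nat (2 * a - int m * b)"] that
    by (simp add: lattice_weight_def cartan_def algebra_simps)
  show "km_occurs m (a, int m * a - b)" if "int m * a \<le> 2 * b"
    using km_root_string[OF assms, of N2 False "nat (2 * b - int m * a)" "nat (2 * b - int m * a)"] that
    by (simp add: lattice_weight_def cartan_def algebra_simps)
qed

lemma gcd_reflect: "gcd (int m * b - a) b = gcd a b" for a b :: int
proof -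
  have "gcd (int m * b - a) b = gcd (- a + int m * b) b" by simp
  also have "\<dots> = gcd (- a) b" by (metis gcd.commute gcd_add_mult mult.commute add.commute)
  finally show ?thesis by simp
qed

text \<open>Reflect down as long as a coordinate decreases. The process ends in the fundamental chamber,
  where the norm is not positive, or with a simple root, which has norm \<open>1\<close>.\<close>

lemma km_occurs_bound:
  assumes m: "2 \<le> m"
  shows "km_occurs m (a, b) \<Longrightarrow> 0 < a \<Longrightarrow> 0 < b \<Longrightarrow> gcd a b = 1 \<Longrightarrow> a * a + b * b - int m * a * b \<le> 1"
proof (induction "nat (a + b)" arbitrary: a b rule: less_induct)
  case less
  consider "int m * b < 2 * a" | "int m * a < 2 * b" | "2 * a \<le> int m * b" "2 * b \<le> int m * a" by linarith
  then show ?case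
  proof cases
    case 1
    define c where "c = int m * b - a"
    have occ: "km_occurs m (c, b)" unfolding c_def by (rule km_reflect) (use less.prems 1 in auto)
    have "0 \<le> c * b" by (rule km_root_same_sign[OF m occ])
    then have "0 \<le> c" using less.prems(3) by (simp add: zero_le_mult_iff)
    show ?thesis
    proof (cases "c = 0")
      case True
      then have a: "a = int m * b" by (simp add: c_def)
      then have "b dvd gcd a b" by simp
      then have "b = 1" using less.prems by simp
      then show ?thesis using a by simp
    next
      case False
      then have "0 < c" using \<open>0 \<le> c\<close> by simp
      moreover have "gcd c b = 1" unfolding c_def gcd_reflect by (rule less.prems)
      moreover have "nat (c + b) < nat (a + b)" using 1 less.prems \<open>0 < c\<close> by (simp add: c_def)
      ultimately have "c * c + b * b - int m * c * b \<le> 1" by (intro less.hyps[OF _ occ] less.prems)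
      then show ?thesis by (simp add: c_def algebra_simps)
    qed
  next
    case 2
    define c where "c = int m * a - b"
    have occ: "km_occurs m (a, c)" unfolding c_def by (rule km_reflect) (use less.prems 2 in auto)
    have "0 \<le> a * c" by (rule km_root_same_sign[OF m occ])
    then have "0 \<le> c" using less.prems(2) by (simp add: zero_le_mult_iff)
    show ?thesis
    proof (cases "c = 0")
      case True
      then have b: "b = int m * a" by (simp add: c_def)
      then have "a dvd gcd a b" by simp
      then have "a = 1" using less.prems by simp
      then show ?thesis using b by simp
    next
      case False
      then have "0 < c" using \<open>0 \<le> c\<close> by simp
      moreover have "gcd a c = 1" unfolding c_def gcd.commute[of a] gcd_reflect using less.prems by (simp add: gcd.commute)
      moreover have "nat (a + c) < nat (a + b)" using 2 less.prems \<open>0 < c\<close> by (simp add: c_def)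
      ultimately have "a * a + c * c - int m * a * c \<le> 1" by (intro less.hyps[OF _ occ] less.prems)
      then show ?thesis by (simp add: c_def algebra_simps)
    qed
  next
    case 3
    have "a * (2 * a - int m * b) + b * (2 * b - int m * a) \<le> 0"
      using 3 less.prems by (intro add_nonpos_nonpos mult_nonneg_nonpos) auto
    then show ?thesis by (simp add: algebra_simps)
  qed
qed

text \<open>Take a root of maximal height below \<open>[a, b]\<close>. A coordinate in which it is smaller cannot be raised, so it is
  nonnegative on the corresponding coroot. If this happens for one coordinate only, then \<open>[a, b]\<close> would be positive on
  that coroot; if it happens for both, then \<open>m = 2\<close> and the root is a multiple of \<open>[1, 1] = [a, b]\<close>.\<close>

lemma km_occurs_chamber:
  assumes m: "2 \<le> m" and ab: "0 < a" "0 < b" "coprime a b" and K: "2 * a \<le> m * b" "2 * b \<le> m * a"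
  shows "km_occurs m (int a, int b)"
proof -
  define \<Omega> where "\<Omega> = {(p, q). p \<le> a \<and> q \<le> b \<and> 0 < p + q \<and> km_occurs m (int p, int q)}"
  have "(1, 0) \<in> \<Omega>" using ab km_occurs_simple(1)[OF m] by (simp add: \<Omega>_def)
  moreover have "fst y + snd y < Suc (a + b)" if "y \<in> \<Omega>" for y using that by (auto simp: \<Omega>_def)
  ultimately obtain x where x: "x \<in> \<Omega>" "\<And>y. y \<in> \<Omega> \<Longrightarrow> fst y + snd y \<le> fst x + snd x"
    using ex_has_greatest_nat[of "\<lambda>y. y \<in> \<Omega>" "(1, 0)" "\<lambda>y. fst y + snd y" "Suc (a + b)"] by blast
  obtain p q where pq: "x = (p, q)" by (cases x)
  have occ: "p \<le> a" "q \<le> b" "0 < p + q" "km_occurs m (int p, int q)" using x(1) by (auto simp: \<Omega>_def pq)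
  have up1: "m * q \<le> 2 * p" if "p < a"
  proof (rule ccontr)
    assume "\<not> m * q \<le> 2 * p"
    then have "int (2 * p) < int (m * q)" by (simp only: of_nat_less_iff not_le)
    then have "km_occurs m (int p + int 1, int q)" by (intro km_raise[OF occ(4)]) simp
    then have "(Suc p, q) \<in> \<Omega>" using that occ by (simp add: \<Omega>_def add.commute)
    then show False using x(2) by (fastforce simp: pq)
  qed
  have up2: "m * p \<le> 2 * q" if "q < b"
  proof (rule ccontr)
    assume "\<not> m * p \<le> 2 * q"
    then have "int (2 * q) < int (m * p)" by (simp only: of_nat_less_iff not_le)
    then have "km_occurs m (int p, int q + int 1)" by (intro km_raise[OF occ(4)]) simp
    then have "(p, Suc q) \<in> \<Omega>" using that occ by (simp add: \<Omega>_def add.commute)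
    then show False using x(2) by (fastforce simp: pq)
  qed
  have "p = a \<and> q = b"
  proof (rule ccontr)
    assume "\<not> (p = a \<and> q = b)"
    then consider "p < a" "q = b" | "p = a" "q < b" | "p < a" "q < b" using occ by linarith
    then show False
    proof cases
      case 1
      then show False using up1 K by simp
    next
      case 2
      then show False using up2 K by simp
    next
      case 3
      have s: "m * (p + q) \<le> 2 * (p + q)" using up1[OF 3(1)] up2[OF 3(2)] by (simp add: distrib_left)
      then have "m \<le> 2" using occ(3) by (simp only: mult_le_cancel2)
      then have m2: "m = 2" using m by simp
      then have "a = b" using K by simp
      then have "a = 1" "b = 1" using ab by simp_all
      then show False using 3 occ by simp
    qed
  qed
  then show ?thesis using occ by simp
qed

text \<open>Ascend along root strings, from a smaller root or from a simple root.\<close>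

lemma is_root_occurs:
  assumes m: "2 \<le> m"
  shows "is_root m a b \<Longrightarrow> km_occurs m (int a, int b)"
proof (induction "a + b" arbitrary: a b rule: less_induct)
  case less
  have ab: "0 < a" "0 < b" "coprime a b" using less.prems by (auto simp: is_root_def)
  consider "m * b < 2 * a" | "m * a < 2 * b" | "2 * a \<le> m * b" "2 * b \<le> m * a" by linarith
  then show ?case
  proof cases
    case 1
    show ?thesis
    proof (cases "a < m * b")
      case True
      have occ: "km_occurs m (int (m * b - a), int b)"
        by (rule less.hyps[OF _ is_root_reflect[OF less.prems True]]) (use 1 in simp)
      have "int (m * b - a) + int (2 * a - m * b) = int a" using True 1 by simp
      moreover have "int (2 * a - m * b) \<le> int m * int b - 2 * int (m * b - a)" using True 1 by (simp add: of_nat_diff)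
      ultimately show ?thesis using km_raise(1)[OF occ, of "2 * a - m * b"] by simp
    next
      case False
      then have "a = m" "b = 1" using is_root_large[OF less.prems] by simp_all
      then show ?thesis using km_raise(1)[OF km_occurs_simple(2)[OF m], of m] by simp
    qed
  next
    case 2
    show ?thesis
    proof (cases "b < m * a")
      case True
      have occ: "km_occurs m (int a, int (m * a - b))"
        by (rule less.hyps[OF _ is_root_sym[OF is_root_reflect[OF is_root_sym[OF less.prems] True]]]) (use 2 in simp)
      have "int (m * a - b) + int (2 * b - m * a) = int b" using True 2 by simp
      moreover have "int (2 * b - m * a) \<le> int m * int a - 2 * int (m * a - b)" using True 2 by (simp add: of_nat_diff)
      ultimately show ?thesis using km_raise(2)[OF occ, of "2 * b - m * a"] by simp
    next
      case False
      then have "b = m" "a = 1" using is_root_large[OF is_root_sym[OF less.prems]] by simp_all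
      then show ?thesis using km_raise(2)[OF km_occurs_simple(1)[OF m], of m] by simp
    qed
  next
    case 3
    then show ?thesis by (rule km_occurs_chamber[OF m ab])
  qed
qed

theorem reduced_positive_roots_eq:
  assumes m: "2 \<le> m"
  shows "reduced_positive_roots m = {(int a, int b) | a b. is_root m a b}"
proof (intro subset_antisym subrelI)
  fix x y assume "(x, y) \<in> reduced_positive_roots m"
  then have xy: "km_occurs m (x, y)" "0 \<le> x" "0 \<le> y" "gcd x y = 1" "x * y \<noteq> 0"
    by (auto simp: reduced_positive_roots_def km_root_iff)
  define a where "a = nat x"
  define b where "b = nat y"
  have ab: "x = int a" "y = int b" using xy by (simp_all add: a_def b_def)
  have "is_root m a b" unfolding is_root_int
    using km_occurs_bound[OF m xy(1)] xy unfolding ab by (auto simp: coprime_iff_gcd_eq_1)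
  then show "(x, y) \<in> {(int a, int b) | a b. is_root m a b}" using ab by blast
next
  fix x y assume "(x, y) \<in> {(int a, int b) | a b. is_root m a b}"
  then obtain a b where ab: "x = int a" "y = int b" "is_root m a b" by blast
  then show "(x, y) \<in> reduced_positive_roots m"
    using is_root_occurs[OF m ab(3)]
    by (auto simp: reduced_positive_roots_def km_root_iff is_root_def coprime_iff_gcd_eq_1)
qed

section \<open>The bijection\<close>

lemma s_elt_weq:
  assumes "is_root m a b"
  shows "s_elt m (int a, int b) = W_prod m w \<longleftrightarrow> weq m w (line_word a b)"
proof -
  have "s_word (int a, int b) = line_word a b"
    by (rule s_word_line_word) (use assms in \<open>auto simp: is_root_def\<close>)
  then show ?thesis by (metis W_prod_eq_iff s_elt_def)
qed

lemma s_elt_rigid: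
  assumes "is_root m a b"
  shows "s_elt m (int a, int b) \<in> rigid_reflections m"
proof -
  have ab: "0 < a" "0 < b" "coprime a b" using assms by (auto simp: is_root_def)
  obtain \<eta> where "admissible \<eta>" "non_self_crossing \<eta>" "curve_word \<eta> (s_word (int a, int b))"
    by (rule line_admissible_curve[OF ab])
  then show ?thesis
    using line_word_palindromic[OF ab] s_word_line_word[OF ab] W_prod_carrier
    unfolding rigid_reflections_def s_elt_def by auto
qed

text \<open>The U-turn-free diagram carries the free reduction of the palindrome, hence again a
  palindrome.\<close>

lemma rigid_reflection_root:
  assumes m: "2 \<le> m" and g: "g \<in> rigid_reflections m"
  obtains a b where "is_root m a b" "g = s_elt m (int a, int b)"
proof -
  obtain w \<eta> where w: "g = W_prod m w" "admissible \<eta>" "non_self_crossing \<eta>" "curve_word \<eta> w" "odd (length w)" "rev w = w"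
    using g by (auto simp: rigid_reflections_def palindromic_words_def)
  obtain D where D: "diagram D" "map fst D = w"
    by (rule admissible_curve_diagram[OF w(2-5)])
  obtain D' where D': "diagram D'" "distinct_adj (map fst D')" "deletes w (map fst D')"
    using diagram_uturn_free[OF D(1)] D(2) by metis
  have red: "map fst D' = free_red w"
    using free_red_deletes[OF D'(3)] free_red_id[OF D'(2)] by simp
  have "rev (map fst D') = map fst D'" unfolding red free_red_rev[symmetric] w(6) ..
  then have "root_element m (map fst D')"
    by (intro spiral_root_element[OF m] palindromic_diagram_spiral D')
  then obtain a b where ab: "is_root m a b" "weq m (map fst D') (line_word a b)"
    unfolding root_element_def by blast
  have "s_elt m (int a, int b) = g"
    using weq_trans[OF weq_deletes[OF D'(3)] ab(2)] s_elt_weq[OF ab(1)] w(1) by simp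
  then show thesis by (intro that[OF ab(1)]) simp
qed

theorem theorem1p1:
  fixes m :: nat
  assumes "m \<ge> 2"
  shows "bij_betw (s_elt m) (reduced_positive_roots m) (rigid_reflections m)"
  unfolding bij_betw_def reduced_positive_roots_eq[OF assms]
proof (intro conjI inj_onI subset_antisym subsetI)
  fix x y
  assume "x \<in> {(int a, int b) |a b. is_root m a b}" "y \<in> {(int a, int b) |a b. is_root m a b}"
  then obtain a b c d where xy: "x = (int a, int b)" "y = (int c, int d)" and r: "is_root m a b" "is_root m c d"
    by blast
  assume "s_elt m x = s_elt m y"
  moreover have "s_elt m y = W_prod m (line_word c d)"
    unfolding xy using s_elt_weq[OF r(2)] by simp
  ultimately have "weq m (line_word a b) (line_word c d)"
    unfolding xy using s_elt_weq[OF r(1)] weq_sym by metis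
  then show "x = y" using line_word_inj[OF assms r] xy by simp
next
  fix g assume "g \<in> s_elt m ` {(int a, int b) |a b. is_root m a b}"
  then show "g \<in> rigid_reflections m" by (auto intro: s_elt_rigid)
next
  fix g assume "g \<in> rigid_reflections m"
  then show "g \<in> s_elt m ` {(int a, int b) |a b. is_root m a b}"
    by (rule rigid_reflection_root[OF assms]) auto
qed

end
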